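(* Let $Q=\Omega\times(0,T]$, where $0<T\le1$ and $\Omega\subset\{x\in\mathbb R^n:|x|<1\}$ is a domain. Let $m>1$, $n+2<q<+\infty$, $p_1<p\le q$, and $$p>\frac{(m-1)q(n+2)}{mq-n-2}.$$ There exists $C=C(n,\Lambda,\lambda,m,p,q)>0$ such that the following holds. Let $f\in L^p(Q)$ and $\mu\in L^q_+(Q)$, and let $G:Q\times\mathbb R^n\times\mathbb S^n\to\mathbb R$ be measurable and satisfy $$\mathcal P^-(X-Y)\le G(x,t,\xi,X)-G(x,t,\xi,Y)\le\mathcal P^+(X-Y),\qquad |G(x,t,\xi,O)|\le\mu(x,t)|\xi|^m$$ for all $(x,t)\in Q$, $\xi\in\mathbb R^n$, $X,Y\in\mathbb S^n$. If $u\in C(\overline Q)$ is an $L^p$-viscosity subsolution of $$u_t+G(x,t,Du,D^2u)-f(x,t)=0\quad\text{in }Q,$$ then $$\sup_Q u\le\sup_{\partial_pQ}u+C\left(1+\|f\|_{L^p(Q)}^{(m-1)q}\|\mu\|_{L^q(Q)}^q\right)^{\frac{p-1}{p}}\|f\|_{L^p(Q)}.$$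
   Context: Fix $n\in\mathbb N$ and constants $0<\lambda\le\Lambda<\infty$. $\mathbb S^n$ is the set of real symmetric $n\times n$ matrices with the usual order, and $O$ is the zero matrix. The Pucci operators are $\mathcal P^+(X)=\max\{-\mathrm{Tr}(AX): A\in\mathbb S^n,\ \lambda I\le A\le\Lambda I\}$ and $\mathcal P^-(X)=\min\{-\mathrm{Tr}(AX): A\in\mathbb S^n,\ \lambda I\le A\le\Lambda I\}$ for $X\in\mathbb S^n$. $Du$, $D^2u$ are the first and second derivatives in the space variable $x$, and $u_t$ is the time derivative. $L^q_+(Q)$ is the set of nonnegative functions in $L^q(Q)$. For $Q=\Omega\times(0,T]$ the parabolic boundary is $\partial_pQ=(\Omega\times\{0\})\cup(\partial\Omega\times[0,T))$. The parabolic distance is $d((x,t),(y,s))=\sqrt{|x-y|^2+|t-s|}$, and $Q'\Subset Q$ means that the parabolic distance from $Q'$ to $\partial_pQ$ is positive. $W^{2,1}_p(Q)$ is the set of $f\in L^p(Q)$ with weak derivatives $f_t,f_{x_k},f_{x_kx_\ell}\in L^p(Q)$, with norm the sum of the $L^p$ norms of $f$ and of these derivatives; $W^{2,1}_{p,\mathrm{loc}}(Q)$ consists of functions in $W^{2,1}_p(Q')$ for all $Q'\Subset Q$. Set $Q_r(x,t)=(x,t)+(-r,r)^n\times(-r^2,0]$. $L^p$-viscosity subsolutions: $u\in C(Q)$ is an $L^p$-viscosity subsolution of $u_t+F(x,t,Du,D^2u)=0$ in $Q$ if for every $\phi\in W^{2,1}_{p,\mathrm{loc}}(Q)$ and every $(x,t)\in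 Q$ such that $u-\phi$ attains a maximum at $(x,t)$ over some cylinder $Q_r(x,t)\subset Q$, one has $\lim_{\varepsilon\to0}\operatorname{ess\,inf}_{(y,s)\in Q_\varepsilon(x,t)}\{\phi_t+F(y,s,D\phi,D^2\phi)\}\le0$. $p_1=p_1(n,\Lambda/\lambda)\in[\frac{n+2}2,n+1)$ is the constant giving the range $p>p_1$ of exponents for which the Aleksandrov-Bakelman-Pucci maximum principle holds, i.e. for every $p>p_1$ there is $C=C(n,\Lambda,\lambda,p)$ such that, with $Q^*=\{|x|<1\}\times(0,1]$, for every $f\in L^p(Q^* )$ there is $u\in C(\overline{Q^*})\cap W^{2,1}_{p,\mathrm{loc}}(Q^* )$ with $u_t+\mathcal P^+(D^2u)=f$ a.e. in $Q^*$, $u=0$ on $\partial_pQ^*$, $-C\|f^-\|_{L^p(Q^* )}\le u\le C\|f^+\|_{L^p(Q^* )}$, and $\|u\|_{W^{2,1}_p(Q')}\le C'\|f\|_{L^p(Q^* )}$ for every $Q'\Subset Q^*$, where $C'$ depends only on $n,\Lambda,\lambda,p$ and the distance of $Q'$ to $\partial_pQ^*$. *)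

theory Defs
  imports "HOL-Analysis.Analysis"
begin

text \<open>Points of space-time are pairs \<open>(x, t)\<close>; the dimension \<open>n\<close> is \<open>CARD('n)\<close>.\<close>

type_synonym 'n spacetime = "(real ^ 'n) \<times> real"

section \<open>Symmetric matrices and Pucci operators\<close>

definition sym_mats :: "(real ^ 'n ^ 'n) set" where
  "sym_mats = {X. transpose X = X}"

definition mat_le :: "real ^ 'n ^ 'n \<Rightarrow> real ^ 'n ^ 'n \<Rightarrow> bool" where
  "mat_le X Y \<longleftrightarrow> (\<forall>v. v \<bullet> (X *v v) \<le> v \<bullet> (Y *v v))"

definition elliptic_mats :: "real \<Rightarrow> real \<Rightarrow> (real ^ 'n ^ 'n) set" where
  "elliptic_mats lam Lam = {A \<in> sym_mats. mat_le (mat lam) A \<and> mat_le A (mat Lam)}"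

text \<open>For \<open>lam \<le> Lam\<close> the set \<open>elliptic_mats lam Lam\<close> is compact and nonempty, so supremum
  and infimum below are a maximum and a minimum.\<close>

definition pucci_plus :: "real \<Rightarrow> real \<Rightarrow> real ^ 'n ^ 'n \<Rightarrow> real" where
  "pucci_plus lam Lam X = (SUP A \<in> elliptic_mats lam Lam. - trace (A ** X))"

definition pucci_minus :: "real \<Rightarrow> real \<Rightarrow> real ^ 'n ^ 'n \<Rightarrow> real" where
  "pucci_minus lam Lam X = (INF A \<in> elliptic_mats lam Lam. - trace (A ** X))"

section \<open>Cylinders and the parabolic distance\<close>

definition cyl :: "(real ^ 'n) set \<Rightarrow> real \<Rightarrow> 'n spacetime set" where
  "cyl \<Omega> T = \<Omega> \<times> {0<..T}"

definition pbdry :: "(real ^ 'n) set \<Rightarrow> real \<Rightarrow> 'n spacetime set" where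
  "pbdry \<Omega> T = (\<Omega> \<times> {0}) \<union> (frontier \<Omega> \<times> {0..<T})"

definition pcube :: "real \<Rightarrow> 'n::finite spacetime \<Rightarrow> 'n spacetime set" where
  "pcube r z = {w. (\<forall>i. \<bar>fst w $ i - fst z $ i\<bar> < r) \<and> snd z - r\<^sup>2 < snd w \<and> snd w \<le> snd z}"

definition pdist :: "'n::finite spacetime \<Rightarrow> 'n spacetime \<Rightarrow> real" where
  "pdist z w = sqrt ((norm (fst z - fst w))\<^sup>2 + \<bar>snd z - snd w\<bar>)"

definition psetdist :: "'n::finite spacetime set \<Rightarrow> 'n spacetime set \<Rightarrow> real" where
  "psetdist A B = Inf {pdist z w |z w. z \<in> A \<and> w \<in> B}"

text \<open>\<open>psubset_in Q' \<Omega> T\<close> is \<open>Q' \<Subset> \<Omega> \<times> (0,T]\<close>. The subregions are taken to be open up to a null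
  set (as cylinders \<open>\<Omega>' \<times> (a,b]\<close> are), so that weak derivatives, which are tested on the
  interior, are determined almost everywhere on \<open>Q'\<close>. Every set at positive parabolic
  distance from the parabolic boundary is contained in such a \<open>Q'\<close>.\<close>

definition psubset_in :: "'n::finite spacetime set \<Rightarrow> (real ^ 'n) set \<Rightarrow> real \<Rightarrow> bool" where
  "psubset_in Q' \<Omega> T \<longleftrightarrow>
     Q' \<subseteq> cyl \<Omega> T \<and> Q' \<noteq> {} \<and> negligible (Q' - interior Q') \<and> 0 < psetdist Q' (pbdry \<Omega> T)"

section \<open>Lebesgue spaces and weak derivatives\<close>

definition Lp_on :: "real \<Rightarrow> 'a::euclidean_space set \<Rightarrow> ('a \<Rightarrow> real) \<Rightarrow> bool" where
  "Lp_on p Q f \<longleftrightarrow>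
     f \<in> borel_measurable (lebesgue_on Q) \<and> integrable (lebesgue_on Q) (\<lambda>z. \<bar>f z\<bar> powr p)"

definition Lp_norm :: "real \<Rightarrow> 'a::euclidean_space set \<Rightarrow> ('a \<Rightarrow> real) \<Rightarrow> real" where
  "Lp_norm p Q f = (integral\<^sup>L (lebesgue_on Q) (\<lambda>z. \<bar>f z\<bar> powr p)) powr (1 / p)"

definition locally_integrable :: "'a::euclidean_space set \<Rightarrow> ('a \<Rightarrow> real) \<Rightarrow> bool" where
  "locally_integrable U f \<longleftrightarrow> (\<forall>K. compact K \<and> K \<subseteq> U \<longrightarrow> integrable (lebesgue_on K) f)"

primrec dir_derivs :: "'a::euclidean_space list \<Rightarrow> ('a \<Rightarrow> real) \<Rightarrow> 'a \<Rightarrow> real" where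
  "dir_derivs [] f = f"
| "dir_derivs (v # vs) f = (\<lambda>z. frechet_derivative (dir_derivs vs f) (at z) v)"

text \<open>All iterated derivatives being differentiable everywhere is the same as being \<open>C\<^sup>\<infinity>\<close>.\<close>

definition test_fun :: "'a::euclidean_space set \<Rightarrow> ('a \<Rightarrow> real) \<Rightarrow> bool" where
  "test_fun U \<psi> \<longleftrightarrow>
     (\<forall>vs z. dir_derivs vs \<psi> differentiable (at z)) \<and>
     compact (closure {z. \<psi> z \<noteq> 0}) \<and> closure {z. \<psi> z \<noteq> 0} \<subseteq> U"

definition has_weak_deriv ::
    "'a::euclidean_space set \<Rightarrow> 'a list \<Rightarrow> ('a \<Rightarrow> real) \<Rightarrow> ('a \<Rightarrow> real) \<Rightarrow> bool" where
  "has_weak_deriv U vs f g \<longleftrightarrow>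
     locally_integrable U f \<and> locally_integrable U g \<and>
     (\<forall>\<psi>. test_fun U \<psi> \<longrightarrow>
        integral\<^sup>L (lebesgue_on U) (\<lambda>z. f z * dir_derivs vs \<psi> z) =
        (- 1) ^ length vs * integral\<^sup>L (lebesgue_on U) (\<lambda>z. g z * \<psi> z))"

definition e_t :: "'n::finite spacetime" where
  "e_t = (0, 1)"

definition e_x :: "'n::finite \<Rightarrow> 'n spacetime" where
  "e_x k = (axis k 1, 0)"

section \<open>Parabolic Sobolev spaces\<close>

text \<open>\<open>W21 p Q f ft fx fxx\<close>: \<open>f\<close> belongs to \<open>W\<^sup>2\<^sup>,\<^sup>1\<^sub>p(Q)\<close>, and \<open>ft\<close>, \<open>fx\<close>, \<open>fxx\<close> are (versions
  of) its weak derivatives \<open>f\<^sub>t\<close>, \<open>Df\<close>, \<open>D\<^sup>2f\<close>.\<close>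

definition W21 :: "real \<Rightarrow> 'n::finite spacetime set \<Rightarrow> ('n spacetime \<Rightarrow> real) \<Rightarrow>
    ('n spacetime \<Rightarrow> real) \<Rightarrow> ('n spacetime \<Rightarrow> real ^ 'n) \<Rightarrow> ('n spacetime \<Rightarrow> real ^ 'n ^ 'n) \<Rightarrow> bool"
  where
  "W21 p Q f ft fx fxx \<longleftrightarrow>
     Lp_on p Q f \<and>
     Lp_on p Q ft \<and> has_weak_deriv (interior Q) [e_t] f ft \<and>
     (\<forall>k. Lp_on p Q (\<lambda>z. fx z $ k) \<and> has_weak_deriv (interior Q) [e_x k] f (\<lambda>z. fx z $ k)) \<and>
     (\<forall>k l. Lp_on p Q (\<lambda>z. fxx z $ k $ l) \<and>
        has_weak_deriv (interior Q) [e_x k, e_x l] f (\<lambda>z. fxx z $ k $ l))"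

definition W21_norm :: "real \<Rightarrow> 'n::finite spacetime set \<Rightarrow> ('n spacetime \<Rightarrow> real) \<Rightarrow>
    ('n spacetime \<Rightarrow> real) \<Rightarrow> ('n spacetime \<Rightarrow> real ^ 'n) \<Rightarrow> ('n spacetime \<Rightarrow> real ^ 'n ^ 'n) \<Rightarrow> real"
  where
  "W21_norm p Q f ft fx fxx =
     Lp_norm p Q f + Lp_norm p Q ft + (\<Sum>k\<in>UNIV. Lp_norm p Q (\<lambda>z. fx z $ k)) +
     (\<Sum>k\<in>UNIV. \<Sum>l\<in>UNIV. Lp_norm p Q (\<lambda>z. fxx z $ k $ l))"

text \<open>Membership in \<open>W\<^sup>2\<^sup>,\<^sup>1\<^sub>p\<^sub>,\<^sub>l\<^sub>o\<^sub>c(\<Omega> \<times> (0,T])\<close>. Weak derivatives on different \<open>Q'\<close> agree almost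
  everywhere on overlaps and \<open>\<Omega> \<times> (0,T]\<close> is a countable union of admissible \<open>Q'\<close>, so the
  derivatives can be given once and for all as functions on the whole cylinder.\<close>

definition W21_loc :: "real \<Rightarrow> (real ^ 'n::finite) set \<Rightarrow> real \<Rightarrow> ('n spacetime \<Rightarrow> real) \<Rightarrow>
    ('n spacetime \<Rightarrow> real) \<Rightarrow> ('n spacetime \<Rightarrow> real ^ 'n) \<Rightarrow> ('n spacetime \<Rightarrow> real ^ 'n ^ 'n) \<Rightarrow> bool"
  where
  "W21_loc p \<Omega> T f ft fx fxx \<longleftrightarrow> (\<forall>Q'. psubset_in Q' \<Omega> T \<longrightarrow> W21 p Q' f ft fx fxx)"

section \<open>Viscosity subsolutions\<close>

text \<open>Unlike the library's essential supremum, this makes sense without measurability of \<open>h\<close>: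
  an operator that is merely Lebesgue measurable need not stay measurable after substituting
  the derivatives of a test function.\<close>

definition ess_inf :: "'a::euclidean_space set \<Rightarrow> ('a \<Rightarrow> real) \<Rightarrow> ereal" where
  "ess_inf S h = Sup {c. AE z in lebesgue_on S. c \<le> ereal (h z)}"

text \<open>The test function \<open>\<phi>\<close> enters through its point values, so it has to be the continuous
  representative of its Sobolev class (which exists for \<open>p > (n+2)/2\<close>).\<close>

definition visc_subsolution :: "real \<Rightarrow> (real ^ 'n::finite) set \<Rightarrow> real \<Rightarrow>
    ('n spacetime \<Rightarrow> real ^ 'n \<Rightarrow> real ^ 'n ^ 'n \<Rightarrow> real) \<Rightarrow> ('n spacetime \<Rightarrow> real) \<Rightarrow> bool" where
  "visc_subsolution p \<Omega> T F u \<longleftrightarrow>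
     continuous_on (cyl \<Omega> T) u \<and>
     (\<forall>\<phi> \<phi>t \<phi>x \<phi>xx. \<forall>z\<in>cyl \<Omega> T.
        continuous_on (cyl \<Omega> T) \<phi> \<and> W21_loc p \<Omega> T \<phi> \<phi>t \<phi>x \<phi>xx \<and>
        (\<exists>r>0. pcube r z \<subseteq> cyl \<Omega> T \<and> (\<forall>w\<in>pcube r z. u w - \<phi> w \<le> u z - \<phi> z)) \<longrightarrow>
        Lim (at_right 0)
          (\<lambda>\<epsilon>. ess_inf (pcube \<epsilon> z) (\<lambda>w. \<phi>t w + F w (\<phi>x w) (\<phi>xx w))) \<le> 0)"

text \<open>Lebesgue measurability on \<open>Q \<times> \<real>\<^sup>n \<times> S\<^sup>n\<close>, where \<open>S\<^sup>n\<close> carries its own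
  \<open>n(n+1)/2\<close>-dimensional Lebesgue measure. As \<open>S\<^sup>n\<close> is a null set in \<open>\<real>\<^sup>n\<^sup>\<times>\<^sup>n\<close> for \<open>n \<ge> 2\<close>, this is
  stated through the projection of all matrices onto the symmetric ones.\<close>

definition measurable_operator :: "'n::finite spacetime set \<Rightarrow>
    ('n spacetime \<Rightarrow> real ^ 'n \<Rightarrow> real ^ 'n ^ 'n \<Rightarrow> real) \<Rightarrow> bool" where
  "measurable_operator Q G \<longleftrightarrow>
     (\<lambda>(z, \<xi>, Z). G z \<xi> ((1 / 2) *\<^sub>R (Z + transpose Z)))
       \<in> borel_measurable (lebesgue_on (Q \<times> UNIV \<times> UNIV))"

section \<open>The exponent of the Aleksandrov--Bakelman--Pucci maximum principle\<close>

text \<open>\<open>ABP_exponent TYPE('n) lam Lam p1\<close>: the number \<open>p1 \<in> [(n+2)/2, n+1)\<close> is such that the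
  maximum principle holds for all exponents \<open>p > p1\<close>. The argument of \<open>C'\<close> is the distance
  from \<open>Q'\<close> to the parabolic boundary.\<close>

definition ABP_exponent :: "'n::finite itself \<Rightarrow> real \<Rightarrow> real \<Rightarrow> real \<Rightarrow> bool" where
  "ABP_exponent (_ :: 'n itself) lam Lam p1 \<longleftrightarrow>
     (real CARD('n) + 2) / 2 \<le> p1 \<and> p1 < real CARD('n) + 1 \<and>
     (\<forall>p>p1. \<exists>C. \<exists>C' :: real \<Rightarrow> real.
        \<forall>f :: 'n spacetime \<Rightarrow> real. Lp_on p (cyl (ball 0 1) 1) f \<longrightarrow>
          (\<exists>u ut ux uxx.
             continuous_on (closure (cyl (ball 0 1) 1)) u \<and>
             W21_loc p (ball 0 1) 1 u ut ux uxx \<and>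
             (AE z in lebesgue_on (cyl (ball 0 1) 1). ut z + pucci_plus lam Lam (uxx z) = f z) \<and>
             (\<forall>z\<in>pbdry (ball 0 1) 1. u z = 0) \<and>
             (\<forall>z\<in>cyl (ball 0 1) 1.
                - C * Lp_norm p (cyl (ball 0 1) 1) (\<lambda>w. max 0 (- f w)) \<le> u z \<and>
                u z \<le> C * Lp_norm p (cyl (ball 0 1) 1) (\<lambda>w. max 0 (f w))) \<and>
             (\<forall>Q'. psubset_in Q' (ball 0 1) 1 \<longrightarrow>
                W21_norm p Q' u ut ux uxx
                  \<le> C' (psetdist Q' (pbdry (ball 0 1) 1)) * Lp_norm p (cyl (ball 0 1) 1) f)))"

end

theory Submission
  imports Defs
begin

text \<open>
  If the product of the norm of \<open>\<mu>\<close> with the power \<open>m - 1\<close> of the norm of \<open>f\<close> is small, a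
  supersolution of the full equation is obtained as a series of solutions without gradient term,
  each having the superlinear term of its predecessor as right-hand side. The series converges
  because \<open>\<mu> * \<bar>Dw\<bar> powr m\<close> is controlled in \<open>L\<^sup>p\<close> by \<open>\<mu>\<close> in \<open>L\<^sup>q\<close> and by the parabolic Sobolev norm
  of \<open>w\<close>. As the condition on \<open>p\<close> is strict, this needs only a non-sharp embedding: the gradient is
  mollified at dyadic parabolic scales, and the difference of two consecutive scales at scale \<open>s\<close> is
  at most \<open>s\<close> times an average of the second space and the time derivatives. Comparing a viscosity
  subsolution with the supersolution gives the estimate under the smallness condition.

  In general the time interval is cut into \<open>N\<close> pieces on which the norm of \<open>\<mu>\<close> is small enough, with \<open>N\<close>
  of the order of \<open>1 + norm f powr ((m - 1) * q) * norm \<mu> powr q\<close>. Adding the estimates of the pieces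
  costs the factor \<open>N powr ((p - 1) / p)\<close> by Hoelder's inequality.
\<close>

section \<open>Smooth functions\<close>

text \<open>The maximum principle gives only interior estimates, so \<open>Q\<close> is placed,
  after scaling, deep inside the unit cylinder, and the supersolutions live on cylinders larger than
  \<open>Q\<close>. In the sign convention used here \<open>pucci_minus\<close> is a minimum of
  linear functions, hence superadditive: a sum of solutions is a supersolution, which is the
  direction that comparison needs.

  The exponents come from one count. The contribution of scale s to the gradient has L^p norm of
  order s and supremum of order s^(1 - (n+2)/p). With \<delta> = 1 - p/q, Hoelder's inequality
  spends the power \<delta> of it on the norm, and the remaining power m - \<delta> goes to the
  supremum. The result is s^\<beta> with \<beta> = \<delta> + (1 - (n+2)/p) (m - \<delta>) = m -
  (n+2)/p (m - \<delta>), and \<beta> > 0 is the hypothesis on \<open>p\<close> in another form.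

  The definition of viscosity subsolutions yields a contradiction only for strict supersolutions.
  For this reason a small constant is added to every right-hand side and removed by a limit.\<close>

definition flat :: "nat \<Rightarrow> real \<Rightarrow> real" where
  "flat k x = (if x \<le> 0 then 0 else inverse x ^ k * exp (- inverse x))"

lemma flat_tendsto_0: "(flat k \<longlongrightarrow> 0) (at_right 0)"
proof -
  have "((\<lambda>x::real. x ^ k / exp x) \<longlongrightarrow> 0) at_top"
    by (rule tendsto_power_div_exp_0)
  then have "((\<lambda>x::real. inverse x ^ k / exp (inverse x)) \<longlongrightarrow> 0) (at_right 0)"
    by (rule filterlim_compose[OF _ filterlim_inverse_at_top_right])
  then show ?thesis
    by (rule Lim_transform_eventually)
      (auto simp: flat_def exp_minus divide_inverse eventually_at_right_less intro!: eventually_at_rightI[of 0 1])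
qed

text \<open>The derivative stays in the linear span of the family, with larger \<open>k\<close>;
  this is why the powers \<open>inverse x ^ k\<close> are carried along. Only 0 is critical, where
  the right difference quotient of \<open>flat k\<close> is \<open>flat (Suc k)\<close>, which tends
  to 0.\<close>

lemma flat_has_derivative:
  "(flat k has_real_derivative (flat (k + 2) x - of_nat k * flat (k + 1) x)) (at x)"
proof -
  consider "x < 0" | "x = 0" | "x > 0" by linarith
  then show ?thesis
  proof cases
    case 1
    have "((\<lambda>x. 0) has_real_derivative 0) (at x)" by simp
    then have "(flat k has_real_derivative 0) (at x)"
      by (rule has_field_derivative_transform_within_open[where S = "{..<0}"])
        (use 1 in \<open>auto simp: flat_def\<close>)
    with 1 show ?thesis by (simp add: flat_def)
  next
    case 2
    have R: "((\<lambda>y. (flat k y - flat k 0) / (y - 0)) \<longlongrightarrow> 0) (at_right 0)"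
      by (rule Lim_transform_eventually[OF flat_tendsto_0[of "Suc k"]])
        (auto simp: flat_def divide_inverse intro!: eventually_at_rightI[of 0 1])
    have L: "((\<lambda>y. (flat k y - flat k 0) / (y - 0)) \<longlongrightarrow> 0) (at_left 0)"
      by (rule Lim_transform_eventually[OF tendsto_const])
        (auto simp: flat_def intro!: eventually_at_leftI[of "-1" 0])
    have "(flat k has_real_derivative 0) (at 0)"
      unfolding has_field_derivative_iff using R L by (rule filterlim_split_at_real[rotated])
    with 2 show ?thesis by (simp add: flat_def)
  next
    case 3
    have "((\<lambda>x. inverse x ^ k) has_real_derivative
        of_nat k * inverse x ^ (k - 1) * - (inverse x * inverse x)) (at x)"
      using 3 by (auto intro!: derivative_eq_intros simp: algebra_simps)
    moreover have "((\<lambda>x. exp (- inverse x)) has_real_derivative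
        exp (- inverse x) * (inverse x * inverse x)) (at x)"
      using 3 by (auto intro!: derivative_eq_intros simp: field_simps)
    ultimately have "((\<lambda>x. inverse x ^ k * exp (- inverse x)) has_real_derivative
        of_nat k * inverse x ^ (k - 1) * - (inverse x * inverse x) * exp (- inverse x) +
        exp (- inverse x) * (inverse x * inverse x) * inverse x ^ k) (at x)"
      by (rule DERIV_mult)
    also have "of_nat k * inverse x ^ (k - 1) * - (inverse x * inverse x) * exp (- inverse x) +
        exp (- inverse x) * (inverse x * inverse x) * inverse x ^ k =
        flat (k + 2) x - of_nat k * flat (k + 1) x"
      using 3 by (cases k) (auto simp: flat_def algebra_simps)
    finally have "((\<lambda>x. inverse x ^ k * exp (- inverse x)) has_real_derivative
        (flat (k + 2) x - of_nat k * flat (k + 1) x)) (at x)" .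
    then show ?thesis
      by (rule has_field_derivative_transform_within_open[where S = "{0<..}"])
        (use 3 in \<open>auto simp: flat_def\<close>)
  qed
qed

text \<open>A syntactic substitute for the space of smooth functions: every member has a derivative
  inside the class, so one induction yields derivatives of all orders.\<close>

inductive smooth_real :: "(real \<Rightarrow> real) \<Rightarrow> bool" where
  smooth_real_flat: "smooth_real (flat k)"
| smooth_real_const: "smooth_real (\<lambda>x. c)"
| smooth_real_add: "smooth_real f \<Longrightarrow> smooth_real g \<Longrightarrow> smooth_real (\<lambda>x. f x + g x)"
| smooth_real_mult: "smooth_real f \<Longrightarrow> smooth_real g \<Longrightarrow> smooth_real (\<lambda>x. f x * g x)"
| smooth_real_inverse: "smooth_real f \<Longrightarrow> (\<forall>x. f x \<noteq> 0) \<Longrightarrow> smooth_real (\<lambda>x. inverse (f x))"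
| smooth_real_affine: "smooth_real f \<Longrightarrow> smooth_real (\<lambda>x. f (a * x + b))"

lemmas smooth_real_intros =
  smooth_real_flat smooth_real_const smooth_real_add smooth_real_mult smooth_real_inverse

lemma smooth_real_diff:
  assumes "smooth_real f" "smooth_real g" shows "smooth_real (\<lambda>x. f x - g x)"
proof -
  have "smooth_real (\<lambda>x. f x + (-1) * g x)"
    using assms by (intro smooth_real_intros)
  then show ?thesis by simp
qed

lemma smooth_real_has_derivative:
  "smooth_real f \<Longrightarrow> \<exists>f'. smooth_real f' \<and> (\<forall>x. (f has_real_derivative f' x) (at x))"
proof (induction rule: smooth_real.induct)
  case (smooth_real_flat k)
  have "smooth_real (\<lambda>x. flat (k + 2) x - of_nat k * flat (k + 1) x)"
    by (intro smooth_real_intros smooth_real_diff)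
  then show ?case using flat_has_derivative by blast
next
  case (smooth_real_const c)
  show ?case by (rule exI[of _ "\<lambda>x. 0"]) (auto intro: smooth_real_intros)
next
  case (smooth_real_add f g)
  then obtain f' g' where "smooth_real f'" "\<forall>x. (f has_real_derivative f' x) (at x)"
    "smooth_real g'" "\<forall>x. (g has_real_derivative g' x) (at x)" by blast
  then show ?case
    by (intro exI[of _ "\<lambda>x. f' x + g' x"]) (auto intro!: smooth_real_intros derivative_intros)
next
  case (smooth_real_mult f g)
  then obtain f' g' where "smooth_real f'" "\<forall>x. (f has_real_derivative f' x) (at x)"
    "smooth_real g'" "\<forall>x. (g has_real_derivative g' x) (at x)" by blast
  with smooth_real_mult.hyps show ?case
    by (intro exI[of _ "\<lambda>x. f' x * g x + g' x * f x"]) (auto intro!: smooth_real_intros DERIV_mult)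
next
  case (smooth_real_inverse f)
  then obtain f' where "smooth_real f'" "\<forall>x. (f has_real_derivative f' x) (at x)" by blast
  moreover from this smooth_real_inverse have "smooth_real (\<lambda>x. (-1) * (inverse (f x) * f' x * inverse (f x)))"
    by (intro smooth_real_intros) auto
  ultimately show ?case
    using smooth_real_inverse by (intro exI[of _ "\<lambda>x. (-1) * (inverse (f x) * f' x * inverse (f x))"])
       (auto intro!: derivative_eq_intros)
next
  case (smooth_real_affine f a b)
  then obtain f' where f': "smooth_real f'" "\<forall>x. (f has_real_derivative f' x) (at x)" by blast
  have "((\<lambda>x. f (a * x + b)) has_real_derivative f' (a * x + b) * a) (at x)" for x
    by (rule DERIV_chain'[of "\<lambda>x. a * x + b" _ _ _ f])
      (use f' in \<open>auto intro!: derivative_eq_intros\<close>)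
  moreover have "smooth_real (\<lambda>x. f' (a * x + b) * a)"
    by (intro smooth_real_mult smooth_real_const smooth_real.smooth_real_affine[OF f'(1)])
  ultimately show ?case by blast
qed

lemma smooth_real_continuous:
  assumes "smooth_real f" shows "continuous_on A f"
proof -
  obtain f' where "\<And>x. (f has_real_derivative f' x) (at x)"
    using smooth_real_has_derivative[OF assms] by blast
  then show ?thesis
    by (intro continuous_at_imp_continuous_on ballI) (rule DERIV_isCont)
qed

text \<open>The classical quotient of \<open>flat 0 x\<close> by
  \<open>flat 0 x + flat 0 (1 - x)\<close>, whose denominator never vanishes. The first derivative
  becomes the mollifier profile, and the second enters when a kernel is differentiated once.\<close>

lemma smooth_step_exists:
  "\<exists>E e e'. smooth_real E \<and> smooth_real e \<and> smooth_real e' \<and>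
     (\<forall>x\<le>0. E x = 0) \<and> (\<forall>x\<ge>1. E x = (1::real)) \<and>
     (\<forall>x. (E has_real_derivative e x) (at x)) \<and> (\<forall>x. (e has_real_derivative e' x) (at x)) \<and>
     (\<forall>x. x \<le> 0 \<or> x \<ge> 1 \<longrightarrow> e x = 0 \<and> e' x = 0)"
proof -
  define E where "E x = flat 0 x * inverse (flat 0 x + flat 0 ((-1) * x + 1))" for x
  have pos: "flat 0 x + flat 0 ((-1) * x + 1) \<noteq> 0" for x
    by (auto simp: flat_def add_nonneg_eq_0_iff)
  have E: "smooth_real E"
    unfolding E_def using pos by (intro smooth_real_intros smooth_real_affine) auto
  have E0: "E x = 0" if "x \<le> 0" for x using that by (simp add: E_def flat_def)
  have E1: "E x = 1" if "x \<ge> 1" for x using that by (simp add: E_def flat_def)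
  obtain e where e: "smooth_real e" "\<And>x. (E has_real_derivative e x) (at x)"
    using smooth_real_has_derivative[OF E] by blast
  obtain e' where e': "smooth_real e'" "\<And>x. (e has_real_derivative e' x) (at x)"
    using smooth_real_has_derivative[OF e(1)] by blast
  \<comment> \<open>Used for both derivatives: where a function is constant on the open half-lines,
    its derivative vanishes there, and continuity carries this to the end points 0 and 1.\<close>
  have *: "d x = 0" if d: "smooth_real d" and g: "\<And>x. (g has_real_derivative d x) (at x)"
    and c: "(\<forall>x\<le>0. g x = a) \<and> (\<forall>x\<ge>1. g x = b)"
    and x: "x \<le> 0 \<or> x \<ge> 1" for g d :: "real \<Rightarrow> real" and a b x :: real
  proof -
    have in_open: "d y = 0" if "open S" "y \<in> S" "\<And>x. x \<in> S \<Longrightarrow> g x = k" for y k S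
    proof -
      have "(g has_real_derivative 0) (at y)"
        by (rule has_field_derivative_transform_within_open[of "\<lambda>_. k" _ _ S]) (use that in auto)
      then show ?thesis using g[of y] DERIV_unique by blast
    qed
    have "d x = 0" if "x \<in> closure {..<0}"
      by (rule continuous_constant_on_closure[OF smooth_real_continuous[OF d] _ that])
        (use in_open[of "{..<0}"] c in auto)
    moreover have "d x = 0" if "x \<in> closure {1<..}"
      by (rule continuous_constant_on_closure[OF smooth_real_continuous[OF d] _ that])
        (use in_open[of "{1<..}"] c in auto)
    ultimately show ?thesis using x by auto
  qed
  have e0: "e x = 0" if "x \<le> 0 \<or> x \<ge> 1" for x
    using *[OF e(1) e(2), of 0 1 x] E0 E1 that by auto
  have "e' x = 0" if "x \<le> 0 \<or> x \<ge> 1" for x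
    using *[OF e'(1) e'(2), of 0 0 x] e0 that by auto
  with E e e' E0 E1 e0 show ?thesis
    by (intro exI[of _ E] exI[of _ e] exI[of _ e'] conjI allI impI) auto
qed

text \<open>Generated by smooth functions of one linear coordinate, which covers tensor product
  kernels. The class is again closed under directional derivatives, so its members are
  differentiable to all orders in the sense of \<open>dir_derivs\<close>.\<close>

inductive smooth_prod :: "('a::euclidean_space \<Rightarrow> real) \<Rightarrow> bool" where
  smooth_prod_real: "smooth_real g \<Longrightarrow> smooth_prod (\<lambda>z. g (z \<bullet> b))"
| smooth_prod_const: "smooth_prod (\<lambda>z. c)"
| smooth_prod_add: "smooth_prod f \<Longrightarrow> smooth_prod g \<Longrightarrow> smooth_prod (\<lambda>z. f z + g z)"
| smooth_prod_mult: "smooth_prod f \<Longrightarrow> smooth_prod g \<Longrightarrow> smooth_prod (\<lambda>z. f z * g z)"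

lemma smooth_prod_prod:
  assumes "finite B" "\<And>b. b \<in> B \<Longrightarrow> smooth_prod (f b)"
  shows "smooth_prod (\<lambda>z. \<Prod>b\<in>B. f b z)"
  using assms
proof (induction B)
  case empty
  then show ?case using smooth_prod_const[of 1] by simp
next
  case (insert b B)
  then show ?case using smooth_prod_mult[of "f b" "\<lambda>z. \<Prod>b\<in>B. f b z"] by simp
qed

lemma smooth_prod_has_derivative:
  "smooth_prod f \<Longrightarrow> \<exists>f'. (\<forall>z. (f has_derivative f' z) (at z)) \<and> (\<forall>v. smooth_prod (\<lambda>z. f' z v))"
proof (induction rule: smooth_prod.induct)
  case (smooth_prod_real g b)
  then obtain g' where g': "smooth_real g'" "\<And>x. (g has_real_derivative g' x) (at x)"
    using smooth_real_has_derivative by blast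
  have "((\<lambda>z. g (z \<bullet> b)) has_derivative (\<lambda>v. (v \<bullet> b) * g' (z \<bullet> b))) (at z)" for z
  proof -
    have "((\<lambda>z. z \<bullet> b) has_derivative (\<lambda>v. v \<bullet> b)) (at z)"
      by (intro bounded_linear_imp_has_derivative bounded_linear_inner_left)
    moreover have "(g has_derivative (\<lambda>h. h * g' (z \<bullet> b))) (at (z \<bullet> b))"
      using g'(2)[of "z \<bullet> b"] by (simp add: has_field_derivative_def mult_commute_abs)
    ultimately show ?thesis using diff_chain_at[of "\<lambda>z. z \<bullet> b"] by (auto simp: o_def)
  qed
  moreover have "smooth_prod (\<lambda>z. (v \<bullet> b) * g' (z \<bullet> b))" for v
    by (intro smooth_prod_mult smooth_prod_const smooth_prod.smooth_prod_real g')
  ultimately show ?case by (intro exI[of _ "\<lambda>z v. (v \<bullet> b) * g' (z \<bullet> b)"]) auto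
next
  case (smooth_prod_const c)
  show ?case by (rule exI[of _ "\<lambda>z v. 0"]) (auto intro: smooth_prod.smooth_prod_const)
next
  case (smooth_prod_add f g)
  then obtain f' g' where "\<forall>z. (f has_derivative f' z) (at z)" "\<forall>v. smooth_prod (\<lambda>z. f' z v)"
    "\<forall>z. (g has_derivative g' z) (at z)" "\<forall>v. smooth_prod (\<lambda>z. g' z v)" by blast
  then show ?case
    by (intro exI[of _ "\<lambda>z v. f' z v + g' z v"])
      (auto intro!: smooth_prod.smooth_prod_add has_derivative_add)
next
  case (smooth_prod_mult f g)
  then obtain f' g' where *: "\<forall>z. (f has_derivative f' z) (at z)" "\<forall>v. smooth_prod (\<lambda>z. f' z v)"
    "\<forall>z. (g has_derivative g' z) (at z)" "\<forall>v. smooth_prod (\<lambda>z. g' z v)" by blast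
  have "smooth_prod (\<lambda>z. f z * g' z v + f' z v * g z)" for v
    using * smooth_prod_mult.hyps
    by (intro smooth_prod.smooth_prod_add smooth_prod.smooth_prod_mult) auto
  with * show ?case
    by (intro exI[of _ "\<lambda>z v. f z * g' z v + f' z v * g z"]) (auto intro!: has_derivative_mult)
qed

lemma smooth_prod_dir_derivs:
  assumes "smooth_prod f"
  shows "smooth_prod (dir_derivs vs f)"
proof (induction vs)
  case (Cons v vs)
  from smooth_prod_has_derivative[OF Cons] obtain f'
    where f': "\<And>z. (dir_derivs vs f has_derivative f' z) (at z)" "\<And>v. smooth_prod (\<lambda>z. f' z v)"
    by blast
  have "dir_derivs (v # vs) f = (\<lambda>z. f' z v)"
    using frechet_derivative_at[OF f'(1)] by auto
  with f'(2) show ?case by simp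
qed (use assms in simp)

lemma smooth_prod_differentiable:
  assumes "smooth_prod f"
  shows "dir_derivs vs f differentiable (at z)"
proof -
  obtain f' where "\<And>z. (dir_derivs vs f has_derivative f' z) (at z)"
    using smooth_prod_has_derivative[OF smooth_prod_dir_derivs[OF assms, of vs]] by blast
  then show ?thesis unfolding differentiable_def by blast
qed

section \<open>Symmetry of iterated directional derivatives\<close>

lemma dir_derivs_append: "dir_derivs (us @ vs) f = dir_derivs us (dir_derivs vs f)"
  by (induction us) auto

lemma dir_derivs_line:
  assumes "\<And>vs z. dir_derivs vs f differentiable (at z)"
  shows "((\<lambda>s. dir_derivs vs f (z + s *\<^sub>R u)) has_real_derivative dir_derivs (u # vs) f (z + s *\<^sub>R u)) (at s)"
proof -
  let ?g = "dir_derivs vs f"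
  have g: "(?g has_derivative frechet_derivative ?g (at (z + s *\<^sub>R u))) (at (z + s *\<^sub>R u))"
    using assms frechet_derivative_works by blast
  have "((\<lambda>s. z + s *\<^sub>R u) has_derivative (\<lambda>h. h *\<^sub>R u)) (at s)"
    by (auto intro!: derivative_eq_intros)
  from diff_chain_at[OF this g]
  have "((\<lambda>s. ?g (z + s *\<^sub>R u)) has_derivative
      (\<lambda>h. frechet_derivative ?g (at (z + s *\<^sub>R u)) (h *\<^sub>R u))) (at s)"
    by (simp add: o_def)
  moreover have "frechet_derivative ?g (at (z + s *\<^sub>R u)) (h *\<^sub>R u) =
      h * frechet_derivative ?g (at (z + s *\<^sub>R u)) u" for h
    using linear_frechet_derivative[of ?g "at (z + s *\<^sub>R u)"] assms by (simp add: linear_cmul)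
  ultimately show ?thesis
    by (simp add: has_field_derivative_def mult_commute_abs)
qed

text \<open>The second difference of \<open>f\<close> over a parallelogram with sides
  \<open>t u\<close> and \<open>t v\<close> is symmetric in \<open>u\<close> and \<open>v\<close>.
  Two applications of the mean value theorem, in either order, express it as \<open>t^2\<close>
  times one mixed derivative or the other at nearby points. Continuity of both finishes the argument
  as \<open>t\<close> tends to 0.\<close>

lemma dir_derivs_commute:
  assumes f: "\<And>vs z. dir_derivs vs f differentiable (at z)"
  shows "dir_derivs [u, v] f z = dir_derivs [v, u] f z"
proof -
  have second_difference: "\<exists>a b. 0 < a \<and> a < t \<and> 0 < b \<and> b < t \<and>
      f (z + t *\<^sub>R u + t *\<^sub>R v) - f (z + t *\<^sub>R u) - f (z + t *\<^sub>R v) + f z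
        = t\<^sup>2 * dir_derivs [v, u] f (z + a *\<^sub>R u + b *\<^sub>R v)"
    if t: "t > 0" for t u v
  proof -
    define g where "g s = f (z + t *\<^sub>R v + s *\<^sub>R u) - f (z + s *\<^sub>R u)" for s
    have dg: "(g has_real_derivative dir_derivs [u] f (z + t *\<^sub>R v + s *\<^sub>R u) - dir_derivs [u] f (z + s *\<^sub>R u)) (at s)" for s
      unfolding g_def using dir_derivs_line[OF f, of "[]"] by (auto intro!: derivative_intros)
    obtain a where a: "0 < a" "a < t" and
      1: "g t - g 0 = (t - 0) * (dir_derivs [u] f (z + t *\<^sub>R v + a *\<^sub>R u) - dir_derivs [u] f (z + a *\<^sub>R u))"
      using MVT2[OF t, of g, OF dg] by blast
    obtain b where b: "0 < b" "b < t" and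
      2: "dir_derivs [u] f (z + a *\<^sub>R u + t *\<^sub>R v) - dir_derivs [u] f (z + a *\<^sub>R u + 0 *\<^sub>R v)
        = (t - 0) * dir_derivs [v, u] f (z + a *\<^sub>R u + b *\<^sub>R v)"
      using MVT2[OF t, of "\<lambda>s. dir_derivs [u] f (z + a *\<^sub>R u + s *\<^sub>R v)"
          "\<lambda>s. dir_derivs [v, u] f (z + a *\<^sub>R u + s *\<^sub>R v)"] dir_derivs_line[OF f, of "[u]"]
      by blast
    have "g t - g 0 = t\<^sup>2 * dir_derivs [v, u] f (z + a *\<^sub>R u + b *\<^sub>R v)"
      using 1 2 by (simp add: algebra_simps power2_eq_square)
    moreover have "g t - g 0 = f (z + t *\<^sub>R u + t *\<^sub>R v) - f (z + t *\<^sub>R u) - f (z + t *\<^sub>R v) + f z"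
      by (simp add: g_def algebra_simps)
    ultimately show ?thesis using a b by metis
  qed
  have "\<exists>p q. norm (p - z) \<le> t * (norm u + norm v) \<and> norm (q - z) \<le> t * (norm u + norm v) \<and>
      dir_derivs [v, u] f p = dir_derivs [u, v] f q"
    if t: "t > 0" for t
  proof -
    obtain a b where 1: "0 < a" "a < t" "0 < b" "b < t"
      "f (z + t *\<^sub>R u + t *\<^sub>R v) - f (z + t *\<^sub>R u) - f (z + t *\<^sub>R v) + f z
        = t\<^sup>2 * dir_derivs [v, u] f (z + a *\<^sub>R u + b *\<^sub>R v)"
      using second_difference[OF t] by blast
    obtain a' b' where 2: "0 < a'" "a' < t" "0 < b'" "b' < t"
      "f (z + t *\<^sub>R v + t *\<^sub>R u) - f (z + t *\<^sub>R v) - f (z + t *\<^sub>R u) + f z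
        = t\<^sup>2 * dir_derivs [u, v] f (z + a' *\<^sub>R v + b' *\<^sub>R u)"
      using second_difference[OF t] by blast
    have "t\<^sup>2 * dir_derivs [v, u] f (z + a *\<^sub>R u + b *\<^sub>R v) = t\<^sup>2 * dir_derivs [u, v] f (z + a' *\<^sub>R v + b' *\<^sub>R u)"
      using 1(5) 2(5) by (simp add: algebra_simps)
    then have "dir_derivs [v, u] f (z + a *\<^sub>R u + b *\<^sub>R v) = dir_derivs [u, v] f (z + a' *\<^sub>R v + b' *\<^sub>R u)"
      using t by simp
    moreover have "norm (z + a *\<^sub>R u + b *\<^sub>R v - z) \<le> t * (norm u + norm v)"
      if "0 < a" "a < t" "0 < b" "b < t" for a b u v
    proof -
      have "norm (a *\<^sub>R u + b *\<^sub>R v) \<le> a * norm u + b * norm v"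
        using norm_triangle_ineq[of "a *\<^sub>R u" "b *\<^sub>R v"] that by simp
      also have "\<dots> \<le> t * norm u + t * norm v"
        using that by (intro add_mono mult_right_mono) auto
      finally show ?thesis by (simp add: algebra_simps)
    qed
    ultimately show ?thesis using 1 2 by (metis add.commute)
  qed
  then have "\<forall>n. \<exists>p q. norm (p - z) \<le> inverse (real (Suc n)) * (norm u + norm v) \<and>
      norm (q - z) \<le> inverse (real (Suc n)) * (norm u + norm v) \<and>
      dir_derivs [v, u] f p = dir_derivs [u, v] f q"
    by (simp del: of_nat_Suc)
  then obtain p q where pq: "\<And>n. norm (p n - z) \<le> inverse (real (Suc n)) * (norm u + norm v)"
      "\<And>n. norm (q n - z) \<le> inverse (real (Suc n)) * (norm u + norm v)"
      "\<And>n. dir_derivs [v, u] f (p n) = dir_derivs [u, v] f (q n)"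
    by metis
  have L: "(\<lambda>n. inverse (real (Suc n)) * (norm u + norm v)) \<longlonglongrightarrow> 0"
    using tendsto_mult_left_zero[OF LIMSEQ_inverse_real_of_nat] .
  have lim: "r \<longlonglongrightarrow> z" if r: "\<And>n. norm (r n - z) \<le> inverse (real (Suc n)) * (norm u + norm v)" for r
  proof (rule LIM_zero_cancel)
    have "\<forall>\<^sub>F n in sequentially. norm (r n - z) \<le> inverse (real (Suc n)) * (norm u + norm v)"
      by (rule always_eventually, rule allI, rule r)
    then show "(\<lambda>n. r n - z) \<longlonglongrightarrow> 0" using L by (rule Lim_null_comparison)
  qed
  have "p \<longlonglongrightarrow> z" by (rule lim) (rule pq)
  moreover have "q \<longlonglongrightarrow> z" by (rule lim) (rule pq)
  moreover have cont: "isCont (dir_derivs vs f) z" for vs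
    using f differentiable_imp_continuous_within by blast
  ultimately have "(\<lambda>n. dir_derivs [v, u] f (p n)) \<longlonglongrightarrow> dir_derivs [v, u] f z"
      "(\<lambda>n. dir_derivs [u, v] f (q n)) \<longlonglongrightarrow> dir_derivs [u, v] f z"
    by (metis isCont_tendsto_compose)+
  then show ?thesis using LIMSEQ_unique pq(3) by simp
qed

section \<open>Pucci operators\<close>

lemma trace_mult_eq: "trace (A ** X) = (\<Sum>i\<in>UNIV. \<Sum>j\<in>UNIV. A $ i $ j * X $ j $ i)"
  for A X :: "real ^ 'n::finite ^ 'n"
  by (simp add: trace_def matrix_matrix_mult_def)

lemma mat_quadratic: "v \<bullet> (mat c *v v) = c * (v \<bullet> v)" for v :: "real ^ 'n::finite"
proof -
  have "mat c *v v = c *\<^sub>R v"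
    by (simp add: vec_eq_iff matrix_vector_mult_def mat_def if_distrib[of "\<lambda>x. x * _"] cong: if_cong)
  then show ?thesis by simp
qed

lemma elliptic_mats_nonempty:
  assumes "lam \<le> Lam" shows "mat lam \<in> (elliptic_mats lam Lam :: (real ^ 'n::finite ^ 'n) set)"
  using assms by (auto simp: elliptic_mats_def sym_mats_def mat_le_def mat_quadratic mult_right_mono)

lemma elliptic_mats_sym: "A \<in> elliptic_mats lam Lam \<Longrightarrow> A $ i $ j = A $ j $ i"
  by (metis (mono_tags, lifting) elliptic_mats_def mem_Collect_eq sym_mats_def transpose_def vec_lambda_beta)

text \<open>Polarization: the values of the quadratic form of \<open>A\<close> at the sum and at the
  difference of two unit vectors lie between 0 and \<open>4 * Lam\<close>, and they differ by four
  times the entry.\<close>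

lemma elliptic_mats_bounded:
  fixes A :: "real ^ 'n::finite ^ 'n"
  assumes A: "A \<in> elliptic_mats lam Lam" and lam: "0 < lam"
  shows "\<bar>A $ i $ j\<bar> \<le> Lam"
proof -
  have quad: "0 \<le> v \<bullet> (A *v v)" "v \<bullet> (A *v v) \<le> Lam * (v \<bullet> v)" for v
    using A lam unfolding elliptic_mats_def mat_le_def mat_quadratic
    by (auto intro: order_trans[OF mult_nonneg_nonneg[of lam "v \<bullet> v"]])
  have expand: "(axis i 1 + s *\<^sub>R axis j 1) \<bullet> (A *v (axis i 1 + s *\<^sub>R axis j 1))
      = A $ i $ i + 2 * s * A $ i $ j + s\<^sup>2 * A $ j $ j" for s
  proof -
    have ent: "axis a 1 \<bullet> (A *v axis b 1) = A $ a $ b" for a b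
      by (simp add: inner_axis' matrix_vector_mult_basis column_def)
    show ?thesis
      by (simp add: matrix_vector_right_distrib inner_simps ent matrix_vector_mult_scaleR
          elliptic_mats_sym[OF A, of j i] power2_eq_square algebra_simps)
  qed
  have nrm: "(axis i 1 + s *\<^sub>R axis j 1) \<bullet> (axis i 1 + s *\<^sub>R (axis j 1 :: real ^ 'n)) \<le> 2 * (1 + s\<^sup>2)"
    for s :: real
  proof -
    have "(axis i 1 + s *\<^sub>R axis j 1) \<bullet> (axis i 1 + s *\<^sub>R (axis j 1 :: real ^ 'n)) =
        1 + 2 * s * (if i = j then 1 else 0) + s\<^sup>2"
      by (auto simp: inner_simps inner_axis_axis power2_eq_square algebra_simps)
    also have "\<dots> \<le> 2 * (1 + s\<^sup>2)"
      using sum_squares_bound[of 1 s] by (auto simp: power2_eq_square algebra_simps)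
    finally show ?thesis .
  qed
  have Lam: "0 \<le> Lam"
    using order_trans[OF quad, of "axis i 1"] by (simp add: inner_axis_axis)
  have diag: "0 \<le> A $ k $ k" for k
    using quad(1)[of "axis k 1"] by (simp add: inner_axis' matrix_vector_mult_basis column_def)
  have "4 * \<bar>A $ i $ j\<bar> \<le> 4 * Lam"
  proof -
    have up: "(axis i 1 + s *\<^sub>R axis j 1) \<bullet> (A *v (axis i 1 + s *\<^sub>R axis j 1)) \<le> Lam * (2 * (1 + s\<^sup>2))" for s
      using quad(2)[of "axis i 1 + s *\<^sub>R axis j 1"] mult_left_mono[OF nrm[of s] Lam] by linarith
    show ?thesis
      using up[of 1] up[of "-1"] quad(1)[of "axis i 1 + 1 *\<^sub>R axis j 1"] quad(1)[of "axis i 1 + (-1) *\<^sub>R axis j 1"]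
      unfolding expand by (simp add: abs_le_iff)
  qed
  then show ?thesis by simp
qed

text \<open>The operators are suprema and infima of sets of reals, which have their usual properties
  only for bounded sets.\<close>

lemma pucci_minus_bdd:
  fixes X :: "real ^ 'n::finite ^ 'n"
  assumes "0 < lam"
  shows "bdd_below ((\<lambda>A. - trace (A ** X)) ` elliptic_mats lam Lam)"
    and "bdd_above ((\<lambda>A. - trace (A ** X)) ` elliptic_mats lam Lam)"
proof -
  have *: "\<bar>trace (A ** X)\<bar> \<le> (\<Sum>i\<in>UNIV. \<Sum>j\<in>UNIV. Lam * \<bar>X $ j $ i\<bar>)" if "A \<in> elliptic_mats lam Lam" for A
  proof -
    have "\<bar>trace (A ** X)\<bar> \<le> (\<Sum>i\<in>UNIV. \<Sum>j\<in>UNIV. \<bar>A $ i $ j * X $ j $ i\<bar>)"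
      unfolding trace_mult_eq by (intro order_trans[OF sum_abs] sum_mono order_refl)
    also have "\<dots> \<le> (\<Sum>i\<in>UNIV. \<Sum>j\<in>UNIV. Lam * \<bar>X $ j $ i\<bar>)"
      unfolding abs_mult by (intro sum_mono mult_right_mono elliptic_mats_bounded[OF that assms]) auto
    finally show ?thesis .
  qed
  show "bdd_below ((\<lambda>A. - trace (A ** X)) ` elliptic_mats lam Lam)"
    by (intro bdd_belowI[of _ "- (\<Sum>i\<in>UNIV. \<Sum>j\<in>UNIV. Lam * \<bar>X $ j $ i\<bar>)"]) (use * in fastforce)
  show "bdd_above ((\<lambda>A. - trace (A ** X)) ` elliptic_mats lam Lam)"
    by (intro bdd_aboveI[of _ "\<Sum>i\<in>UNIV. \<Sum>j\<in>UNIV. Lam * \<bar>X $ j $ i\<bar>"]) (use * in fastforce)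
qed

lemma pucci_minus_le:
  "0 < lam \<Longrightarrow> A \<in> elliptic_mats lam Lam \<Longrightarrow> pucci_minus lam Lam X \<le> - trace (A ** X)"
  unfolding pucci_minus_def by (rule cINF_lower[OF pucci_minus_bdd(1)])

lemma pucci_minus_ge:
  fixes X :: "real ^ 'n::finite ^ 'n"
  assumes "lam \<le> Lam" "\<And>A. A \<in> elliptic_mats lam Lam \<Longrightarrow> c \<le> - trace (A ** X)"
  shows "c \<le> pucci_minus lam Lam X"
  unfolding pucci_minus_def using elliptic_mats_nonempty[OF assms(1)]
  by (intro cINF_greatest assms(2)) auto

text \<open>The duality between the two operators, together with homogeneity. It turns a solution
  for \<open>pucci_plus\<close> into one for \<open>pucci_minus\<close> after a change of sign and a
  parabolic scaling.\<close>

lemma pucci_minus_scaleR_minus: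
  fixes X :: "real ^ 'n::finite ^ 'n"
  assumes "0 < lam" "lam \<le> Lam" "0 < c"
  shows "pucci_minus lam Lam (- (c *\<^sub>R X)) = - c * pucci_plus lam Lam X"
proof -
  let ?E = "elliptic_mats lam Lam :: (real ^ 'n ^ 'n) set"
  have ne: "?E \<noteq> {}" using elliptic_mats_nonempty[OF assms(2)] by blast
  have tr: "- trace (A ** (- (c *\<^sub>R X))) = - c * (- trace (A ** X))" for A :: "real ^ 'n ^ 'n"
    by (simp add: trace_mult_eq sum_distrib_left mult_ac sum_negf)
  have up: "- trace (A ** X) \<le> pucci_plus lam Lam X" if "A \<in> ?E" for A
    unfolding pucci_plus_def by (rule cSUP_upper[OF that pucci_minus_bdd(2)[OF assms(1)]])
  have "- c * pucci_plus lam Lam X \<le> pucci_minus lam Lam (- (c *\<^sub>R X))"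
  proof (rule pucci_minus_ge[OF assms(2)])
    fix A :: "real ^ 'n ^ 'n" assume "A \<in> ?E"
    then show "- c * pucci_plus lam Lam X \<le> - trace (A ** (- (c *\<^sub>R X)))"
      unfolding tr using mult_left_mono[OF up[of A], of c] assms(3) by simp
  qed
  moreover have "pucci_plus lam Lam X \<le> - pucci_minus lam Lam (- (c *\<^sub>R X)) / c"
    unfolding pucci_plus_def
  proof (rule cSUP_least[OF ne])
    fix A assume "A \<in> ?E"
    from pucci_minus_le[OF assms(1) this, of "- (c *\<^sub>R X)"]
    show "- trace (A ** X) \<le> - pucci_minus lam Lam (- (c *\<^sub>R X)) / c"
      unfolding tr using assms(3) by (simp add: field_simps)
  qed
  then have "- c * pucci_plus lam Lam X \<ge> pucci_minus lam Lam (- (c *\<^sub>R X))"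
    using assms(3) by (simp add: field_simps)
  ultimately show ?thesis by simp
qed

text \<open>A symmetric coefficient matrix pairs only with the symmetric part. Versions of the mixed
  weak derivatives may therefore be symmetrized without changing the equation.\<close>

lemma pucci_minus_cong_trace:
  fixes X Y :: "real ^ 'n::finite ^ 'n"
  assumes "\<And>i j. X $ i $ j + X $ j $ i = Y $ i $ j + Y $ j $ i"
  shows "pucci_minus lam Lam X = pucci_minus lam Lam Y"
  unfolding pucci_minus_def
proof (rule INF_cong[OF refl])
  fix A assume A: "A \<in> (elliptic_mats lam Lam :: (real ^ 'n ^ 'n) set)"
  have "2 * trace (A ** Z) = (\<Sum>i\<in>UNIV. \<Sum>j\<in>UNIV. A $ i $ j * (Z $ i $ j + Z $ j $ i))" for Z
  proof -
    have "trace (A ** Z) = (\<Sum>i\<in>UNIV. \<Sum>j\<in>UNIV. A $ i $ j * Z $ i $ j)"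
      unfolding trace_mult_eq by (subst sum.swap) (simp add: elliptic_mats_sym[OF A, of _])
    moreover have "trace (A ** Z) = (\<Sum>i\<in>UNIV. \<Sum>j\<in>UNIV. A $ i $ j * Z $ j $ i)"
      by (rule trace_mult_eq)
    ultimately show ?thesis by (simp add: distrib_left sum.distrib)
  qed
  from this[of X] this[of Y] show "- trace (A ** X) = - trace (A ** Y)" using assms by simp
qed

text \<open>An infimum of linear functions is superadditive, and the bound passes to convergent
  series because it is tested on each coefficient matrix separately.\<close>

lemma pucci_minus_sums:
  fixes X :: "nat \<Rightarrow> real ^ 'n::finite ^ 'n"
  assumes "0 < lam" "lam \<le> Lam"
    and X: "\<And>i j. (\<lambda>k. X k $ i $ j) sums (Y $ i $ j)"
    and s: "(\<lambda>k. pucci_minus lam Lam (X k)) sums s"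
  shows "s \<le> pucci_minus lam Lam Y"
proof (rule pucci_minus_ge[OF assms(2)])
  fix A assume A: "A \<in> (elliptic_mats lam Lam :: (real ^ 'n ^ 'n) set)"
  have "(\<lambda>k. - trace (A ** X k)) sums (- trace (A ** Y))"
    unfolding trace_mult_eq by (intro sums_minus sums_sum sums_mult X)
  then show "s \<le> - trace (A ** Y)"
    by (rule sums_le[OF pucci_minus_le[OF assms(1) A] s])
qed

section \<open>Weak derivatives of Borel functions\<close>

text \<open>The counterpart of \<open>has_weak_deriv\<close> for integrals over the whole space,
  where Fubini's theorem and linear substitutions for \<open>lborel\<close> apply. The test function
  confines the integrals to \<open>U\<close>; integrability is kept apart and supplied by bounds in
  \<open>L^p\<close>.\<close>

definition weak_deriv ::
    "'a::euclidean_space set \<Rightarrow> 'a list \<Rightarrow> ('a \<Rightarrow> real) \<Rightarrow> ('a \<Rightarrow> real) \<Rightarrow> bool" where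
  "weak_deriv U vs f g \<longleftrightarrow> (\<forall>\<psi>. test_fun U \<psi> \<longrightarrow>
     (\<integral>z. f z * dir_derivs vs \<psi> z \<partial>lborel) = (- 1) ^ length vs * (\<integral>z. g z * \<psi> z \<partial>lborel))"

lemma dir_derivs_cong_open:
  assumes "open S" "z \<in> S" "\<And>y. y \<in> S \<Longrightarrow> f y = g y"
    and f: "\<And>vs z. dir_derivs vs f differentiable (at z)"
    and g: "\<And>vs z. dir_derivs vs g differentiable (at z)"
  shows "dir_derivs vs f z = dir_derivs vs g z"
  using assms(2)
proof (induction vs arbitrary: z)
  case (Cons v vs)
  have "(dir_derivs vs g has_derivative frechet_derivative (dir_derivs vs g) (at z)) (at z)"
    using g frechet_derivative_works by blast
  then have "(dir_derivs vs f has_derivative frechet_derivative (dir_derivs vs g) (at z)) (at z)"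
    by (rule has_derivative_transform_within_open[OF _ assms(1)]) (use Cons in auto)
  from frechet_derivative_at[OF this] show ?case by simp
qed (use assms(3) in auto)

lemma dir_derivs_zero: "dir_derivs vs (\<lambda>z. 0) z = 0"
proof (induction vs arbitrary: z)
  case (Cons v vs)
  then have "dir_derivs vs (\<lambda>z. 0) = (\<lambda>z. 0)" by blast
  then show ?case by simp
qed simp

text \<open>Derivatives at a point depend only on a neighbourhood, and the complement of the closed
  support is open.\<close>

lemma test_fun_outside:
  assumes "test_fun U \<psi>" "z \<notin> closure {z. \<psi> z \<noteq> 0}"
  shows "dir_derivs vs \<psi> z = 0"
proof -
  have diff0: "dir_derivs vs (\<lambda>z::'a. 0) differentiable (at z)" for vs z
  proof -
    have "dir_derivs vs (\<lambda>z::'a. 0) = (\<lambda>z. 0)" by (simp add: fun_eq_iff dir_derivs_zero)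
    then show ?thesis by simp
  qed
  have "dir_derivs vs \<psi> z = dir_derivs vs (\<lambda>z. 0) z"
    by (rule dir_derivs_cong_open[of "- closure {z. \<psi> z \<noteq> 0}"])
      (use assms diff0 closure_subset[of "{z. \<psi> z \<noteq> 0}"] in \<open>auto simp: test_fun_def\<close>)
  then show ?thesis by (simp add: dir_derivs_zero)
qed

lemma test_fun_outside_domain: "test_fun U \<psi> \<Longrightarrow> z \<notin> U \<Longrightarrow> dir_derivs vs \<psi> z = 0"
  by (rule test_fun_outside) (auto simp: test_fun_def)

lemma test_fun_continuous:
  assumes "test_fun U \<psi>" shows "continuous_on A (dir_derivs vs \<psi>)"
  using assms by (auto simp: test_fun_def intro!: continuous_at_imp_continuous_on differentiable_imp_continuous_within)

lemma test_fun_measurable [measurable_dest]: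
  "test_fun U \<psi> \<Longrightarrow> dir_derivs vs \<psi> \<in> borel_measurable borel"
  by (intro borel_measurable_continuous_onI test_fun_continuous)

lemma test_fun_bounded:
  assumes "test_fun U \<psi>" shows "\<exists>B. \<forall>z. \<bar>dir_derivs vs \<psi> z\<bar> \<le> B"
proof -
  let ?K = "closure {z. \<psi> z \<noteq> 0}"
  have "compact (dir_derivs vs \<psi> ` ?K)"
    using assms by (intro compact_continuous_image test_fun_continuous) (auto simp: test_fun_def)
  then obtain B where B: "\<And>z. z \<in> ?K \<Longrightarrow> \<bar>dir_derivs vs \<psi> z\<bar> \<le> B"
    by (meson bounded_real compact_imp_bounded imageI)
  have "\<bar>dir_derivs vs \<psi> z\<bar> \<le> max B 0" for z
    using B[of z] test_fun_outside[OF assms, of z] by (cases "z \<in> ?K") (auto simp: le_max_iff_disj)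
  then show ?thesis by blast
qed

lemma test_fun_mono: "test_fun U \<psi> \<Longrightarrow> U \<subseteq> V \<Longrightarrow> test_fun V \<psi>"
  by (auto simp: test_fun_def)

lemma weak_deriv_mono: "weak_deriv V vs f g \<Longrightarrow> U \<subseteq> V \<Longrightarrow> weak_deriv U vs f g"
  by (auto simp: weak_deriv_def test_fun_mono)

section \<open>Passage between Lebesgue functions on a set and Borel functions on the space\<close>

lemma integral_lebesgue_on_lborel:
  fixes f g :: "'a::euclidean_space \<Rightarrow> real"
  assumes U: "U \<in> sets lebesgue" and g[measurable]: "g \<in> borel_measurable borel"
    and f: "f \<in> borel_measurable (lebesgue_on U)"
    and eq: "AE z in lebesgue_on U. f z = g z" and out: "\<And>z. z \<notin> U \<Longrightarrow> g z = 0"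
  shows "integral\<^sup>L (lebesgue_on U) f = integral\<^sup>L lborel g"
    and "integrable (lebesgue_on U) f \<longleftrightarrow> integrable lborel g"
proof -
  have gm: "g \<in> borel_measurable (lebesgue_on U)"
    by (intro measurable_restrict_space1 measurable_completion) simp
  have ind: "(\<lambda>x. indicat_real U x * g x) = g" using out by (auto simp: fun_eq_iff indicator_def)
  have "integral\<^sup>L (lebesgue_on U) f = integral\<^sup>L (lebesgue_on U) g"
    by (rule integral_cong_AE[OF f gm eq])
  also have "\<dots> = integral\<^sup>L lebesgue g"
    using U by (subst integral_restrict_space) (auto simp: ind)
  also have "\<dots> = integral\<^sup>L lborel g" by (rule integral_completion) simp
  finally show "integral\<^sup>L (lebesgue_on U) f = integral\<^sup>L lborel g" .
  have "integrable (lebesgue_on U) f \<longleftrightarrow> integrable (lebesgue_on U) g"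
    by (rule integrable_cong_AE[OF f gm eq])
  also have "\<dots> \<longleftrightarrow> integrable lebesgue g"
    using U by (subst integrable_restrict_space) (auto simp: ind)
  also have "\<dots> \<longleftrightarrow> integrable lborel g" by (rule integrable_completion) simp
  finally show "integrable (lebesgue_on U) f \<longleftrightarrow> integrable lborel g" .
qed

lemma borel_version:
  fixes f :: "'a::euclidean_space \<Rightarrow> real"
  assumes U: "U \<in> sets borel" and f: "f \<in> borel_measurable (lebesgue_on U)"
  shows "\<exists>g\<in>borel_measurable borel. (AE z in lebesgue_on U. f z = g z) \<and> (\<forall>z. z \<notin> U \<longrightarrow> g z = 0)"
proof -
  have UL: "U \<in> sets lebesgue" using U by simp
  have "(\<lambda>z. indicat_real U z *\<^sub>R f z) \<in> borel_measurable lebesgue"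
    using f UL by (subst (asm) borel_measurable_restrict_space_iff) auto
  from completion_ex_borel_measurable_real[OF this] obtain g
    where g: "g \<in> borel_measurable lborel" "AE z in lborel. indicat_real U z *\<^sub>R f z = g z" by blast
  have "AE z in lebesgue. indicat_real U z *\<^sub>R f z = g z" by (rule AE_completion[OF g(2)])
  then have "AE z in lebesgue_on U. f z = indicat_real U z * g z"
    using UL by (subst AE_restrict_space_iff) (auto elim!: eventually_mono simp: indicator_def)
  moreover have "(\<lambda>z. indicat_real U z * g z) \<in> borel_measurable borel"
    using g(1) U by simp
  ultimately show ?thesis by (intro bexI[of _ "\<lambda>z. indicat_real U z * g z"]) auto
qed

text \<open>The integrals against test functions do not notice changes on null sets, so Lebesgue
  measurable versions may be exchanged for Borel ones.\<close>

lemma has_weak_deriv_imp_weak_deriv: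
  fixes f g f' g' :: "'a::euclidean_space \<Rightarrow> real"
  assumes h: "has_weak_deriv U vs f g" and U: "open U"
    and [measurable]: "f' \<in> borel_measurable borel" "g' \<in> borel_measurable borel"
    and m: "f \<in> borel_measurable (lebesgue_on U)" "g \<in> borel_measurable (lebesgue_on U)"
    and ae: "AE z in lebesgue_on U. f z = f' z" "AE z in lebesgue_on U. g z = g' z"
  shows "weak_deriv U vs f' g'"
  unfolding weak_deriv_def
proof (intro allI impI)
  fix \<psi> assume \<psi>: "test_fun U \<psi>"
  note [measurable] = test_fun_measurable[OF \<psi>]
  have dm: "dir_derivs ws \<psi> \<in> borel_measurable (lebesgue_on U)" for ws
    by (intro measurable_restrict_space1 measurable_completion) simp
  have UL: "U \<in> sets lebesgue" using U by simp
  have 1: "integral\<^sup>L (lebesgue_on U) (\<lambda>z. f z * dir_derivs vs \<psi> z) = (\<integral>z. f' z * dir_derivs vs \<psi> z \<partial>lborel)"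
    by (rule integral_lebesgue_on_lborel[OF UL])
       (use m dm[of vs] ae test_fun_outside_domain[OF \<psi>, of _ vs] in auto)
  have \<psi>m: "\<psi> \<in> borel_measurable borel" "\<psi> \<in> borel_measurable (lebesgue_on U)"
    using test_fun_measurable[OF \<psi>, of "[]"] dm[of "[]"] by simp_all
  have 2: "integral\<^sup>L (lebesgue_on U) (\<lambda>z. g z * \<psi> z) = (\<integral>z. g' z * \<psi> z \<partial>lborel)"
    by (rule integral_lebesgue_on_lborel[OF UL])
       (use m \<psi>m ae test_fun_outside_domain[OF \<psi>, of _ "[]"] in auto)
  show "(\<integral>z. f' z * dir_derivs vs \<psi> z \<partial>lborel) = (- 1) ^ length vs * (\<integral>z. g' z * \<psi> z \<partial>lborel)"
    using h \<psi> unfolding has_weak_deriv_def 1[symmetric] 2[symmetric] by blast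
qed

lemma weak_deriv_imp_has_weak_deriv:
  fixes f g :: "'a::euclidean_space \<Rightarrow> real"
  assumes h: "weak_deriv V vs f g" and UV: "U \<subseteq> V" and U: "open U"
    and [measurable]: "f \<in> borel_measurable borel" "g \<in> borel_measurable borel"
    and loc: "locally_integrable U f" "locally_integrable U g"
  shows "has_weak_deriv U vs f g"
  unfolding has_weak_deriv_def
proof (intro conjI loc allI impI)
  fix \<psi> assume \<psi>: "test_fun U \<psi>"
  note [measurable] = test_fun_measurable[OF \<psi>] test_fun_measurable[OF \<psi>, of "[]", simplified]
  have UL: "U \<in> sets lebesgue" using U by simp
  have Lm: "k \<in> borel_measurable (lebesgue_on U)" if "k \<in> borel_measurable borel" for k :: "'a \<Rightarrow> real"
    using that by (intro measurable_restrict_space1 measurable_completion) simp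
  have 1: "integral\<^sup>L (lebesgue_on U) (\<lambda>z. f z * dir_derivs vs \<psi> z) = (\<integral>z. f z * dir_derivs vs \<psi> z \<partial>lborel)"
    by (rule integral_lebesgue_on_lborel[OF UL])
       (auto intro!: Lm simp: test_fun_outside_domain[OF \<psi>, of _ vs])
  have 2: "integral\<^sup>L (lebesgue_on U) (\<lambda>z. g z * \<psi> z) = (\<integral>z. g z * \<psi> z \<partial>lborel)"
    by (rule integral_lebesgue_on_lborel[OF UL])
       (auto intro!: Lm simp: test_fun_outside_domain[OF \<psi>, of _ "[]", simplified])
  show "integral\<^sup>L (lebesgue_on U) (\<lambda>z. f z * dir_derivs vs \<psi> z) =
       (- 1) ^ length vs * integral\<^sup>L (lebesgue_on U) (\<lambda>z. g z * \<psi> z)"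
    unfolding 1 2 using h test_fun_mono[OF \<psi> UV] unfolding weak_deriv_def by blast
qed

section \<open>Affine changes of variables\<close>

text \<open>Space and time scale differently under a parabolic scaling, hence one factor per
  coordinate. Basis vectors are eigenvectors of the linear part, so derivatives along them pick up
  plain factors.\<close>

definition diag_affine :: "'a::euclidean_space \<Rightarrow> ('a \<Rightarrow> real) \<Rightarrow> 'a \<Rightarrow> 'a" where
  "diag_affine a c z = a + (\<Sum>j\<in>Basis. (c j * (z \<bullet> j)) *\<^sub>R j)"

lemma diag_affine_measurable [measurable]: "diag_affine a c \<in> borel \<rightarrow>\<^sub>M borel"
  unfolding diag_affine_def[abs_def] by simp

lemma continuous_on_diag_affine: "continuous_on A (diag_affine a c)"
  unfolding diag_affine_def[abs_def] by (intro continuous_intros)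

lemma lborel_diag_affine:
  assumes "\<And>j. j \<in> Basis \<Longrightarrow> c j \<noteq> 0"
  shows "lborel = density (distr lborel borel (diag_affine a c)) (\<lambda>_. ennreal (\<Prod>j\<in>Basis. \<bar>c j\<bar>))"
  using lborel_affine_euclidean[of c a] assms by (simp add: diag_affine_def[abs_def])

lemma integral_diag_affine:
  fixes f :: "'a::euclidean_space \<Rightarrow> real"
  assumes c: "\<And>j. j \<in> Basis \<Longrightarrow> c j \<noteq> 0" and [measurable]: "f \<in> borel_measurable borel"
  shows "(\<integral>z. f (diag_affine a c z) \<partial>lborel) = (\<integral>z. f z \<partial>lborel) / (\<Prod>j\<in>Basis. \<bar>c j\<bar>)"
    and "integrable lborel (\<lambda>z. f (diag_affine a c z)) \<longleftrightarrow> integrable lborel f"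
proof -
  have k: "(\<Prod>j\<in>Basis. \<bar>c j\<bar>) > 0" using c by (intro prod_pos) auto
  have "(\<integral>z. f z \<partial>lborel) = (\<integral>z. f z \<partial>density (distr lborel borel (diag_affine a c)) (\<lambda>_. ennreal (\<Prod>j\<in>Basis. \<bar>c j\<bar>)))"
    using lborel_diag_affine[of c a] c by metis
  also have "\<dots> = (\<Prod>j\<in>Basis. \<bar>c j\<bar>) * (\<integral>z. f (diag_affine a c z) \<partial>lborel)"
    using k by (subst integral_density) (auto simp: integral_distr)
  finally show "(\<integral>z. f (diag_affine a c z) \<partial>lborel) = (\<integral>z. f z \<partial>lborel) / (\<Prod>j\<in>Basis. \<bar>c j\<bar>)"
    using k c by auto
  have "integrable lborel f \<longleftrightarrow>
      integrable (density (distr lborel borel (diag_affine a c)) (\<lambda>_. ennreal (\<Prod>j\<in>Basis. \<bar>c j\<bar>))) f"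
    using lborel_diag_affine[of c a] c by metis
  also have "\<dots> \<longleftrightarrow> integrable lborel (\<lambda>z. f (diag_affine a c z))"
    using k c by (subst integrable_density) (auto simp: integrable_distr_eq)
  finally show "integrable lborel (\<lambda>z. f (diag_affine a c z)) \<longleftrightarrow> integrable lborel f" ..
qed

lemma AE_diag_affine:
  assumes c: "\<And>j. j \<in> Basis \<Longrightarrow> c j \<noteq> (0::real)" and P: "AE z in lborel. P z"
  shows "AE z in lborel. P (diag_affine a c z :: 'a::euclidean_space)"
proof -
  have k: "(\<Prod>j\<in>Basis. \<bar>c j\<bar>) > 0" using c by (intro prod_pos) auto
  have "AE z in density (distr lborel borel (diag_affine a c)) (\<lambda>_. ennreal (\<Prod>j\<in>Basis. \<bar>c j\<bar>)). P z"
    using P lborel_diag_affine[of c a] c by metis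
  then have "AE z in distr lborel borel (diag_affine a c). P z"
    using k by (subst (asm) AE_density) auto
  then show ?thesis by (rule AE_distrD[rotated]) simp
qed

lemma dir_derivs_diag_affine:
  assumes f: "\<And>vs z. dir_derivs vs f differentiable (at z)"
    and vs: "set vs \<subseteq> Basis"
  shows "dir_derivs vs (\<lambda>z. f (diag_affine a c z)) z = prod_list (map c vs) * dir_derivs vs f (diag_affine a c z)"
    and "dir_derivs ws (\<lambda>z. f (diag_affine a c z)) differentiable (at z)"
proof -
  let ?L = "\<lambda>v. \<Sum>j\<in>Basis. (c j * (v \<bullet> j)) *\<^sub>R j"
  have L: "(diag_affine a c has_derivative ?L) (at z)" for z
    unfolding diag_affine_def[abs_def] by (auto intro!: derivative_eq_intros)
  have Lv: "?L v = c v *\<^sub>R v" if "v \<in> Basis" for v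
  proof -
    have "?L v = (\<Sum>j\<in>Basis. if j = v then c v *\<^sub>R v else 0)"
      by (intro sum.cong) (use that in \<open>auto simp: inner_Basis\<close>)
    with that show ?thesis by simp
  qed
  have d: "((\<lambda>z. k * dir_derivs vs f (diag_affine a c z)) has_derivative
      (\<lambda>v. k * frechet_derivative (dir_derivs vs f) (at (diag_affine a c z)) (?L v))) (at z)" for vs z and k :: real
  proof -
    have "(dir_derivs vs f has_derivative frechet_derivative (dir_derivs vs f) (at (diag_affine a c z))) (at (diag_affine a c z))"
      using f frechet_derivative_works by blast
    from diff_chain_at[OF L this] show ?thesis
      by (auto simp: o_def intro!: has_derivative_mult_right)
  qed
  have *: "dir_derivs vs (\<lambda>z. f (diag_affine a c z)) = (\<lambda>z. prod_list (map c vs) * dir_derivs vs f (diag_affine a c z))"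
    if "set vs \<subseteq> Basis" for vs
    using that
  proof (induction vs)
    case (Cons v vs)
    then have IH: "dir_derivs vs (\<lambda>z. f (diag_affine a c z)) = (\<lambda>z. prod_list (map c vs) * dir_derivs vs f (diag_affine a c z))"
      and v: "v \<in> Basis" by auto
    show ?case
    proof
      fix z
      have "linear (frechet_derivative (dir_derivs vs f) (at (diag_affine a c z)))"
        using f linear_frechet_derivative by blast
      then show "dir_derivs (v # vs) (\<lambda>z. f (diag_affine a c z)) z =
          prod_list (map c (v # vs)) * dir_derivs (v # vs) f (diag_affine a c z)"
        using fun_cong[OF frechet_derivative_at[OF d[of "prod_list (map c vs)" vs z]], of v] Lv[OF v]
        by (simp add: IH linear_cmul mult_ac)
    qed
  qed simp
  show "dir_derivs vs (\<lambda>z. f (diag_affine a c z)) z = prod_list (map c vs) * dir_derivs vs f (diag_affine a c z)"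
    using *[OF vs] by simp
  \<comment> \<open>Directions outside the basis need not be eigenvectors; each is replaced by its
    image \<open>?L v\<close>, which suffices for differentiability to all orders. The factor 1 only
    gives the right-hand side the form of \<open>d\<close>.\<close>
  have eq: "dir_derivs ws (\<lambda>z. f (diag_affine a c z)) = (\<lambda>z. 1 * dir_derivs (map ?L ws) f (diag_affine a c z))"
  proof (induction ws)
    case (Cons v ws)
    show ?case
    proof
      fix z show "dir_derivs (v # ws) (\<lambda>z. f (diag_affine a c z)) z =
          1 * dir_derivs (map ?L (v # ws)) f (diag_affine a c z)"
        using fun_cong[OF frechet_derivative_at[OF d[of 1 "map ?L ws" z]], of v] by (simp add: Cons)
    qed
  qed simp
  show "dir_derivs ws (\<lambda>z. f (diag_affine a c z)) differentiable (at z)"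
    unfolding eq differentiable_def by (rule exI, rule d)
qed

lemma diag_affine_inner: "b \<in> Basis \<Longrightarrow> diag_affine a c z \<bullet> b = a \<bullet> b + c b * (z \<bullet> b)"
  by (simp add: diag_affine_def inner_add_left inner_sum_left_Basis)

definition diag_affine_inv :: "'a::euclidean_space \<Rightarrow> ('a \<Rightarrow> real) \<Rightarrow> 'a \<Rightarrow> 'a" where
  "diag_affine_inv a c = diag_affine (\<Sum>j\<in>Basis. (- (a \<bullet> j) / c j) *\<^sub>R j) (\<lambda>j. 1 / c j)"

lemma diag_affine_inv:
  assumes "\<And>j. j \<in> Basis \<Longrightarrow> c j \<noteq> 0"
  shows "diag_affine a c (diag_affine_inv a c z) = z" "diag_affine_inv a c (diag_affine a c z) = z"
proof -
  have ia: "(\<Sum>j\<in>Basis. (- (a \<bullet> j) / c j) *\<^sub>R j) \<bullet> b = - (a \<bullet> b) / c b" if "b \<in> Basis" for b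
    by (rule inner_sum_left_Basis[OF that])
  show "diag_affine a c (diag_affine_inv a c z) = z"
  proof (rule euclidean_eqI)
    fix b :: 'a assume b: "b \<in> Basis"
    show "diag_affine a c (diag_affine_inv a c z) \<bullet> b = z \<bullet> b"
      unfolding diag_affine_inv_def diag_affine_inner[OF b] ia[OF b] using assms[OF b] by (simp add: distrib_left right_diff_distrib)
  qed
  show "diag_affine_inv a c (diag_affine a c z) = z"
  proof (rule euclidean_eqI)
    fix b :: 'a assume b: "b \<in> Basis"
    show "diag_affine_inv a c (diag_affine a c z) \<bullet> b = z \<bullet> b"
      unfolding diag_affine_inv_def diag_affine_inner[OF b] ia[OF b] using assms[OF b] by (simp add: add_divide_distrib)
  qed
qed

lemma test_fun_diag_affine_inv:
  assumes c: "\<And>j. j \<in> Basis \<Longrightarrow> c j \<noteq> 0" and \<psi>: "test_fun U \<psi>"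
    and UV: "\<And>z. z \<in> U \<Longrightarrow> diag_affine a c z \<in> V"
  shows "test_fun V (\<lambda>y. \<psi> (diag_affine_inv a c y))"
proof -
  let ?K = "closure {z. \<psi> z \<noteq> 0}" and ?T = "diag_affine a c"
  have K: "compact (?T ` ?K)"
    using \<psi> by (intro compact_continuous_image continuous_on_diag_affine) (auto simp: test_fun_def)
  have "{y. \<psi> (diag_affine_inv a c y) \<noteq> 0} \<subseteq> ?T ` ?K"
  proof
    fix y assume "y \<in> {y. \<psi> (diag_affine_inv a c y) \<noteq> 0}"
    then have "diag_affine_inv a c y \<in> {z. \<psi> z \<noteq> 0}" by simp
    then have "diag_affine_inv a c y \<in> ?K" by (rule subsetD[OF closure_subset])
    moreover have "y = ?T (diag_affine_inv a c y)"
      by (rule diag_affine_inv(1)[symmetric]) (rule c)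
    ultimately show "y \<in> ?T ` ?K" by (rule rev_image_eqI)
  qed
  then have sub: "closure {y. \<psi> (diag_affine_inv a c y) \<noteq> 0} \<subseteq> ?T ` ?K"
    using K by (simp add: closure_minimal compact_imp_closed)
  moreover have "compact (closure {y. \<psi> (diag_affine_inv a c y) \<noteq> 0})"
    using compact_Int_closed[OF K, of "closure {y. \<psi> (diag_affine_inv a c y) \<noteq> 0}"] sub
    by (simp add: Int_absorb1)
  moreover have "?T ` ?K \<subseteq> V" using \<psi> UV by (auto simp: test_fun_def)
  moreover have "dir_derivs vs (\<lambda>y. \<psi> (diag_affine_inv a c y)) differentiable (at z)" for vs z
    unfolding diag_affine_inv_def using \<psi> by (intro dir_derivs_diag_affine(2)[of _ "[]"]) (auto simp: test_fun_def)
  ultimately show ?thesis by (auto simp: test_fun_def)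
qed

text \<open>The substitution moves the integral to \<open>V\<close>, where the test function is
  composed with the inverse map; each derivative in a direction \<open>v\<close> then contributes
  the factor \<open>c v\<close>.\<close>

lemma weak_deriv_diag_affine:
  fixes f g :: "'a::euclidean_space \<Rightarrow> real"
  assumes c: "\<And>j. j \<in> Basis \<Longrightarrow> c j \<noteq> 0" and vs: "set vs \<subseteq> Basis"
    and [measurable]: "f \<in> borel_measurable borel" "g \<in> borel_measurable borel"
    and wd: "weak_deriv V vs f g" and UV: "\<And>z. z \<in> U \<Longrightarrow> diag_affine a c z \<in> V"
  shows "weak_deriv U vs (\<lambda>z. f (diag_affine a c z)) (\<lambda>z. prod_list (map c vs) * g (diag_affine a c z))"
  unfolding weak_deriv_def
proof (intro allI impI)
  fix \<psi> assume \<psi>: "test_fun U \<psi>"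
  note [measurable] = test_fun_measurable[OF \<psi>] test_fun_measurable[OF \<psi>, of "[]", simplified]
  let ?T = "diag_affine a c" and ?I = "diag_affine_inv a c" and ?k = "\<Prod>j\<in>Basis. \<bar>c j\<bar>"
  define \<eta> where "\<eta> = (\<lambda>y. \<psi> (?I y))"
  have \<eta>: "test_fun V \<eta>" unfolding \<eta>_def by (rule test_fun_diag_affine_inv[OF c \<psi> UV])
  note [measurable] = test_fun_measurable[OF \<eta>] test_fun_measurable[OF \<eta>, of "[]", simplified]
  have inv: "?I (?T z) = z" for z by (rule diag_affine_inv) (rule c)
  have "dir_derivs vs \<eta> y = prod_list (map (\<lambda>j. 1 / c j) vs) * dir_derivs vs \<psi> (?I y)" for y
    unfolding \<eta>_def diag_affine_inv_def
    by (rule dir_derivs_diag_affine(1)) (use \<psi> vs in \<open>auto simp: test_fun_def\<close>)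
  moreover have "prod_list (map c vs) * prod_list (map (\<lambda>j. 1 / c j) vs) = 1"
    using vs c by (induction vs) (auto simp: field_simps)
  ultimately have d: "dir_derivs vs \<psi> (?I y) = prod_list (map c vs) * dir_derivs vs \<eta> y" for y
    by (simp add: mult.assoc[symmetric])
  have "(\<integral>z. f (?T z) * dir_derivs vs \<psi> z \<partial>lborel) =
      (\<integral>z. (\<lambda>y. prod_list (map c vs) * (f y * dir_derivs vs \<eta> y)) (?T z) \<partial>lborel)"
    using d[of "?T _"] by (simp add: inv mult_ac)
  also have "\<dots> = prod_list (map c vs) * (\<integral>z. f z * dir_derivs vs \<eta> z \<partial>lborel) / ?k"
    by (subst integral_diag_affine) (auto simp: c)
  also have "(\<integral>z. f z * dir_derivs vs \<eta> z \<partial>lborel) = (- 1) ^ length vs * (\<integral>z. g z * \<eta> z \<partial>lborel)"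
    using wd \<eta> unfolding weak_deriv_def by blast
  also have "prod_list (map c vs) * ((- 1) ^ length vs * (\<integral>z. g z * \<eta> z \<partial>lborel)) / ?k =
      (- 1) ^ length vs * (prod_list (map c vs) * ((\<integral>z. g z * \<eta> z \<partial>lborel) / ?k))"
    by simp
  also have "(\<integral>z. g z * \<eta> z \<partial>lborel) / ?k = (\<integral>z. g (?T z) * \<eta> (?T z) \<partial>lborel)"
    by (rule integral_diag_affine(1)[symmetric]) (auto simp: c)
  also have "\<dots> = (\<integral>z. g (?T z) * \<psi> z \<partial>lborel)"
    by (simp add: \<eta>_def inv)
  also have "prod_list (map c vs) * \<dots> = (\<integral>z. prod_list (map c vs) * g (?T z) * \<psi> z \<partial>lborel)"
    by (simp add: mult.assoc)
  finally show "(\<integral>z. f (?T z) * dir_derivs vs \<psi> z \<partial>lborel) =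
      (- 1) ^ length vs * (\<integral>z. prod_list (map c vs) * g (?T z) * \<psi> z \<partial>lborel)" .
qed

section \<open>Coordinate directions of space-time\<close>

lemma e_t_Basis: "(e_t :: 'n::finite spacetime) \<in> Basis"
  by (simp add: e_t_def Basis_prod_def)

lemma e_x_Basis: "(e_x k :: 'n::finite spacetime) \<in> Basis"
  by (auto simp: e_x_def Basis_prod_def axis_in_Basis_iff)

lemma e_x_neq_e_t: "(e_x k :: 'n::finite spacetime) \<noteq> e_t"
  by (simp add: e_x_def e_t_def)

lemma Basis_spacetime: "(Basis :: 'n::finite spacetime set) = insert e_t (range e_x)"
  by (auto simp: Basis_prod_def Basis_vec_def e_x_def e_t_def)

lemma inner_e: "z \<bullet> e_t = snd z" "z \<bullet> e_x k = fst z $ k"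
  by (simp_all add: e_t_def e_x_def inner_prod_def inner_axis)

lemma diag_affine_spacetime:
  fixes z :: "'n::finite spacetime"
  shows "diag_affine a (\<lambda>j. if j = e_t then \<beta> else \<alpha>) z = (fst a + \<alpha> *\<^sub>R fst z, snd a + \<beta> * snd z)"
proof (rule euclidean_eqI)
  fix b :: "'n spacetime" assume b: "b \<in> Basis"
  show "diag_affine a (\<lambda>j. if j = e_t then \<beta> else \<alpha>) z \<bullet> b = (fst a + \<alpha> *\<^sub>R fst z, snd a + \<beta> * snd z) \<bullet> b"
    using b unfolding diag_affine_inner[OF b]
    by (auto simp: Basis_spacetime inner_e e_x_neq_e_t)
qed

text \<open>For nonnegative \<open>A\<close> this says that the \<open>L^p\<close> norm is at most
  \<open>A\<close>. A bound in place of the norm allows one constant to serve a function and all its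
  derivatives.\<close>

definition Lp_bound :: "real \<Rightarrow> real \<Rightarrow> ('a::euclidean_space \<Rightarrow> real) \<Rightarrow> bool" where
  "Lp_bound p A f \<longleftrightarrow> f \<in> borel_measurable borel \<and> integrable lborel (\<lambda>z. \<bar>f z\<bar> powr p) \<and>
     (\<integral>z. \<bar>f z\<bar> powr p \<partial>lborel) \<le> A powr p"

lemma Lp_bound_measurable [measurable_dest]: "Lp_bound p A f \<Longrightarrow> f \<in> borel_measurable borel"
  by (simp add: Lp_bound_def)

lemma Lp_bound_mono:
  assumes "Lp_bound p A f" "0 \<le> A" "A \<le> B" "0 \<le> p" shows "Lp_bound p B f"
  using assms powr_mono2[of p A B] by (auto simp: Lp_bound_def)

lemma Lp_bound_cmult:
  assumes "Lp_bound p A f" "0 \<le> A"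
  shows "Lp_bound p (\<bar>c\<bar> * A) (\<lambda>z. c * f z)"
  using assms by (auto simp: Lp_bound_def abs_mult powr_mult intro!: mult_left_mono)

lemma Lp_bound_dominated:
  assumes "Lp_bound p A g" "0 \<le> p" "\<And>z. \<bar>f z\<bar> \<le> \<bar>g z\<bar>" "f \<in> borel_measurable borel"
  shows "Lp_bound p A f"
proof -
  note [measurable] = assms(4)
  have g: "integrable lborel (\<lambda>z. \<bar>g z\<bar> powr p)" using assms by (simp add: Lp_bound_def)
  have le: "\<bar>f z\<bar> powr p \<le> \<bar>g z\<bar> powr p" for z using assms by (intro powr_mono2) auto
  have f: "integrable lborel (\<lambda>z. \<bar>f z\<bar> powr p)"
    by (rule Bochner_Integration.integrable_bound[OF g]) (use le in auto)
  have "(\<integral>z. \<bar>f z\<bar> powr p \<partial>lborel) \<le> (\<integral>z. \<bar>g z\<bar> powr p \<partial>lborel)"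
    by (rule integral_mono[OF f g le])
  with assms f show ?thesis by (simp add: Lp_bound_def)
qed

lemma powr_add_le: "(a + b) powr p \<le> 2 powr p * (a powr p + b powr p)"
  if "0 \<le> a" "0 \<le> b" "0 \<le> p" for a b p :: real
proof -
  have "(a + b) powr p \<le> (2 * max a b) powr p"
    using that by (intro powr_mono2) auto
  also have "\<dots> = 2 powr p * max a b powr p" using that by (simp add: powr_mult)
  also have "max a b powr p \<le> a powr p + b powr p" by (auto simp: max_def)
  finally show ?thesis by simp
qed

text \<open>Minkowski's inequality with the constant 4, which is enough where the number of summands
  depends on the dimension only. One \<open>2 powr p\<close> comes from \<open>powr_add_le\<close>,
  and the remaining factor 2 is at most another one.\<close>

lemma Lp_bound_add:
  assumes f: "Lp_bound p A f" and g: "Lp_bound p B g" and "0 \<le> A" "0 \<le> B" "1 \<le> p"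
  shows "Lp_bound p (4 * (A + B)) (\<lambda>z. f z + g z)"
proof -
  note [measurable] = Lp_bound_measurable[OF f] Lp_bound_measurable[OF g]
  have le: "\<bar>f z + g z\<bar> powr p \<le> 2 powr p * (\<bar>f z\<bar> powr p + \<bar>g z\<bar> powr p)" for z
    using powr_add_le[of "\<bar>f z\<bar>" "\<bar>g z\<bar>" p] assms powr_mono2[of p "\<bar>f z + g z\<bar>" "\<bar>f z\<bar> + \<bar>g z\<bar>"]
    by (smt (verit) abs_ge_zero abs_triangle_ineq)
  have I: "integrable lborel (\<lambda>z. 2 powr p * (\<bar>f z\<bar> powr p + \<bar>g z\<bar> powr p))"
    using f g by (auto simp: Lp_bound_def)
  have i: "integrable lborel (\<lambda>z. \<bar>f z + g z\<bar> powr p)"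
    by (rule Bochner_Integration.integrable_bound[OF I]) (use le in auto)
  have "(\<integral>z. \<bar>f z + g z\<bar> powr p \<partial>lborel) \<le> (\<integral>z. 2 powr p * (\<bar>f z\<bar> powr p + \<bar>g z\<bar> powr p) \<partial>lborel)"
    by (rule integral_mono[OF i I le])
  also have "\<dots> = 2 powr p * ((\<integral>z. \<bar>f z\<bar> powr p \<partial>lborel) + (\<integral>z. \<bar>g z\<bar> powr p \<partial>lborel))"
    using f g by (simp add: Lp_bound_def)
  also have "\<dots> \<le> 2 powr p * (A powr p + B powr p)"
    using f g by (intro mult_left_mono add_mono) (auto simp: Lp_bound_def)
  also have "\<dots> \<le> 2 powr p * ((A + B) powr p + (A + B) powr p)"
    using assms by (intro mult_left_mono add_mono powr_mono2) auto
  also have "\<dots> = 2 * 2 powr p * (A + B) powr p" by simp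
  also have "\<dots> \<le> 2 powr p * 2 powr p * (A + B) powr p"
    using assms powr_mono[of 1 p 2] by (intro mult_right_mono) auto
  also have "\<dots> = (4 * (A + B)) powr p"
    using assms by (simp add: powr_mult flip: powr_mult)
  finally show ?thesis using i by (simp add: Lp_bound_def)
qed

text \<open>Where \<open>\<bar>f\<bar>\<close> exceeds \<open>B\<close>, it is at most
  \<open>B powr (1 - p)\<close> times its power \<open>p\<close>; elsewhere it is at most
  \<open>B\<close>, on the set \<open>S\<close>. The choice \<open>B = A\<close> makes the bound
  linear in \<open>A\<close>, so that it can be summed over geometric series.\<close>

lemma Lp_bound_integrable:
  assumes f: "Lp_bound p A f" and "1 \<le> p" and S: "S \<in> sets borel" "emeasure lborel S < \<infinity>"
    and out: "\<And>z. z \<notin> S \<Longrightarrow> f z = 0"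
  shows "integrable lborel f"
    and "0 < A \<Longrightarrow> (\<integral>z. \<bar>f z\<bar> \<partial>lborel) \<le> A * (measure lborel S + 1)"
proof -
  note [measurable] = Lp_bound_measurable[OF f] S(1)
  have fp: "integrable lborel (\<lambda>z. \<bar>f z\<bar> powr p)" using f by (simp add: Lp_bound_def)
  have ind: "integrable lborel (indicat_real S)"
    using S by (simp add: integrable_indicator_iff)
  have le: "\<bar>f z\<bar> \<le> B * indicat_real S z + B powr (1 - p) * \<bar>f z\<bar> powr p" if B: "B > 0" for z B
  proof (cases "\<bar>f z\<bar> \<le> B")
    case True
    then show ?thesis using out[of z] B by (cases "z \<in> S") (auto intro: add_increasing2)
  next
    case False
    then have "\<bar>f z\<bar> = \<bar>f z\<bar> powr (1 - p) * \<bar>f z\<bar> powr p" using B by (simp flip: powr_add)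
    also have "\<dots> \<le> B powr (1 - p) * \<bar>f z\<bar> powr p"
      using False B assms(2) powr_mono2'[of "1 - p" B "\<bar>f z\<bar>"] by (intro mult_right_mono) auto
    also have "\<dots> \<le> B * indicat_real S z + B powr (1 - p) * \<bar>f z\<bar> powr p" using B by simp
    finally show ?thesis .
  qed
  have dom: "integrable lborel (\<lambda>z. B * indicat_real S z + B powr (1 - p) * \<bar>f z\<bar> powr p)" for B
    using fp ind by simp
  show int: "integrable lborel f"
    by (rule Bochner_Integration.integrable_bound[OF dom[of 1]]) (use le[of 1] in auto)
  assume A: "0 < A"
  have "(\<integral>z. \<bar>f z\<bar> \<partial>lborel) \<le> (\<integral>z. A * indicat_real S z + A powr (1 - p) * \<bar>f z\<bar> powr p \<partial>lborel)"
    by (rule integral_mono[OF _ dom le[OF A]]) (use int in simp)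
  also have "\<dots> = A * measure lborel S + A powr (1 - p) * (\<integral>z. \<bar>f z\<bar> powr p \<partial>lborel)"
    using fp ind by simp
  also have "\<dots> \<le> A * measure lborel S + A powr (1 - p) * A powr p"
    using f by (intro add_left_mono mult_left_mono) (auto simp: Lp_bound_def)
  also have "\<dots> = A * (measure lborel S + 1)" using A by (simp add: algebra_simps flip: powr_add)
  finally show "(\<integral>z. \<bar>f z\<bar> \<partial>lborel) \<le> A * (measure lborel S + 1)" .
qed

lemma Lp_bound_diag_affine:
  fixes f :: "'a::euclidean_space \<Rightarrow> real"
  assumes c: "\<And>j. j \<in> Basis \<Longrightarrow> c j \<noteq> 0" and f: "Lp_bound p A f" and "0 \<le> A" "0 < p"
  shows "Lp_bound p ((1 / (\<Prod>j\<in>Basis. \<bar>c j\<bar>)) powr (1 / p) * A) (\<lambda>z. f (diag_affine a c z))"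
proof -
  note [measurable] = Lp_bound_measurable[OF f]
  have k: "(\<Prod>j\<in>Basis. \<bar>c j\<bar>) > 0" using c by (intro prod_pos) auto
  have m: "(\<lambda>z. \<bar>f z\<bar> powr p) \<in> borel_measurable borel" by simp
  show ?thesis
    unfolding Lp_bound_def
    using integral_diag_affine[of c "\<lambda>z. \<bar>f z\<bar> powr p" a, OF c m] f k assms(3,4)
    by (auto simp: Lp_bound_def powr_mult powr_powr divide_right_mono)
qed

lemma weak_deriv_cmult:
  "weak_deriv U vs f g \<Longrightarrow> weak_deriv U vs (\<lambda>z. k * f z) (\<lambda>z. k * g z)"
  by (simp add: weak_deriv_def mult.assoc)

lemma test_fun_integrable:
  fixes g :: "'a::euclidean_space \<Rightarrow> real"
  assumes "test_fun U \<psi>" "integrable lborel g"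
  shows "integrable lborel (\<lambda>z. g z * dir_derivs vs \<psi> z)"
proof -
  note [measurable] = test_fun_measurable[OF assms(1)]
  from test_fun_bounded[OF assms(1)] obtain B where B: "\<And>z. \<bar>dir_derivs vs \<psi> z\<bar> \<le> B" by blast
  have le: "norm (g z * dir_derivs vs \<psi> z) \<le> norm (B * g z)" for z
    using mult_right_mono[OF order_trans[OF B[of z] abs_ge_self], of "\<bar>g z\<bar>"] by (simp add: abs_mult mult.commute)
  show ?thesis
    by (rule Bochner_Integration.integrable_bound[of _ "\<lambda>z. B * g z"])
      (use assms(2) le in auto)
qed

text \<open>Second derivatives of the test function commute, so \<open>g\<close> and
  \<open>g'\<close> represent the same functional and so does their mean. This provides a Hessian
  that is symmetric at every point, as needed to insert it into \<open>G\<close>.\<close>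

lemma weak_deriv_symmetrize:
  assumes "weak_deriv U [u, v] f g" "weak_deriv U [v, u] f g'" "integrable lborel g" "integrable lborel g'"
  shows "weak_deriv U [u, v] f (\<lambda>z. (g z + g' z) / 2)"
  unfolding weak_deriv_def
proof (intro allI impI)
  fix \<psi> assume \<psi>: "test_fun U \<psi>"
  have "dir_derivs [u, v] \<psi> = dir_derivs [v, u] \<psi>"
    using \<psi> by (intro ext dir_derivs_commute) (auto simp: test_fun_def)
  then have "(\<integral>z. f z * dir_derivs [u, v] \<psi> z \<partial>lborel) = (\<integral>z. g z * \<psi> z \<partial>lborel)"
    "(\<integral>z. f z * dir_derivs [u, v] \<psi> z \<partial>lborel) = (\<integral>z. g' z * \<psi> z \<partial>lborel)"
    using assms(1,2) \<psi> unfolding weak_deriv_def by (auto simp del: dir_derivs.simps)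
  moreover have "integrable lborel (\<lambda>z. g z * \<psi> z)" "integrable lborel (\<lambda>z. g' z * \<psi> z)"
    using test_fun_integrable[OF \<psi> assms(3), of "[]"] test_fun_integrable[OF \<psi> assms(4), of "[]"] by simp_all
  ultimately show "(\<integral>z. f z * dir_derivs [u, v] \<psi> z \<partial>lborel) =
      (- 1) ^ length [u, v] * (\<integral>z. (g z + g' z) / 2 * \<psi> z \<partial>lborel)"
    by (simp add: add_divide_distrib distrib_right del: dir_derivs.simps)
qed

text \<open>One constant \<open>A\<close> controls the function and the \<open>L^p\<close> norms of
  all derivatives. After the extension by zero outside \<open>U\<close>, integrals over the whole
  space and over \<open>U\<close> coincide.\<close>

definition local_sol :: "real \<Rightarrow> real \<Rightarrow> real \<Rightarrow> 'n::finite spacetime set \<Rightarrow> real \<Rightarrow> ('n spacetime \<Rightarrow> real) \<Rightarrow>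
   ('n spacetime \<Rightarrow> real) \<Rightarrow> ('n spacetime \<Rightarrow> real) \<Rightarrow> ('n spacetime \<Rightarrow> real ^ 'n) \<Rightarrow> ('n spacetime \<Rightarrow> real ^ 'n ^ 'n) \<Rightarrow> bool"
  where
  "local_sol lam Lam p U A g w wt wx wxx \<longleftrightarrow>
     w \<in> borel_measurable borel \<and> continuous_on U w \<and> (\<forall>z. 0 \<le> w z \<and> w z \<le> A) \<and>
     (\<forall>z. z \<notin> U \<longrightarrow> w z = 0 \<and> wt z = 0 \<and> wx z = 0 \<and> wxx z = 0) \<and>
     Lp_bound p A wt \<and> weak_deriv U [e_t] w wt \<and>
     (\<forall>k. Lp_bound p A (\<lambda>z. wx z $ k) \<and> weak_deriv U [e_x k] w (\<lambda>z. wx z $ k)) \<and>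
     (\<forall>k l. Lp_bound p A (\<lambda>z. wxx z $ k $ l) \<and> weak_deriv U [e_x k, e_x l] w (\<lambda>z. wxx z $ k $ l)) \<and>
     (\<forall>z. wxx z \<in> sym_mats) \<and>
     (AE z in lborel. z \<in> U \<longrightarrow> wt z + pucci_minus lam Lam (wxx z) = g z)"

text \<open>Leaves room, around the unit ball and the times from 0 to 1, for the averaging boxes and
  for the smaller cylinder on which they are centred.\<close>

definition outer :: "'n::finite spacetime set" where
  "outer = ball 0 2 \<times> {-1<..<2}"

lemma open_outer: "open outer" by (simp add: outer_def open_Times)

text \<open>The estimates of the maximum principle degenerate at the parabolic boundary, so the problem is
  moved well inside the unit cylinder by a parabolic scaling.\<close>

definition to_unit :: "'n::finite spacetime \<Rightarrow> 'n spacetime" where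
  "to_unit = diag_affine (0, 1 / 4) (\<lambda>j. if j = e_t then 1 / 16 else 1 / 4)"

lemma to_unit_eq: "to_unit z = ((1 / 4) *\<^sub>R fst z, 1 / 4 + snd z / 16)"
  by (simp add: to_unit_def diag_affine_spacetime)

text \<open>The image of \<open>outer\<close> under \<open>to_unit\<close>: the radius is 2/4, and
  the times run from 1/4 - 1/16 to 1/4 + 2/16.\<close>

definition unit_inner :: "'n::finite spacetime set" where
  "unit_inner = ball 0 (1 / 2) \<times> {3 / 16<..<3 / 8}"

lemma to_unit_outer: "to_unit z \<in> unit_inner \<longleftrightarrow> z \<in> outer"
  by (cases z) (auto simp: to_unit_eq unit_inner_def outer_def)

lemma psubset_in_unit_inner: "psubset_in (unit_inner :: 'n::finite spacetime set) (ball 0 1) 1"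
proof -
  have op: "open (unit_inner :: 'n spacetime set)" by (simp add: unit_inner_def open_Times)
  have ne: "((0, 1 / 4) :: 'n spacetime) \<in> unit_inner" by (simp add: unit_inner_def)
  have d: "1 / 4 \<le> pdist z w" if z: "z \<in> unit_inner" and w: "w \<in> pbdry (ball 0 1) 1" for z w :: "'n spacetime"
  proof -
    \<comment> \<open>Against a boundary point at time 0 the time difference suffices, being at
      least 3/16; any other boundary point is lateral and has distance at least 1/2 in
      space.\<close>
    have "1 / 16 \<le> (norm (fst z - fst w))\<^sup>2 + \<bar>snd z - snd w\<bar>"
    proof (cases "snd w = 0")
      case True
      then have "1 / 16 \<le> \<bar>snd z - snd w\<bar>" using z by (auto simp: unit_inner_def)
      then show ?thesis by (simp add: add_increasing)
    next
      case False
      then have "norm (fst w) = 1" using w by (auto simp: pbdry_def)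
      moreover have "norm (fst z) < 1 / 2" using z by (auto simp: unit_inner_def)
      ultimately have "1 / 2 \<le> norm (fst z - fst w)"
        using norm_triangle_ineq2[of "fst w" "fst z"] by (simp add: norm_minus_commute)
      then have "(1 / 2)\<^sup>2 \<le> (norm (fst z - fst w))\<^sup>2" by (intro power_mono) auto
      moreover have "1 / 16 \<le> (1 / 2 :: real)\<^sup>2" by (simp add: power2_eq_square)
      ultimately show ?thesis using abs_ge_zero[of "snd z - snd w"] by linarith
    qed
    then have "sqrt (1 / 16) \<le> pdist z w" unfolding pdist_def by (rule real_sqrt_le_mono)
    moreover have "sqrt (1 / 16) = 1 / 4" by (rule real_sqrt_unique) (auto simp: power2_eq_square)
    ultimately show ?thesis by simp
  qed
  have "((0, 0) :: 'n spacetime) \<in> pbdry (ball 0 1) 1" by (simp add: pbdry_def)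
  with ne have "{pdist z w |z w. z \<in> (unit_inner :: 'n spacetime set) \<and> w \<in> pbdry (ball 0 1) 1} \<noteq> {}" by blast
  then have "1 / 4 \<le> psetdist (unit_inner :: 'n spacetime set) (pbdry (ball 0 1) 1)"
    unfolding psetdist_def by (rule cInf_greatest) (use d in blast)
  moreover have "(unit_inner :: 'n spacetime set) \<subseteq> cyl (ball 0 1) 1"
    by (auto simp: unit_inner_def cyl_def)
  ultimately show ?thesis
    using op ne unfolding psubset_in_def by (auto simp: interior_open)
qed

lemma Lp_norm_le_W21_norm:
  "Lp_norm p Q ft \<le> W21_norm p Q f ft fx fxx"
  "Lp_norm p Q (\<lambda>z. fx z $ k) \<le> W21_norm p Q f ft fx fxx"
  "Lp_norm p Q (\<lambda>z. fxx z $ k $ l) \<le> W21_norm p Q f ft fx fxx"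
proof -
  have nn: "0 \<le> Lp_norm p Q h" for h by (simp add: Lp_norm_def)
  have 1: "Lp_norm p Q (\<lambda>z. fx z $ k) \<le> (\<Sum>k\<in>UNIV. Lp_norm p Q (\<lambda>z. fx z $ k))"
    by (rule member_le_sum) (auto simp: nn)
  have "Lp_norm p Q (\<lambda>z. fxx z $ k $ l) \<le> (\<Sum>l\<in>UNIV. Lp_norm p Q (\<lambda>z. fxx z $ k $ l))"
    by (rule member_le_sum) (auto simp: nn)
  also have "\<dots> \<le> (\<Sum>k\<in>UNIV. \<Sum>l\<in>UNIV. Lp_norm p Q (\<lambda>z. fxx z $ k $ l))"
    by (rule member_le_sum) (auto simp: nn intro!: sum_nonneg)
  finally have 2: "Lp_norm p Q (\<lambda>z. fxx z $ k $ l) \<le> (\<Sum>k\<in>UNIV. \<Sum>l\<in>UNIV. Lp_norm p Q (\<lambda>z. fxx z $ k $ l))" .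
  have 3: "0 \<le> (\<Sum>k\<in>UNIV. \<Sum>l\<in>UNIV. Lp_norm p Q (\<lambda>z. fxx z $ k $ l))"
    "0 \<le> (\<Sum>k\<in>UNIV. Lp_norm p Q (\<lambda>z. fx z $ k))"
    by (auto simp: nn intro!: sum_nonneg)
  show "Lp_norm p Q ft \<le> W21_norm p Q f ft fx fxx"
  "Lp_norm p Q (\<lambda>z. fx z $ k) \<le> W21_norm p Q f ft fx fxx"
  "Lp_norm p Q (\<lambda>z. fxx z $ k $ l) \<le> W21_norm p Q f ft fx fxx"
    using 1 2 3 nn[of f] nn[of ft] unfolding W21_norm_def by linarith+
qed

lemma borel_version_Lp_bound:
  fixes f :: "'a::euclidean_space \<Rightarrow> real"
  assumes f: "Lp_on p U f" and U: "U \<in> sets borel" and A: "Lp_norm p U f \<le> A" and p: "0 < p"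
  shows "\<exists>g. Lp_bound p A g \<and> (AE z in lebesgue_on U. f z = g z) \<and> (\<forall>z. z \<notin> U \<longrightarrow> g z = 0)"
proof -
  obtain g where g[measurable]: "g \<in> borel_measurable borel" and eq: "AE z in lebesgue_on U. f z = g z"
    and out: "\<forall>z. z \<notin> U \<longrightarrow> g z = 0"
    using borel_version[OF U, of f] f by (auto simp: Lp_on_def)
  have UL: "U \<in> sets lebesgue" using U by simp
  have fm[measurable]: "f \<in> borel_measurable (lebesgue_on U)" using f by (simp add: Lp_on_def)
  have *: "integral\<^sup>L (lebesgue_on U) (\<lambda>z. \<bar>f z\<bar> powr p) = (\<integral>z. \<bar>g z\<bar> powr p \<partial>lborel)"
    "integrable (lebesgue_on U) (\<lambda>z. \<bar>f z\<bar> powr p) \<longleftrightarrow> integrable lborel (\<lambda>z. \<bar>g z\<bar> powr p)"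
    by (rule integral_lebesgue_on_lborel[OF UL]; use eq out in auto)+
  have "(\<integral>z. \<bar>g z\<bar> powr p \<partial>lborel) = (Lp_norm p U f) powr p"
    unfolding Lp_norm_def *(1) using p by (simp add: powr_powr)
  also have "\<dots> \<le> A powr p" using A p by (intro powr_mono2) (auto simp: Lp_norm_def)
  finally have "Lp_bound p A g" using * f by (simp add: Lp_bound_def Lp_on_def)
  with eq out show ?thesis by blast
qed

lemma Lp_on_of_lborel:
  fixes f :: "'a::euclidean_space \<Rightarrow> real"
  assumes f: "Lp_bound p A f" and U: "U \<in> sets borel" and p: "0 < p" and A: "0 \<le> A"
  shows "Lp_on p U f" "Lp_norm p U f \<le> A"
proof -
  note [measurable] = Lp_bound_measurable[OF f] U
  have UL: "U \<in> sets lebesgue" using U by simp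
  have fm: "f \<in> borel_measurable (lebesgue_on U)"
    by (intro measurable_restrict_space1 measurable_completion) simp
  let ?g = "\<lambda>z. indicat_real U z * \<bar>f z\<bar> powr p"
  have fi: "integrable lborel (\<lambda>z. \<bar>f z\<bar> powr p)" using f by (simp add: Lp_bound_def)
  have gi: "integrable lborel ?g"
    by (rule Bochner_Integration.integrable_bound[OF fi]) (auto simp: indicator_def)
  have *: "integral\<^sup>L (lebesgue_on U) (\<lambda>z. \<bar>f z\<bar> powr p) = (\<integral>z. ?g z \<partial>lborel)"
    "integrable (lebesgue_on U) (\<lambda>z. \<bar>f z\<bar> powr p) \<longleftrightarrow> integrable lborel ?g"
    by (rule integral_lebesgue_on_lborel[OF UL];
        use fm UL in \<open>auto intro!: AE_I2 simp: space_restrict_space indicator_def\<close>)+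
  then show "Lp_on p U f" using gi fm by (simp add: Lp_on_def)
  have "(\<integral>z. ?g z \<partial>lborel) \<le> (\<integral>z. \<bar>f z\<bar> powr p \<partial>lborel)"
    by (rule integral_mono[OF gi fi]) (auto simp: indicator_def)
  also have "\<dots> \<le> A powr p" using f by (simp add: Lp_bound_def)
  finally have "(\<integral>z. ?g z \<partial>lborel) powr (1 / p) \<le> (A powr p) powr (1 / p)"
    using p by (intro powr_mono2 integral_nonneg) auto
  then show "Lp_norm p U f \<le> A" unfolding Lp_norm_def *(1) using p A by (simp add: powr_powr)
qed

lemma Lp_norm_zero: "Lp_norm p U (\<lambda>z. 0) = 0"
  by (simp add: Lp_norm_def)

lemma lebesgue_on_AE_lborel:
  assumes "AE z in lebesgue_on U. P z" "U \<in> sets borel"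
  shows "AE z in lborel. z \<in> U \<longrightarrow> P z"
proof -
  have "AE z in lebesgue. z \<in> U \<longrightarrow> P z"
    using assms by (subst (asm) AE_restrict_space_iff) auto
  then show ?thesis by (simp add: AE_completion_iff)
qed

text \<open>With the right-hand side \<open>- 16 * g\<close>, which has no positive part, the
  solution \<open>u\<close> for \<open>pucci_plus\<close> is nonpositive. Hence \<open>- u\<close>
  after scaling is nonnegative, and it solves the equation for \<open>pucci_minus\<close>. The
  factor 16 compensates the scaling of one time derivative by 1/16 and of two space derivatives by
  1/4 each.\<close>

lemma ABP_scaled:
  fixes lam Lam p1 p :: real
  assumes lam: "0 < lam" "lam \<le> Lam"
    and ABP: "ABP_exponent TYPE('n::finite) lam Lam p1" and p: "p1 < p"
  shows "\<exists>C>0. \<forall>(g :: 'n spacetime \<Rightarrow> real) N. Lp_bound p N g \<and> 0 \<le> N \<and> (\<forall>z. 0 \<le> g z) \<longrightarrow>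
    (\<exists>w wt wx wxx. local_sol lam Lam p outer (C * N) g w wt wx wxx)"
proof -
  let ?B = "ball 0 1 :: (real ^ 'n) set" and ?V = "unit_inner :: 'n spacetime set"
  let ?c = "\<lambda>j::'n spacetime. if j = e_t then 1 / 16 else (1 / 4 :: real)" and ?a = "(0, 1 / 4) :: 'n spacetime"
  let ?Q = "cyl ?B 1"
  let ?I = "diag_affine_inv ?a ?c"
  define \<kappa> where "\<kappa> = (\<Prod>j\<in>Basis. \<bar>?c j\<bar>)"
  have c0: "?c j \<noteq> 0" for j by simp
  have T: "to_unit = diag_affine ?a ?c" by (simp add: to_unit_def)
  have inv: "?I (to_unit z) = z" for z unfolding T by (rule diag_affine_inv) (rule c0)
  have \<kappa>: "\<kappa> > 0" unfolding \<kappa>_def by (intro prod_pos) auto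
  define d where "d = real CARD('n)"
  have "1 \<le> d" unfolding d_def using one_le_card_finite[where 'a='n] by simp
  moreover have "(d + 2) / 2 \<le> p1" using ABP unfolding ABP_exponent_def d_def by (elim conjE)
  ultimately have "p1 \<ge> 3 / 2" by simp
  then have p: "p1 < p" "1 < p" using p by auto
  obtain C0 C' where main: "\<And>f :: 'n spacetime \<Rightarrow> real. Lp_on p ?Q f \<Longrightarrow>
          (\<exists>u ut ux uxx.
             continuous_on (closure ?Q) u \<and>
             W21_loc p ?B 1 u ut ux uxx \<and>
             (AE z in lebesgue_on ?Q. ut z + pucci_plus lam Lam (uxx z) = f z) \<and>
             (\<forall>z\<in>pbdry ?B 1. u z = 0) \<and>
             (\<forall>z\<in>?Q.
                - C0 * Lp_norm p ?Q (\<lambda>w. max 0 (- f w)) \<le> u z \<and>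
                u z \<le> C0 * Lp_norm p ?Q (\<lambda>w. max 0 (f w))) \<and>
             (\<forall>Q'. psubset_in Q' ?B 1 \<longrightarrow>
                W21_norm p Q' u ut ux uxx
                  \<le> C' (psetdist Q' (pbdry ?B 1)) * Lp_norm p ?Q f))"
    using ABP p(1) unfolding ABP_exponent_def by blast
  define C1 where "C1 = max 0 (C' (psetdist ?V (pbdry ?B 1)))"
  define K where "K = 16 * \<kappa> powr (1 / p)"
  define D where "D = (1 / \<kappa>) powr (1 / p)"
  have D: "D > 0" and K: "K > 0" using \<kappa> by (auto simp: D_def K_def)
  \<comment> \<open>The first summand secures positivity, the second serves the bound of the maximum
    principle, and the third the derivatives: \<open>D\<close> comes from the change of variables, 8
    from symmetrizing the Hessian.\<close>
  define C where "C = 1 + \<bar>C0\<bar> * K + 8 * (D * (C1 * K))"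
  have C: "C > 0" unfolding C_def C1_def using D K by (intro add_pos_nonneg mult_nonneg_nonneg) auto
  show ?thesis
  proof (intro exI[of _ C] conjI C allI impI)
    fix g :: "'n spacetime \<Rightarrow> real" and N :: real
    assume asm: "Lp_bound p N g \<and> 0 \<le> N \<and> (\<forall>z. 0 \<le> g z)"
    then have g: "Lp_bound p N g" and N: "0 \<le> N" and g0: "\<And>z. 0 \<le> g z" by auto
    define f where "f y = - 16 * g (?I y)" for y
    have k': "(\<Prod>j\<in>Basis. \<bar>1 / ?c j\<bar>) = 1 / \<kappa>"
    proof -
      have "(\<Prod>j\<in>Basis. \<bar>1 / ?c j\<bar>) = (\<Prod>j\<in>Basis. inverse \<bar>?c j\<bar>)"
        by (intro prod.cong refl) auto
      also have "\<dots> = inverse \<kappa>"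
        unfolding \<kappa>_def using prod_inversef[of "\<lambda>j. \<bar>?c j\<bar>" Basis] by (simp only: o_def)
      finally show ?thesis by (simp only: inverse_eq_divide)
    qed
    have fI: "Lp_bound p ((1 / (1 / \<kappa>)) powr (1 / p) * N) (\<lambda>y. g (?I y))"
      unfolding k'[symmetric] diag_affine_inv_def by (rule Lp_bound_diag_affine) (use g N p in auto)
    then have fb: "Lp_bound p (K * N) f"
      using Lp_bound_cmult[OF fI, of "-16"] N by (simp add: f_def[abs_def] K_def mult.assoc)
    have KN: "0 \<le> K * N" using K N by simp
    have Qb: "?Q \<in> sets borel" unfolding cyl_def by (intro borel_Times) auto
    have Vb: "?V \<in> sets borel" unfolding unit_inner_def by (intro borel_open open_Times) auto
    have Vo: "open ?V" unfolding unit_inner_def by (intro open_Times) auto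
    have VQ: "?V \<subseteq> ?Q" using psubset_in_unit_inner by (auto simp: psubset_in_def)
    have f: "Lp_on p ?Q f" "Lp_norm p ?Q f \<le> K * N"
      using Lp_on_of_lborel[OF fb Qb _ KN] p by auto
    obtain u ut ux uxx where u: "continuous_on (closure ?Q) u" "W21_loc p ?B 1 u ut ux uxx"
      and ae: "AE z in lebesgue_on ?Q. ut z + pucci_plus lam Lam (uxx z) = f z"
      and bd: "\<forall>z\<in>?Q. - C0 * Lp_norm p ?Q (\<lambda>w. max 0 (- f w)) \<le> u z \<and> u z \<le> C0 * Lp_norm p ?Q (\<lambda>w. max 0 (f w))"
      and nrm: "\<forall>Q'. psubset_in Q' ?B 1 \<longrightarrow> W21_norm p Q' u ut ux uxx
                  \<le> C' (psetdist Q' (pbdry ?B 1)) * Lp_norm p ?Q f"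
      using main[OF f(1)] by (elim exE conjE) (rule that; assumption)
    define M where "M = C1 * (K * N)"
    have M: "0 \<le> M" using KN by (simp add: M_def C1_def)
    have WM: "W21_norm p ?V u ut ux uxx \<le> M"
    proof -
      have "W21_norm p ?V u ut ux uxx \<le> C' (psetdist ?V (pbdry ?B 1)) * Lp_norm p ?Q f"
        by (rule nrm[rule_format, OF psubset_in_unit_inner])
      also have "\<dots> \<le> C1 * Lp_norm p ?Q f" by (intro mult_right_mono) (auto simp: C1_def Lp_norm_def)
      also have "\<dots> \<le> M" unfolding M_def using f by (intro mult_left_mono) (auto simp: C1_def)
      finally show ?thesis .
    qed
    have W: "W21 p ?V u ut ux uxx" using u(2) psubset_in_unit_inner unfolding W21_loc_def by blast
    have iV: "interior ?V = ?V" using Vo by (rule interior_open)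
    define ub where "ub z = (if z \<in> ?V then u z else 0)" for z
    have ucont: "continuous_on ?V u"
      using continuous_on_subset[OF u(1), of ?V] VQ closure_subset[of ?Q] by auto
    have ubm: "ub \<in> borel_measurable borel"
      unfolding ub_def by (rule borel_measurable_continuous_on_if[OF Vb ucont]) auto
    have um: "u \<in> borel_measurable (lebesgue_on ?V)" using W by (auto simp: W21_def Lp_on_def)
    have uae: "AE z in lebesgue_on ?V. u z = ub z"
      by (rule AE_I2) (auto simp: ub_def)
    have version: "\<exists>h. Lp_bound p M h \<and> (AE z in lebesgue_on ?V. v z = h z) \<and> (\<forall>z. z \<notin> ?V \<longrightarrow> h z = 0) \<and> weak_deriv ?V vs ub h"
      if v: "Lp_on p ?V v" "has_weak_deriv (interior ?V) vs u v" "Lp_norm p ?V v \<le> W21_norm p ?V u ut ux uxx" for v vs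
    proof -
      obtain h where h: "Lp_bound p M h" "AE z in lebesgue_on ?V. v z = h z" "\<forall>z. z \<notin> ?V \<longrightarrow> h z = 0"
        using borel_version_Lp_bound[OF v(1) Vb order_trans[OF v(3) WM]] p by auto
      have "weak_deriv ?V vs ub h"
        by (rule has_weak_deriv_imp_weak_deriv[OF v(2)[unfolded iV] Vo ubm _ um _ uae h(2)])
          (use h v in \<open>auto simp: Lp_bound_def Lp_on_def\<close>)
      with h show ?thesis by blast
    qed
    obtain tb where tb: "Lp_bound p M tb" "AE z in lebesgue_on ?V. ut z = tb z" "\<forall>z. z \<notin> ?V \<longrightarrow> tb z = 0" "weak_deriv ?V [e_t] ub tb"
      using version[of ut "[e_t]"] W Lp_norm_le_W21_norm(1) unfolding W21_def by blast
    have "\<forall>k. \<exists>h. Lp_bound p M h \<and> (\<forall>z. z \<notin> ?V \<longrightarrow> h z = 0) \<and> weak_deriv ?V [e_x k] ub h"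
    proof
      fix k show "\<exists>h. Lp_bound p M h \<and> (\<forall>z. z \<notin> ?V \<longrightarrow> h z = 0) \<and> weak_deriv ?V [e_x k] ub h"
        using version[of "\<lambda>z. ux z $ k" "[e_x k]"] W Lp_norm_le_W21_norm(2)[of p ?V ux k] unfolding W21_def by blast
    qed
    then obtain xb where xb: "\<And>k. Lp_bound p M (xb k)" "\<And>k z. z \<notin> ?V \<Longrightarrow> xb k z = 0" "\<And>k. weak_deriv ?V [e_x k] ub (xb k)"
      by metis
    let ?P = "\<lambda>k l h. Lp_bound p M h \<and> (AE z in lebesgue_on ?V. uxx z $ k $ l = h z) \<and>
      (\<forall>z. z \<notin> ?V \<longrightarrow> h z = 0) \<and> weak_deriv ?V [e_x k, e_x l] ub h"
    have "\<exists>h. ?P k l h" for k l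
      using version[of "\<lambda>z. uxx z $ k $ l" "[e_x k, e_x l]"] W Lp_norm_le_W21_norm(3)[of p ?V uxx k l] unfolding W21_def by blast
    then have "\<forall>k. \<exists>X. \<forall>l. ?P k l (X l)" by (intro allI choice)
    then have "\<exists>X. \<forall>k l. ?P k l (X k l)" by (rule choice)
    then obtain xxb where X: "\<forall>k l. ?P k l (xxb k l)" by (rule exE)
    have xxb: "\<And>k l. Lp_bound p M (xxb k l)" "\<And>k l. AE z in lebesgue_on ?V. uxx z $ k $ l = xxb k l z"
        "\<And>k l z. z \<notin> ?V \<Longrightarrow> xxb k l z = 0" "\<And>k l. weak_deriv ?V [e_x k, e_x l] ub (xxb k l)"
      by (use X in \<open>simp_all del: split_paired_All\<close>)
    define w where "w z = - 1 * ub (to_unit z)" for z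
    define wt where "wt z = - 1 * (1 / 16 * tb (to_unit z))" for z
    define wx where "wx z = (\<chi> k. - 1 * (1 / 4 * xb k (to_unit z)))" for z
    define sxx where "sxx k l z = (xxb k l z + xxb l k z) / 2" for k l z
    define wxx where "wxx z = (\<chi> k l. - 1 * (1 / 16 * sxx k l (to_unit z)))" for z
    have DM: "0 \<le> D * M" using D M by simp
    have DMC: "8 * (D * M) \<le> C * N"
      unfolding C_def M_def using N K by (simp add: algebra_simps)
    have Vfin: "emeasure lborel ?V < \<infinity>"
    proof -
      have "bounded ?V" unfolding unit_inner_def by (intro bounded_Times) auto
      then show ?thesis using emeasure_bounded_finite by auto
    qed
    have toT: "\<And>z. z \<in> outer \<Longrightarrow> diag_affine ?a ?c z \<in> ?V" by (simp only: T[symmetric] to_unit_outer)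
    have toU: "to_unit z \<in> ?V" if "z \<in> outer" for z using that by (simp only: to_unit_outer)
    have sxxi: "integrable lborel (xxb k l)" for k l
      by (rule Lp_bound_integrable(1)[OF xxb(1) _ Vb Vfin xxb(3)]) (use p in auto)
    have sxx: "Lp_bound p (8 * M) (sxx k l)" "weak_deriv ?V [e_x k, e_x l] ub (sxx k l)" for k l
    proof -
      have "Lp_bound p (4 * (M + M)) (\<lambda>z. xxb k l z + xxb l k z)"
        using xxb(1) M p by (intro Lp_bound_add) auto
      then have "Lp_bound p (8 * M) (\<lambda>z. xxb k l z + xxb l k z)" by simp
      then show "Lp_bound p (8 * M) (sxx k l)"
        by (rule Lp_bound_dominated) (use p xxb(1)[THEN Lp_bound_measurable] in \<open>auto simp: sxx_def[abs_def]\<close>)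
      show "weak_deriv ?V [e_x k, e_x l] ub (sxx k l)"
        unfolding sxx_def by (rule weak_deriv_symmetrize) (use xxb sxxi in auto)
    qed
    have scale: "Lp_bound p (C * N) (\<lambda>z. - 1 * (q * h (to_unit z)))"
      if "Lp_bound p (8 * M) h" "0 \<le> q" "q \<le> 1" for q and h :: "'n spacetime \<Rightarrow> real"
    proof -
      have "Lp_bound p (D * (8 * M)) (\<lambda>z. h (to_unit z))"
        unfolding T D_def \<kappa>_def by (rule Lp_bound_diag_affine) (use that M p in auto)
      then have "Lp_bound p (C * N) (\<lambda>z. h (to_unit z))"
        by (rule Lp_bound_mono) (use DMC DM p in auto)
      then show ?thesis
        by (rule Lp_bound_dominated)
          (use p that mult_right_mono[of q 1] in \<open>auto simp: abs_mult T Lp_bound_def\<close>)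
    qed
    have M8: "Lp_bound p (8 * M) h" if "Lp_bound p M h" for h :: "'n spacetime \<Rightarrow> real"
      by (rule Lp_bound_mono[OF that]) (use M p in auto)
    have wd: "weak_deriv outer vs w (\<lambda>z. - 1 * (prod_list (map ?c vs) * h (to_unit z)))"
      if "weak_deriv ?V vs ub h" "set vs \<subseteq> Basis" "h \<in> borel_measurable borel" for vs h
      unfolding w_def T
      by (rule weak_deriv_cmult, rule weak_deriv_diag_affine[OF c0 that(2) ubm that(3,1) toT])
    have out: "z \<notin> outer \<Longrightarrow> to_unit z \<notin> ?V" for z using to_unit_outer by blast
    have bound: "0 \<le> w z \<and> w z \<le> C * N" for z
    proof (cases "to_unit z \<in> ?V")
      case True
      have "(\<lambda>w. max 0 (f w)) = (\<lambda>w. 0)" using g0 by (auto simp: f_def)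
      moreover have "(\<lambda>w. max 0 (- f w)) = (\<lambda>w. - f w)" using g0 by (auto simp: f_def)
      moreover have "Lp_norm p ?Q (\<lambda>w. - f w) = Lp_norm p ?Q f" by (simp add: Lp_norm_def)
      ultimately have "- C0 * Lp_norm p ?Q f \<le> u (to_unit z)" "u (to_unit z) \<le> 0"
        using bd[rule_format, of "to_unit z"] True VQ by (auto simp: Lp_norm_zero)
      moreover have "C0 * Lp_norm p ?Q f \<le> \<bar>C0\<bar> * (K * N)"
        using f(2) by (intro mult_mono) (auto simp: Lp_norm_def)
      moreover have "\<bar>C0\<bar> * (K * N) \<le> C * N"
        unfolding C_def using N DM D K by (simp add: algebra_simps C1_def)
      ultimately show ?thesis using True by (simp add: w_def ub_def)
    next
      case False
      then show ?thesis using C N by (simp add: w_def ub_def)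
    qed
    have cont: "continuous_on outer w"
    proof -
      have "continuous_on outer (\<lambda>z. u (to_unit z))"
      proof (rule continuous_on_compose2[OF ucont])
        show "continuous_on (outer :: 'n spacetime set) to_unit" unfolding T by (rule continuous_on_diag_affine)
        show "to_unit ` (outer :: 'n spacetime set) \<subseteq> ?V" by (rule image_subsetI) (rule toU)
      qed
      then have "continuous_on outer (\<lambda>z. - 1 * u (to_unit z))" by (intro continuous_intros)
      then show ?thesis
        by (rule continuous_on_eq) (simp only: w_def ub_def toU if_True)
    qed
    have pde: "AE z in lborel. z \<in> outer \<longrightarrow> wt z + pucci_minus lam Lam (wxx z) = g z"
    proof -
      have 1: "AE y in lborel. y \<in> ?V \<longrightarrow> ut y = tb y" by (rule lebesgue_on_AE_lborel[OF tb(2) Vb])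
      have 2: "AE y in lborel. \<forall>k l. y \<in> ?V \<longrightarrow> uxx y $ k $ l = xxb k l y"
        by (intro AE_all_countable[THEN iffD2] allI lebesgue_on_AE_lborel[OF xxb(2) Vb])
      have 3: "AE y in lborel. y \<in> ?Q \<longrightarrow> ut y + pucci_plus lam Lam (uxx y) = f y"
        by (rule lebesgue_on_AE_lborel[OF ae Qb])
      from 1 2 3 have "AE y in lborel. y \<in> ?V \<longrightarrow>
          tb y + pucci_plus lam Lam (\<chi> k l. xxb k l y) = f y"
      proof eventually_elim
        case (elim y)
        show ?case
        proof
          assume y: "y \<in> ?V"
          have "uxx y = (\<chi> k l. xxb k l y)" using elim(2) y by (simp add: vec_eq_iff)
          with elim y VQ show "tb y + pucci_plus lam Lam (\<chi> k l. xxb k l y) = f y" by auto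
        qed
      qed
      from AE_diag_affine[of ?c, OF c0 this, of ?a] show ?thesis
        unfolding T[symmetric]
      proof eventually_elim
        case (elim z)
        show ?case
        proof
          assume z: "z \<in> outer"
          let ?y = "to_unit z"
          have "pucci_minus lam Lam (wxx z) = pucci_minus lam Lam (- ((1 / 16) *\<^sub>R (\<chi> k l. xxb k l ?y)))"
            by (rule pucci_minus_cong_trace) (simp add: wxx_def sxx_def field_simps)
          also have "\<dots> = - (1 / 16) * pucci_plus lam Lam (\<chi> k l. xxb k l ?y)"
            by (rule pucci_minus_scaleR_minus) (use lam in auto)
          finally have "wt z + pucci_minus lam Lam (wxx z) = - (1 / 16) * f ?y"
            using elim[rule_format, OF toU[OF z]] by (simp add: wt_def algebra_simps)
          then show "wt z + pucci_minus lam Lam (wxx z) = g z" by (simp add: f_def inv)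
        qed
      qed
    qed
    have "local_sol lam Lam p outer (C * N) g w wt wx wxx"
      unfolding local_sol_def
    proof (intro conjI allI impI)
      show "w \<in> borel_measurable borel" unfolding w_def T using ubm by simp
      show "Lp_bound p (C * N) wt" unfolding wt_def by (rule scale[OF M8[OF tb(1)]]) auto
      show "weak_deriv outer [e_t] w wt"
        using wd[OF tb(4) _ Lp_bound_measurable[OF tb(1)]] e_t_Basis[where 'n='n] by (simp add: wt_def[abs_def])
      show "Lp_bound p (C * N) (\<lambda>z. wx z $ k)" for k
        using scale[OF M8[OF xb(1)], of "1/4" k] by (simp add: wx_def)
      show "weak_deriv outer [e_x k] w (\<lambda>z. wx z $ k)" for k
        using wd[OF xb(3)[of k] _ Lp_bound_measurable[OF xb(1)]] e_x_Basis[of k] by (simp add: wx_def e_x_neq_e_t)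
      show "Lp_bound p (C * N) (\<lambda>z. wxx z $ k $ l)" for k l
        using scale[OF sxx(1), of "1/16" k l] by (simp add: wxx_def)
      show "weak_deriv outer [e_x k, e_x l] w (\<lambda>z. wxx z $ k $ l)" for k l
        using wd[OF sxx(2)[of k l] _ Lp_bound_measurable[OF sxx(1)]] e_x_Basis[of k] e_x_Basis[of l]
        by (simp add: wxx_def e_x_neq_e_t)
      show "wxx z \<in> sym_mats" for z
        by (simp add: sym_mats_def wxx_def sxx_def transpose_def vec_eq_iff add.commute)
      fix z :: "'n spacetime" assume z: "z \<notin> outer"
      then have V: "to_unit z \<notin> ?V" by (rule out)
      show "w z = 0" "wt z = 0" "wx z = 0" "wxx z = 0"
        using tb(3)[rule_format, OF V] xb(2)[OF V] xxb(3)[OF V] V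
        by (simp_all add: w_def ub_def wt_def wx_def wxx_def sxx_def vec_eq_iff)
    qed (use bound cont pde in blast)+
    then show "\<exists>w wt wx wxx. local_sol lam Lam p outer (C * N) g w wt wx wxx" by blast
  qed
qed

section \<open>Anisotropic mollifiers\<close>

text \<open>The profile \<open>e\<close> lives on the unit interval, so the kernels look only
  backward in every coordinate, including time. As its primitive \<open>E\<close> rises from 0 to 1,
  \<open>e\<close> has integral 1. The single bound \<open>B\<close> serves all three
  functions.\<close>

locale step_profile =
  fixes E e e' :: "real \<Rightarrow> real" and B :: real
  assumes smooth: "smooth_real E" "smooth_real e" "smooth_real e'"
    and E_left: "x \<le> 0 \<Longrightarrow> E x = 0" and E_right: "x \<ge> 1 \<Longrightarrow> E x = 1"
    and dE: "(E has_real_derivative e x) (at x)" and de: "(e has_real_derivative e' x) (at x)"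
    and e_out: "x \<le> 0 \<or> x \<ge> 1 \<Longrightarrow> e x = 0" and e'_out: "x \<le> 0 \<or> x \<ge> 1 \<Longrightarrow> e' x = 0"
    and B: "1 \<le> B" and E_le: "\<bar>E x\<bar> \<le> B" and e_le: "\<bar>e x\<bar> \<le> B" and e'_le: "\<bar>e' x\<bar> \<le> B"

lemma step_profile_exists: "\<exists>E e e' B. step_profile E e e' B"
proof -
  obtain E e e' where P: "smooth_real E" "smooth_real e" "smooth_real e'"
     "\<forall>x\<le>0. E x = 0" "\<forall>x\<ge>1. E x = (1::real)"
     "\<forall>x. (E has_real_derivative e x) (at x)" "\<forall>x. (e has_real_derivative e' x) (at x)"
     "\<forall>x. x \<le> 0 \<or> x \<ge> 1 \<longrightarrow> e x = 0 \<and> e' x = 0"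
    using smooth_step_exists by (elim exE conjE) (rule that; assumption)
  have bdd: "\<exists>B. \<forall>x. \<bar>f x\<bar> \<le> B" if "smooth_real f" "\<And>x. x \<le> 0 \<or> x \<ge> 1 \<Longrightarrow> \<bar>f x\<bar> \<le> 1" for f
  proof -
    have "compact (f ` {0..1})"
      by (intro compact_continuous_image smooth_real_continuous that(1)) auto
    then obtain B where B: "\<And>x. x \<in> {0..1} \<Longrightarrow> \<bar>f x\<bar> \<le> B"
      by (meson bounded_real compact_imp_bounded imageI)
    have "\<bar>f x\<bar> \<le> max B 1" for x
    proof (cases "x \<in> {0..1}")
      case True
      then show ?thesis using B[of x] by simp
    next
      case False
      then show ?thesis using that(2)[of x] by auto
    qed
    then show ?thesis by blast
  qed
  obtain B1 B2 B3 where b: "\<And>x. \<bar>E x\<bar> \<le> B1" "\<And>x. \<bar>e x\<bar> \<le> B2" "\<And>x. \<bar>e' x\<bar> \<le> B3"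
    using bdd[OF P(1)] bdd[OF P(2)] bdd[OF P(3)] P(4,5,8) by (metis abs_0 abs_1 order_refl zero_le_one)
  define B where "B = max 1 (max B1 (max B2 B3))"
  have "step_profile E e e' B"
  proof
    show "\<bar>E x\<bar> \<le> B" "\<bar>e x\<bar> \<le> B" "\<bar>e' x\<bar> \<le> B" for x
      using b(1)[of x] b(2)[of x] b(3)[of x] unfolding B_def by linarith+
  qed (use P in \<open>auto simp: B_def\<close>)
  then show ?thesis by blast
qed

text \<open>Contains the supports of all kernels at \<open>z\<close> whose scales are at most
  \<open>\<rho>\<close>.\<close>

definition back_box :: "('a::euclidean_space \<Rightarrow> real) \<Rightarrow> 'a \<Rightarrow> 'a set" where
  "back_box \<rho> z = {y. \<forall>b\<in>Basis. 0 \<le> (z - y) \<bullet> b \<and> (z - y) \<bullet> b \<le> \<rho> b}"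

lemma back_box_cbox: "back_box \<rho> z = cbox (z - (\<Sum>b\<in>Basis. \<rho> b *\<^sub>R b)) z"
  by (auto simp: back_box_def mem_box inner_diff_left algebra_simps)

lemma compact_back_box: "compact (back_box \<rho> z)" by (simp add: back_box_cbox)

lemma prod_without:
  fixes f :: "'a::euclidean_space \<Rightarrow> real"
  assumes "b \<in> Basis" "\<And>b. b \<in> Basis \<Longrightarrow> f b > 0"
  shows "(\<Prod>b'\<in>Basis - {b}. c / f b') = c ^ (DIM('a) - 1) * f b / (\<Prod>b\<in>Basis. f b)"
proof -
  have "(\<Prod>b\<in>Basis. f b) = f b * (\<Prod>b'\<in>Basis - {b}. f b')"
    by (rule prod.remove) (use assms in auto)
  moreover have "(\<Prod>b'\<in>Basis - {b}. f b') > 0" using assms by (intro prod_pos) auto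
  moreover have "f b > 0" using assms by auto
  ultimately show ?thesis
    using assms(1) by (simp add: prod_dividef)
qed

context step_profile
begin

definition molf :: "('a::euclidean_space \<Rightarrow> real) \<Rightarrow> 'a \<Rightarrow> 'a \<Rightarrow> real" where
  "molf \<sigma> z y = (\<Prod>b\<in>Basis. e ((z - y) \<bullet> b / \<sigma> b) / \<sigma> b)"

text \<open>A primitive in direction \<open>b\<close> of the difference of two kernels that differ
  only in the scale of that coordinate. Both values of \<open>E\<close> are 0 on one side of the box
  and 1 on the other, so their difference has compact support and the primitive is an admissible
  test function.\<close>

definition stepk :: "('a::euclidean_space \<Rightarrow> real) \<Rightarrow> real \<Rightarrow> 'a \<Rightarrow> 'a \<Rightarrow> 'a \<Rightarrow> real" where
  "stepk \<sigma> \<tau> b z y = (E ((z - y) \<bullet> b / \<tau>) - E ((z - y) \<bullet> b / \<sigma> b)) *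
     (\<Prod>b'\<in>Basis - {b}. e ((z - y) \<bullet> b' / \<sigma> b') / \<sigma> b')"

lemma smooth_factor:
  assumes "smooth_real g" shows "smooth_prod (\<lambda>y::'a::euclidean_space. g ((z - y) \<bullet> b / s))"
proof -
  have "smooth_prod (\<lambda>y. (\<lambda>x. g ((- 1 / s) * x + z \<bullet> b / s)) (y \<bullet> b))"
    by (rule smooth_prod_real, rule smooth_real_affine, rule assms)
  moreover have "(z - y) \<bullet> b / s = (- 1 / s) * (y \<bullet> b) + z \<bullet> b / s" for y
    by (simp add: inner_diff_left diff_divide_distrib)
  ultimately show ?thesis by simp
qed

lemma smooth_stepk: "smooth_prod (stepk \<sigma> \<tau> b z)"
proof -
  have "smooth_prod (\<lambda>y. (E ((z - y) \<bullet> b / \<tau>) + (- 1) * E ((z - y) \<bullet> b / \<sigma> b)) *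
     (\<Prod>b'\<in>Basis - {b}. e ((z - y) \<bullet> b' / \<sigma> b') * (1 / \<sigma> b')))"
    by (intro smooth_prod_mult smooth_prod_add smooth_prod_prod smooth_factor smooth smooth_prod_const) auto
  then show ?thesis by (simp add: stepk_def[abs_def])
qed

lemma dir_deriv_eqI:
  assumes "smooth_prod f" "((\<lambda>s. f (y + s *\<^sub>R v)) has_real_derivative d) (at 0)"
  shows "dir_derivs [v] f y = d"
proof -
  have "((\<lambda>s. f (y + s *\<^sub>R v)) has_real_derivative dir_derivs [v] f y) (at 0)"
    using dir_derivs_line[of f "[]" y v 0] smooth_prod_differentiable[OF assms(1)] by simp
  then show ?thesis using assms(2) by (rule DERIV_unique)
qed

lemma inner_line:
  assumes "b \<in> Basis" "c \<in> Basis"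
  shows "(z - (y + s *\<^sub>R b)) \<bullet> c = (z - y) \<bullet> c - (if c = b then s else 0)"
  using assms by (simp add: inner_simps inner_Basis)

lemma stepk_deriv:
  assumes b: "b \<in> Basis" and pos: "\<tau> > 0" "\<sigma> b > 0"
  shows "dir_derivs [b] (stepk \<sigma> \<tau> b z) y = molf \<sigma> z y - molf (\<sigma>(b := \<tau>)) z y"
proof (rule dir_deriv_eqI[OF smooth_stepk])
  let ?x = "(z - y) \<bullet> b" and ?P = "\<Prod>b'\<in>Basis - {b}. e ((z - y) \<bullet> b' / \<sigma> b') / \<sigma> b'"
  have eq: "stepk \<sigma> \<tau> b z (y + s *\<^sub>R b) = (E ((?x - s) / \<tau>) - E ((?x - s) / \<sigma> b)) * ?P" for s
  proof -
    have "(\<Prod>b'\<in>Basis - {b}. e ((z - (y + s *\<^sub>R b)) \<bullet> b' / \<sigma> b') / \<sigma> b') = ?P"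
      by (rule prod.cong) (use b in \<open>auto simp: inner_line[OF b]\<close>)
    then show ?thesis by (simp only: stepk_def inner_line[OF b b] refl if_True)
  qed
  have dE': "((\<lambda>s. E ((?x - s) / t)) has_real_derivative e (?x / t) * (- 1 / t)) (at 0)" if "t > 0" for t
  proof -
    have "((\<lambda>s. (?x - s) / t) has_real_derivative (- 1 / t)) (at 0)"
      using that by (auto intro!: derivative_eq_intros)
    from DERIV_chain'[OF this dE] show ?thesis by (simp add: mult.commute)
  qed
  have "((\<lambda>s. (E ((?x - s) / \<tau>) - E ((?x - s) / \<sigma> b)) * ?P) has_real_derivative
     (e (?x / \<tau>) * (- 1 / \<tau>) - e (?x / \<sigma> b) * (- 1 / \<sigma> b)) * ?P) (at 0)"
    by (intro DERIV_cmult_right DERIV_diff dE' pos)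
  moreover have "molf \<sigma> z y = e (?x / \<sigma> b) / \<sigma> b * ?P"
    unfolding molf_def by (rule prod.remove) (use b in auto)
  moreover have "molf (\<sigma>(b := \<tau>)) z y = e (?x / \<tau>) / \<tau> * ?P"
    unfolding molf_def by (subst prod.remove[OF _ b]) (auto intro!: prod.cong)
  ultimately show "((\<lambda>s. stepk \<sigma> \<tau> b z (y + s *\<^sub>R b)) has_real_derivative molf \<sigma> z y - molf (\<sigma>(b := \<tau>)) z y) (at 0)"
    unfolding eq by (simp add: algebra_simps)
qed

lemma stepk_cross_deriv:
  assumes b: "b \<in> Basis" and c: "c \<in> Basis" "c \<noteq> b" and pos: "\<sigma> c > 0"
  shows "dir_derivs [c] (stepk \<sigma> \<tau> b z) y = (E ((z - y) \<bullet> b / \<tau>) - E ((z - y) \<bullet> b / \<sigma> b)) *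
     ((- e' ((z - y) \<bullet> c / \<sigma> c) / (\<sigma> c)\<^sup>2) * (\<Prod>b'\<in>Basis - {b} - {c}. e ((z - y) \<bullet> b' / \<sigma> b') / \<sigma> b'))"
proof (rule dir_deriv_eqI[OF smooth_stepk])
  let ?x = "(z - y) \<bullet> c" and ?P = "\<Prod>b'\<in>Basis - {b} - {c}. e ((z - y) \<bullet> b' / \<sigma> b') / \<sigma> b'"
  let ?D = "E ((z - y) \<bullet> b / \<tau>) - E ((z - y) \<bullet> b / \<sigma> b)"
  have eq: "stepk \<sigma> \<tau> b z (y + s *\<^sub>R c) = ?D * (e ((?x - s) / \<sigma> c) / \<sigma> c * ?P)" for s
  proof -
    have "(\<Prod>b'\<in>Basis - {b}. e ((z - (y + s *\<^sub>R c)) \<bullet> b' / \<sigma> b') / \<sigma> b') =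
       e ((z - (y + s *\<^sub>R c)) \<bullet> c / \<sigma> c) / \<sigma> c * (\<Prod>b'\<in>Basis - {b} - {c}. e ((z - (y + s *\<^sub>R c)) \<bullet> b' / \<sigma> b') / \<sigma> b')"
      by (rule prod.remove) (use c in auto)
    also have "(\<Prod>b'\<in>Basis - {b} - {c}. e ((z - (y + s *\<^sub>R c)) \<bullet> b' / \<sigma> b') / \<sigma> b') = ?P"
      by (rule prod.cong) (use c in \<open>auto simp: inner_line[OF c(1)]\<close>)
    finally show ?thesis
      using c by (simp only: stepk_def inner_line[OF c(1) c(1)] inner_line[OF c(1) b] refl if_True) simp
  qed
  have "((\<lambda>s. (?x - s) / \<sigma> c) has_real_derivative (- 1 / \<sigma> c)) (at 0)"
    using pos by (auto intro!: derivative_eq_intros)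
  from DERIV_chain'[OF this de]
  have "((\<lambda>s. e ((?x - s) / \<sigma> c)) has_real_derivative e' (?x / \<sigma> c) * (- 1 / \<sigma> c)) (at 0)"
    by (simp add: mult.commute)
  then have "((\<lambda>s. ?D * (e ((?x - s) / \<sigma> c) / \<sigma> c * ?P)) has_real_derivative
     ?D * (e' (?x / \<sigma> c) * (- 1 / \<sigma> c) / \<sigma> c * ?P)) (at 0)"
    by (intro DERIV_cmult DERIV_cmult_right DERIV_cdivide)
  then show "((\<lambda>s. stepk \<sigma> \<tau> b z (y + s *\<^sub>R c)) has_real_derivative
     ?D * ((- e' (?x / \<sigma> c) / (\<sigma> c)\<^sup>2) * ?P)) (at 0)"
    unfolding eq by (simp add: power2_eq_square)
qed

lemma e_outside: "e (x / s) = 0" if "s > 0" "s \<le> r" "\<not> (0 \<le> x \<and> x \<le> r)" for x s r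
  by (rule e_out) (use that in \<open>auto simp: field_simps\<close>)

lemma molf_outside:
  assumes "y \<notin> back_box \<rho> z" "\<And>b. b \<in> Basis \<Longrightarrow> 0 < \<sigma> b \<and> \<sigma> b \<le> \<rho> b"
  shows "molf \<sigma> z y = 0"
proof -
  from assms(1) obtain b where b: "b \<in> Basis" "\<not> (0 \<le> (z - y) \<bullet> b \<and> (z - y) \<bullet> b \<le> \<rho> b)"
    by (auto simp: back_box_def)
  then have "e ((z - y) \<bullet> b / \<sigma> b) = 0" using assms(2)[OF b(1)] by (intro e_outside) auto
  with b(1) show ?thesis unfolding molf_def by (auto intro!: prod_zero)
qed

lemma stepk_outside:
  assumes "y \<notin> back_box \<rho> z" "\<And>b. b \<in> Basis \<Longrightarrow> 0 < \<sigma> b \<and> \<sigma> b \<le> \<rho> b" "0 < \<tau>" "\<tau> \<le> \<rho> b" "b \<in> Basis"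
  shows "stepk \<sigma> \<tau> b z y = 0"
proof -
  from assms(1) obtain c where c: "c \<in> Basis" "\<not> (0 \<le> (z - y) \<bullet> c \<and> (z - y) \<bullet> c \<le> \<rho> c)"
    by (auto simp: back_box_def)
  show ?thesis
  proof (cases "c = b")
    case True
    have s: "0 < \<sigma> b" "\<sigma> b \<le> \<rho> b" using assms(2,5) by auto
    from c True consider "(z - y) \<bullet> b < 0" | "(z - y) \<bullet> b > \<rho> b" by fastforce
    then have "E ((z - y) \<bullet> b / \<tau>) = E ((z - y) \<bullet> b / \<sigma> b)"
    proof cases
      case 1
      then show ?thesis using s assms(3) by (simp add: E_left divide_le_0_iff)
    next
      case 2
      then show ?thesis using s assms(3,4) by (simp add: E_right)
    qed
    then show ?thesis by (simp add: stepk_def)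
  next
    case False
    have "e ((z - y) \<bullet> c / \<sigma> c) = 0" using assms(2)[OF c(1)] c(2) by (intro e_outside) auto
    with c(1) False show ?thesis unfolding stepk_def by (auto intro!: prod_zero)
  qed
qed

lemma test_fun_stepk:
  assumes "back_box \<rho> z \<subseteq> U" "\<And>b. b \<in> Basis \<Longrightarrow> 0 < \<sigma> b \<and> \<sigma> b \<le> \<rho> b" "0 < \<tau>" "\<tau> \<le> \<rho> b" "b \<in> Basis"
  shows "test_fun U (stepk \<sigma> \<tau> b z)" "closure {y. stepk \<sigma> \<tau> b z y \<noteq> 0} \<subseteq> back_box \<rho> z"
proof -
  have "{y. stepk \<sigma> \<tau> b z y \<noteq> 0} \<subseteq> back_box \<rho> z"
    using stepk_outside[of _ \<rho> z \<sigma> \<tau> b] assms(2-5) by blast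
  then show sub: "closure {y. stepk \<sigma> \<tau> b z y \<noteq> 0} \<subseteq> back_box \<rho> z"
    by (simp add: closure_minimal compact_imp_closed compact_back_box)
  then have "compact (closure {y. stepk \<sigma> \<tau> b z y \<noteq> 0})"
    using compact_Int_closed[OF compact_back_box[of \<rho> z], of "closure {y. stepk \<sigma> \<tau> b z y \<noteq> 0}"]
    by (simp add: Int_absorb1)
  then show "test_fun U (stepk \<sigma> \<tau> b z)"
    using sub assms(1) smooth_prod_differentiable[OF smooth_stepk] unfolding test_fun_def by blast
qed

text \<open>The quarter is the smallest ratio of scales that occurs: halving \<open>s\<close>
  divides the time scale \<open>s^2\<close> by four.\<close>

lemma prod_e_le:
  assumes "\<And>b. b \<in> S \<Longrightarrow> 0 < \<rho> b \<and> \<rho> b / 4 \<le> \<sigma> b" "S \<subseteq> Basis"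
  shows "\<bar>\<Prod>b'\<in>S. e ((z - y) \<bullet> b' / \<sigma> b') / \<sigma> b'\<bar> \<le> (\<Prod>b'\<in>S. 4 * B / \<rho> b')"
  unfolding abs_prod
proof (rule prod_mono)
  fix b assume "b \<in> S"
  then have "0 < \<rho> b" "\<rho> b / 4 \<le> \<sigma> b" using assms by auto
  moreover from this have "\<bar>e ((z - y) \<bullet> b / \<sigma> b)\<bar> / \<sigma> b \<le> B / (\<rho> b / 4)"
    using e_le B by (intro frac_le) auto
  ultimately show "0 \<le> \<bar>e ((z - y) \<bullet> b / \<sigma> b) / \<sigma> b\<bar> \<and> \<bar>e ((z - y) \<bullet> b / \<sigma> b) / \<sigma> b\<bar> \<le> 4 * B / \<rho> b"
    by (simp add: mult.commute)
qed

lemma molf_le: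
  fixes \<rho> :: "'a::euclidean_space \<Rightarrow> real"
  assumes "\<And>b. b \<in> Basis \<Longrightarrow> 0 < \<rho> b \<and> \<rho> b / 4 \<le> \<sigma> b"
  shows "\<bar>molf \<sigma> z y\<bar> \<le> (4 * B) ^ DIM('a) / (\<Prod>b\<in>Basis. \<rho> b)"
proof -
  have "\<bar>molf \<sigma> z y\<bar> \<le> (\<Prod>b'\<in>Basis. 4 * B / \<rho> b')"
    unfolding molf_def by (rule prod_e_le) (use assms in auto)
  then show ?thesis by (simp add: prod_dividef)
qed

lemma E_diff_le: "\<bar>E x - E x'\<bar> \<le> 2 * B"
  using E_le[of x] E_le[of x'] by linarith

text \<open>Compared with a full kernel, the coordinate \<open>b\<close> contributes no density;
  this gains the factor \<open>\<rho> b\<close> over the reciprocal of the volume.\<close>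

lemma stepk_le:
  fixes \<rho> :: "'a::euclidean_space \<Rightarrow> real"
  assumes "\<And>b. b \<in> Basis \<Longrightarrow> 0 < \<rho> b \<and> \<rho> b / 4 \<le> \<sigma> b" "b \<in> Basis"
  shows "\<bar>stepk \<sigma> \<tau> b z y\<bar> \<le> 2 * B * ((4 * B) ^ (DIM('a) - 1) * \<rho> b / (\<Prod>b\<in>Basis. \<rho> b))"
proof -
  have "\<bar>\<Prod>b'\<in>Basis - {b}. e ((z - y) \<bullet> b' / \<sigma> b') / \<sigma> b'\<bar> \<le> (\<Prod>b'\<in>Basis - {b}. 4 * B / \<rho> b')"
    by (rule prod_e_le) (use assms in auto)
  also have "\<dots> = (4 * B) ^ (DIM('a) - 1) * \<rho> b / (\<Prod>b\<in>Basis. \<rho> b)"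
    by (rule prod_without) (use assms in auto)
  finally show ?thesis
    unfolding stepk_def abs_mult using E_diff_le B by (intro mult_mono) auto
qed

text \<open>Differentiation in another direction \<open>c\<close> replaces one \<open>e\<close> by
  \<open>e'\<close> and costs a further \<open>1 / \<sigma> c\<close>, which is at most
  \<open>4 / \<rho> c\<close>.\<close>

lemma stepk_cross_le:
  fixes \<rho> :: "'a::euclidean_space \<Rightarrow> real"
  assumes pos: "\<And>b. b \<in> Basis \<Longrightarrow> 0 < \<rho> b \<and> \<rho> b / 4 \<le> \<sigma> b" and b: "b \<in> Basis" and c: "c \<in> Basis" "c \<noteq> b"
  shows "\<bar>dir_derivs [c] (stepk \<sigma> \<tau> b z) y\<bar> \<le>
    2 * B * (4 / \<rho> c * ((4 * B) ^ (DIM('a) - 1) * \<rho> b / (\<Prod>b\<in>Basis. \<rho> b)))"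
proof -
  have r: "0 < \<rho> c" "\<rho> c / 4 \<le> \<sigma> c" "0 < \<sigma> c" using pos[OF c(1)] by auto
  let ?P = "\<Prod>b'\<in>Basis - {b} - {c}. e ((z - y) \<bullet> b' / \<sigma> b') / \<sigma> b'"
  have P: "\<bar>?P\<bar> \<le> (\<Prod>b'\<in>Basis - {b} - {c}. 4 * B / \<rho> b')"
    by (rule prod_e_le) (use pos in auto)
  have "(\<rho> c / 4)\<^sup>2 \<le> (\<sigma> c)\<^sup>2" using r by (intro power_mono) auto
  then have "\<bar>- e' ((z - y) \<bullet> c / \<sigma> c) / (\<sigma> c)\<^sup>2\<bar> \<le> B / (\<rho> c / 4)\<^sup>2"
    using e'_le r B by (simp only: abs_divide abs_minus_cancel) (intro frac_le; auto)
  also have "\<dots> = 4 / \<rho> c * (4 * B / \<rho> c)" by (simp add: power2_eq_square)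
  finally have "\<bar>(- e' ((z - y) \<bullet> c / \<sigma> c) / (\<sigma> c)\<^sup>2) * ?P\<bar> \<le>
      4 / \<rho> c * (4 * B / \<rho> c) * (\<Prod>b'\<in>Basis - {b} - {c}. 4 * B / \<rho> b')"
    unfolding abs_mult using P r B by (intro mult_mono) auto
  also have "(4 * B / \<rho> c) * (\<Prod>b'\<in>Basis - {b} - {c}. 4 * B / \<rho> b') = (\<Prod>b'\<in>Basis - {b}. 4 * B / \<rho> b')"
    by (rule prod.remove[symmetric]) (use c in auto)
  then have "4 / \<rho> c * (4 * B / \<rho> c) * (\<Prod>b'\<in>Basis - {b} - {c}. 4 * B / \<rho> b') = 4 / \<rho> c * (\<Prod>b'\<in>Basis - {b}. 4 * B / \<rho> b')"
    by (simp only: mult.assoc)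
  also have "(\<Prod>b'\<in>Basis - {b}. 4 * B / \<rho> b') = (4 * B) ^ (DIM('a) - 1) * \<rho> b / (\<Prod>b\<in>Basis. \<rho> b)"
    by (rule prod_without) (use pos b in auto)
  finally show ?thesis
    unfolding stepk_cross_deriv[of b c \<sigma>, OF b c r(3)] abs_mult[of "E _ - E _"]
    by (rule mult_mono[OF E_diff_le]) (use B in auto)
qed

end

lemma test_fun_dir_deriv:
  assumes "test_fun U \<psi>" shows "test_fun U (dir_derivs [v] \<psi>)"
proof -
  let ?K = "closure {z. \<psi> z \<noteq> 0}"
  have "{z. dir_derivs [v] \<psi> z \<noteq> 0} \<subseteq> ?K" using test_fun_outside[OF assms, of _ "[v]"] by blast
  then have sub: "closure {z. dir_derivs [v] \<psi> z \<noteq> 0} \<subseteq> ?K" by (simp add: closure_minimal)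
  moreover have "compact ?K" "?K \<subseteq> U" using assms by (auto simp: test_fun_def)
  moreover from this sub have "compact (closure {z. dir_derivs [v] \<psi> z \<noteq> 0})"
    using compact_Int_closed[of ?K "closure {z. dir_derivs [v] \<psi> z \<noteq> 0}"] by (simp add: Int_absorb1)
  moreover have "dir_derivs vs (dir_derivs [v] \<psi>) differentiable (at z)" for vs z
    unfolding dir_derivs_append[symmetric] using assms by (simp add: test_fun_def del: dir_derivs.simps)
  ultimately show ?thesis unfolding test_fun_def by blast
qed

lemma integral_kernel_le:
  fixes f h k :: "'a::euclidean_space \<Rightarrow> real"
  assumes [measurable]: "f \<in> borel_measurable borel" "k \<in> borel_measurable borel" "S \<in> sets borel"
    and h: "integrable lborel h" and fh: "\<And>y. \<bar>f y\<bar> \<le> h y"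
    and k: "\<And>y. \<bar>k y\<bar> \<le> D" "\<And>y. y \<notin> S \<Longrightarrow> k y = 0"
  shows "\<bar>\<integral>y. f y * k y \<partial>lborel\<bar> \<le> D * (\<integral>y. indicat_real S y * h y \<partial>lborel)"
    and "integrable lborel (\<lambda>y. f y * k y)"
proof -
  have D: "0 \<le> D" using k(1) abs_ge_zero order_trans by blast
  have [measurable]: "h \<in> borel_measurable borel" using h by simp
  have h0: "0 \<le> h y" for y using fh[of y] by linarith
  have i: "integrable lborel (\<lambda>y. D * (indicat_real S y * h y))"
    by (rule Bochner_Integration.integrable_bound[of _ "\<lambda>y. D * h y"]) (use h D h0 in \<open>auto simp: indicator_def\<close>)
  have le: "\<bar>f y * k y\<bar> \<le> D * (indicat_real S y * h y)" for y
    using mult_mono[OF fh[of y] k(1)[of y]] h0[of y] k(2)[of y] by (cases "y \<in> S") (auto simp: abs_mult mult.commute)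
  show I: "integrable lborel (\<lambda>y. f y * k y)"
    by (rule Bochner_Integration.integrable_bound[OF i]) (use le in \<open>auto intro: order_trans[OF _ abs_ge_self]\<close>)
  have "\<bar>\<integral>y. f y * k y \<partial>lborel\<bar> \<le> (\<integral>y. \<bar>f y * k y\<bar> \<partial>lborel)"
    using integral_norm_bound[of lborel "\<lambda>y. f y * k y"] by simp
  also have "\<dots> \<le> (\<integral>y. D * (indicat_real S y * h y) \<partial>lborel)"
    by (rule integral_mono[OF _ i le]) (use I in simp)
  finally show "\<bar>\<integral>y. f y * k y \<partial>lborel\<bar> \<le> D * (\<integral>y. indicat_real S y * h y \<partial>lborel)" by simp
qed

section \<open>Parabolic scales and averages over boxes\<close>

definition pscale :: "real \<Rightarrow> 'n::finite spacetime \<Rightarrow> real" where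
  "pscale s b = (if b = e_t then s\<^sup>2 else s)"

lemma pscale_simps: "pscale s e_t = s\<^sup>2" "pscale s (e_x k) = s"
  by (auto simp: pscale_def e_x_neq_e_t)

lemma pscale_pos: "s > 0 \<Longrightarrow> pscale s b > 0" by (simp add: pscale_def)

lemma inj_e_x: "inj (e_x :: 'n::finite \<Rightarrow> 'n spacetime)"
  by (auto simp: inj_def e_x_def axis_eq_axis)

lemma prod_spacetime: "(\<Prod>b\<in>Basis. f b) = f e_t * (\<Prod>k\<in>UNIV. f (e_x k :: 'n::finite spacetime))"
proof -
  have "(\<Prod>b\<in>Basis. f b) = f e_t * (\<Prod>b\<in>range (e_x :: 'n \<Rightarrow> 'n spacetime). f b)"
    unfolding Basis_spacetime by (subst prod.insert) (auto simp: e_x_neq_e_t[symmetric])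
  also have "(\<Prod>b\<in>range (e_x :: 'n \<Rightarrow> 'n spacetime). f b) = (\<Prod>k\<in>UNIV. f (e_x k))"
    by (subst prod.reindex[OF inj_e_x]) (simp add: o_def)
  finally show ?thesis .
qed

lemma prod_pscale: "(\<Prod>b\<in>Basis. pscale s (b :: 'n::finite spacetime)) = s ^ (CARD('n) + 2)"
  unfolding prod_spacetime by (simp add: pscale_simps power_add power2_eq_square mult_ac)

lemma DIM_spacetime: "DIM('n::finite spacetime) = CARD('n) + 1"
  by simp

definition box_avg :: "('n::finite spacetime \<Rightarrow> real) \<Rightarrow> real \<Rightarrow> 'n spacetime \<Rightarrow> real" where
  "box_avg h s z = (\<integral>y. indicat_real (back_box (pscale s) z) y * h y \<partial>lborel) / s ^ (CARD('n) + 2)"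

context step_profile
begin

lemma molf_measurable_pair [measurable]:
  "(\<lambda>x. molf \<sigma> (fst x) (snd x)) \<in> borel_measurable (borel \<Otimes>\<^sub>M borel)"
proof -
  have [measurable]: "e \<in> borel_measurable borel"
    by (intro borel_measurable_continuous_onI smooth_real_continuous smooth)
  show ?thesis unfolding molf_def by measurable
qed

lemma molf_measurable [measurable]: "molf \<sigma> z \<in> borel_measurable borel" "(\<lambda>z. molf \<sigma> z y) \<in> borel_measurable borel"
proof -
  have [measurable]: "e \<in> borel_measurable borel"
    by (intro borel_measurable_continuous_onI smooth_real_continuous smooth)
  show "molf \<sigma> z \<in> borel_measurable borel" "(\<lambda>z. molf \<sigma> z y) \<in> borel_measurable borel"
    unfolding molf_def[abs_def] by measurable
qed

definition mollify :: "real \<Rightarrow> ('n::finite spacetime \<Rightarrow> real) \<Rightarrow> 'n spacetime \<Rightarrow> real" where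
  "mollify s f z = (\<integral>y. f y * molf (pscale s) z y \<partial>lborel)"

text \<open>Changing the scale of the mollifier in one coordinate only adds an exact derivative, which
  is moved onto \<open>wk\<close>; this produces a second space derivative or the time derivative of \<open>w\<close>.\<close>

lemma mollify_change_coordinate:
  fixes w wt h :: "'n::finite spacetime \<Rightarrow> real" and wxx :: "'n \<Rightarrow> 'n spacetime \<Rightarrow> real"
  assumes [measurable]: "wk \<in> borel_measurable borel" "wt \<in> borel_measurable borel" "\<And>l. wxx l \<in> borel_measurable borel"
    and wd: "weak_deriv U [e_t] w wt" "weak_deriv U [e_x k] w wk" "\<And>l. weak_deriv U [e_x k, e_x l] w (wxx l)"
    and h: "integrable lborel h" "\<And>y. \<bar>wt y\<bar> \<le> h y" "\<And>y. \<bar>wk y\<bar> \<le> h y" "\<And>l y. \<bar>wxx l y\<bar> \<le> h y"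
    and s: "0 < s" and sub: "back_box (pscale s) z \<subseteq> U"
    and \<sigma>: "\<And>b. b \<in> Basis \<Longrightarrow> pscale s b / 4 \<le> \<sigma> b \<and> \<sigma> b \<le> pscale s b"
    and \<tau>: "pscale s b / 4 \<le> \<tau>" "\<tau> \<le> pscale s b" and b: "b \<in> Basis"
  shows "\<bar>(\<integral>y. wk y * (molf \<sigma> z y - molf (\<sigma>(b := \<tau>)) z y) \<partial>lborel)\<bar>
    \<le> 8 * B * (4 * B) ^ CARD('n) * (s * box_avg h s z)"
proof -
  let ?f = "stepk \<sigma> \<tau> b z"
  let ?K = "back_box (pscale s) z"
  have pos: "\<tau> > 0" "\<And>b. b \<in> Basis \<Longrightarrow> 0 < \<sigma> b \<and> \<sigma> b \<le> pscale s b"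
    "\<And>b. b \<in> Basis \<Longrightarrow> 0 < pscale s b \<and> pscale s b / 4 \<le> \<sigma> b"
  proof -
    have p4: "0 < pscale s b / 4" for b :: "'n spacetime" using pscale_pos[OF s, of b] by simp
    show "\<tau> > 0" using p4 \<tau>(1) by (rule less_le_trans)
    fix b :: "'n spacetime" assume b: "b \<in> Basis"
    show "0 < \<sigma> b \<and> \<sigma> b \<le> pscale s b" using less_le_trans[OF p4[of b]] \<sigma>[OF b] by blast
    show "0 < pscale s b \<and> pscale s b / 4 \<le> \<sigma> b" using pscale_pos[OF s] \<sigma>[OF b] by blast
  qed
  have Kb[measurable]: "?K \<in> sets borel" using compact_back_box by (intro borel_compact)
  have test: "test_fun U ?f" "closure {y. ?f y \<noteq> 0} \<subseteq> ?K"
    using test_fun_stepk[of "pscale s" z U \<sigma> \<tau> b] sub pos(1,2) \<tau>(2) b by auto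
  note [measurable] = test_fun_measurable[OF test(1)]
  have fm[measurable]: "?f \<in> borel_measurable borel" using test_fun_measurable[OF test(1), of "[]"] by simp
  have out: "y \<notin> ?K \<Longrightarrow> dir_derivs vs ?f y = 0" for y vs
    using test_fun_outside[OF test(1), of y vs] test(2) by blast
  have d: "dir_derivs [b] ?f y = molf \<sigma> z y - molf (\<sigma>(b := \<tau>)) z y" for y
    by (rule stepk_deriv) (use b pos in auto)
  have avg: "(\<integral>y. indicat_real ?K y * h y \<partial>lborel) = s ^ (CARD('n) + 2) * box_avg h s z"
    using s by (simp add: box_avg_def)
  have avg0: "0 \<le> box_avg h s z"
  proof -
    have h0: "0 \<le> h y" for y by (rule order_trans[OF abs_ge_zero h(2)])
    show ?thesis unfolding box_avg_def
      by (intro divide_nonneg_nonneg Bochner_Integration.integral_nonneg mult_nonneg_nonneg h0) (use s in auto)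
  qed
  have test1: "test_fun U (dir_derivs [b] ?f)" by (rule test_fun_dir_deriv[OF test(1)])
  have "(\<integral>y. w y * dir_derivs [e_x k] (dir_derivs [b] ?f) y \<partial>lborel) =
      (- 1) ^ length [e_x k] * (\<integral>y. wk y * dir_derivs [b] ?f y \<partial>lborel)"
    using wd(2) test1 unfolding weak_deriv_def by blast
  \<comment> \<open>Going back from \<open>wk\<close> to \<open>w\<close> leaves two derivatives on
    the kernel primitive, and one may choose anew which of them to move onto
    \<open>w\<close>.\<close>
  then have key: "(\<integral>y. wk y * (molf \<sigma> z y - molf (\<sigma>(b := \<tau>)) z y) \<partial>lborel) =
      - (\<integral>y. w y * dir_derivs [e_x k, b] ?f y \<partial>lborel)"
    by (simp add: d[symmetric])
  from b consider l where "b = e_x l" | "b = e_t" by (auto simp: Basis_spacetime)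
  then show ?thesis
  proof cases
    case 1
    \<comment> \<open>In a space direction both derivatives move onto \<open>w\<close>; the
      primitive itself gains the factor \<open>s\<close> over the kernel.\<close>
    have "(\<integral>y. w y * dir_derivs [e_x k, e_x l] ?f y \<partial>lborel) = (- 1) ^ length [e_x k, e_x l] * (\<integral>y. wxx l y * ?f y \<partial>lborel)"
      using wd(3)[of l] test(1) unfolding weak_deriv_def by blast
    then have "\<bar>(\<integral>y. wk y * (molf \<sigma> z y - molf (\<sigma>(b := \<tau>)) z y) \<partial>lborel)\<bar> = \<bar>\<integral>y. wxx l y * ?f y \<partial>lborel\<bar>"
      unfolding key by (simp add: 1 del: dir_derivs.simps)
    also have "\<dots> \<le> (2 * B * ((4 * B) ^ (DIM('n spacetime) - 1) * pscale s b / (\<Prod>b\<in>(Basis :: 'n spacetime set). pscale s b))) *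
        (\<integral>y. indicat_real ?K y * h y \<partial>lborel)"
    proof (rule integral_kernel_le(1)[OF _ fm Kb h(1) h(4)])
      show "\<bar>?f y\<bar> \<le> 2 * B * ((4 * B) ^ (DIM('n spacetime) - 1) * pscale s b / (\<Prod>b\<in>(Basis :: 'n spacetime set). pscale s b))" for y
        by (rule stepk_le[OF _ b]) (rule pos(3))
      show "?f y = 0" if "y \<notin> ?K" for y using out[OF that, of "[]"] by simp
    qed simp
    also have "\<dots> = 2 * B * (4 * B) ^ CARD('n) * (s * box_avg h s z)"
      unfolding avg prod_pscale DIM_spacetime 1 pscale_simps using s by simp
    also have "\<dots> \<le> 8 * B * (4 * B) ^ CARD('n) * (s * box_avg h s z)"
      using s avg0 B by (intro mult_right_mono) auto
    finally show ?thesis .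
  next
    case 2
    \<comment> \<open>In the time direction only \<open>e_t\<close> moves onto \<open>w\<close>. The
      primitive now gains \<open>s^2\<close>, and the space derivative that stays on it costs
      \<open>4 / s\<close>, which again leaves a factor \<open>s\<close>.\<close>
    have test2: "test_fun U (dir_derivs [e_x k] ?f)" by (rule test_fun_dir_deriv[OF test(1)])
    have "dir_derivs [e_x k, e_t] ?f = dir_derivs [e_t, e_x k] ?f"
      by (intro ext dir_derivs_commute smooth_prod_differentiable smooth_stepk)
    moreover have "(\<integral>y. w y * dir_derivs [e_t] (dir_derivs [e_x k] ?f) y \<partial>lborel) =
        (- 1) ^ length [e_t :: 'n spacetime] * (\<integral>y. wt y * dir_derivs [e_x k] ?f y \<partial>lborel)"
      using wd(1) test2 unfolding weak_deriv_def by blast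
    ultimately have "(\<integral>y. w y * dir_derivs [e_x k, e_t] ?f y \<partial>lborel) = - (\<integral>y. wt y * dir_derivs [e_x k] ?f y \<partial>lborel)"
      by simp
    then have "\<bar>(\<integral>y. wk y * (molf \<sigma> z y - molf (\<sigma>(b := \<tau>)) z y) \<partial>lborel)\<bar> = \<bar>\<integral>y. wt y * dir_derivs [e_x k] ?f y \<partial>lborel\<bar>"
      unfolding key by (simp add: 2 del: dir_derivs.simps)
    also have "\<dots> \<le> (2 * B * (4 / pscale s (e_x k) * ((4 * B) ^ (DIM('n spacetime) - 1) * pscale s b / (\<Prod>b\<in>(Basis :: 'n spacetime set). pscale s b)))) *
        (\<integral>y. indicat_real ?K y * h y \<partial>lborel)"
    proof (rule integral_kernel_le(1)[OF _ _ Kb h(1) h(2)])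
      show "\<bar>dir_derivs [e_x k] ?f y\<bar> \<le> 2 * B * (4 / pscale s (e_x k) * ((4 * B) ^ (DIM('n spacetime) - 1) * pscale s b / (\<Prod>b\<in>(Basis :: 'n spacetime set). pscale s b)))" for y
        by (rule stepk_cross_le[OF _ b e_x_Basis]) (use pos(3) in \<open>auto simp: 2 e_x_neq_e_t\<close>)
      show "dir_derivs [e_x k] ?f y = 0" if "y \<notin> ?K" for y using out[OF that] .
    qed (simp_all del: dir_derivs.simps)
    also have "\<dots> = 8 * B * (4 * B) ^ CARD('n) * (s * box_avg h s z)"
      unfolding avg prod_pscale DIM_spacetime 2 pscale_simps using s by (simp add: power2_eq_square)
    finally show ?thesis .
  qed
qed

text \<open>The coordinates are rescaled one after the other; \<open>\<sigma> S\<close> is the state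
  in which those in \<open>S\<close> are done, and each of the \<open>CARD('n) + 1\<close> changes
  obeys the same bound.\<close>

lemma mollify_halve:
  fixes w wt h :: "'n::finite spacetime \<Rightarrow> real" and wxx :: "'n \<Rightarrow> 'n spacetime \<Rightarrow> real"
  assumes [measurable]: "wk \<in> borel_measurable borel" "wt \<in> borel_measurable borel" "\<And>l. wxx l \<in> borel_measurable borel"
    and wd: "weak_deriv U [e_t] w wt" "weak_deriv U [e_x k] w wk" "\<And>l. weak_deriv U [e_x k, e_x l] w (wxx l)"
    and h: "integrable lborel h" "\<And>y. \<bar>wt y\<bar> \<le> h y" "\<And>y. \<bar>wk y\<bar> \<le> h y" "\<And>l y. \<bar>wxx l y\<bar> \<le> h y"
    and s: "0 < s" and sub: "back_box (pscale s) z \<subseteq> U"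
  shows "\<bar>mollify (s / 2) wk z - mollify s wk z\<bar>
    \<le> real (CARD('n) + 1) * (8 * B * (4 * B) ^ CARD('n)) * (s * box_avg h s z)"
proof -
  let ?K = "8 * B * (4 * B) ^ CARD('n) * (s * box_avg h s z)"
  define \<sigma> where "\<sigma> S b = (if b \<in> S then pscale (s / 2) b else pscale s b)" for S and b :: "'n spacetime"
  have half: "pscale s b / 4 \<le> pscale (s / 2) b \<and> pscale (s / 2) b \<le> pscale s b" for b :: "'n spacetime"
    using s by (simp add: pscale_def power2_eq_square)
  have rng: "pscale s b / 4 \<le> \<sigma> S b \<and> \<sigma> S b \<le> pscale s b" for S and b :: "'n spacetime"
    using half[of b] pscale_pos[OF s, of b] by (auto simp: \<sigma>_def)
  have pos: "0 < pscale s b \<and> pscale s b / 4 \<le> \<sigma> S b" "0 < \<sigma> S b \<and> \<sigma> S b \<le> pscale s b" for S and b :: "'n spacetime"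
    using rng[of b S] pscale_pos[OF s, of b] by auto
  have int: "integrable lborel (\<lambda>y. wk y * molf (\<sigma> S) z y)" for S
  proof (rule integral_kernel_le(2)[where S = "back_box (pscale s) z", OF _ _ _ h(1) h(3)])
    show "back_box (pscale s) z \<in> sets borel" by (rule borel_compact[OF compact_back_box])
    show "\<bar>molf (\<sigma> S) z y\<bar> \<le> (4 * B) ^ DIM('n spacetime) / (\<Prod>b\<in>(Basis :: 'n spacetime set). pscale s b)" for y
      by (rule molf_le) (rule pos)
    show "molf (\<sigma> S) z y = 0" if "y \<notin> back_box (pscale s) z" for y
      by (rule molf_outside[OF that]) (rule pos)
  qed simp_all
  have "\<bar>(\<integral>y. wk y * molf (\<sigma> S) z y \<partial>lborel) - (\<integral>y. wk y * molf (\<sigma> {}) z y \<partial>lborel)\<bar> \<le> real (card S) * ?K"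
    if "finite S" "S \<subseteq> Basis" for S
    using that
  proof (induction S)
    case (insert b S)
    have "\<sigma> (insert b S) = (\<sigma> S)(b := pscale (s / 2) b)" by (auto simp: \<sigma>_def)
    then have "\<bar>\<integral>y. wk y * (molf (\<sigma> S) z y - molf (\<sigma> (insert b S)) z y) \<partial>lborel\<bar> \<le> ?K"
      using mollify_change_coordinate[of wk wt wxx U w k h s z "\<sigma> S" b "pscale (s / 2) b"] assms insert half rng by auto
    also have "(\<integral>y. wk y * (molf (\<sigma> S) z y - molf (\<sigma> (insert b S)) z y) \<partial>lborel) =
        (\<integral>y. wk y * molf (\<sigma> S) z y \<partial>lborel) - (\<integral>y. wk y * molf (\<sigma> (insert b S)) z y \<partial>lborel)"
      using int by (simp add: right_diff_distrib)
    finally show ?case using insert by (simp add: algebra_simps)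
  qed simp
  from this[of Basis] have "\<bar>(\<integral>y. wk y * molf (\<sigma> Basis) z y \<partial>lborel) - (\<integral>y. wk y * molf (\<sigma> {}) z y \<partial>lborel)\<bar>
      \<le> real (CARD('n) + 1) * ?K" by simp
  moreover have "molf (\<sigma> Basis) = molf (pscale (s / 2))" "molf (\<sigma> {}) = molf (pscale s)"
    by (auto simp: molf_def fun_eq_iff \<sigma>_def)
  ultimately show ?thesis by (simp add: mollify_def mult.assoc)
qed

lemma mollify_le:
  fixes h :: "'n::finite spacetime \<Rightarrow> real"
  assumes [measurable]: "f \<in> borel_measurable borel" and h: "integrable lborel h" "\<And>y. \<bar>f y\<bar> \<le> h y" and s: "0 < s"
  shows "\<bar>mollify s f z\<bar> \<le> (4 * B) ^ (CARD('n) + 1) * box_avg h s z"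
proof -
  have pos: "0 < pscale s b \<and> pscale s b / 4 \<le> pscale s b" "0 < pscale s b \<and> pscale s b \<le> pscale s b" for b :: "'n spacetime"
    using pscale_pos[OF s, of b] by auto
  have "\<bar>mollify s f z\<bar> \<le> (4 * B) ^ DIM('n spacetime) / (\<Prod>b\<in>(Basis :: 'n spacetime set). pscale s b) *
      (\<integral>y. indicat_real (back_box (pscale s) z) y * h y \<partial>lborel)"
    unfolding mollify_def
  proof (rule integral_kernel_le(1)[OF _ _ _ h])
    show "back_box (pscale s) z \<in> sets borel" by (rule borel_compact[OF compact_back_box])
    show "\<bar>molf (pscale s) z y\<bar> \<le> (4 * B) ^ DIM('n spacetime) / (\<Prod>b\<in>(Basis :: 'n spacetime set). pscale s b)" for y
      by (rule molf_le) (rule pos)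
    show "molf (pscale s) z y = 0" if "y \<notin> back_box (pscale s) z" for y
      by (rule molf_outside[OF that]) (rule pos)
  qed simp_all
  then show ?thesis unfolding prod_pscale DIM_spacetime by (simp add: box_avg_def)
qed

end

section \<open>Averages over parabolic boxes\<close>

text \<open>The convex power lies above its tangent at \<open>c\<close>; this is that inequality
  solved for \<open>t\<close>. Being linear in \<open>t powr r\<close>, it can be summed or
  integrated before \<open>c\<close> is chosen as the mean, and so it stands in for Jensen's and
  Hoelder's inequalities.\<close>

lemma tangent_powr:
  fixes t c r :: real
  assumes "0 \<le> t" "0 < c" "1 \<le> r"
  shows "t \<le> (1 - 1 / r) * c + 1 / r * (c powr (1 - r) * t powr r)"
proof (cases "t = 0")
  case False
  then have t: "t > 0" using assms by simp
  have "(c powr (1 - r) * t powr r) powr (1 / r) * c powr (1 - 1 / r) \<le> 1 / r * (c powr (1 - r) * t powr r) + (1 - 1 / r) * c"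
    using assms t by (intro Youngs_inequality_0) auto
  moreover have "(c powr (1 - r) * t powr r) powr (1 / r) * c powr (1 - 1 / r) = c powr ((1 - r) / r + (1 - 1 / r)) * t"
    using assms t by (simp add: powr_mult powr_powr powr_add)
  moreover have "(1 - r) / r + (1 - 1 / r) = 0" using assms by (simp add: field_simps)
  ultimately show ?thesis using assms by simp
qed (use assms in simp)

text \<open>Jensen's inequality for the values \<open>b j / a j\<close> with weights
  \<open>a j\<close>.\<close>

lemma powr_suminf_le:
  fixes a b :: "nat \<Rightarrow> real"
  assumes r: "1 \<le> r" and a: "\<And>j. 0 < a j" "a sums 1" and b: "\<And>j. 0 \<le> b j"
    and s: "summable (\<lambda>j. a j powr (1 - r) * b j powr r)"
  shows "summable b" "(\<Sum>j. b j) powr r \<le> (\<Sum>j. a j powr (1 - r) * b j powr r)"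
proof -
  have le: "b j \<le> (1 - 1 / r) * c * a j + 1 / r * c powr (1 - r) * (a j powr (1 - r) * b j powr r)" if c: "c > 0" for j c
  proof -
    have "a j * (b j / a j) \<le> a j * ((1 - 1 / r) * c + 1 / r * (c powr (1 - r) * (b j / a j) powr r))"
      using a(1)[of j] b[of j] c r by (intro mult_left_mono tangent_powr) auto
    moreover have "a j * (b j / a j) powr r = a j powr (1 - r) * b j powr r"
      using a(1)[of j] b[of j] by (simp add: powr_divide powr_diff)
    moreover have "a j * ((1 - 1 / r) * c + 1 / r * (c powr (1 - r) * (b j / a j) powr r)) =
        (1 - 1 / r) * c * a j + 1 / r * c powr (1 - r) * (a j * (b j / a j) powr r)"
      by (simp add: algebra_simps)
    ultimately show ?thesis using a(1)[of j] by simp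
  qed
  have rhs: "summable (\<lambda>j. (1 - 1 / r) * c * a j + 1 / r * c powr (1 - r) * (a j powr (1 - r) * b j powr r))" for c
    using s sums_summable[OF a(2)] by (intro summable_add summable_mult)
  show sb: "summable b"
    by (rule summable_comparison_test'[OF rhs[of 1], of 0]) (use le[of 1] b in auto)
  show "(\<Sum>j. b j) powr r \<le> (\<Sum>j. a j powr (1 - r) * b j powr r)"
  proof (cases "(\<Sum>j. b j) = 0")
    case True
    then show ?thesis using suminf_nonneg[OF s] a(1) b by (simp add: less_imp_le)
  next
    case False
    \<comment> \<open>The tangent is taken at the weighted mean of the values
      \<open>b j / a j\<close>, which is the sum of \<open>b\<close>.\<close>
    define c where "c = (\<Sum>j. b j)"
    have c: "c > 0" using False suminf_nonneg[OF sb b] by (simp add: c_def)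
    have "c \<le> (\<Sum>j. (1 - 1 / r) * c * a j + 1 / r * c powr (1 - r) * (a j powr (1 - r) * b j powr r))"
      unfolding c_def by (rule suminf_le[OF _ sb rhs]) (use le c in \<open>auto simp: c_def\<close>)
    also have "\<dots> = (1 - 1 / r) * c * 1 + 1 / r * c powr (1 - r) * (\<Sum>j. a j powr (1 - r) * b j powr r)"
      by (rule sums_unique[symmetric], intro sums_add sums_mult a(2) summable_sums s)
    finally have "c / r \<le> 1 / r * c powr (1 - r) * (\<Sum>j. a j powr (1 - r) * b j powr r)"
      by (simp add: algebra_simps)
    then have "c \<le> c powr (1 - r) * (\<Sum>j. a j powr (1 - r) * b j powr r)"
      using r by (simp add: field_simps)
    then have "c powr (r - 1) * c \<le> c powr (r - 1) * (c powr (1 - r) * (\<Sum>j. a j powr (1 - r) * b j powr r))"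
      by (intro mult_left_mono) auto
    moreover have "c powr (r - 1) * c = c powr r" using c by (simp add: powr_diff)
    moreover have "c powr (r - 1) * c powr (1 - r) = 1" using c by (simp flip: powr_add)
    ultimately show ?thesis by (simp add: c_def[symmetric] mult.assoc[symmetric])
  qed
qed

section \<open>Geometrically decreasing series in \<open>L^p\<close>\<close>

lemma series_integrable:
  fixes f :: "nat \<Rightarrow> 'a \<Rightarrow> real"
  assumes f: "\<And>i. integrable M (f i)" and s: "summable (\<lambda>i. \<integral>x. \<bar>f i x\<bar> \<partial>M)"
  shows "AE x in M. summable (\<lambda>i. \<bar>f i x\<bar>)"
    and "integrable M (\<lambda>x. \<Sum>i. f i x)" "(\<integral>x. (\<Sum>i. f i x) \<partial>M) = (\<Sum>i. \<integral>x. f i x \<partial>M)"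
    and "summable (\<lambda>i. \<integral>x. f i x \<partial>M)"
proof -
  have [measurable]: "\<And>i. f i \<in> borel_measurable M" using f by simp
  have "(\<integral>\<^sup>+x. (\<Sum>i. ennreal \<bar>f i x\<bar>) \<partial>M) = (\<Sum>i. \<integral>\<^sup>+x. ennreal \<bar>f i x\<bar> \<partial>M)"
    by (rule nn_integral_suminf) simp
  also have "\<dots> = (\<Sum>i. ennreal (\<integral>x. \<bar>f i x\<bar> \<partial>M))"
    by (intro arg_cong[where f = suminf] ext nn_integral_eq_integral) (use f in auto)
  also have "\<dots> \<noteq> \<infinity>"
    using s by (simp add: ennreal_suminf_neq_top)
  finally have "AE x in M. (\<Sum>i. ennreal \<bar>f i x\<bar>) \<noteq> \<infinity>"
    by (intro nn_integral_PInf_AE) auto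
  then show ae: "AE x in M. summable (\<lambda>i. \<bar>f i x\<bar>)"
    by eventually_elim (auto intro!: summable_suminf_not_top)
  show "integrable M (\<lambda>x. \<Sum>i. f i x)" "(\<integral>x. (\<Sum>i. f i x) \<partial>M) = (\<Sum>i. \<integral>x. f i x \<partial>M)"
    "summable (\<lambda>i. \<integral>x. f i x \<partial>M)"
    by (rule integrable_suminf integral_suminf summable_integral; use f ae s in simp)+
qed

lemma Lp_bound_dominated_AE:
  assumes g: "Lp_bound p A g" and "0 \<le> p" and le: "AE z in lborel. \<bar>f z\<bar> \<le> \<bar>g z\<bar>"
    and [measurable]: "f \<in> borel_measurable borel"
  shows "Lp_bound p A f"
proof -
  have gi: "integrable lborel (\<lambda>z. \<bar>g z\<bar> powr p)" using g by (simp add: Lp_bound_def)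
  have le': "AE z in lborel. \<bar>f z\<bar> powr p \<le> \<bar>g z\<bar> powr p"
    using le by eventually_elim (use assms(2) in \<open>auto intro!: powr_mono2\<close>)
  have fi: "integrable lborel (\<lambda>z. \<bar>f z\<bar> powr p)"
    by (rule Bochner_Integration.integrable_bound[OF gi]) (use le' in auto)
  have "(\<integral>z. \<bar>f z\<bar> powr p \<partial>lborel) \<le> (\<integral>z. \<bar>g z\<bar> powr p \<partial>lborel)"
    by (rule integral_mono_AE[OF fi gi le'])
  with g fi show ?thesis by (simp add: Lp_bound_def)
qed

lemma geometric_weights:
  assumes "0 < \<tau>" "\<tau> < (1::real)"
  shows "(\<lambda>j. (1 - \<tau>) * \<tau> ^ j) sums 1" "\<And>j. 0 < (1 - \<tau>) * \<tau> ^ j"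
  using sums_mult[OF geometric_sums[of \<tau>], of "1 - \<tau>"] assms by auto

lemma Lp_bound_series:
  fixes p \<theta> :: real
  assumes p: "1 \<le> p" and \<theta>: "0 < \<theta>" "\<theta> < 1"
  shows "\<exists>C>0. \<forall>A (b :: nat \<Rightarrow> 'a::euclidean_space \<Rightarrow> real). 0 \<le> A \<longrightarrow> (\<forall>j. Lp_bound p (A * \<theta> ^ j) (b j)) \<longrightarrow>
    (AE z in lborel. summable (\<lambda>j. \<bar>b j z\<bar>)) \<and> Lp_bound p (C * A) (\<lambda>z. \<Sum>j. \<bar>b j z\<bar>)"
proof -
  \<comment> \<open>The square root shares out the geometric decay: one part pays for the negative
    powers of the Jensen weights \<open>a j\<close>, and what is left makes the series of integrals
    converge.\<close>
  define \<tau> where "\<tau> = sqrt \<theta>"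
  have \<tau>: "0 < \<tau>" "\<tau> < 1" "\<tau> * \<tau> = \<theta>" using \<theta> by (auto simp: \<tau>_def real_sqrt_lt_1_iff)
  define a where "a j = (1 - \<tau>) * \<tau> ^ j" for j
  have a: "a sums 1" "\<And>j. 0 < a j" unfolding a_def using geometric_weights[OF \<tau>(1,2)] by auto
  define D where "D = (1 - \<tau>) powr (1 - p) * (1 / (1 - \<tau>))"
  have D: "D > 0" using \<tau> by (simp add: D_def)
  define C where "C = D powr (1 / p)"
  have C: "C > 0" using D by (simp add: C_def)
  show ?thesis
  proof (intro exI[of _ C] conjI C allI impI)
    fix A :: real and b :: "nat \<Rightarrow> 'a \<Rightarrow> real"
    assume A: "0 \<le> A" and b: "\<forall>j. Lp_bound p (A * \<theta> ^ j) (b j)"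
    have [measurable]: "\<And>j. b j \<in> borel_measurable borel" using b Lp_bound_measurable by blast
    define f where "f j z = a j powr (1 - p) * \<bar>b j z\<bar> powr p" for j z
    have fi: "integrable lborel (f j)" for j
      unfolding f_def using b by (simp add: Lp_bound_def)
    have f0: "0 \<le> f j z" for j z by (simp add: f_def)
    have wt: "a j powr (1 - p) * (A * \<theta> ^ j) powr p \<le> A powr p * (1 - \<tau>) powr (1 - p) * \<tau> ^ j" for j
    proof -
      have tj: "\<theta> ^ j = \<tau> ^ j * \<tau> ^ j" by (simp add: \<tau>(3)[symmetric] power_mult_distrib)
      have "a j powr (1 - p) * (A * \<theta> ^ j) powr p = A powr p * (1 - \<tau>) powr (1 - p) * ((\<tau> ^ j) powr (1 - p) * (\<theta> ^ j) powr p)"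
        using \<tau> A \<theta> by (simp add: a_def powr_mult)
      also have "(\<tau> ^ j) powr (1 - p) * (\<theta> ^ j) powr p = (\<tau> ^ j) powr (1 + p)"
        unfolding tj using \<tau> by (simp add: powr_mult add.commute flip: powr_add)
      also have "\<dots> \<le> (\<tau> ^ j) powr 1"
        using \<tau> p by (intro powr_mono') (auto intro: power_le_one)
      finally show ?thesis using \<tau> by (simp add: mult_left_mono)
    qed
    have If: "(\<integral>z. f j z \<partial>lborel) \<le> A powr p * (1 - \<tau>) powr (1 - p) * \<tau> ^ j" for j
    proof -
      have "(\<integral>z. f j z \<partial>lborel) = a j powr (1 - p) * (\<integral>z. \<bar>b j z\<bar> powr p \<partial>lborel)" by (simp add: f_def)
      also have "\<dots> \<le> a j powr (1 - p) * (A * \<theta> ^ j) powr p"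
        using b by (intro mult_left_mono) (auto simp: Lp_bound_def)
      finally show ?thesis using wt[of j] by linarith
    qed
    have gs: "(\<lambda>j. A powr p * (1 - \<tau>) powr (1 - p) * \<tau> ^ j) sums (A powr p * D)"
      unfolding D_def mult.assoc[symmetric] using \<tau> by (intro sums_mult geometric_sums) auto
    have sf: "summable (\<lambda>j. \<integral>z. \<bar>f j z\<bar> \<partial>lborel)"
      by (rule summable_comparison_test'[OF sums_summable[OF gs], of 0])
        (use If f0 in \<open>auto intro!: integral_nonneg\<close>)
    note ser = series_integrable[of lborel f, OF fi sf]
    have pt: "AE z in lborel. summable (\<lambda>j. \<bar>b j z\<bar>) \<and> (\<Sum>j. \<bar>b j z\<bar>) powr p \<le> (\<Sum>j. f j z)"
      using ser(1)
    proof eventually_elim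
      case (elim z)
      have "summable (\<lambda>j. a j powr (1 - p) * \<bar>b j z\<bar> powr p)" using elim f0 by (simp add: f_def)
      from powr_suminf_le[OF p a(2) a(1) _ this] show ?case by (simp add: f_def)
    qed
    show "AE z in lborel. summable (\<lambda>j. \<bar>b j z\<bar>)" using pt by eventually_elim auto
    have le: "AE z in lborel. norm (\<bar>\<Sum>j. \<bar>b j z\<bar>\<bar> powr p) \<le> norm (\<Sum>j. f j z)"
      using pt
    proof eventually_elim
      case (elim z)
      have "0 \<le> (\<Sum>j. \<bar>b j z\<bar>)" using elim by (intro suminf_nonneg) auto
      with elim show ?case by (simp add: order_trans[OF _ abs_ge_self])
    qed
    have bi: "integrable lborel (\<lambda>z. \<bar>\<Sum>j. \<bar>b j z\<bar>\<bar> powr p)"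
      by (rule Bochner_Integration.integrable_bound[OF ser(2) _ le]) simp
    have "(\<integral>z. \<bar>\<Sum>j. \<bar>b j z\<bar>\<bar> powr p \<partial>lborel) \<le> (\<integral>z. (\<Sum>j. f j z) \<partial>lborel)"
    proof (rule integral_mono_AE[OF bi ser(2)])
      show "AE z in lborel. \<bar>\<Sum>j. \<bar>b j z\<bar>\<bar> powr p \<le> (\<Sum>j. f j z)"
        using pt
      proof eventually_elim
        case (elim z)
        have "0 \<le> (\<Sum>j. \<bar>b j z\<bar>)" using elim by (intro suminf_nonneg) auto
        with elim show ?case by simp
      qed
    qed
    also have "\<dots> = (\<Sum>j. \<integral>z. f j z \<partial>lborel)" by (rule ser(3))
    also have "\<dots> \<le> (\<Sum>j. A powr p * (1 - \<tau>) powr (1 - p) * \<tau> ^ j)"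
      by (rule suminf_le[OF If ser(4) sums_summable[OF gs]])
    also have "\<dots> = A powr p * D" using gs by (simp add: sums_iff)
    also have "\<dots> = (C * A) powr p"
      using A D p by (simp add: C_def powr_mult powr_powr)
    finally show "Lp_bound p (C * A) (\<lambda>z. \<Sum>j. \<bar>b j z\<bar>)"
      using bi by (simp add: Lp_bound_def)
  qed
qed

lemma back_box_indicator:
  "indicat_real (back_box \<rho> z) y = (\<Prod>b\<in>Basis. indicat_real {0..\<rho> b} ((z - y) \<bullet> b))"
  by (auto simp: back_box_def indicator_def)

lemma back_box_flip: "{z. y \<in> back_box \<rho> z} = cbox y (y + (\<Sum>b\<in>Basis. \<rho> b *\<^sub>R b))"
  by (auto simp: back_box_def mem_box inner_diff_left inner_add_left algebra_simps)

lemma measure_back_box: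
  fixes z :: "'a::euclidean_space"
  assumes "\<And>b. b \<in> Basis \<Longrightarrow> 0 \<le> \<rho> b"
  shows "emeasure lborel (back_box \<rho> z) = ennreal (\<Prod>b\<in>Basis. \<rho> b)"
    and "emeasure lborel {z. y \<in> back_box \<rho> z} = ennreal (\<Prod>b\<in>Basis. \<rho> b)"
proof -
  let ?r = "\<Sum>b\<in>Basis. \<rho> b *\<^sub>R b"
  have r: "?r \<bullet> b = \<rho> b" if "b \<in> Basis" for b using that by simp
  show "emeasure lborel (back_box \<rho> z) = ennreal (\<Prod>b\<in>Basis. \<rho> b)"
    unfolding back_box_cbox using assms
    by (subst emeasure_lborel_cbox) (auto simp: inner_diff_left r intro!: arg_cong[where f = ennreal] prod.cong)
  show "emeasure lborel {z. y \<in> back_box \<rho> z} = ennreal (\<Prod>b\<in>Basis. \<rho> b)"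
    unfolding back_box_flip using assms by (subst emeasure_lborel_cbox)
      (auto simp: inner_diff_left inner_add_left r intro!: arg_cong[where f = ennreal] prod.cong)
qed

text \<open>By Jensen's inequality the power \<open>p\<close> of the average is at most the average
  of the power. Integration over \<open>z\<close> gives back the norm, since the points whose box
  contains a given \<open>y\<close> fill a box of the same volume. Estimating by the integral over
  the whole space gives the supremum bound, at the price of the reciprocal volume to the power
  \<open>1 / p\<close>.\<close>

lemma box_avg_bounds:
  fixes h :: "'n::finite spacetime \<Rightarrow> real"
  assumes h: "Lp_bound p N h" "integrable lborel h" "\<And>z. 0 \<le> h z" and p: "1 \<le> p" and s: "0 < s" and N: "0 \<le> N"
  shows "Lp_bound p N (box_avg h s)" "0 \<le> box_avg h s z"
    "box_avg h s z \<le> N * s powr (- (real CARD('n) + 2) / p)"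
proof -
  note [measurable] = Lp_bound_measurable[OF h(1)]
  let ?I = "\<lambda>z. indicat_real (back_box (pscale s) z)"
  define v where "v = s ^ (CARD('n) + 2)"
  have v: "v > 0" using s by (simp add: v_def)
  have vol: "emeasure lborel (back_box (pscale s) z) = ennreal v" "emeasure lborel {z. y \<in> back_box (pscale s) z} = ennreal v"
    for z y :: "'n spacetime"
    unfolding v_def prod_pscale[symmetric] by (rule measure_back_box; rule less_imp_le[OF pscale_pos[OF s]])+
  have bb[measurable]: "back_box (pscale s) z \<in> sets borel" for z :: "'n spacetime"
    by (rule borel_compact[OF compact_back_box])
  have hp: "integrable lborel (\<lambda>y. \<bar>h y\<bar> powr p)" using h by (simp add: Lp_bound_def)
  have Ii: "integrable lborel (?I z)" for z :: "'n spacetime"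
    using vol(1)[of z] by (simp add: integrable_indicator_iff)
  have ivol: "(\<integral>y. ?I z y \<partial>lborel) = v" for z :: "'n spacetime"
    using vol(1)[of z] v by (simp add: measure_def)
  have Ih: "integrable lborel (\<lambda>y. ?I z y * h y)" for z
    by (rule Bochner_Integration.integrable_bound[OF h(2)]) (auto simp: indicator_def)
  have Ihp: "integrable lborel (\<lambda>y. ?I z y * \<bar>h y\<bar> powr p)" for z
    by (rule Bochner_Integration.integrable_bound[OF hp]) (auto simp: indicator_def)
  have c0: "0 \<le> box_avg h s z" for z
    unfolding box_avg_def by (intro divide_nonneg_nonneg Bochner_Integration.integral_nonneg mult_nonneg_nonneg h(3)) (use s in auto)
  have jensen: "box_avg h s z powr p \<le> (\<integral>y. ?I z y * \<bar>h y\<bar> powr p \<partial>lborel) / v" for z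
  proof (cases "box_avg h s z = 0")
    case True
    have "0 \<le> (\<integral>y. ?I z y * \<bar>h y\<bar> powr p \<partial>lborel)"
      by (intro Bochner_Integration.integral_nonneg mult_nonneg_nonneg) auto
    with True v show ?thesis by simp
  next
    case False
    define c where "c = box_avg h s z"
    have c: "c > 0" using False c0[of z] by (simp add: c_def)
    have "c * v = (\<integral>y. ?I z y * h y \<partial>lborel)" using v s by (simp add: c_def box_avg_def v_def)
    also have "\<dots> \<le> (\<integral>y. ((1 - 1 / p) * c) * ?I z y + (1 / p * c powr (1 - p)) * (?I z y * \<bar>h y\<bar> powr p) \<partial>lborel)"
    proof (rule integral_mono[OF Ih])
      show "integrable lborel (\<lambda>y. ((1 - 1 / p) * c) * ?I z y + (1 / p * c powr (1 - p)) * (?I z y * \<bar>h y\<bar> powr p))"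
        using Ii Ihp by simp
      fix y
      have "h y \<le> (1 - 1 / p) * c + 1 / p * (c powr (1 - p) * h y powr p)"
        by (rule tangent_powr) (use h(3) c p in auto)
      then show "?I z y * h y \<le> ((1 - 1 / p) * c) * ?I z y + (1 / p * c powr (1 - p)) * (?I z y * \<bar>h y\<bar> powr p)"
        using h(3)[of y] by (simp add: indicator_def)
    qed
    also have "\<dots> = (1 - 1 / p) * c * v + 1 / p * c powr (1 - p) * (\<integral>y. ?I z y * \<bar>h y\<bar> powr p \<partial>lborel)"
      using Ii Ihp ivol by simp
    finally have "c * v / p \<le> 1 / p * c powr (1 - p) * (\<integral>y. ?I z y * \<bar>h y\<bar> powr p \<partial>lborel)"
      by (simp add: algebra_simps)
    then have "c * v \<le> c powr (1 - p) * (\<integral>y. ?I z y * \<bar>h y\<bar> powr p \<partial>lborel)"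
      using p by (simp add: field_simps)
    then have "c powr (p - 1) * (c * v) \<le> c powr (p - 1) * (c powr (1 - p) * (\<integral>y. ?I z y * \<bar>h y\<bar> powr p \<partial>lborel))"
      by (intro mult_left_mono) auto
    moreover have "c powr (p - 1) * c = c powr p" using c by (simp add: powr_diff)
    moreover have "c powr (p - 1) * c powr (1 - p) = 1" using c by (simp flip: powr_add)
    ultimately have "c powr p * v \<le> (\<integral>y. ?I z y * \<bar>h y\<bar> powr p \<partial>lborel)"
      by (simp add: mult.assoc[symmetric])
    then show ?thesis using v by (simp add: c_def field_simps)
  qed
  show "0 \<le> box_avg h s z" by (rule c0)
  have am[measurable]: "box_avg h s \<in> borel_measurable borel"
    unfolding box_avg_def[abs_def] back_box_indicator by measurable
  have "(\<integral>\<^sup>+z. ennreal (\<bar>box_avg h s z\<bar> powr p) \<partial>lborel) \<le> (\<integral>\<^sup>+z. (\<integral>\<^sup>+y. ennreal (?I z y * \<bar>h y\<bar> powr p / v) \<partial>lborel) \<partial>lborel)"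
  proof (rule nn_integral_mono)
    fix z :: "'n spacetime"
    have "ennreal (\<bar>box_avg h s z\<bar> powr p) \<le> ennreal ((\<integral>y. ?I z y * \<bar>h y\<bar> powr p / v \<partial>lborel))"
      using jensen[of z] c0[of z] by (intro ennreal_leI) simp
    also have "\<dots> = (\<integral>\<^sup>+y. ennreal (?I z y * \<bar>h y\<bar> powr p / v) \<partial>lborel)"
      using Ihp[of z] v by (subst nn_integral_eq_integral) auto
    finally show "ennreal (\<bar>box_avg h s z\<bar> powr p) \<le> (\<integral>\<^sup>+y. ennreal (?I z y * \<bar>h y\<bar> powr p / v) \<partial>lborel)" .
  qed
  also have "\<dots> = (\<integral>\<^sup>+y. (\<integral>\<^sup>+z. ennreal (?I z y * \<bar>h y\<bar> powr p / v) \<partial>lborel) \<partial>lborel)"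
    unfolding back_box_indicator by (rule lborel_pair.Fubini') measurable
  also have "\<dots> = (\<integral>\<^sup>+y. ennreal (\<bar>h y\<bar> powr p) \<partial>lborel)"
  proof (rule nn_integral_cong)
    fix y :: "'n spacetime"
    have [measurable]: "{z. y \<in> back_box (pscale s) z} \<in> sets borel"
      unfolding back_box_flip by simp
    have "ennreal (?I z y * \<bar>h y\<bar> powr p / v) = ennreal (\<bar>h y\<bar> powr p / v) * indicator {z. y \<in> back_box (pscale s) z} z" for z
      by (simp add: indicator_def)
    then have "(\<integral>\<^sup>+z. ennreal (?I z y * \<bar>h y\<bar> powr p / v) \<partial>lborel) = ennreal (\<bar>h y\<bar> powr p / v) * ennreal v"
      by (simp add: nn_integral_cmult_indicator vol)
    also have "\<dots> = ennreal (\<bar>h y\<bar> powr p)" using v by (simp add: ennreal_mult'[symmetric])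
    finally show "(\<integral>\<^sup>+z. ennreal (?I z y * \<bar>h y\<bar> powr p / v) \<partial>lborel) = ennreal (\<bar>h y\<bar> powr p)" .
  qed
  also have "\<dots> = ennreal (\<integral>y. \<bar>h y\<bar> powr p \<partial>lborel)"
    by (rule nn_integral_eq_integral[OF hp]) simp
  also have "\<dots> \<le> ennreal (N powr p)" using h(1) by (intro ennreal_leI) (simp add: Lp_bound_def)
  finally have nn: "(\<integral>\<^sup>+z. ennreal (\<bar>box_avg h s z\<bar> powr p) \<partial>lborel) \<le> ennreal (N powr p)" .
  have ai: "integrable lborel (\<lambda>z. \<bar>box_avg h s z\<bar> powr p)"
    by (rule integrableI_bounded) (use le_less_trans[OF nn] in auto)
  then have "ennreal (\<integral>z. \<bar>box_avg h s z\<bar> powr p \<partial>lborel) \<le> ennreal (N powr p)"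
    using nn by (subst (asm) nn_integral_eq_integral) auto
  then have "(\<integral>z. \<bar>box_avg h s z\<bar> powr p \<partial>lborel) \<le> N powr p" by (simp add: ennreal_le_iff)
  with ai show "Lp_bound p N (box_avg h s)" by (simp add: Lp_bound_def)
  have "box_avg h s z powr p \<le> (\<integral>y. ?I z y * \<bar>h y\<bar> powr p \<partial>lborel) / v" by (rule jensen)
  also have "\<dots> \<le> (\<integral>y. \<bar>h y\<bar> powr p \<partial>lborel) / v"
    using v by (intro divide_right_mono integral_mono[OF Ihp hp]) (auto simp: indicator_def)
  also have "\<dots> \<le> N powr p / v" using h(1) v by (intro divide_right_mono) (auto simp: Lp_bound_def)
  finally have "(box_avg h s z powr p) powr (1 / p) \<le> (N powr p / v) powr (1 / p)"
    using p by (intro powr_mono2) auto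
  moreover have "(box_avg h s z powr p) powr (1 / p) = box_avg h s z" using c0[of z] p by (simp add: powr_powr)
  moreover have "(N powr p / v) powr (1 / p) = N * s powr (- (real CARD('n) + 2) / p)"
  proof -
    have "v = s powr (real CARD('n) + 2)" by (simp only: v_def powr_realpow[OF s, symmetric] of_nat_add of_nat_numeral)
    then have "v powr (1 / p) = s powr ((real CARD('n) + 2) / p)" by (simp add: powr_powr)
    then have "(N powr p / v) powr (1 / p) = N / s powr ((real CARD('n) + 2) / p)"
      using N p v s by (simp add: powr_divide powr_powr)
    also have "\<dots> = N * s powr (- ((real CARD('n) + 2) / p))" by (simp only: powr_minus divide_inverse)
    finally show ?thesis by (simp only: minus_divide_left)
  qed
  ultimately show "box_avg h s z \<le> N * s powr (- (real CARD('n) + 2) / p)" by simp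
qed

text \<open>Since 1/p = 1/q + \<delta>/p with \<delta> = 1 - p/q, the power \<delta> of
  \<open>f\<close> pairs with \<open>\<mu>\<close> in Hoelder's inequality, and the remaining power
  m - \<delta> goes to the supremum. Hoelder's inequality appears as Young's inequality for the
  normalized functions.\<close>

lemma weighted_power_bound:
  fixes \<mu> f :: "'a::euclidean_space \<Rightarrow> real"
  assumes \<mu>: "Lp_bound q U \<mu>" "\<And>z. 0 \<le> \<mu> z" "0 < U" and f: "Lp_bound p N f" "0 < N"
    and fS: "\<And>z. 0 \<le> f z" "\<And>z. f z \<le> S" "0 < S" and p: "1 \<le> p" "p \<le> q" and m: "1 \<le> m"
  shows "Lp_bound p (U * N powr (1 - p / q) * S powr (m - (1 - p / q))) (\<lambda>z. \<mu> z * f z powr m)"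
proof -
  note [measurable] = Lp_bound_measurable[OF \<mu>(1)] Lp_bound_measurable[OF f(1)]
  define \<delta> where "\<delta> = 1 - p / q"
  have \<delta>: "0 \<le> \<delta>" "\<delta> < 1" using p by (auto simp: \<delta>_def)
  have q: "q > 0" using p by simp
  let ?K = "(U * N powr \<delta> * S powr (m - \<delta>)) powr p"
  let ?g = "\<lambda>z. ?K * (p / q * (\<bar>\<mu> z\<bar> powr q / U powr q) + \<delta> * (\<bar>f z\<bar> powr p / N powr p))"
  have gi: "integrable lborel ?g" using \<mu>(1) f(1) by (simp add: Lp_bound_def)
  have pt: "\<bar>\<mu> z * f z powr m\<bar> powr p \<le> ?g z" for z
  proof (cases "\<mu> z = 0 \<or> f z = 0")
    case True
    then have "\<bar>\<mu> z * f z powr m\<bar> powr p = 0" by auto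
    moreover have "0 \<le> ?g z" using \<delta> p q by (intro mult_nonneg_nonneg add_nonneg_nonneg) auto
    ultimately show ?thesis by (simp only:)
  next
    case False
    then have pos: "\<mu> z > 0" "f z > 0" using \<mu>(2)[of z] fS(1)[of z] by auto
    have "\<bar>\<mu> z * f z powr m\<bar> powr p = \<mu> z powr p * (f z powr \<delta> * f z powr (m - \<delta>)) powr p"
      using pos by (simp add: abs_mult powr_mult flip: powr_add)
    also have "\<dots> \<le> \<mu> z powr p * (f z powr \<delta> * S powr (m - \<delta>)) powr p"
      using pos fS(2)[of z] m \<delta> p by (intro mult_left_mono powr_mono2 mult_nonneg_nonneg) auto
    also have "\<dots> = ?K * (((\<mu> z / U) powr p) * ((f z / N) powr (p * \<delta>)))"
      using pos \<mu>(3) f(2) fS(3) by (simp add: powr_mult powr_divide powr_powr mult.commute)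
    also have "(\<mu> z / U) powr p = ((\<mu> z / U) powr q) powr (p / q)" using q by (simp add: powr_powr)
    also have "(f z / N) powr (p * \<delta>) = ((f z / N) powr p) powr \<delta>" by (simp add: powr_powr)
    also have "?K * (((\<mu> z / U) powr q) powr (p / q) * ((f z / N) powr p) powr \<delta>) \<le>
        ?K * (p / q * (\<mu> z / U) powr q + \<delta> * (f z / N) powr p)"
      using pos \<mu>(3) f(2) p q \<delta> by (intro mult_left_mono Youngs_inequality_0) (auto simp: \<delta>_def)
    also have "\<dots> = ?g z" using pos \<mu>(3) f(2) by (simp add: powr_divide)
    finally show ?thesis .
  qed
  have i: "integrable lborel (\<lambda>z. \<bar>\<mu> z * f z powr m\<bar> powr p)"
    by (rule Bochner_Integration.integrable_bound[OF gi]) (use pt in \<open>auto intro: order_trans[OF _ abs_ge_self]\<close>)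
  have "(\<integral>z. \<bar>\<mu> z * f z powr m\<bar> powr p \<partial>lborel) \<le> (\<integral>z. ?g z \<partial>lborel)" by (rule integral_mono[OF i gi pt])
  also have "\<dots> = ?K * (p / q * ((\<integral>z. \<bar>\<mu> z\<bar> powr q \<partial>lborel) / U powr q) + \<delta> * ((\<integral>z. \<bar>f z\<bar> powr p \<partial>lborel) / N powr p))"
    using \<mu>(1) f(1) by (simp add: Lp_bound_def)
  also have "\<dots> \<le> ?K * (p / q * 1 + \<delta> * 1)"
    using \<mu>(1,3) f \<delta> p q
    by (intro mult_left_mono add_mono) (auto simp: Lp_bound_def)
  also have "\<dots> = ?K" by (simp add: \<delta>_def)
  finally show ?thesis using i unfolding Lp_bound_def \<delta>_def[symmetric] by simp
qed

text \<open>The prefactor makes \<open>CARD('n) + 1\<close> times the largest scale equal to 1/2. A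
  box of such a scale stays within distance 1/2 of its corner, which is the margin between
  \<open>inner_cyl\<close> and \<open>outer\<close>.\<close>

definition dyadic :: "'n::finite itself \<Rightarrow> nat \<Rightarrow> real" where
  "dyadic _ j = (1 / (2 * (real CARD('n) + 1))) * (1 / 2) ^ j"

lemma dyadic_pos: "0 < dyadic TYPE('n::finite) j" by (simp add: dyadic_def add_pos_pos)

lemma dyadic_Suc: "dyadic TYPE('n::finite) (Suc j) = dyadic TYPE('n) j / 2" by (simp add: dyadic_def)

lemma dyadic_le: "dyadic TYPE('n::finite) j \<le> (1 / 2) ^ j"
  unfolding dyadic_def by (rule mult_left_le_one_le) (auto simp: field_simps)

text \<open>The term of scale s has \<open>L^p\<close> norm at most s N and supremum at most N s^(1
  - (n+2)/p), so \<open>weighted_power_bound\<close> produces the power s^\<beta>, where \<beta> is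
  the quantity assumed to be positive. Jensen's inequality for the power \<open>m\<close> then
  assembles the terms.\<close>

lemma box_avg_series:
  fixes m p q :: real
  assumes p: "1 \<le> p" "p \<le> q" and m: "1 < m"
    and \<beta>: "0 < m - (real CARD('n::finite) + 2) / p * (m - (1 - p / q))"
  shows "\<exists>C>0. \<forall>(h :: 'n spacetime \<Rightarrow> real) N. 0 < N \<longrightarrow> Lp_bound p N h \<longrightarrow> integrable lborel h \<longrightarrow> (\<forall>z. 0 \<le> h z) \<longrightarrow>
    (let X = (\<lambda>z. \<Sum>j. dyadic TYPE('n) j * box_avg h (dyadic TYPE('n) j) z) in
     (AE z in lborel. summable (\<lambda>j. dyadic TYPE('n) j * box_avg h (dyadic TYPE('n) j) z)) \<and>
     Lp_bound p (C * N) X \<and>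
     (\<forall>\<mu> U. 0 < U \<longrightarrow> Lp_bound q U \<mu> \<longrightarrow> (\<forall>z. 0 \<le> \<mu> z) \<longrightarrow> Lp_bound p (C * (U * N powr m)) (\<lambda>z. \<mu> z * X z powr m)))"
proof -
  define \<beta> where "\<beta> = m - (real CARD('n) + 2) / p * (m - (1 - p / q))"
  define \<delta> where "\<delta> = 1 - p / q"
  \<comment> \<open>For this ratio the decay (1/2)^(j \<beta>) equals \<tau>^(j m). The Jensen
    weights use up \<tau>^(j (m - 1)), and a summable factor \<tau>^j remains.\<close>
  define \<tau> where "\<tau> = 2 powr (- \<beta> / m)"
  have \<beta>0: "\<beta> > 0" using assms(4) by (simp add: \<beta>_def)
  have \<tau>: "0 < \<tau>" "\<tau> < 1" using \<beta>0 m by (auto simp: \<tau>_def powr_less_one)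
  define a where "a j = (1 - \<tau>) * \<tau> ^ j" for j
  have a: "a sums 1" "\<And>j. 0 < a j" unfolding a_def using geometric_weights[OF \<tau>] by auto
  obtain C1 where C1: "C1 > 0" "\<And>A (b :: nat \<Rightarrow> 'n spacetime \<Rightarrow> real). 0 \<le> A \<Longrightarrow> (\<forall>j. Lp_bound p (A * (1 / 2) ^ j) (b j)) \<Longrightarrow>
    (AE z in lborel. summable (\<lambda>j. \<bar>b j z\<bar>)) \<and> Lp_bound p (C1 * A) (\<lambda>z. \<Sum>j. \<bar>b j z\<bar>)"
    using Lp_bound_series[of p "1 / 2"] p by auto
  obtain C2 where C2: "C2 > 0" "\<And>A (b :: nat \<Rightarrow> 'n spacetime \<Rightarrow> real). 0 \<le> A \<Longrightarrow> (\<forall>j. Lp_bound p (A * \<tau> ^ j) (b j)) \<Longrightarrow>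
    (AE z in lborel. summable (\<lambda>j. \<bar>b j z\<bar>)) \<and> Lp_bound p (C2 * A) (\<lambda>z. \<Sum>j. \<bar>b j z\<bar>)"
    using Lp_bound_series[of p \<tau>] p \<tau> by auto
  define D where "D = (1 - \<tau>) powr (1 - m)"
  have D: "D > 0" using \<tau> by (simp add: D_def)
  define C where "C = C1 + C2 * D"
  have C: "C > 0" "C1 \<le> C" "C2 * D \<le> C" using C1(1) C2(1) D by (auto simp: C_def add_pos_pos)
  show ?thesis
  proof (intro exI[of _ C] conjI C(1) allI impI)
    fix h :: "'n spacetime \<Rightarrow> real" and N :: real
    assume N: "0 < N" and h: "Lp_bound p N h" "integrable lborel h" "\<forall>z. 0 \<le> h z"
    let ?s = "dyadic TYPE('n)"
    define x where "x j z = ?s j * box_avg h (?s j) z" for j z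
    have avg: "Lp_bound p N (box_avg h (?s j))" "0 \<le> box_avg h (?s j) z"
       "box_avg h (?s j) z \<le> N * ?s j powr (- (real CARD('n) + 2) / p)" for j z
      by (rule box_avg_bounds[OF h(1,2)]; use h(3) p N dyadic_pos in \<open>auto intro: less_imp_le\<close>)+
    have x0: "0 \<le> x j z" for j z using avg(2) dyadic_pos[where 'n='n and j=j] by (simp add: x_def less_imp_le)
    have xL: "Lp_bound p (?s j * N) (x j)" for j
      using Lp_bound_cmult[OF avg(1)[of j], of "?s j"] N dyadic_pos[where 'n='n and j=j] by (simp add: x_def[abs_def])
    have xS: "x j z \<le> N * ?s j powr (1 - (real CARD('n) + 2) / p)" for j z
    proof -
      have "x j z \<le> ?s j * (N * ?s j powr (- (real CARD('n) + 2) / p))"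
        unfolding x_def using avg(3) dyadic_pos[where 'n='n and j=j] by (intro mult_left_mono) (auto intro: less_imp_le)
      also have "\<dots> = N * ?s j powr (1 + - (real CARD('n) + 2) / p)"
        using dyadic_pos[where 'n='n and j=j] by (simp add: powr_add)
      also have "1 + - (real CARD('n) + 2) / p = 1 - (real CARD('n) + 2) / p" by (simp only: minus_divide_left[symmetric] diff_conv_add_uminus)
      finally show ?thesis .
    qed
    have [measurable]: "x j \<in> borel_measurable borel" for j using Lp_bound_measurable[OF xL] .
    have "Lp_bound p (N * (1 / 2) ^ j) (x j)" for j
      by (rule Lp_bound_mono[OF xL]) (use N dyadic_pos[where 'n='n and j=j] dyadic_le[where 'n='n and j=j] p in \<open>auto simp: mult.commute intro: less_imp_le\<close>)
    then have X: "AE z in lborel. summable (\<lambda>j. \<bar>x j z\<bar>)" "Lp_bound p (C1 * N) (\<lambda>z. \<Sum>j. \<bar>x j z\<bar>)"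
      using C1(2)[of N x] N by auto
    have X': "AE z in lborel. summable (\<lambda>j. x j z)" "Lp_bound p (C1 * N) (\<lambda>z. \<Sum>j. x j z)"
      using X x0 by (auto simp: abs_of_nonneg)
    have "Lp_bound p (C * N) (\<lambda>z. \<Sum>j. x j z)"
      by (rule Lp_bound_mono[OF X'(2)]) (use C1(1) N C p in auto)
    moreover have "Lp_bound p (C * (U * N powr m)) (\<lambda>z. \<mu> z * (\<Sum>j. x j z) powr m)"
      if U: "0 < U" and \<mu>: "Lp_bound q U \<mu>" "\<forall>z. 0 \<le> \<mu> z" for \<mu> U
    proof -
      note [measurable] = Lp_bound_measurable[OF \<mu>(1)]
      define b where "b j z = a j powr (1 - m) * (\<mu> z * x j z powr m)" for j z
      have \<mu>0: "0 \<le> \<mu> z" for z using \<mu>(2) by blast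
      have b0: "0 \<le> b j z" for j z by (simp add: b_def \<mu>0)
      have bL: "Lp_bound p (D * (U * N powr m) * \<tau> ^ j) (b j)" for j
      proof -
        let ?S = "N * ?s j powr (1 - (real CARD('n) + 2) / p)"
        have sp: "0 < ?s j" by (rule dyadic_pos)
        have 1: "Lp_bound p (U * (?s j * N) powr (1 - p / q) * ?S powr (m - (1 - p / q))) (\<lambda>z. \<mu> z * x j z powr m)"
          by (rule weighted_power_bound[OF \<mu>(1) \<mu>0 U xL _ x0 xS]) (use N sp p m in auto)
        have eq: "U * (?s j * N) powr (1 - p / q) * ?S powr (m - (1 - p / q)) = U * N powr m * ?s j powr \<beta>"
        proof -
          have "U * (?s j * N) powr \<delta> * ?S powr (m - \<delta>) =
             U * (N powr \<delta> * N powr (m - \<delta>)) * (?s j powr \<delta> * ?s j powr ((1 - (real CARD('n) + 2) / p) * (m - \<delta>)))"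
            using N sp by (simp add: powr_mult powr_powr)
          also have "\<dots> = U * N powr m * ?s j powr (\<delta> + (1 - (real CARD('n) + 2) / p) * (m - \<delta>))"
            using N by (simp flip: powr_add)
          also have "\<delta> + (1 - (real CARD('n) + 2) / p) * (m - \<delta>) = \<beta>"
            by (simp add: \<beta>_def \<delta>_def left_diff_distrib)
          finally show ?thesis by (simp add: \<delta>_def)
        qed
        have "a j powr (1 - m) * ?s j powr \<beta> \<le> a j powr (1 - m) * ((1 / 2) ^ j) powr \<beta>"
          using sp dyadic_le[where 'n='n and j=j] \<beta>0 by (intro mult_left_mono powr_mono2) (auto intro: less_imp_le)
        also have "\<dots> = D * \<tau> ^ j"
        proof -
          have "((1 / 2 :: real) ^ j) powr \<beta> = (\<tau> ^ j) powr m"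
          proof -
            have "((1 / 2 :: real) ^ j) powr \<beta> = (2 powr (- real j)) powr \<beta>"
              by (simp add: powr_minus powr_realpow power_divide inverse_eq_divide)
            also have "\<dots> = (2 powr (- \<beta> / m * real j)) powr m" using m by (simp add: powr_powr mult.commute)
            also have "2 powr (- \<beta> / m * real j) = \<tau> ^ j" unfolding \<tau>_def by (subst powr_realpow[symmetric]) (simp_all add: powr_powr)
            finally show ?thesis .
          qed
          moreover have "a j powr (1 - m) = D * (\<tau> ^ j) powr (1 - m)"
            using \<tau> by (simp add: a_def D_def powr_mult)
          ultimately show ?thesis using \<tau> by (simp add: mult.assoc flip: powr_add)
        qed
        finally have le: "a j powr (1 - m) * ?s j powr \<beta> \<le> D * \<tau> ^ j" .
        have "Lp_bound p (a j powr (1 - m) * (U * N powr m * ?s j powr \<beta>)) (b j)"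
          using Lp_bound_cmult[OF 1[unfolded eq], of "a j powr (1 - m)"] U N by (simp add: b_def[abs_def])
        then show ?thesis
        proof (rule Lp_bound_mono)
          have "a j powr (1 - m) * (U * N powr m * ?s j powr \<beta>) = (U * N powr m) * (a j powr (1 - m) * ?s j powr \<beta>)" by simp
          also have "\<dots> \<le> (U * N powr m) * (D * \<tau> ^ j)" using U le by (intro mult_left_mono) auto
          finally show "a j powr (1 - m) * (U * N powr m * ?s j powr \<beta>) \<le> D * (U * N powr m) * \<tau> ^ j" by (simp add: mult_ac)
        qed (use U p in auto)
      qed
      have S: "AE z in lborel. summable (\<lambda>j. \<bar>b j z\<bar>)" "Lp_bound p (C2 * (D * (U * N powr m))) (\<lambda>z. \<Sum>j. \<bar>b j z\<bar>)"
        using C2(2)[of "D * (U * N powr m)" b] bL D U by auto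
      have "AE z in lborel. \<bar>\<mu> z * (\<Sum>j. x j z) powr m\<bar> \<le> \<bar>\<Sum>j. \<bar>b j z\<bar>\<bar>"
        using S(1)
      proof eventually_elim
        case (elim z)
        have sb: "summable (\<lambda>j. b j z)" using elim b0 by simp
        show ?case
        \<comment> \<open>The summability of \<open>b\<close> says something about the series of
          \<open>x\<close> only where \<open>\<mu>\<close> is positive; elsewhere the left side is
          0, whatever value a divergent sum is given.\<close>
        proof (cases "\<mu> z = 0")
          case False
          then have mz: "\<mu> z > 0" using \<mu>0[of z] by linarith
          have "summable (\<lambda>j. inverse (\<mu> z) * b j z)" using sb by (rule summable_mult)
          moreover have "inverse (\<mu> z) * b j z = a j powr (1 - m) * x j z powr m" for j
            using mz by (simp add: b_def)
          ultimately have sx: "summable (\<lambda>j. a j powr (1 - m) * x j z powr m)" by (simp only:)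
          have "(\<Sum>j. x j z) powr m \<le> (\<Sum>j. a j powr (1 - m) * x j z powr m)"
            by (rule powr_suminf_le(2)[OF _ a(2,1) x0 sx]) (use m in simp)
          then have "\<mu> z * (\<Sum>j. x j z) powr m \<le> \<mu> z * (\<Sum>j. a j powr (1 - m) * x j z powr m)"
            using mz by (intro mult_left_mono) auto
          also have "\<dots> = (\<Sum>j. b j z)"
            unfolding suminf_mult[OF sx, symmetric] by (simp add: b_def mult_ac)
          finally have "\<bar>\<mu> z * (\<Sum>j. x j z) powr m\<bar> \<le> (\<Sum>j. b j z)" using mz by (simp add: abs_mult)
          also have "\<dots> \<le> \<bar>\<Sum>j. \<bar>b j z\<bar>\<bar>" using b0 by (simp add: abs_of_nonneg)
          finally show ?thesis .
        qed simp
      qed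
      then have "Lp_bound p (C2 * (D * (U * N powr m))) (\<lambda>z. \<mu> z * (\<Sum>j. x j z) powr m)"
        by (rule Lp_bound_dominated_AE[OF S(2), rotated]) (use p in auto)
      then show ?thesis
        by (rule Lp_bound_mono) (use C2(1) D U C(3) p mult_right_mono[OF C(3), of "U * N powr m"] in \<open>auto simp: mult.assoc\<close>)
    qed
    ultimately show "let X = (\<lambda>z. \<Sum>j. ?s j * box_avg h (?s j) z) in
     (AE z in lborel. summable (\<lambda>j. ?s j * box_avg h (?s j) z)) \<and>
     Lp_bound p (C * N) X \<and>
     (\<forall>\<mu> U. 0 < U \<longrightarrow> Lp_bound q U \<mu> \<longrightarrow> (\<forall>z. 0 \<le> \<mu> z) \<longrightarrow> Lp_bound p (C * (U * N powr m)) (\<lambda>z. \<mu> z * X z powr m))"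
      using X'(1) unfolding Let_def x_def by blast
  qed
qed

section \<open>The gradient of a local solution\<close>

lemma integrable_abs_le:
  fixes f g :: "'a \<Rightarrow> real"
  assumes "integrable M g" "f \<in> borel_measurable M" "\<And>z. \<bar>f z\<bar> \<le> g z"
  shows "integrable M f"
proof (rule Bochner_Integration.integrable_bound[OF assms(1,2)], rule AE_I2)
  fix z show "norm (f z) \<le> norm (g z)" using order_trans[OF assms(3) abs_ge_self] by simp
qed

lemma integral_lborel_prod:
  fixes f :: "'a::euclidean_space \<Rightarrow> real \<Rightarrow> real"
  assumes f: "\<And>b. b \<in> Basis \<Longrightarrow> integrable lborel (f b)"
  shows "(\<integral>z. (\<Prod>b\<in>Basis. f b (z \<bullet> b)) \<partial>lborel) = (\<Prod>b\<in>Basis. \<integral>x. f b x \<partial>lborel)"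
proof -
  interpret product_sigma_finite "\<lambda>_::'a. lborel :: real measure" ..
  have [measurable]: "f b \<in> borel_measurable borel" if "b \<in> Basis" for b using f[OF that] by simp
  have m: "(\<lambda>g. \<Sum>b\<in>Basis. g b *\<^sub>R b) \<in> (\<Pi>\<^sub>M b\<in>(Basis :: 'a set). (lborel :: real measure)) \<rightarrow>\<^sub>M borel"
    by measurable
  have "(\<integral>z. (\<Prod>b\<in>Basis. f b (z \<bullet> b)) \<partial>lborel) =
      (\<integral>z. (\<Prod>b\<in>Basis. f b (z \<bullet> b)) \<partial>distr (\<Pi>\<^sub>M b\<in>(Basis :: 'a set). lborel) borel (\<lambda>g. \<Sum>b\<in>Basis. g b *\<^sub>R b))"
    by (simp only: lborel_eq[symmetric])
  also have "\<dots> = (\<integral>g. (\<Prod>b\<in>Basis. f b ((\<Sum>b\<in>Basis. g b *\<^sub>R b) \<bullet> b)) \<partial>(\<Pi>\<^sub>M b\<in>(Basis :: 'a set). lborel))"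
    by (rule integral_distr[OF m]) measurable
  also have "\<dots> = (\<integral>g. (\<Prod>b\<in>Basis. f b (g b)) \<partial>(\<Pi>\<^sub>M b\<in>(Basis :: 'a set). lborel))"
    by (intro Bochner_Integration.integral_cong refl prod.cong) simp
  also have "\<dots> = (\<Prod>b\<in>Basis. \<integral>x. f b x \<partial>lborel)"
    by (rule product_integral_prod) (use f in auto)
  finally show ?thesis .
qed

context step_profile
begin

lemma integral_profile:
  assumes s: "s > 0"
  shows "integrable lborel (\<lambda>x. e ((x - c) / s) / s)" "(\<integral>x. e ((x - c) / s) / s \<partial>lborel) = 1"
proof -
  have eq: "e ((x - c) / s) / s * indicator {c..c + s} x = e ((x - c) / s) / s" for x
    using e_outside[OF s order_refl, of "x - c"] by (cases "x \<in> {c..c + s}") (auto simp: algebra_simps)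
  have "((\<lambda>x. E ((x - c) / s)) has_real_derivative e ((x - c) / s) / s) (at x)" for x
  proof -
    have "((\<lambda>x. (x - c) / s) has_real_derivative 1 / s) (at x)" using s by (auto intro!: derivative_eq_intros)
    from DERIV_chain'[OF this dE] show ?thesis by simp
  qed
  moreover have "isCont (\<lambda>x. e ((x - c) / s) / s) x" for x
  proof -
    have "isCont e y" for y by (rule DERIV_isCont[OF de])
    moreover have "isCont (\<lambda>x. (x - c) / s) x" using s by (intro isCont_divide isCont_diff) auto
    ultimately have "isCont (\<lambda>x. e ((x - c) / s)) x" by (rule isCont_o2[rotated])
    then show ?thesis using s by (intro isCont_divide) auto
  qed
  ultimately have "has_bochner_integral lborel (\<lambda>x. e ((x - c) / s) / s * indicator {c..c + s} x) (E ((c + s - c) / s) - E ((c - c) / s))"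
    using s by (intro has_bochner_integral_FTC_Icc_real) auto
  then have "has_bochner_integral lborel (\<lambda>x. e ((x - c) / s) / s) 1"
    unfolding eq using s by (simp add: E_left E_right)
  then show "integrable lborel (\<lambda>x. e ((x - c) / s) / s)" "(\<integral>x. e ((x - c) / s) / s \<partial>lborel) = 1"
    by (auto simp: has_bochner_integral_iff)
qed

text \<open>The integral is over the base point \<open>z\<close>, because the mollification will be
  transposed onto the test function.\<close>

lemma integral_molf:
  fixes y :: "'a::euclidean_space"
  assumes "\<And>b. b \<in> Basis \<Longrightarrow> 0 < \<sigma> b"
  shows "(\<integral>z. molf \<sigma> z y \<partial>lborel) = 1"
proof -
  have "(\<integral>z. molf \<sigma> z y \<partial>lborel) = (\<integral>z. (\<Prod>b\<in>Basis. (\<lambda>x. e ((x - y \<bullet> b) / \<sigma> b) / \<sigma> b) (z \<bullet> b)) \<partial>lborel)"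
    by (simp add: molf_def inner_diff_left)
  also have "\<dots> = (\<Prod>b\<in>Basis. \<integral>x. e ((x - y \<bullet> b) / \<sigma> b) / \<sigma> b \<partial>lborel)"
    by (rule integral_lborel_prod) (use integral_profile assms in auto)
  also have "\<dots> = (\<Prod>b\<in>(Basis :: 'a set). 1)"
    by (rule prod.cong[OF refl]) (rule integral_profile(2)[OF assms])
  also have "\<dots> = 1" by simp
  finally show ?thesis .
qed

text \<open>The points \<open>z\<close> whose box contains \<open>y\<close> form a set whose volume
  cancels the height of the kernel, so the constant does not depend on the scale.\<close>

lemma integral_molf_mult_le:
  fixes k :: "'n::finite spacetime \<Rightarrow> real"
  assumes s: "0 < s" and [measurable]: "k \<in> borel_measurable borel"
    and le: "\<And>z. y \<in> back_box (pscale s) z \<Longrightarrow> \<bar>k z\<bar> \<le> K" and K: "0 \<le> K"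
  shows "integrable lborel (\<lambda>z. molf (pscale s) z y * k z)"
    "\<bar>\<integral>z. molf (pscale s) z y * k z \<partial>lborel\<bar> \<le> (4 * B) ^ (CARD('n) + 1) * K"
proof -
  define v where "v = s ^ (CARD('n) + 2)"
  have v: "v > 0" using s by (simp add: v_def)
  let ?S = "{z. y \<in> back_box (pscale s) z}" and ?D = "(4 * B) ^ (CARD('n) + 1) / v"
  have [measurable]: "?S \<in> sets borel" unfolding back_box_flip by simp
  have vol: "emeasure lborel ?S = ennreal v"
    unfolding v_def prod_pscale[symmetric] by (rule measure_back_box; rule less_imp_le[OF pscale_pos[OF s]])
  have i: "integrable lborel (\<lambda>z. ?D * K * indicat_real ?S z)"
    using vol by (simp add: integrable_indicator_iff)
  have pt: "\<bar>molf (pscale s) z y * k z\<bar> \<le> ?D * K * indicat_real ?S z" for z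
  proof (cases "z \<in> ?S")
    case True
    have "\<bar>molf (pscale s) z y\<bar> \<le> (4 * B) ^ DIM('n spacetime) / (\<Prod>b\<in>(Basis :: 'n spacetime set). pscale s b)"
      by (rule molf_le) (use pscale_pos[OF s] in \<open>auto intro: less_imp_le\<close>)
    then have "\<bar>molf (pscale s) z y\<bar> \<le> ?D" unfolding prod_pscale DIM_spacetime v_def .
    moreover have "\<bar>k z\<bar> \<le> K" using True le by simp
    ultimately have "\<bar>molf (pscale s) z y * k z\<bar> \<le> ?D * K"
      unfolding abs_mult using B v by (intro mult_mono) auto
    with True show ?thesis by simp
  next
    case False
    have "molf (pscale s) z y = 0"
      by (rule molf_outside[where \<rho> = "pscale s"]) (use False pscale_pos[OF s] in auto)
    with False show ?thesis by simp
  qed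
  show I: "integrable lborel (\<lambda>z. molf (pscale s) z y * k z)"
    by (rule integrable_abs_le[OF i _ pt]) simp
  have "\<bar>\<integral>z. molf (pscale s) z y * k z \<partial>lborel\<bar> \<le> (\<integral>z. \<bar>molf (pscale s) z y * k z\<bar> \<partial>lborel)"
    using integral_norm_bound[of lborel "\<lambda>z. molf (pscale s) z y * k z"] by simp
  also have "\<dots> \<le> (\<integral>z. ?D * K * indicat_real ?S z \<partial>lborel)"
    by (rule integral_mono[OF _ i pt]) (use I in simp)
  also have "\<dots> = ?D * K * v" using vol v by (simp add: measure_def)
  finally show "\<bar>\<integral>z. molf (pscale s) z y * k z \<partial>lborel\<bar> \<le> (4 * B) ^ (CARD('n) + 1) * K" using v by simp
qed

lemma back_box_norm:
  fixes y z :: "'n::finite spacetime"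
  assumes "y \<in> back_box (pscale s) z" "0 < s" "s \<le> 1"
  shows "norm (z - y) \<le> (real CARD('n) + 1) * s"
proof -
  have "norm (z - y) \<le> (\<Sum>b\<in>Basis. \<bar>(z - y) \<bullet> b\<bar>)" by (rule norm_le_l1)
  also have "\<dots> \<le> (\<Sum>b\<in>(Basis :: 'n spacetime set). s)"
  proof (rule sum_mono)
    fix b :: "'n spacetime" assume "b \<in> Basis"
    then have "\<bar>(z - y) \<bullet> b\<bar> \<le> pscale s b" using assms(1) by (auto simp: back_box_def)
    also have "\<dots> \<le> s" using assms(2,3) by (auto simp: pscale_def power2_eq_square mult_left_le_one_le)
    finally show "\<bar>(z - y) \<bullet> b\<bar> \<le> s" .
  qed
  finally show ?thesis by (simp add: add.commute)
qed

lemma dyadic_bounds: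
  "dyadic TYPE('n::finite) j \<le> 1" "(real CARD('n) + 1) * dyadic TYPE('n) j \<le> 1 / 2"
  "(\<lambda>j. (real CARD('n) + 1) * dyadic TYPE('n) j) \<longlonglongrightarrow> 0"
proof -
  have eq: "(real CARD('n) + 1) * dyadic TYPE('n) j = 1 / 2 * (1 / 2) ^ j" for j
  proof -
    define c where "c = real CARD('n) + 1"
    have "c > 0" by (simp add: c_def add_nonneg_pos)
    then show ?thesis unfolding dyadic_def c_def[symmetric] by simp
  qed
  show "dyadic TYPE('n) j \<le> 1" by (rule order_trans[OF dyadic_le]) (simp add: power_le_one)
  have "(1 / 2 :: real) ^ j \<le> 1" by (simp add: power_le_one)
  then show "(real CARD('n) + 1) * dyadic TYPE('n) j \<le> 1 / 2" unfolding eq by simp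
  have "(\<lambda>j. 1 / 2 * (1 / 2 :: real) ^ j) \<longlonglongrightarrow> 1 / 2 * 0"
    by (intro tendsto_mult tendsto_const LIMSEQ_power_zero) simp
  then show "(\<lambda>j. (real CARD('n) + 1) * dyadic TYPE('n) j) \<longlonglongrightarrow> 0" unfolding eq by simp
qed

text \<open>The kernel has integral 1, and its absolute value has integral at most
  \<open>(4 * B) ^ (CARD('n) + 1)\<close>. The deviation is therefore at most that constant times
  the oscillation of \<open>\<psi>\<close> over a shrinking box.\<close>

lemma molf_approx_identity:
  fixes \<psi> :: "'n::finite spacetime \<Rightarrow> real"
  assumes cont: "isCont \<psi> y" and [measurable]: "\<psi> \<in> borel_measurable borel" and bd: "\<And>z. \<bar>\<psi> z\<bar> \<le> P"
  shows "(\<lambda>j. \<integral>z. molf (pscale (dyadic TYPE('n) j)) z y * \<psi> z \<partial>lborel) \<longlonglongrightarrow> \<psi> y"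
proof (rule LIMSEQ_I)
  fix r :: real assume r: "0 < r"
  let ?K = "(4 * B) ^ (CARD('n) + 1)" and ?s = "dyadic TYPE('n)"
  have K: "?K > 0" using B by simp
  define \<epsilon> where "\<epsilon> = r / (2 * ?K)"
  have \<epsilon>: "\<epsilon> > 0" using r K by (simp add: \<epsilon>_def)
  obtain d where d: "d > 0" "\<And>z. dist z y < d \<Longrightarrow> dist (\<psi> z) (\<psi> y) < \<epsilon>"
    using cont \<epsilon> unfolding continuous_at_eps_delta by blast
  obtain J where J: "\<And>j. j \<ge> J \<Longrightarrow> (real CARD('n) + 1) * ?s j < d"
  proof -
    obtain J where "\<And>j. j \<ge> J \<Longrightarrow> norm ((real CARD('n) + 1) * ?s j - 0) < d"
      using LIMSEQ_D[OF dyadic_bounds(3) d(1)] by blast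
    then show ?thesis using that by force
  qed
  have "norm ((\<integral>z. molf (pscale (?s j)) z y * \<psi> z \<partial>lborel) - \<psi> y) < r" if j: "j \<ge> J" for j
  proof -
    have s: "0 < ?s j" by (rule dyadic_pos)
    have P: "0 \<le> P" by (rule order_trans[OF abs_ge_zero bd])
    have i1: "integrable lborel (\<lambda>z. molf (pscale (?s j)) z y * \<psi> z)"
      by (rule integral_molf_mult_le(1)[OF s _ bd P]) simp
    have i2: "integrable lborel (\<lambda>z. molf (pscale (?s j)) z y * \<psi> y)"
      by (rule integral_molf_mult_le(1)[OF s _ bd P]) simp
    have mean: "(\<integral>z. molf (pscale (?s j)) z y \<partial>lborel) = 1"
      by (rule integral_molf) (rule pscale_pos[OF s])
    have "(\<integral>z. molf (pscale (?s j)) z y * \<psi> z \<partial>lborel) - \<psi> y = (\<integral>z. molf (pscale (?s j)) z y * (\<psi> z - \<psi> y) \<partial>lborel)"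
      using i1 i2 mean by (simp add: right_diff_distrib)
    also have "\<bar>\<dots>\<bar> \<le> ?K * \<epsilon>"
    proof (rule integral_molf_mult_le(2)[OF s])
      fix z assume "y \<in> back_box (pscale (?s j)) z"
      then have "norm (z - y) \<le> (real CARD('n) + 1) * ?s j"
        by (rule back_box_norm) (auto simp: s dyadic_bounds)
      then have "dist z y < d" using J[OF j] by (simp add: dist_norm)
      then show "\<bar>\<psi> z - \<psi> y\<bar> \<le> \<epsilon>" using d(2)[of z] by (simp add: dist_real_def)
    qed (use \<epsilon> in simp_all)
    also have "?K * \<epsilon> < r" using r K by (simp add: \<epsilon>_def)
    finally show ?thesis by simp
  qed
  then show "\<exists>no. \<forall>n\<ge>no. norm ((\<integral>z. molf (pscale (?s n)) z y * \<psi> z \<partial>lborel) - \<psi> y) < r" by blast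
qed

text \<open>Fubini's theorem transposes the mollification onto the test function, where it converges
  pointwise and boundedly; a multiple of the absolute value of \<open>f\<close> dominates.\<close>

lemma mollify_weak_limit:
  fixes f \<psi> :: "'n::finite spacetime \<Rightarrow> real"
  assumes f: "integrable lborel f" and \<psi>: "test_fun U \<psi>"
  shows "(\<lambda>j. \<integral>z. mollify (dyadic TYPE('n) j) f z * \<psi> z \<partial>lborel) \<longlonglongrightarrow> (\<integral>z. f z * \<psi> z \<partial>lborel)"
proof -
  let ?s = "dyadic TYPE('n)"
  have [measurable]: "f \<in> borel_measurable borel" using f by simp
  have [measurable]: "\<psi> \<in> borel_measurable borel" using test_fun_measurable[OF \<psi>, of "[]"] by simp
  obtain P where P: "\<And>z. \<bar>\<psi> z\<bar> \<le> P" using test_fun_bounded[OF \<psi>, of "[]"] by auto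
  have P0: "0 \<le> P" by (rule order_trans[OF abs_ge_zero P])
  have cont: "isCont \<psi> y" for y
    using \<psi> unfolding test_fun_def by (metis differentiable_imp_continuous_within dir_derivs.simps(1))
  have \<psi>i: "integrable lborel \<psi>"
  proof -
    have "compact (closure {z. \<psi> z \<noteq> 0})" using \<psi> by (auto simp: test_fun_def)
    moreover have "continuous_on (closure {z. \<psi> z \<noteq> 0}) \<psi>" using cont by (simp add: continuous_at_imp_continuous_on)
    ultimately have "integrable lborel (\<lambda>z. indicat_real (closure {z. \<psi> z \<noteq> 0}) z *\<^sub>R \<psi> z)"
      by (rule borel_integrable_compact)
    moreover have "(\<lambda>z. indicat_real (closure {z. \<psi> z \<noteq> 0}) z *\<^sub>R \<psi> z) = \<psi>"
    proof
      fix z show "indicat_real (closure {z. \<psi> z \<noteq> 0}) z *\<^sub>R \<psi> z = \<psi> z"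
        using subsetD[OF closure_subset[of "{z. \<psi> z \<noteq> 0}"], of z] by (cases "\<psi> z = 0") auto
    qed
    ultimately show ?thesis by (simp only:)
  qed
  define c where "c j y = (\<integral>z. molf (pscale (?s j)) z y * \<psi> z \<partial>lborel)" for j y
  have cb: "\<bar>c j y\<bar> \<le> (4 * B) ^ (CARD('n) + 1) * P" for j y
    unfolding c_def by (rule integral_molf_mult_le(2)[OF dyadic_pos]) (use P P0 in auto)
  have molfm[measurable]: "(\<lambda>x. molf \<sigma> (fst x) (snd x)) \<in> borel_measurable (lborel \<Otimes>\<^sub>M (lborel :: 'n spacetime measure))" for \<sigma>
    using molf_measurable_pair by (simp cong: measurable_cong_sets sets_pair_measure_cong)
  have cm: "c j \<in> borel_measurable borel" for j
  proof -
    have [measurable]: "(\<lambda>x. molf (pscale (?s j)) (snd x) (fst x)) \<in> borel_measurable (borel \<Otimes>\<^sub>M (lborel :: 'n spacetime measure))"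
      using measurable_compose[OF measurable_pair_swap'[of "borel :: 'n spacetime measure" "lborel :: 'n spacetime measure"]
          , of "\<lambda>x. molf (pscale (?s j)) (fst x) (snd x)" borel] molf_measurable_pair[of "pscale (?s j)"]
      by (simp add: split_beta' cong: measurable_cong_sets sets_pair_measure_cong)
    show ?thesis unfolding c_def[abs_def] by measurable
  qed
  have swap: "(\<integral>z. mollify (?s j) f z * \<psi> z \<partial>lborel) = (\<integral>y. f y * c j y \<partial>lborel)" for j
  proof -
    let ?g = "\<lambda>z y. f y * molf (pscale (?s j)) z y * \<psi> z"
    have s: "0 < ?s j" by (rule dyadic_pos)
    define D where "D = (4 * B) ^ DIM('n spacetime) / (\<Prod>b\<in>(Basis :: 'n spacetime set). pscale (?s j) b)"
    have D: "\<bar>molf (pscale (?s j)) z y\<bar> \<le> D" for z y :: "'n spacetime"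
      unfolding D_def by (rule molf_le) (use pscale_pos[OF s] in \<open>auto intro: less_imp_le\<close>)
    have bnd: "\<bar>?g z y\<bar> \<le> D * \<bar>\<psi> z\<bar> * \<bar>f y\<bar>" for z y
    proof -
      have "\<bar>?g z y\<bar> = (\<bar>\<psi> z\<bar> * \<bar>f y\<bar>) * \<bar>molf (pscale (?s j)) z y\<bar>" by (simp add: abs_mult)
      also have "\<dots> \<le> (\<bar>\<psi> z\<bar> * \<bar>f y\<bar>) * D" by (intro mult_left_mono D) auto
      finally show ?thesis by (simp add: mult_ac)
    qed
    have gm: "(\<lambda>x. ?g (fst x) (snd x)) \<in> borel_measurable (lborel \<Otimes>\<^sub>M lborel)" by measurable
    have gy: "integrable lborel (?g z)" for z
      by (rule integrable_abs_le[OF _ _ bnd]) (use f in auto)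
    have "integrable (lborel \<Otimes>\<^sub>M lborel) (\<lambda>x. ?g (fst x) (snd x))"
    proof (rule lborel_pair.Fubini_integrable[OF gm])
      show "AE z in lborel. integrable lborel (\<lambda>y. ?g (fst (z, y)) (snd (z, y)))" using gy by simp
      have "(\<integral>y. \<bar>?g z y\<bar> \<partial>lborel) \<le> (\<integral>y. D * \<bar>\<psi> z\<bar> * \<bar>f y\<bar> \<partial>lborel)" for z
        by (rule integral_mono) (use gy[of z] f bnd in auto)
      then have le: "(\<integral>y. \<bar>?g z y\<bar> \<partial>lborel) \<le> D * (\<integral>y. \<bar>f y\<bar> \<partial>lborel) * \<bar>\<psi> z\<bar>" for z
        using f by (simp add: mult_ac)
      have [measurable]: "(\<lambda>z. \<integral>y. \<bar>?g z y\<bar> \<partial>lborel) \<in> borel_measurable lborel"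
      proof -
        have "(\<lambda>x. \<bar>?g (fst x) (snd x)\<bar>) \<in> borel_measurable (lborel \<Otimes>\<^sub>M lborel)" using gm by simp
        then show ?thesis
          using lborel.borel_measurable_lebesgue_integral[of "\<lambda>z y. \<bar>?g z y\<bar>" lborel] by (simp add: split_beta')
      qed
      have "integrable lborel (\<lambda>z. \<integral>y. \<bar>?g z y\<bar> \<partial>lborel)"
      proof (rule Bochner_Integration.integrable_bound[of _ "\<lambda>z. D * (\<integral>y. \<bar>f y\<bar> \<partial>lborel) * \<bar>\<psi> z\<bar>"])
        show "AE z in lborel. norm (\<integral>y. \<bar>?g z y\<bar> \<partial>lborel) \<le> norm (D * (\<integral>y. \<bar>f y\<bar> \<partial>lborel) * \<bar>\<psi> z\<bar>)"
        proof (rule AE_I2)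
          fix z
          have "0 \<le> (\<integral>y. \<bar>?g z y\<bar> \<partial>lborel)" by (rule Bochner_Integration.integral_nonneg) simp
          then show "norm (\<integral>y. \<bar>?g z y\<bar> \<partial>lborel) \<le> norm (D * (\<integral>y. \<bar>f y\<bar> \<partial>lborel) * \<bar>\<psi> z\<bar>)"
            using le[of z] unfolding real_norm_def by linarith
        qed
      qed (use \<psi>i in auto)
      then show "integrable lborel (\<lambda>z. \<integral>y. norm (?g (fst (z, y)) (snd (z, y))) \<partial>lborel)" by simp
    qed
    then have gi: "integrable (lborel \<Otimes>\<^sub>M lborel) (case_prod ?g)" by (simp add: split_beta')
    have "(\<integral>z. mollify (?s j) f z * \<psi> z \<partial>lborel) = (\<integral>z. (\<integral>y. ?g z y \<partial>lborel) \<partial>lborel)"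
      by (simp add: mollify_def)
    also have "\<dots> = (\<integral>y. (\<integral>z. ?g z y \<partial>lborel) \<partial>lborel)"
      by (rule lborel_pair.Fubini_integral[OF gi, symmetric])
    also have "\<dots> = (\<integral>y. f y * c j y \<partial>lborel)" by (simp add: c_def mult.assoc)
    finally show ?thesis .
  qed
  have "(\<lambda>j. \<integral>y. f y * c j y \<partial>lborel) \<longlonglongrightarrow> (\<integral>y. f y * \<psi> y \<partial>lborel)"
  proof (rule integral_dominated_convergence[where w = "\<lambda>y. (4 * B) ^ (CARD('n) + 1) * P * \<bar>f y\<bar>"])
    show "AE y in lborel. (\<lambda>j. f y * c j y) \<longlonglongrightarrow> f y * \<psi> y"
      unfolding c_def by (intro AE_I2 tendsto_mult tendsto_const molf_approx_identity[OF cont _ P]) simp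
    show "AE y in lborel. norm (f y * c j y) \<le> (4 * B) ^ (CARD('n) + 1) * P * \<bar>f y\<bar>" for j
    proof (rule AE_I2)
      fix y
      have "\<bar>f y\<bar> * \<bar>c j y\<bar> \<le> \<bar>f y\<bar> * ((4 * B) ^ (CARD('n) + 1) * P)" by (intro mult_left_mono cb) auto
      then show "norm (f y * c j y) \<le> (4 * B) ^ (CARD('n) + 1) * P * \<bar>f y\<bar>" by (simp only: real_norm_def abs_mult mult.commute)
    qed
    show "(\<lambda>y. f y * c j y) \<in> borel_measurable lborel" for j using cm[of j] by simp
  qed (use f in auto)
  then show ?thesis by (simp only: swap)
qed

end

text \<open>Keeps a margin of 1/2 to \<open>outer\<close> in space and in time, and still contains
  the closed unit ball times the interval from 0 to 1.\<close>

definition inner_cyl :: "'n::finite spacetime set" where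
  "inner_cyl = ball 0 (3 / 2) \<times> {-1/2<..<3/2}"

lemma open_inner_cyl: "open inner_cyl" by (simp add: inner_cyl_def open_Times)

lemma inner_cyl_finite: "emeasure lborel (inner_cyl :: 'n::finite spacetime set) < \<infinity>"
proof -
  have "bounded (inner_cyl :: 'n spacetime set)" unfolding inner_cyl_def by (intro bounded_Times) auto
  then show ?thesis using emeasure_bounded_finite by auto
qed

lemma outer_finite: "emeasure lborel (outer :: 'n::finite spacetime set) < \<infinity>"
proof -
  have "bounded (outer :: 'n spacetime set)" unfolding outer_def by (intro bounded_Times) auto
  then show ?thesis using emeasure_bounded_finite by auto
qed

lemma back_box_inner_cyl:
  fixes z :: "'n::finite spacetime"
  assumes z: "z \<in> inner_cyl"
  shows "back_box (pscale (dyadic TYPE('n) j)) z \<subseteq> outer"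
proof
  fix y assume y: "y \<in> back_box (pscale (dyadic TYPE('n) j)) z"
  obtain E e e' B where "step_profile E e e' B" using step_profile_exists by blast
  then interpret step_profile E e e' B .
  have "norm (z - y) \<le> (real CARD('n) + 1) * dyadic TYPE('n) j"
    by (rule back_box_norm[OF y dyadic_pos dyadic_bounds(1)])
  also have "\<dots> \<le> 1 / 2" by (rule dyadic_bounds(2))
  finally have n: "norm (z - y) \<le> 1 / 2" .
  have 1: "norm (fst z - fst y) \<le> 1 / 2"
    using norm_fst_le[of "fst (z - y)" "snd (z - y)"] n unfolding prod.collapse unfolding fst_diff by linarith
  have 2: "\<bar>snd z - snd y\<bar> \<le> 1 / 2"
    using norm_snd_le[of "snd (z - y)" "fst (z - y)"] n unfolding prod.collapse unfolding snd_diff real_norm_def by linarith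
  have zz: "norm (fst z) < 3 / 2" "- 1 / 2 < snd z" "snd z < 3 / 2" using z by (auto simp: inner_cyl_def)
  have "norm (fst y) \<le> norm (fst z) + norm (fst z - fst y)"
    using norm_triangle_ineq4[of "fst z" "fst z - fst y"] by simp
  then have "norm (fst y) < 2" using 1 zz by linarith
  moreover have "- 1 < snd y" "snd y < 2" using 2 zz by linarith+
  ultimately show "y \<in> outer" by (cases y) (auto simp: outer_def)
qed

lemma Lp_bound_sum:
  assumes "finite I" "\<And>i. i \<in> I \<Longrightarrow> Lp_bound p A (f i)" "0 \<le> A" "1 \<le> p"
  shows "Lp_bound p (8 ^ card I * A) (\<lambda>z. \<Sum>i\<in>I. f i z)"
  using assms(1,2)
proof (induction I)
  case empty
  then show ?case by (simp add: Lp_bound_def)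
next
  case (insert i I)
  have "Lp_bound p (4 * (A + 8 ^ card I * A)) (\<lambda>z. f i z + (\<Sum>i\<in>I. f i z))"
    by (rule Lp_bound_add) (use insert assms in auto)
  moreover have "4 * (A + 8 ^ card I * A) \<le> 8 ^ card (insert i I) * A"
  proof -
    have "1 * A \<le> 8 ^ card I * A" using assms by (intro mult_right_mono) auto
    then show ?thesis using insert by (simp add: mult.commute)
  qed
  ultimately show ?case using insert assms by (auto intro: Lp_bound_mono)
qed

lemma Lp_bound_abs: "Lp_bound p A f \<Longrightarrow> Lp_bound p A (\<lambda>z. \<bar>f z\<bar>)"
  by (auto simp: Lp_bound_def intro: borel_measurable_abs)

text \<open>The version of the gradient is the pointwise limit of the mollified gradient: the telescoping
  series over dyadic scales is dominated by averages of second space and first time derivatives.\<close>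

lemma gradient_version:
  fixes m p q lam Lam :: real
  assumes p: "1 \<le> p" "p \<le> q" and m: "1 < m"
    and \<beta>: "0 < m - (real CARD('n::finite) + 2) / p * (m - (1 - p / q))"
  shows "\<exists>C>0. \<forall>A g (w :: 'n spacetime \<Rightarrow> real) wt wx wxx. 0 < A \<longrightarrow> local_sol lam Lam p outer A g w wt wx wxx \<longrightarrow>
    (\<exists>vx. (\<forall>k. weak_deriv inner_cyl [e_x k] w (\<lambda>z. vx z $ k)) \<and> (\<forall>k. Lp_bound p (C * A) (\<lambda>z. vx z $ k)) \<and>
      (\<forall>z. z \<notin> inner_cyl \<longrightarrow> vx z = 0) \<and>
      (\<forall>\<mu> U. 0 < U \<longrightarrow> Lp_bound q U \<mu> \<longrightarrow> (\<forall>z. 0 \<le> \<mu> z) \<longrightarrow>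
         Lp_bound p (C * (U * A powr m)) (\<lambda>z. \<mu> z * norm (vx z) powr m)))"
proof -
  obtain E e e' B where "step_profile E e e' B" using step_profile_exists by blast
  then interpret step_profile E e e' B .
  let ?s = "dyadic TYPE('n)" and ?n = "CARD('n)"
  obtain C0 where C0: "C0 > 0" and C0b: "\<forall>(h :: 'n spacetime \<Rightarrow> real) N. 0 < N \<longrightarrow> Lp_bound p N h \<longrightarrow> integrable lborel h \<longrightarrow> (\<forall>z. 0 \<le> h z) \<longrightarrow>
    (let X = (\<lambda>z. \<Sum>j. ?s j * box_avg h (?s j) z) in
     (AE z in lborel. summable (\<lambda>j. ?s j * box_avg h (?s j) z)) \<and>
     Lp_bound p (C0 * N) X \<and>
     (\<forall>\<mu> U. 0 < U \<longrightarrow> Lp_bound q U \<mu> \<longrightarrow> (\<forall>z. 0 \<le> \<mu> z) \<longrightarrow> Lp_bound p (C0 * (U * N powr m)) (\<lambda>z. \<mu> z * X z powr m)))"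
    using box_avg_series[OF p m \<beta>] by (elim exE conjE) (rule that; assumption)
  \<comment> \<open>The constants of \<open>Lp_bound_sum\<close> and \<open>Lp_bound_add\<close> for
    the sum of all derivatives of \<open>w\<close>, generously rounded up.\<close>
  define M where "M = (8 :: real) ^ 3 * 8 ^ (?n + 1) * 8 ^ (?n * ?n)"
  have M: "M > 0" by (simp add: M_def)
  \<comment> \<open>The first summand is the cost of the halvings of the scale, the second that of
    the coarsest mollification, each relative to the series of averages.\<close>
  define K where "K = real (?n + 1) * (8 * B * (4 * B) ^ ?n) + (4 * B) ^ (?n + 1) / ?s 0"
  have K1: "real (?n + 1) * (8 * B * (4 * B) ^ ?n) \<ge> 0" "(4 * B) ^ (?n + 1) / ?s 0 \<ge> 0"
    using B dyadic_pos[where 'n='n and j=0] by (auto intro!: mult_nonneg_nonneg divide_nonneg_pos)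
  have K: "K \<ge> 0" using K1 by (simp add: K_def)
  define C where "C = 1 + K * (C0 * M) + (real ?n * K) powr m * (C0 * M powr m)"
  have C: "C > 0" "K * (C0 * M) \<le> C" "(real ?n * K) powr m * (C0 * M powr m) \<le> C"
    using K C0 M by (auto simp: C_def add_pos_nonneg)
  show ?thesis
  proof (intro exI[of _ C] conjI C(1) allI impI)
    fix A :: real and g w wt :: "'n spacetime \<Rightarrow> real" and wx :: "'n spacetime \<Rightarrow> real ^ 'n" and wxx :: "'n spacetime \<Rightarrow> real ^ 'n ^ 'n"
    assume A: "0 < A" and sol: "local_sol lam Lam p outer A g w wt wx wxx"
    have L: "Lp_bound p A wt" "\<And>k. Lp_bound p A (\<lambda>z. wx z $ k)" "\<And>k l. Lp_bound p A (\<lambda>z. wxx z $ k $ l)"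
      and wd: "weak_deriv outer [e_t] w wt" "\<And>k. weak_deriv outer [e_x k] w (\<lambda>z. wx z $ k)"
        "\<And>k l. weak_deriv outer [e_x k, e_x l] w (\<lambda>z. wxx z $ k $ l)"
      and out: "\<And>z. z \<notin> outer \<Longrightarrow> w z = 0 \<and> wt z = 0 \<and> wx z = 0 \<and> wxx z = 0"
      using sol unfolding local_sol_def by blast+
    note [measurable] = L[THEN Lp_bound_measurable]
    \<comment> \<open>A common majorant of all derivatives, so that a single series of averages
      controls every component of the gradient.\<close>
    define h where "h z = \<bar>wt z\<bar> + ((\<Sum>k\<in>UNIV. \<bar>wx z $ k\<bar>) + (\<Sum>kl\<in>UNIV. \<bar>wxx z $ fst kl $ snd kl\<bar>))" for z
    have h0: "0 \<le> h z" for z unfolding h_def by (intro add_nonneg_nonneg sum_nonneg) auto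
    have hge: "\<bar>wt z\<bar> \<le> h z" "\<bar>wx z $ k\<bar> \<le> h z" "\<bar>wxx z $ k $ l\<bar> \<le> h z" for z k l
    proof -
      have 1: "0 \<le> (\<Sum>k\<in>UNIV. \<bar>wx z $ k\<bar>)" "0 \<le> (\<Sum>kl\<in>UNIV. \<bar>wxx z $ fst kl $ snd kl\<bar>)"
        by (intro sum_nonneg; simp)+
      have 2: "\<bar>wx z $ k\<bar> \<le> (\<Sum>k\<in>UNIV. \<bar>wx z $ k\<bar>)" by (rule member_le_sum) auto
      have 3: "\<bar>wxx z $ fst (k, l) $ snd (k, l)\<bar> \<le> (\<Sum>kl\<in>UNIV. \<bar>wxx z $ fst kl $ snd kl\<bar>)"
        by (rule member_le_sum) auto
      show "\<bar>wt z\<bar> \<le> h z" "\<bar>wx z $ k\<bar> \<le> h z" "\<bar>wxx z $ k $ l\<bar> \<le> h z"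
        unfolding h_def using 1 2 3 abs_ge_zero[of "wt z"] by auto
    qed
    have hL: "Lp_bound p (M * A) h"
    proof -
      have 1: "Lp_bound p (8 ^ card (UNIV :: 'n set) * A) (\<lambda>z. \<Sum>k\<in>UNIV. \<bar>wx z $ k\<bar>)"
        by (rule Lp_bound_sum) (use L A p in \<open>auto intro: Lp_bound_abs\<close>)
      have 2: "Lp_bound p (8 ^ card (UNIV :: ('n \<times> 'n) set) * A) (\<lambda>z. \<Sum>kl\<in>UNIV. \<bar>wxx z $ fst kl $ snd kl\<bar>)"
        by (rule Lp_bound_sum) (use L A p in \<open>auto intro: Lp_bound_abs\<close>)
      let ?a = "8 ^ ?n * A" and ?b = "8 ^ (?n * ?n) * A"
      have 3: "Lp_bound p (4 * (?a + ?b)) (\<lambda>z. (\<Sum>k\<in>UNIV. \<bar>wx z $ k\<bar>) + (\<Sum>kl\<in>UNIV. \<bar>wxx z $ fst kl $ snd kl\<bar>))"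
        by (rule Lp_bound_add[OF 1]) (use 2 A p in \<open>auto simp: card_cartesian_product simp flip: UNIV_Times_UNIV\<close>)
      have "Lp_bound p (4 * (A + 4 * (?a + ?b))) h"
        unfolding h_def by (rule Lp_bound_add[OF Lp_bound_abs[OF L(1)] 3]) (use A p in auto)
      moreover have "4 * (A + 4 * (?a + ?b)) \<le> M * A"
      proof -
        have ab: "A \<le> ?a" "A \<le> ?b" using A by auto
        have "?a \<le> (8 ^ ?n * A) * 8 ^ (?n * ?n)" "?b \<le> (8 ^ (?n * ?n) * A) * 8 ^ ?n"
          using A by (auto intro!: mult_left_mono[of 1, simplified])
        then have le: "?a \<le> 8 ^ ?n * 8 ^ (?n * ?n) * A" "?b \<le> 8 ^ ?n * 8 ^ (?n * ?n) * A"
          by (simp_all add: mult_ac)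
        have "4 * (A + 4 * (?a + ?b)) \<le> 4 * (8 ^ ?n * 8 ^ (?n * ?n) * A + 4 * (8 ^ ?n * 8 ^ (?n * ?n) * A + 8 ^ ?n * 8 ^ (?n * ?n) * A))"
          using le order_trans[OF ab(1) le(1)] by (intro mult_left_mono add_mono) auto
        also have "\<dots> = 36 * (8 ^ ?n * 8 ^ (?n * ?n) * A)" by simp
        also have "\<dots> \<le> M * A" using A by (simp add: M_def)
        finally show ?thesis .
      qed
      ultimately show ?thesis using A p by (auto intro: Lp_bound_mono)
    qed
    have hout: "h z = 0" if "z \<notin> outer" for z using out[OF that] by (simp add: h_def)
    have ob: "(outer :: 'n spacetime set) \<in> sets borel" by (rule borel_open[OF open_outer])
    have hi: "integrable lborel h"
      by (rule Lp_bound_integrable(1)[OF hL p(1) ob outer_finite hout])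
    have MA: "0 < M * A" using M A by simp
    define X where "X z = (\<Sum>j. ?s j * box_avg h (?s j) z)" for z
    have X: "AE z in lborel. summable (\<lambda>j. ?s j * box_avg h (?s j) z)" "Lp_bound p (C0 * (M * A)) X"
       "\<And>\<mu> U. 0 < U \<Longrightarrow> Lp_bound q U \<mu> \<Longrightarrow> (\<forall>z. 0 \<le> \<mu> z) \<Longrightarrow> Lp_bound p (C0 * (U * (M * A) powr m)) (\<lambda>z. \<mu> z * X z powr m)"
      using C0b[THEN spec, THEN spec, THEN mp, OF MA, THEN mp, OF hL, THEN mp, OF hi, THEN mp, OF allI, OF h0]
      unfolding Let_def X_def by blast+
    note [measurable] = Lp_bound_measurable[OF X(2)]
    define x where "x j z = ?s j * box_avg h (?s j) z" for j z
    have avg0: "0 \<le> box_avg h (?s j) z" for j z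
      by (rule box_avg_bounds(2)[OF hL hi h0 p(1) dyadic_pos]) (use MA in simp)
    have x0: "0 \<le> x j z" for j z unfolding x_def using avg0 dyadic_pos[where 'n='n and j=j] by (simp add: less_imp_le)
    define F where "F k j z = mollify (?s j) (\<lambda>z. wx z $ k) z" for k j z
    have Fm[measurable]: "F k j \<in> borel_measurable borel" for k j
    proof -
      have m1: "(\<lambda>x. molf (pscale (?s j)) (fst x) (snd x)) \<in> borel_measurable (borel \<Otimes>\<^sub>M (lborel :: 'n spacetime measure))"
        using molf_measurable_pair[of "pscale (?s j)"] by (simp cong: measurable_cong_sets sets_pair_measure_cong)
      have "(\<lambda>x. wx (snd x) $ k * molf (pscale (?s j)) (fst x) (snd x)) \<in> borel_measurable (borel \<Otimes>\<^sub>M (lborel :: 'n spacetime measure))"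
        using m1 by measurable
      then show ?thesis unfolding F_def[abs_def] mollify_def
        using lborel.borel_measurable_lebesgue_integral[of "\<lambda>z y. wx y $ k * molf (pscale (?s j)) z y" borel] by (simp add: split_beta')
    qed
    have F0: "\<bar>F k 0 z\<bar> \<le> (4 * B) ^ (?n + 1) / ?s 0 * x 0 z" for k z
      using mollify_le[of "\<lambda>z. wx z $ k" h "?s 0" z, OF _ hi hge(2) dyadic_pos] dyadic_pos[where 'n='n and j=0]
      by (simp add: F_def x_def del: power_Suc)
    have Fs: "\<bar>F k (Suc j) z - F k j z\<bar> \<le> real (?n + 1) * (8 * B * (4 * B) ^ ?n) * x j z" if z: "z \<in> inner_cyl" for k j z
      unfolding F_def x_def dyadic_Suc
      by (rule mollify_halve[OF _ _ _ wd(1) wd(2) wd(3) hi hge(1) hge(2) hge(3) dyadic_pos back_box_inner_cyl[OF z]]) simp_all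
    \<comment> \<open>The limit of the mollifications, written as a telescoping series. The cut-off
      is there because the estimate for a halving requires the box at \<open>z\<close> to lie in
      \<open>outer\<close>.\<close>
    define V where "V k z = indicat_real inner_cyl z * (F k 0 z + (\<Sum>j. F k (Suc j) z - F k j z))" for k z
    have ib[measurable]: "(inner_cyl :: 'n spacetime set) \<in> sets borel" by (rule borel_open[OF open_inner_cyl])
    have Vm[measurable]: "V k \<in> borel_measurable borel" for k unfolding V_def by measurable
    have main: "AE z in lborel. z \<in> inner_cyl \<longrightarrow> 0 \<le> X z \<and> (\<forall>k. \<bar>V k z\<bar> \<le> K * X z \<and> (\<lambda>j. F k j z) \<longlonglongrightarrow> V k z \<and> (\<forall>j. \<bar>F k j z\<bar> \<le> K * X z))"
      using X(1)
    proof eventually_elim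
      case (elim z)
      show ?case
      proof
        assume z: "z \<in> inner_cyl"
        have sx: "summable (\<lambda>j. x j z)" using elim by (simp add: x_def)
        have Xx: "X z = (\<Sum>j. x j z)" by (simp add: X_def x_def)
        let ?L = "real (?n + 1) * (8 * B * (4 * B) ^ ?n)"
        have part: "(\<Sum>j<i. x j z) \<le> X z" for i
          unfolding Xx by (rule sum_le_suminf[OF sx]) (use x0 in auto)
        have X0: "0 \<le> X z" using part[of 0] by simp
        have x0X: "x 0 z \<le> X z" using part[of 1] by simp
        have F0': "\<bar>F k 0 z\<bar> \<le> (4 * B) ^ (?n + 1) / ?s 0 * X z" for k
          by (rule order_trans[OF F0 mult_left_mono[OF x0X K1(2)]])
        have sF: "summable (\<lambda>j. \<bar>F k (Suc j) z - F k j z\<bar>)" for k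
          by (rule summable_comparison_test'[OF summable_mult[OF sx, of ?L], of 0]) (use Fs[OF z] in auto)
        have sumle: "\<bar>\<Sum>j. F k (Suc j) z - F k j z\<bar> \<le> ?L * X z" for k
        proof -
          have "\<bar>\<Sum>j. F k (Suc j) z - F k j z\<bar> \<le> (\<Sum>j. \<bar>F k (Suc j) z - F k j z\<bar>)"
            by (rule summable_rabs[OF sF])
          also have "\<dots> \<le> (\<Sum>j. ?L * x j z)"
            by (rule suminf_le[OF Fs[OF z] sF summable_mult[OF sx]])
          also have "\<dots> = ?L * X z" unfolding Xx by (rule suminf_mult[OF sx])
          finally show ?thesis .
        qed
        have Vz: "V k z = F k 0 z + (\<Sum>j. F k (Suc j) z - F k j z)" for k using z by (simp add: V_def)
        have VX: "\<bar>V k z\<bar> \<le> K * X z" for k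
          using F0'[of k] sumle[of k] abs_triangle_ineq[of "F k 0 z" "\<Sum>j. F k (Suc j) z - F k j z"]
          unfolding K_def distrib_right Vz by linarith
        have tele: "(\<Sum>j<i. F k (Suc j) z - F k j z) = F k i z - F k 0 z" for k i
          by (rule sum_lessThan_telescope)
        have lim: "(\<lambda>j. F k j z) \<longlonglongrightarrow> V k z" for k
        proof -
          have "(\<lambda>i. \<Sum>j<i. F k (Suc j) z - F k j z) \<longlonglongrightarrow> (\<Sum>j. F k (Suc j) z - F k j z)"
            by (rule summable_LIMSEQ[OF summable_rabs_cancel[OF sF]])
          then have "(\<lambda>i. F k 0 z + (F k i z - F k 0 z)) \<longlonglongrightarrow> F k 0 z + (\<Sum>j. F k (Suc j) z - F k j z)"
            unfolding tele by (rule tendsto_add[OF tendsto_const])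
          then show ?thesis unfolding Vz by simp
        qed
        \<comment> \<open>The partial sums obey the same bound as the limit, which makes
          \<open>K * X\<close> a majorant of all the mollifications.\<close>
        have "\<bar>F k i z\<bar> \<le> K * X z" for k i
        proof -
          have "\<bar>F k i z - F k 0 z\<bar> \<le> (\<Sum>j<i. \<bar>F k (Suc j) z - F k j z\<bar>)"
            unfolding tele[symmetric] by (rule sum_abs)
          also have "\<dots> \<le> (\<Sum>j<i. ?L * x j z)" by (rule sum_mono) (rule Fs[OF z])
          also have "\<dots> = ?L * (\<Sum>j<i. x j z)" by (simp add: sum_distrib_left)
          also have "\<dots> \<le> ?L * X z" by (rule mult_left_mono[OF part K1(1)])
          finally show ?thesis using F0'[of k] unfolding K_def distrib_right by linarith
        qed
        with X0 VX lim show "0 \<le> X z \<and> (\<forall>k. \<bar>V k z\<bar> \<le> K * X z \<and> (\<lambda>j. F k j z) \<longlonglongrightarrow> V k z \<and> (\<forall>j. \<bar>F k j z\<bar> \<le> K * X z))"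
          by blast
      qed
    qed
    have V0: "V k z = 0" if "z \<notin> inner_cyl" for k z using that by (simp add: V_def)
    have Vdom: "AE z in lborel. \<bar>V k z\<bar> \<le> \<bar>K * X z\<bar>" for k
      using main by eventually_elim (use V0[of _ k] abs_ge_self order_trans in \<open>fastforce\<close>)
    have KX: "Lp_bound p (K * (C0 * (M * A))) (\<lambda>z. K * X z)"
      using Lp_bound_cmult[OF X(2), of K] K C0 MA by simp
    have Xi: "integrable lborel (\<lambda>z. indicat_real inner_cyl z * X z)"
    proof (rule Lp_bound_integrable(1)[OF _ p(1) ib inner_cyl_finite])
      show "Lp_bound p (C0 * (M * A)) (\<lambda>z. indicat_real inner_cyl z * X z)"
        by (rule Lp_bound_dominated[OF X(2)]) (use p in \<open>auto simp: indicator_def\<close>)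
    qed simp
    have VL: "Lp_bound p (C * A) (V k)" for k
    proof (rule Lp_bound_mono[OF Lp_bound_dominated_AE[OF KX _ Vdom Vm]])
      show "K * (C0 * (M * A)) \<le> C * A" using mult_right_mono[OF C(2), of A] A by (simp add: mult.assoc)
    qed (use p K C0 MA in auto)
    have Vwd: "weak_deriv inner_cyl [e_x k] w (V k)" for k
      unfolding weak_deriv_def
    proof (intro allI impI)
      fix \<psi> :: "'n spacetime \<Rightarrow> real" assume \<psi>: "test_fun inner_cyl \<psi>"
      have \<psi>m[measurable]: "\<psi> \<in> borel_measurable borel" using test_fun_measurable[OF \<psi>, of "[]"] by simp
      obtain P where P: "\<And>z. \<bar>\<psi> z\<bar> \<le> P" using test_fun_bounded[OF \<psi>, of "[]"] by auto
      have \<psi>0: "\<psi> z = 0" if "z \<notin> inner_cyl" for z using test_fun_outside_domain[OF \<psi> that, of "[]"] by simp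
      \<comment> \<open>The pairings with a test function converge to that of \<open>V\<close> by
        dominated convergence and to that of \<open>wx\<close> by the approximate identity; so
        \<open>V\<close> is a weak derivative as well.\<close>
      have "(\<lambda>j. \<integral>z. F k j z * \<psi> z \<partial>lborel) \<longlonglongrightarrow> (\<integral>z. V k z * \<psi> z \<partial>lborel)"
      proof (rule integral_dominated_convergence[where w = "\<lambda>z. K * P * (indicat_real inner_cyl z * X z)"])
        show "AE z in lborel. (\<lambda>j. F k j z * \<psi> z) \<longlonglongrightarrow> V k z * \<psi> z"
          using main
        proof eventually_elim
          case (elim z)
          show ?case
          proof (cases "z \<in> inner_cyl")
            case True
            then show ?thesis using elim by (intro tendsto_mult tendsto_const) blast
          qed (simp add: \<psi>0)
        qed
        show "AE z in lborel. norm (F k j z * \<psi> z) \<le> K * P * (indicat_real inner_cyl z * X z)" for j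
          using main
        proof eventually_elim
          case (elim z)
          show ?case
          proof (cases "z \<in> inner_cyl")
            case True
            then have "\<bar>F k j z\<bar> \<le> K * X z" "0 \<le> X z" using elim by blast+
            then have "\<bar>F k j z\<bar> * \<bar>\<psi> z\<bar> \<le> (K * X z) * P" using K P by (intro mult_mono) auto
            with True show ?thesis by (simp add: abs_mult mult_ac)
          qed (simp add: \<psi>0)
        qed
      qed (use Xi in auto)
      moreover have "(\<lambda>j. \<integral>z. F k j z * \<psi> z \<partial>lborel) \<longlonglongrightarrow> (\<integral>z. wx z $ k * \<psi> z \<partial>lborel)"
        unfolding F_def
      proof (rule mollify_weak_limit[OF _ \<psi>])
        show "integrable lborel (\<lambda>z. wx z $ k)"
          by (rule Lp_bound_integrable(1)[OF L(2) p(1) ob outer_finite]) (use out in simp)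
      qed
      ultimately have eq: "(\<integral>z. V k z * \<psi> z \<partial>lborel) = (\<integral>z. wx z $ k * \<psi> z \<partial>lborel)"
        by (rule LIMSEQ_unique)
      have "inner_cyl \<subseteq> (outer :: 'n spacetime set)" by (auto simp: inner_cyl_def outer_def)
      from test_fun_mono[OF \<psi> this] show "(\<integral>z. w z * dir_derivs [e_x k] \<psi> z \<partial>lborel) =
          (- 1) ^ length [e_x k] * (\<integral>z. V k z * \<psi> z \<partial>lborel)"
        unfolding eq using wd(2)[of k] unfolding weak_deriv_def by blast
    qed
    define vx where "vx z = (\<chi> k. V k z)" for z
    have vxk: "vx z $ k = V k z" for z k by (simp add: vx_def)
    have wgt: "Lp_bound p (C * (U * A powr m)) (\<lambda>z. \<mu> z * norm (vx z) powr m)"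
      if U: "0 < U" and \<mu>: "Lp_bound q U \<mu>" "\<forall>z. 0 \<le> \<mu> z" for \<mu> U
    proof -
      note [measurable] = Lp_bound_measurable[OF \<mu>(1)]
      have \<mu>0: "0 \<le> \<mu> z" for z using \<mu>(2) by blast
      have nm[measurable]: "(\<lambda>z. norm (vx z)) \<in> borel_measurable borel"
        unfolding norm_vec_def L2_set_def vxk by measurable
      let ?c = "(real ?n * K) powr m"
      have dom: "AE z in lborel. \<bar>\<mu> z * norm (vx z) powr m\<bar> \<le> \<bar>?c * (\<mu> z * X z powr m)\<bar>"
        using main
      proof eventually_elim
        case (elim z)
        show ?case
        proof (cases "z \<in> inner_cyl")
          case True
          then have e: "0 \<le> X z" "\<And>k. \<bar>V k z\<bar> \<le> K * X z" using elim by blast+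
          have "norm (vx z) \<le> (\<Sum>k\<in>UNIV. \<bar>vx z $ k\<bar>)" by (rule norm_le_l1_cart)
          also have "\<dots> \<le> (\<Sum>k\<in>(UNIV :: 'n set). K * X z)" unfolding vxk by (rule sum_mono) (rule e)
          also have "\<dots> = real ?n * K * X z" by simp
          finally have "norm (vx z) powr m \<le> (real ?n * K * X z) powr m" using m by (intro powr_mono2) auto
          also have "\<dots> = ?c * X z powr m" using e K by (simp add: powr_mult)
          finally have "\<mu> z * norm (vx z) powr m \<le> \<mu> z * (?c * X z powr m)" by (intro mult_left_mono \<mu>0)
          moreover have "0 \<le> \<mu> z * norm (vx z) powr m" "0 \<le> ?c * (\<mu> z * X z powr m)"
            using \<mu>0[of z] by (auto intro!: mult_nonneg_nonneg)
          moreover have "\<mu> z * (?c * X z powr m) = ?c * (\<mu> z * X z powr m)" by simp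
          ultimately show ?thesis by linarith
        next
          case False
          then have "vx z = 0" by (simp add: vx_def V0 vec_eq_iff)
          then show ?thesis using m by simp
        qed
      qed
      have lb: "Lp_bound p (?c * (C0 * (U * (M * A) powr m))) (\<lambda>z. ?c * (\<mu> z * X z powr m))"
        using Lp_bound_cmult[OF X(3)[OF U \<mu>], of ?c] C0 U by simp
      have "Lp_bound p (?c * (C0 * (U * (M * A) powr m))) (\<lambda>z. \<mu> z * norm (vx z) powr m)"
      proof (rule Lp_bound_dominated_AE[OF lb _ dom])
        show "(\<lambda>z. \<mu> z * norm (vx z) powr m) \<in> borel_measurable borel" by measurable
      qed (use p in simp)
      then show ?thesis
      proof (rule Lp_bound_mono)
        have "?c * (C0 * (U * (M * A) powr m)) = (?c * (C0 * M powr m)) * (U * A powr m)"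
          using M A by (simp add: powr_mult mult_ac)
        also have "\<dots> \<le> C * (U * A powr m)" using C(3) U by (intro mult_right_mono) auto
        finally show "?c * (C0 * (U * (M * A) powr m)) \<le> C * (U * A powr m)" .
      qed (use p C0 U in auto)
    qed
    show "\<exists>vx. (\<forall>k. weak_deriv inner_cyl [e_x k] w (\<lambda>z. vx z $ k)) \<and> (\<forall>k. Lp_bound p (C * A) (\<lambda>z. vx z $ k)) \<and>
      (\<forall>z. z \<notin> inner_cyl \<longrightarrow> vx z = 0) \<and>
      (\<forall>\<mu> U. 0 < U \<longrightarrow> Lp_bound q U \<mu> \<longrightarrow> (\<forall>z. 0 \<le> \<mu> z) \<longrightarrow>
         Lp_bound p (C * (U * A powr m)) (\<lambda>z. \<mu> z * norm (vx z) powr m))"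
    proof (intro exI[of _ vx] conjI)
      show "\<forall>z. z \<notin> inner_cyl \<longrightarrow> vx z = 0" using V0 by (auto simp: vx_def vec_eq_iff)
      show "\<forall>k. weak_deriv inner_cyl [e_x k] w (\<lambda>z. vx z $ k)" unfolding vxk using Vwd by blast
      show "\<forall>k. Lp_bound p (C * A) (\<lambda>z. vx z $ k)" unfolding vxk using VL by blast
    qed (use wgt in blast)
  qed
qed

section \<open>Supersolutions of the superlinear equation\<close>

text \<open>Sum and integral may be exchanged on both sides because the \<open>L^1\<close> norms are
  summable and every derivative of the test function is bounded.\<close>

lemma weak_deriv_suminf:
  fixes w d :: "nat \<Rightarrow> 'a::euclidean_space \<Rightarrow> real"
  assumes w: "\<And>k. integrable lborel (w k)" "summable (\<lambda>k. \<integral>z. \<bar>w k z\<bar> \<partial>lborel)"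
    and d: "\<And>k. integrable lborel (d k)" "summable (\<lambda>k. \<integral>z. \<bar>d k z\<bar> \<partial>lborel)"
    and wd: "\<And>k. weak_deriv U vs (w k) (d k)"
  shows "weak_deriv U vs (\<lambda>z. \<Sum>k. w k z) (\<lambda>z. \<Sum>k. d k z)"
  unfolding weak_deriv_def
proof (intro allI impI)
  fix \<psi> assume \<psi>: "test_fun U \<psi>"
  have gen: "(\<integral>z. (\<Sum>k. f k z) * dir_derivs us \<psi> z \<partial>lborel) = (\<Sum>k. \<integral>z. f k z * dir_derivs us \<psi> z \<partial>lborel)"
      "summable (\<lambda>k. \<integral>z. f k z * dir_derivs us \<psi> z \<partial>lborel)"
    if f: "\<And>k. integrable lborel (f k)" "summable (\<lambda>k. \<integral>z. \<bar>f k z\<bar> \<partial>lborel)" for f :: "nat \<Rightarrow> 'a \<Rightarrow> real" and us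
  proof -
    obtain B where B: "\<And>z. \<bar>dir_derivs us \<psi> z\<bar> \<le> B" using test_fun_bounded[OF \<psi>] by blast
    note [measurable] = test_fun_measurable[OF \<psi>, of us]
    have [measurable]: "f k \<in> borel_measurable borel" for k using f(1)[of k] by simp
    have i: "integrable lborel (\<lambda>z. f k z * dir_derivs us \<psi> z)" for k by (rule test_fun_integrable[OF \<psi> f(1)])
    have le: "(\<integral>z. \<bar>f k z * dir_derivs us \<psi> z\<bar> \<partial>lborel) \<le> B * (\<integral>z. \<bar>f k z\<bar> \<partial>lborel)" for k
    proof -
      have "(\<integral>z. \<bar>f k z * dir_derivs us \<psi> z\<bar> \<partial>lborel) \<le> (\<integral>z. B * \<bar>f k z\<bar> \<partial>lborel)"
      proof (rule integral_mono)
        fix z show "\<bar>f k z * dir_derivs us \<psi> z\<bar> \<le> B * \<bar>f k z\<bar>"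
          using mult_right_mono[OF B[of z], of "\<bar>f k z\<bar>"] by (simp add: abs_mult mult.commute)
      qed (use i[of k] f(1)[of k] in auto)
      then show ?thesis by simp
    qed
    have s: "summable (\<lambda>k. \<integral>z. \<bar>f k z * dir_derivs us \<psi> z\<bar> \<partial>lborel)"
    proof (rule summable_comparison_test'[OF summable_mult[OF f(2), of B], of 0])
      fix k
      have "0 \<le> (\<integral>z. \<bar>f k z * dir_derivs us \<psi> z\<bar> \<partial>lborel)" by (rule Bochner_Integration.integral_nonneg) simp
      then show "norm (\<integral>z. \<bar>f k z * dir_derivs us \<psi> z\<bar> \<partial>lborel) \<le> B * (\<integral>z. \<bar>f k z\<bar> \<partial>lborel)"
        using le[of k] by simp
    qed
    note ser = series_integrable[of lborel "\<lambda>k z. f k z * dir_derivs us \<psi> z", OF i s]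
    have "AE z in lborel. (\<Sum>k. f k z) * dir_derivs us \<psi> z = (\<Sum>k. f k z * dir_derivs us \<psi> z)"
      using series_integrable(1)[of lborel f, OF f]
      by eventually_elim (rule suminf_mult2[OF summable_rabs_cancel])
    then have "(\<integral>z. (\<Sum>k. f k z) * dir_derivs us \<psi> z \<partial>lborel) = (\<integral>z. (\<Sum>k. f k z * dir_derivs us \<psi> z) \<partial>lborel)"
      by (intro integral_cong_AE) measurable
    then show "(\<integral>z. (\<Sum>k. f k z) * dir_derivs us \<psi> z \<partial>lborel) = (\<Sum>k. \<integral>z. f k z * dir_derivs us \<psi> z \<partial>lborel)"
      "summable (\<lambda>k. \<integral>z. f k z * dir_derivs us \<psi> z \<partial>lborel)"
      using ser by auto
  qed
  have eqk: "(\<integral>z. w k z * dir_derivs vs \<psi> z \<partial>lborel) = (- 1) ^ length vs * (\<integral>z. d k z * \<psi> z \<partial>lborel)" for k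
    using wd[of k] \<psi> unfolding weak_deriv_def by blast
  have "(\<integral>z. (\<Sum>k. w k z) * dir_derivs vs \<psi> z \<partial>lborel) = (\<Sum>k. (- 1) ^ length vs * (\<integral>z. d k z * \<psi> z \<partial>lborel))"
    using gen(1)[OF w, of vs] by (simp only: eqk)
  also have "\<dots> = (- 1) ^ length vs * (\<Sum>k. \<integral>z. d k z * \<psi> z \<partial>lborel)"
    using gen(2)[OF d, of "[]"] by (intro suminf_mult) simp
  also have "(\<Sum>k. \<integral>z. d k z * \<psi> z \<partial>lborel) = (\<integral>z. (\<Sum>k. d k z) * \<psi> z \<partial>lborel)"
    using gen(1)[OF d, of "[]"] by simp
  finally show "(\<integral>z. (\<Sum>k. w k z) * dir_derivs vs \<psi> z \<partial>lborel) = (- 1) ^ length vs * (\<integral>z. (\<Sum>k. d k z) * \<psi> z \<partial>lborel)" .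
qed

lemma half_sums: "(\<lambda>k. A * (1 / 2) ^ k) sums (A * 2 :: real)"
  using sums_mult[OF geometric_sums[of "1 / 2 :: real"], of A] by simp

lemma Lp_geometric_summable:
  fixes d :: "nat \<Rightarrow> 'a::euclidean_space \<Rightarrow> real"
  assumes d: "\<And>k. Lp_bound p (A * (1 / 2) ^ k) (d k)" and A: "0 < A" and p: "1 \<le> p"
    and S: "S \<in> sets borel" "emeasure lborel S < \<infinity>" and out: "\<And>k z. z \<notin> S \<Longrightarrow> d k z = 0"
  shows "integrable lborel (d k)" "summable (\<lambda>k. \<integral>z. \<bar>d k z\<bar> \<partial>lborel)"
proof -
  show "integrable lborel (d k)" for k by (rule Lp_bound_integrable(1)[OF d p S out])
  have le: "(\<integral>z. \<bar>d k z\<bar> \<partial>lborel) \<le> A * (1 / 2) ^ k * (measure lborel S + 1)" for k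
    by (rule Lp_bound_integrable(2)[OF d p S out]) (use A in auto)
  show "summable (\<lambda>k. \<integral>z. \<bar>d k z\<bar> \<partial>lborel)"
  proof (rule summable_comparison_test'[OF summable_mult2[OF sums_summable[OF half_sums], of A "measure lborel S + 1"], of 0])
    fix k
    have "0 \<le> (\<integral>z. \<bar>d k z\<bar> \<partial>lborel)" by (rule Bochner_Integration.integral_nonneg) simp
    then show "norm (\<integral>z. \<bar>d k z\<bar> \<partial>lborel) \<le> A * (1 / 2) ^ k * (measure lborel S + 1)" using le[of k] by simp
  qed
qed

text \<open>An inequality, since both the superadditivity of \<open>pucci_minus\<close> and Jensen's
  inequality for the power \<open>m\<close> may lose something when solutions are summed.\<close>

definition super_sol :: "real \<Rightarrow> real \<Rightarrow> real \<Rightarrow> real \<Rightarrow> real \<Rightarrow> ('n::finite spacetime \<Rightarrow> real) \<Rightarrow> ('n spacetime \<Rightarrow> real) \<Rightarrow>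
   ('n spacetime \<Rightarrow> real) \<Rightarrow> ('n spacetime \<Rightarrow> real) \<Rightarrow> ('n spacetime \<Rightarrow> real ^ 'n) \<Rightarrow> ('n spacetime \<Rightarrow> real ^ 'n ^ 'n) \<Rightarrow> bool"
  where
  "super_sol lam Lam p m A f \<mu> w wt wx wxx \<longleftrightarrow>
     w \<in> borel_measurable borel \<and> continuous_on inner_cyl w \<and> (\<forall>z. 0 \<le> w z \<and> w z \<le> A) \<and>
     Lp_bound p A wt \<and> weak_deriv inner_cyl [e_t] w wt \<and>
     (\<forall>k. Lp_bound p A (\<lambda>z. wx z $ k) \<and> weak_deriv inner_cyl [e_x k] w (\<lambda>z. wx z $ k)) \<and>
     (\<forall>k l. Lp_bound p A (\<lambda>z. wxx z $ k $ l) \<and> weak_deriv inner_cyl [e_x k, e_x l] w (\<lambda>z. wxx z $ k $ l)) \<and>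
     (\<forall>z. wxx z \<in> sym_mats) \<and>
     (AE z in lborel. z \<in> inner_cyl \<longrightarrow> f z + \<mu> z * norm (wx z) powr m \<le> wt z + pucci_minus lam Lam (wxx z))"

text \<open>The weights \<open>((1 / 2) ^ Suc k) powr (1 - m)\<close> on the right-hand sides come from Jensen's inequality
  for the power \<open>m\<close> of a series with weights \<open>(1 / 2) ^ Suc k\<close>.\<close>

lemma super_sol_exists:
  fixes lam Lam p1 m p q :: real
  assumes lam: "0 < lam" "lam \<le> Lam" and ABP: "ABP_exponent TYPE('n::finite) lam Lam p1"
    and m: "1 < m" and p: "p1 < p" "1 \<le> p" "p \<le> q"
    and \<beta>: "0 < m - (real CARD('n) + 2) / p * (m - (1 - p / q))"
  shows "\<exists>C>0. \<exists>\<delta>>0. \<forall>(f :: 'n spacetime \<Rightarrow> real) \<mu> K U. 0 < K \<longrightarrow> 0 < U \<longrightarrow> Lp_bound p K f \<longrightarrow> (\<forall>z. 0 \<le> f z) \<longrightarrow>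
     Lp_bound q U \<mu> \<longrightarrow> (\<forall>z. 0 \<le> \<mu> z) \<longrightarrow> U * K powr (m - 1) \<le> \<delta> \<longrightarrow>
     (\<exists>w wt wx wxx. super_sol lam Lam p m (C * K) f \<mu> w wt wx wxx)"
proof -
  obtain C1 where C1: "C1 > 0" "\<forall>(g :: 'n spacetime \<Rightarrow> real) N. Lp_bound p N g \<and> 0 \<le> N \<and> (\<forall>z. 0 \<le> g z) \<longrightarrow>
    (\<exists>w wt wx wxx. local_sol lam Lam p outer (C1 * N) g w wt wx wxx)"
    using ABP_scaled[OF lam ABP p(1)] by (elim exE conjE) (rule that; assumption)
  obtain C2 where C2: "C2 > 0" "\<forall>A g (w :: 'n spacetime \<Rightarrow> real) wt wx wxx. 0 < A \<longrightarrow> local_sol lam Lam p outer A g w wt wx wxx \<longrightarrow>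
    (\<exists>vx. (\<forall>k. weak_deriv inner_cyl [e_x k] w (\<lambda>z. vx z $ k)) \<and> (\<forall>k. Lp_bound p (C2 * A) (\<lambda>z. vx z $ k)) \<and>
      (\<forall>z. z \<notin> inner_cyl \<longrightarrow> vx z = 0) \<and>
      (\<forall>\<mu> U. 0 < U \<longrightarrow> Lp_bound q U \<mu> \<longrightarrow> (\<forall>z. 0 \<le> \<mu> z) \<longrightarrow>
         Lp_bound p (C2 * (U * A powr m)) (\<lambda>z. \<mu> z * norm (vx z) powr m)))"
    using gradient_version[OF p(2,3) m \<beta>, of lam Lam] by (elim exE conjE) (rule that; assumption)
  obtain C3 where C3: "C3 > 0" "\<forall>A (b :: nat \<Rightarrow> 'n spacetime \<Rightarrow> real). 0 \<le> A \<longrightarrow> (\<forall>j. Lp_bound p (A * (1 / 2) ^ j) (b j)) \<longrightarrow>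
    (AE z in lborel. summable (\<lambda>j. \<bar>b j z\<bar>)) \<and> Lp_bound p (C3 * A) (\<lambda>z. \<Sum>j. \<bar>b j z\<bar>)"
  proof -
    have h: "0 < (1 / 2 :: real)" "1 / 2 < (1 :: real)" by simp_all
    show ?thesis using Lp_bound_series[OF p(2) h] by (elim exE conjE) (rule that; assumption)
  qed
  \<comment> \<open>Makes the bounds on the right-hand sides halve at each step: under the smallness
    condition the ratio of consecutive ones is at most
    \<open>(1 / 2) powr (1 - m) / 2 powr m\<close>, which is 1/2.\<close>
  define \<delta> where "\<delta> = 1 / (2 powr m * (C2 * C1 powr m))"
  have \<delta>: "\<delta> > 0" using C1(1) C2(1) by (simp add: \<delta>_def)
  define C where "C = C1 * 2 + C3 * C1 + C3 * (C2 * C1)"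
  have C: "C > 0" "C1 * 2 \<le> C" "C3 * C1 \<le> C" "C3 * (C2 * C1) \<le> C"
    using C1(1) C2(1) C3(1) by (auto simp: C_def add_pos_pos)
  show ?thesis
  proof (rule exI[of _ C], rule conjI[OF C(1)], rule exI[of _ \<delta>], rule conjI[OF \<delta>], intro allI impI)
    fix f \<mu> :: "'n spacetime \<Rightarrow> real" and K U :: real
    assume K: "0 < K" and U: "0 < U" and f: "Lp_bound p K f" "\<forall>z. 0 \<le> f z"
      and \<mu>: "Lp_bound q U \<mu>" "\<forall>z. 0 \<le> \<mu> z" and small: "U * K powr (m - 1) \<le> \<delta>"
    have \<mu>0: "0 \<le> \<mu> z" for z using \<mu>(2) by blast
    \<comment> \<open>The gradient version \<open>vx\<close> with the weighted estimate takes over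
      from the one delivered with the solution, which survives only under the quantifier.\<close>
    let ?R = "\<lambda>g N s. case s of (w, wt, vx, wxx) \<Rightarrow>
      (\<exists>wx. local_sol lam Lam p outer (C1 * N) g w wt wx wxx) \<and>
      (\<forall>k. weak_deriv inner_cyl [e_x k] w (\<lambda>z. vx z $ k)) \<and> (\<forall>k. Lp_bound p (C2 * (C1 * N)) (\<lambda>z. vx z $ k)) \<and>
      (\<forall>z. z \<notin> inner_cyl \<longrightarrow> vx z = 0) \<and>
      Lp_bound p (C2 * (U * (C1 * N) powr m)) (\<lambda>z. \<mu> z * norm (vx z) powr m)"
    \<comment> \<open>Solving becomes a total function of the right-hand side and its bound, so that
      the iteration can be defined by recursion before its invariant is proved.\<close>
    have "\<forall>gN. \<exists>s. Lp_bound p (snd gN) (fst gN) \<and> 0 < snd gN \<and> (\<forall>z. 0 \<le> fst gN z) \<longrightarrow> ?R (fst gN) (snd gN) s"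
    proof
      fix gN :: "('n spacetime \<Rightarrow> real) \<times> real"
      show "\<exists>s. Lp_bound p (snd gN) (fst gN) \<and> 0 < snd gN \<and> (\<forall>z. 0 \<le> fst gN z) \<longrightarrow> ?R (fst gN) (snd gN) s"
      proof (cases "Lp_bound p (snd gN) (fst gN) \<and> 0 < snd gN \<and> (\<forall>z. 0 \<le> fst gN z)")
        case True
        then have "Lp_bound p (snd gN) (fst gN) \<and> 0 \<le> snd gN \<and> (\<forall>z. 0 \<le> fst gN z)" by (simp add: less_imp_le)
        then obtain w wt wx wxx where sol: "local_sol lam Lam p outer (C1 * snd gN) (fst gN) w wt wx wxx"
          using C1(2) by blast
        have pos: "0 < C1 * snd gN" using True C1(1) by simp
        obtain vx where "(\<forall>k. weak_deriv inner_cyl [e_x k] w (\<lambda>z. vx z $ k)) \<and> (\<forall>k. Lp_bound p (C2 * (C1 * snd gN)) (\<lambda>z. vx z $ k)) \<and>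
            (\<forall>z. z \<notin> inner_cyl \<longrightarrow> vx z = 0) \<and>
            (\<forall>\<mu> U. 0 < U \<longrightarrow> Lp_bound q U \<mu> \<longrightarrow> (\<forall>z. 0 \<le> \<mu> z) \<longrightarrow>
              Lp_bound p (C2 * (U * (C1 * snd gN) powr m)) (\<lambda>z. \<mu> z * norm (vx z) powr m))"
          using C2(2)[THEN spec, THEN spec, THEN spec, THEN spec, THEN spec, THEN spec, THEN mp, OF pos, THEN mp, OF sol] by (rule exE)
        with sol U \<mu> have "?R (fst gN) (snd gN) (w, wt, vx, wxx)" unfolding prod.case by blast
        then show ?thesis by blast
      qed blast
    qed
    then have "\<exists>S. \<forall>gN. Lp_bound p (snd gN) (fst gN) \<and> 0 < snd gN \<and> (\<forall>z. 0 \<le> fst gN z) \<longrightarrow> ?R (fst gN) (snd gN) (S gN)"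
      by (rule choice)
    then obtain S where S: "\<forall>gN. Lp_bound p (snd gN) (fst gN) \<and> 0 < snd gN \<and> (\<forall>z. 0 \<le> fst gN z) \<longrightarrow> ?R (fst gN) (snd gN) (S gN)"
      by (rule exE)
    define Nk where "Nk k = K * (1 / 2) ^ k" for k
    have Nk: "0 < Nk k" for k using K by (simp add: Nk_def)
    define ck where "ck k = ((1 / 2 :: real) ^ Suc k) powr (1 - m)" for k
    have ck: "0 < ck k" for k by (simp add: ck_def)
    \<comment> \<open>The factor \<open>ck k\<close> enlarges the superlinear term in advance: it is
      what the passage from the sum of the powers to the power of the sum will cost.\<close>
    define G where "G = rec_nat f (\<lambda>k g z. ck k * (\<mu> z * norm (fst (snd (snd (S (g, Nk k)))) z) powr m))"
    define w where "w k = fst (S (G k, Nk k))" for k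
    define wt where "wt k = fst (snd (S (G k, Nk k)))" for k
    define vx where "vx k = fst (snd (snd (S (G k, Nk k))))" for k
    define wxx where "wxx k = snd (snd (snd (S (G k, Nk k))))" for k
    have G0: "G 0 = f" by (simp add: G_def)
    have GS: "G (Suc k) = (\<lambda>z. ck k * (\<mu> z * norm (vx k z) powr m))" for k
      by (simp add: G_def vx_def)
    have Skdef: "S (G k, Nk k) = (w k, wt k, vx k, wxx k)" for k by (simp add: w_def wt_def vx_def wxx_def)
    have step: "?R (G k) (Nk k) (w k, wt k, vx k, wxx k)" if "Lp_bound p (Nk k) (G k)" "\<forall>z. 0 \<le> G k z" for k
      using S[THEN spec, of "(G k, Nk k)"] that Nk[of k] unfolding Skdef fst_conv snd_conv by blast
    have inv: "Lp_bound p (Nk k) (G k) \<and> (\<forall>z. 0 \<le> G k z)" for k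
    proof (induction k)
      case 0
      then show ?case using f by (simp add: G0 Nk_def)
    next
      case (Suc k)
      then have R: "Lp_bound p (C2 * (U * (C1 * Nk k) powr m)) (\<lambda>z. \<mu> z * norm (vx k z) powr m)"
        using step[of k] unfolding prod.case by blast
      have LG: "Lp_bound p (ck k * (C2 * (U * (C1 * Nk k) powr m))) (G (Suc k))"
        unfolding GS using Lp_bound_cmult[OF R, of "ck k"] ck[of k] C2(1) U by simp
      have leN: "ck k * (C2 * (U * (C1 * Nk k) powr m)) \<le> Nk (Suc k)"
      proof -
        let ?h = "(1 / 2 :: real) ^ k"
        have h: "?h > 0" by simp
        have "ck k = (1 / 2) powr (1 - m) * ?h powr (1 - m)"
          unfolding ck_def power_Suc by (subst powr_mult) auto
        moreover have "(C1 * Nk k) powr m = C1 powr m * (K powr m * ?h powr m)"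
          using C1(1) K by (simp add: Nk_def powr_mult)
        ultimately have "ck k * (C2 * (U * (C1 * Nk k) powr m)) =
            (1 / 2) powr (1 - m) * (C2 * C1 powr m) * (U * K powr m) * (?h powr (1 - m) * ?h powr m)" by simp
        also have "?h powr (1 - m) * ?h powr m = ?h" using h by (simp flip: powr_add)
        also have "K powr m = K * K powr (m - 1)" using K by (simp add: powr_diff)
        also have "(1 / 2) powr (1 - m) * (C2 * C1 powr m) * (U * (K * K powr (m - 1))) * ?h =
            ((1 / 2) powr (1 - m) * (C2 * C1 powr m)) * (U * K powr (m - 1)) * (K * ?h)" by simp
        also have "\<dots> \<le> ((1 / 2) powr (1 - m) * (C2 * C1 powr m)) * \<delta> * (K * ?h)"
          using small C1(1) C2(1) K by (intro mult_right_mono mult_left_mono) auto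
        also have "\<dots> = (1 / 2) powr (1 - m) / 2 powr m * (K * ?h)"
          using C1(1) C2(1) by (simp add: \<delta>_def)
        also have "(1 / 2) powr (1 - m) / 2 powr m = (1 / 2 :: real)"
        proof -
          have h2: "(1 / 2 :: real) powr (1 - m) = 2 powr (m - 1)" by (simp add: powr_divide powr_diff)
          show ?thesis unfolding h2 by (simp add: powr_diff)
        qed
        finally show ?thesis by (simp add: Nk_def)
      qed
      have "Lp_bound p (Nk (Suc k)) (G (Suc k))"
        by (rule Lp_bound_mono[OF LG _ leN]) (use ck[of k] C2(1) U p in auto)
      moreover have "\<forall>z. 0 \<le> G (Suc k) z"
        unfolding GS by (intro allI mult_nonneg_nonneg less_imp_le[OF ck] \<mu>0 powr_ge_zero)
      ultimately show ?case by blast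
    qed
    have GL: "Lp_bound p (K * (1 / 2) ^ k) (G k)" and Gn: "0 \<le> G k z" for k z
      using inv[of k] unfolding Nk_def by blast+
    have R: "?R (G k) (Nk k) (w k, wt k, vx k, wxx k)" for k using step[of k] inv[of k] by blast
    have sol: "\<exists>wx. local_sol lam Lam p outer (C1 * Nk k) (G k) (w k) (wt k) wx (wxx k)" for k
      using R[of k] unfolding prod.case by blast
    have vwd: "weak_deriv inner_cyl [e_x i] (w k) (\<lambda>z. vx k z $ i)" for k i
      using R[of k] unfolding prod.case by blast
    have vL: "Lp_bound p (C2 * C1 * K * (1 / 2) ^ k) (\<lambda>z. vx k z $ i)" for k i
      using R[of k] unfolding prod.case Nk_def by (simp add: mult.assoc)
    have vout: "z \<notin> inner_cyl \<Longrightarrow> vx k z = 0" for k z using R[of k] unfolding prod.case by blast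
    have sub: "(inner_cyl :: 'n spacetime set) \<subseteq> outer" by (auto simp: inner_cyl_def outer_def)
    have A: "C1 * Nk k = C1 * K * (1 / 2) ^ k" for k by (simp add: Nk_def)
    have sols: "w k \<in> borel_measurable borel" "continuous_on outer (w k)" "\<forall>z. 0 \<le> w k z \<and> w k z \<le> C1 * K * (1 / 2) ^ k"
      "\<forall>z. z \<notin> outer \<longrightarrow> w k z = 0 \<and> wt k z = 0 \<and> wxx k z = 0"
      "Lp_bound p (C1 * K * (1 / 2) ^ k) (wt k)" "weak_deriv outer [e_t] (w k) (wt k)"
      "\<forall>i j. Lp_bound p (C1 * K * (1 / 2) ^ k) (\<lambda>z. wxx k z $ i $ j) \<and> weak_deriv outer [e_x i, e_x j] (w k) (\<lambda>z. wxx k z $ i $ j)"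
      "\<forall>z. wxx k z \<in> sym_mats"
      "AE z in lborel. z \<in> outer \<longrightarrow> wt k z + pucci_minus lam Lam (wxx k z) = G k z" for k
      using sol[of k] unfolding local_sol_def A by blast+
    have C1K: "0 < C1 * K" "0 < C2 * C1 * K" using C1(1) C2(1) K by auto
    have ob: "(outer :: 'n spacetime set) \<in> sets borel" by (rule borel_open[OF open_outer])
    have ib: "(inner_cyl :: 'n spacetime set) \<in> sets borel" by (rule borel_open[OF open_inner_cyl])
    note [measurable] = sols(1) sols(5)[THEN Lp_bound_measurable] vL[THEN Lp_bound_measurable]
    have xxL: "Lp_bound p (C1 * K * (1 / 2) ^ k) (\<lambda>z. wxx k z $ i $ j)"
      and xxwd: "weak_deriv outer [e_x i, e_x j] (w k) (\<lambda>z. wxx k z $ i $ j)" for k i j using sols(7)[of k] by blast+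
    note [measurable] = xxL[THEN Lp_bound_measurable]
    have outz: "w k z = 0" "wt k z = 0" "wxx k z = 0" if "z \<notin> outer" for k z using sols(4)[of k] that by blast+
    have ti: "integrable lborel (wt k)" "summable (\<lambda>k. \<integral>z. \<bar>wt k z\<bar> \<partial>lborel)" for k
      by (rule Lp_geometric_summable[OF sols(5) C1K(1) p(2) ob outer_finite], erule outz)+
    have xi: "integrable lborel (\<lambda>z. vx k z $ i)" "summable (\<lambda>k. \<integral>z. \<bar>vx k z $ i\<bar> \<partial>lborel)" for k i
      by (rule Lp_geometric_summable[OF vL C1K(2) p(2) ib inner_cyl_finite], simp add: vout)+
    have xxi: "integrable lborel (\<lambda>z. wxx k z $ i $ j)" "summable (\<lambda>k. \<integral>z. \<bar>wxx k z $ i $ j\<bar> \<partial>lborel)" for k i j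
      by (rule Lp_geometric_summable[OF xxL C1K(1) p(2) ob outer_finite], simp add: outz)+
    have wi: "integrable lborel (w k)" "summable (\<lambda>k. \<integral>z. \<bar>w k z\<bar> \<partial>lborel)" for k
    proof -
      let ?i = "indicat_real (outer :: 'n spacetime set)"
      have ii: "integrable lborel (\<lambda>z. c * ?i z)" for c
        using outer_finite[where 'n='n] ob by (simp add: integrable_indicator_iff)
      have le: "\<bar>w k z\<bar> \<le> C1 * K * (1 / 2) ^ k * ?i z" for k z
        using sols(3)[of k, THEN spec, of z] outz(1)[of z k] by (cases "z \<in> outer") auto
      show wint: "integrable lborel (w k)" for k by (rule integrable_abs_le[OF ii _ le]) simp
      have "(\<integral>z. \<bar>w k z\<bar> \<partial>lborel) \<le> C1 * K * (1 / 2) ^ k * measure lborel (outer :: 'n spacetime set)" for k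
      proof -
        have "(\<integral>z. \<bar>w k z\<bar> \<partial>lborel) \<le> (\<integral>z. C1 * K * (1 / 2) ^ k * ?i z \<partial>lborel)"
          by (rule integral_mono[OF _ ii le]) (use wint in simp)
        then show ?thesis using ob by simp
      qed
      moreover have "0 \<le> (\<integral>z. \<bar>w k z\<bar> \<partial>lborel)" for k by (rule Bochner_Integration.integral_nonneg) simp
      ultimately show "summable (\<lambda>k. \<integral>z. \<bar>w k z\<bar> \<partial>lborel)"
        by (intro summable_comparison_test'[OF summable_mult2[OF sums_summable[OF half_sums], of "C1 * K" "measure lborel (outer :: 'n spacetime set)"], of 0])
          simp
    qed
    define W where "W z = (\<Sum>k. w k z)" for z
    define Wt where "Wt z = (\<Sum>k. wt k z)" for z
    define Wx where "Wx z = (\<chi> i. \<Sum>k. vx k z $ i)" for z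
    define Wxx where "Wxx z = (\<chi> i j. \<Sum>k. wxx k z $ i $ j)" for z
    have wb: "0 \<le> w k z" "w k z \<le> C1 * K * (1 / 2) ^ k" for k z using sols(3)[of k] by blast+
    have ws: "summable (\<lambda>k. w k z)" for z
      by (rule summable_comparison_test'[OF sums_summable[OF half_sums[of "C1 * K"]], of 0]) (use wb in simp)
    have Wb: "0 \<le> W z \<and> W z \<le> C * K" for z
    proof
      show "0 \<le> W z" unfolding W_def using ws wb by (intro suminf_nonneg) auto
      have "W z \<le> (\<Sum>k. C1 * K * (1 / 2) ^ k)"
        unfolding W_def by (rule suminf_le[OF _ ws sums_summable[OF half_sums]]) (rule wb)
      also have "\<dots> = C1 * K * 2" using half_sums[of "C1 * K"] by (simp add: sums_iff)
      also have "\<dots> \<le> C * K" using mult_right_mono[OF C(2), of K] K by simp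
      finally show "W z \<le> C * K" .
    qed
    have Wc: "continuous_on inner_cyl W"
    proof -
      have "uniform_limit inner_cyl (\<lambda>i z. \<Sum>k<i. w k z) (\<lambda>z. \<Sum>k. w k z) sequentially"
        by (rule Weierstrass_m_test[OF _ sums_summable[OF half_sums[of "C1 * K"]]]) (use wb in simp)
      moreover have "continuous_on inner_cyl (\<lambda>z. \<Sum>k<i. w k z)" for i
        by (intro continuous_on_sum continuous_on_subset[OF sols(2) sub])
      ultimately show ?thesis unfolding W_def
        by (intro uniform_limit_theorem[where F = sequentially]) auto
    qed
    have sumL: "(AE z in lborel. summable (\<lambda>j. \<bar>b j z\<bar>)) \<and> Lp_bound p (C3 * A) (\<lambda>z. \<Sum>j. b j z)"
      if b: "\<And>j. Lp_bound p (A * (1 / 2) ^ j) (b j)" and A: "0 < A" for A and b :: "nat \<Rightarrow> 'n spacetime \<Rightarrow> real"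
    proof -
      have [measurable]: "b j \<in> borel_measurable borel" for j by (rule Lp_bound_measurable[OF b])
      have *: "AE z in lborel. summable (\<lambda>j. \<bar>b j z\<bar>)" "Lp_bound p (C3 * A) (\<lambda>z. \<Sum>j. \<bar>b j z\<bar>)"
        using C3(2)[THEN spec, THEN spec, THEN mp, OF less_imp_le[OF A], THEN mp, OF allI, OF b] by blast+
      have "AE z in lborel. \<bar>\<Sum>j. b j z\<bar> \<le> \<bar>\<Sum>j. \<bar>b j z\<bar>\<bar>"
        using *(1) by eventually_elim (rule order_trans[OF summable_rabs abs_ge_self])
      then have "Lp_bound p (C3 * A) (\<lambda>z. \<Sum>j. b j z)"
        by (intro Lp_bound_dominated_AE[OF *(2)]) (use p in auto)
      with * show ?thesis by blast
    qed
    have C3K: "C3 * (C1 * K) \<le> C * K" "C3 * (C2 * C1 * K) \<le> C * K" "0 \<le> C3 * (C1 * K)" "0 \<le> C3 * (C2 * C1 * K)"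
      using mult_right_mono[OF C(3), of K] mult_right_mono[OF C(4), of K] K C1(1) C2(1) C3(1) by (auto simp: mult.assoc)
    have p0: "0 \<le> p" using p(2) by simp
    have L1: "Lp_bound p (C * K) Wt"
      unfolding Wt_def using sumL[of "C1 * K" wt, OF sols(5) C1K(1)] C3K p0 Lp_bound_mono by blast
    have L2: "Lp_bound p (C * K) (\<lambda>z. Wx z $ i)" for i
      unfolding Wx_def vec_lambda_beta using sumL[of "C2 * C1 * K" "\<lambda>k z. vx k z $ i", OF vL C1K(2)] C3K p0 Lp_bound_mono by blast
    have L3: "Lp_bound p (C * K) (\<lambda>z. Wxx z $ i $ j)" for i j
      unfolding Wxx_def vec_lambda_beta using sumL[of "C1 * K" "\<lambda>k z. wxx k z $ i $ j", OF xxL C1K(1)] C3K p0 Lp_bound_mono by blast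
    have D1: "weak_deriv inner_cyl [e_t] W Wt"
      unfolding W_def Wt_def by (rule weak_deriv_suminf[OF wi ti weak_deriv_mono[OF sols(6) sub]])
    have D2: "weak_deriv inner_cyl [e_x i] W (\<lambda>z. Wx z $ i)" for i
      unfolding W_def Wx_def vec_lambda_beta by (rule weak_deriv_suminf[OF wi xi vwd])
    have D3: "weak_deriv inner_cyl [e_x i, e_x j] W (\<lambda>z. Wxx z $ i $ j)" for i j
      unfolding W_def Wxx_def vec_lambda_beta by (rule weak_deriv_suminf[OF wi xxi weak_deriv_mono[OF xxwd sub]])
    have symW: "Wxx z \<in> sym_mats" for z
    proof -
      have "wxx k z $ i $ j = wxx k z $ j $ i" for k i j
      proof -
        have t: "transpose (wxx k z) = wxx k z" using sols(8)[of k, THEN spec, of z] unfolding sym_mats_def by (rule CollectD)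
        have "wxx k z $ i $ j = transpose (wxx k z) $ j $ i" by (simp add: transpose_def)
        then show ?thesis unfolding t .
      qed
      then show ?thesis unfolding sym_mats_def Wxx_def by (simp add: transpose_def vec_eq_iff)
    qed
    have pde: "AE z in lborel. z \<in> inner_cyl \<longrightarrow> f z + \<mu> z * norm (Wx z) powr m \<le> Wt z + pucci_minus lam Lam (Wxx z)"
    proof -
      have 1: "AE z in lborel. \<forall>k. z \<in> outer \<longrightarrow> wt k z + pucci_minus lam Lam (wxx k z) = G k z"
        by (intro AE_all_countable[THEN iffD2] allI sols(9))
      have 2: "AE z in lborel. summable (\<lambda>k. \<bar>wt k z\<bar>)" using sumL[of "C1 * K" wt, OF sols(5) C1K(1)] by blast
      have 3: "AE z in lborel. \<forall>i j. summable (\<lambda>k. \<bar>wxx k z $ i $ j\<bar>)"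
        by (intro AE_all_countable[THEN iffD2] allI conjunct1[OF sumL[of "C1 * K", OF xxL C1K(1)]])
      have 4: "AE z in lborel. summable (\<lambda>k. \<bar>G k z\<bar>)" using sumL[of K G, OF GL K] by blast
      from 1 2 3 4 show ?thesis
      proof eventually_elim
        case (elim z)
        show ?case
        proof
          assume "z \<in> inner_cyl"
          then have zo: "z \<in> outer" using sub by blast
          have sG: "summable (\<lambda>k. G k z)" by (rule summable_rabs_cancel[OF elim(4)])
          have st: "summable (\<lambda>k. wt k z)" by (rule summable_rabs_cancel[OF elim(2)])
          have "(\<lambda>k. G k z - wt k z) sums ((\<Sum>k. G k z) - Wt z)"
            unfolding Wt_def by (rule sums_diff[OF summable_sums[OF sG] summable_sums[OF st]])
          moreover have "G k z - wt k z = pucci_minus lam Lam (wxx k z)" for k using elim(1) zo by (simp add: algebra_simps)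
          ultimately have "(\<lambda>k. pucci_minus lam Lam (wxx k z)) sums ((\<Sum>k. G k z) - Wt z)" by (simp only:)
          moreover have "(\<lambda>k. wxx k z $ i $ j) sums (Wxx z $ i $ j)" for i j
            unfolding Wxx_def vec_lambda_beta
            by (rule summable_sums, rule summable_rabs_cancel, rule elim(3)[THEN spec, THEN spec])
          \<comment> \<open>By superadditivity of \<open>pucci_minus\<close>, adding up the
            equations gives an inequality in the right direction.\<close>
          ultimately have "(\<Sum>k. G k z) - Wt z \<le> pucci_minus lam Lam (Wxx z)"
            by (rule pucci_minus_sums[OF lam, rotated])
          moreover have "f z + \<mu> z * norm (Wx z) powr m \<le> (\<Sum>k. G k z)"
          proof -
            \<comment> \<open>The head of the series is \<open>f\<close>, and the tail is
              \<open>\<mu> z\<close> times the Jensen bound for the power of the summed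
              gradient.\<close>
            have split: "(\<Sum>k. G k z) = f z + (\<Sum>k. G (Suc k) z)"
              using suminf_split_head[OF sG] by (simp add: G0)
            have sG1: "summable (\<lambda>k. G (Suc k) z)" using summable_Suc_iff[of "\<lambda>k. G k z"] sG by blast
            have "\<mu> z * norm (Wx z) powr m \<le> (\<Sum>k. G (Suc k) z)"
            proof (cases "\<mu> z = 0")
              case True
              then show ?thesis using suminf_nonneg[OF sG1] Gn by simp
            next
              case False
              then have mz: "\<mu> z > 0" using \<mu>0[of z] by linarith
              have eq: "inverse (\<mu> z) * G (Suc k) z = ((1 / 2) ^ Suc k) powr (1 - m) * norm (vx k z) powr m" for k
                using mz by (simp add: GS ck_def)
              have sx: "summable (\<lambda>k. ((1 / 2 :: real) ^ Suc k) powr (1 - m) * norm (vx k z) powr m)"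
                using summable_mult[OF sG1, of "inverse (\<mu> z)"] by (simp only: eq)
              have as: "(\<lambda>k. (1 / 2 :: real) ^ Suc k) sums 1"
                using half_sums[of "1 / 2"] by simp
              have J: "summable (\<lambda>k. norm (vx k z))"
                "(\<Sum>k. norm (vx k z)) powr m \<le> (\<Sum>k. ((1 / 2 :: real) ^ Suc k) powr (1 - m) * norm (vx k z) powr m)"
                using powr_suminf_le[OF _ _ as _ sx] m by auto
              have sv: "summable (\<lambda>k. vx k z)" by (rule summable_norm_cancel[OF J(1)])
              have "Wx z = (\<Sum>k. vx k z)"
                unfolding Wx_def vec_eq_iff vec_lambda_beta
                using bounded_linear.suminf[OF bounded_linear_vec_nth sv] by simp
              then have "norm (Wx z) \<le> (\<Sum>k. norm (vx k z))" using summable_norm[OF J(1)] by simp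
              then have "norm (Wx z) powr m \<le> (\<Sum>k. norm (vx k z)) powr m" using m by (intro powr_mono2) auto
              also note J(2)
              also have "(\<Sum>k. ((1 / 2 :: real) ^ Suc k) powr (1 - m) * norm (vx k z) powr m) = inverse (\<mu> z) * (\<Sum>k. G (Suc k) z)"
                unfolding suminf_mult[OF sG1, symmetric] eq ..
              finally show ?thesis using mz by (simp add: field_simps)
            qed
            with split show ?thesis by simp
          qed
          ultimately show "f z + \<mu> z * norm (Wx z) powr m \<le> Wt z + pucci_minus lam Lam (Wxx z)" by linarith
        qed
      qed
    qed
    have Wm: "W \<in> borel_measurable borel" unfolding W_def by measurable
    have "super_sol lam Lam p m (C * K) f \<mu> W Wt Wx Wxx"
      unfolding super_sol_def using Wm Wc Wb L1 D1 L2 D2 L3 D3 symW pde by blast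
    then show "\<exists>w wt wx wxx. super_sol lam Lam p m (C * K) f \<mu> w wt wx wxx" by blast
  qed
qed

section \<open>Comparison with a supersolution\<close>

lemma integrable_lborel_lebesgue_on:
  fixes g :: "'a::euclidean_space \<Rightarrow> real"
  assumes g: "integrable lborel g" and S: "S \<in> sets lebesgue" and eq: "\<And>z. z \<in> S \<Longrightarrow> f z = g z"
  shows "integrable (lebesgue_on S) f"
proof -
  have "integrable lebesgue g" using g by (simp add: integrable_completion)
  then have "integrable lebesgue (\<lambda>z. indicat_real S z *\<^sub>R g z)" by (rule integrable_mult_indicator[OF S])
  then have "integrable (lebesgue_on S) g" using S by (simp add: integrable_restrict_space)
  then show ?thesis by (rule Bochner_Integration.integrable_cong[THEN iffD1, rotated -1]) (auto simp: eq)
qed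

lemma borel_imp_lebesgue_on:
  fixes f :: "'a::euclidean_space \<Rightarrow> real"
  shows "f \<in> borel_measurable borel \<Longrightarrow> f \<in> borel_measurable (lebesgue_on S)"
  by (intro measurable_restrict_space1 measurable_completion) simp

lemma super_sol_W21_loc:
  fixes w :: "'n::finite spacetime \<Rightarrow> real"
  assumes sol: "super_sol lam Lam p m A f \<mu> w wt wx wxx" and sub: "cyl \<Omega> T \<subseteq> inner_cyl" and p: "1 \<le> p"
  shows "W21_loc p \<Omega> T w wt wx wxx"
  unfolding W21_loc_def
proof (intro allI impI)
  fix Q' assume "psubset_in Q' \<Omega> T"
  then have Q: "Q' \<subseteq> inner_cyl" and neg: "negligible (Q' - interior Q')" using sub by (auto simp: psubset_in_def)
  \<comment> \<open>An admissible subregion differs from an open set by a null set, which gives its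
    measurability.\<close>
  have "interior Q' \<in> sets lebesgue" "Q' - interior Q' \<in> sets lebesgue"
    using neg by (auto simp: negligible_iff_null_sets null_sets_def)
  then have "interior Q' \<union> (Q' - interior Q') \<in> sets lebesgue" by (rule sets.Un)
  moreover have "interior Q' \<union> (Q' - interior Q') = Q'" using interior_subset[of Q'] by blast
  ultimately have QL: "Q' \<in> sets lebesgue" by simp
  have wm: "w \<in> borel_measurable borel" and wb: "\<forall>z. 0 \<le> w z \<and> w z \<le> A"
    and t: "Lp_bound p A wt" "weak_deriv inner_cyl [e_t] w wt"
    and x: "\<forall>k. Lp_bound p A (\<lambda>z. wx z $ k) \<and> weak_deriv inner_cyl [e_x k] w (\<lambda>z. wx z $ k)"
    and xx: "\<forall>k l. Lp_bound p A (\<lambda>z. wxx z $ k $ l) \<and> weak_deriv inner_cyl [e_x k, e_x l] w (\<lambda>z. wxx z $ k $ l)"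
    using sol unfolding super_sol_def by blast+
  note [measurable] = wm
  have ib[measurable]: "(inner_cyl :: 'n spacetime set) \<in> sets borel" by (rule borel_open[OF open_inner_cyl])
  have ii: "integrable lborel (\<lambda>z. c * indicat_real (inner_cyl :: 'n spacetime set) z)" for c :: real
    using inner_cyl_finite[where 'n='n] ib by (simp add: integrable_indicator_iff)
  have wi: "integrable lborel (\<lambda>z. indicat_real inner_cyl z * w z)"
  proof (rule integrable_abs_le[OF ii[of A]])
    fix z show "\<bar>indicat_real inner_cyl z * w z\<bar> \<le> A * indicat_real inner_cyl z"
      using wb[THEN spec, of z] by (auto simp: indicator_def)
  qed simp
  have wpi: "integrable lborel (\<lambda>z. indicat_real inner_cyl z * \<bar>w z\<bar> powr p)"
  proof (rule integrable_abs_le[OF ii[of "A powr p"]])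
    fix z show "\<bar>indicat_real inner_cyl z * \<bar>w z\<bar> powr p\<bar> \<le> A powr p * indicat_real inner_cyl z"
      using wb[THEN spec, of z] powr_mono2[of p "w z" A] p by (auto simp: indicator_def)
  qed simp
  have Lpw: "Lp_on p Q' w"
    unfolding Lp_on_def using borel_imp_lebesgue_on[OF wm] integrable_lborel_lebesgue_on[OF wpi QL, of "\<lambda>z. \<bar>w z\<bar> powr p"] Q
    by (auto simp: indicator_def subset_iff)
  have Lp: "Lp_on p Q' d" if d: "Lp_bound p A d" for d
    unfolding Lp_on_def using borel_imp_lebesgue_on[OF Lp_bound_measurable[OF d]]
      integrable_lborel_lebesgue_on[OF _ QL, of "\<lambda>z. \<bar>d z\<bar> powr p" "\<lambda>z. \<bar>d z\<bar> powr p"] d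
    by (auto simp: Lp_bound_def)
  have loc: "locally_integrable (interior Q') d" if "integrable lborel (\<lambda>z. indicat_real inner_cyl z * d z)" for d
    unfolding locally_integrable_def
  proof (intro allI impI)
    fix K assume K: "compact K \<and> K \<subseteq> interior Q'"
    show "integrable (lebesgue_on K) d"
    proof (rule integrable_lborel_lebesgue_on[OF that])
      have "K \<in> sets borel" using K by (intro borel_compact) blast
      then show "K \<in> sets lebesgue" by simp
      fix z assume "z \<in> K"
      then have "z \<in> inner_cyl" using K Q interior_subset[of Q'] by blast
      then show "d z = indicat_real inner_cyl z * d z" by simp
    qed
  qed
  have di: "integrable lborel (\<lambda>z. indicat_real inner_cyl z * d z)" if d: "Lp_bound p A d" for d :: "'n spacetime \<Rightarrow> real"
  proof (rule Lp_bound_integrable(1)[OF _ p ib inner_cyl_finite])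
    note [measurable] = Lp_bound_measurable[OF d]
    show "Lp_bound p A (\<lambda>z. indicat_real inner_cyl z * d z)"
      by (rule Lp_bound_dominated[OF d]) (use p in \<open>auto simp: indicator_def\<close>)
  qed simp
  have wd: "has_weak_deriv (interior Q') vs w d" if d: "Lp_bound p A d" "weak_deriv inner_cyl vs w d" for vs d
    by (rule weak_deriv_imp_has_weak_deriv[OF d(2) _ open_interior wm Lp_bound_measurable[OF d(1)] loc[OF wi] loc[OF di[OF d(1)]]])
      (use Q interior_subset[of Q'] in blast)
  show "W21 p Q' w wt wx wxx"
    unfolding W21_def using Lpw t x xx Lp wd by blast
qed

section \<open>Essential infima over shrinking cylinders\<close>

lemma ess_inf_antimono:
  assumes "S \<subseteq> S'" "S \<in> sets lebesgue" "S' \<in> sets lebesgue"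
  shows "ess_inf S' h \<le> ess_inf S h"
  unfolding ess_inf_def
proof (rule Sup_subset_mono, rule Collect_mono, rule impI)
  fix c assume "AE z in lebesgue_on S'. c \<le> ereal (h z)"
  then have "AE z in lebesgue. z \<in> S' \<longrightarrow> c \<le> ereal (h z)" using assms(3) by (simp add: AE_restrict_space_iff)
  then have "AE z in lebesgue. z \<in> S \<longrightarrow> c \<le> ereal (h z)" by eventually_elim (use assms(1) in blast)
  then show "AE z in lebesgue_on S. c \<le> ereal (h z)" using assms(2) by (simp add: AE_restrict_space_iff)
qed

text \<open>\<open>Lim\<close> has a meaningful value only if the limit exists. Monotonicity
  provides it, as the supremum over all radii.\<close>

lemma Lim_antimono_ge:
  fixes F :: "real \<Rightarrow> ereal"
  assumes mono: "\<And>a b. 0 < a \<Longrightarrow> a \<le> b \<Longrightarrow> F b \<le> F a" and r: "0 < r" "c \<le> F r"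
  shows "c \<le> Lim (at_right 0) F"
proof -
  define L where "L = (SUP a\<in>{0<..}. F a)"
  have "(F \<longlongrightarrow> L) (at_right 0)"
  proof (rule order_tendstoI)
    fix l assume "l < L"
    then obtain a where a: "a > 0" "l < F a" unfolding L_def by (auto simp: less_SUP_iff)
    then show "\<forall>\<^sub>F x in at_right 0. l < F x"
      using mono by (intro eventually_at_rightI[of 0 a]) (auto intro: less_le_trans)
  next
    fix l assume l: "L < l"
    have "F x < l" if "x > 0" for x
      by (rule le_less_trans[OF _ l]) (use that in \<open>auto simp: L_def intro: SUP_upper\<close>)
    then show "\<forall>\<^sub>F x in at_right 0. F x < l" by (intro eventually_at_rightI[of 0 1]) auto
  qed
  then have "Lim (at_right 0) F = L" by (intro tendsto_Lim) auto
  moreover have "F r \<le> L" unfolding L_def using r by (intro SUP_upper) auto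
  ultimately show ?thesis using r(2) by simp
qed

lemma pcube_borel: "pcube r (z :: 'n::finite spacetime) \<in> sets borel"
proof -
  have "pcube r z = {w \<in> space borel. (\<forall>i. \<bar>(w - z) \<bullet> e_x i\<bar> < r) \<and> (z \<bullet> e_t - r\<^sup>2 < w \<bullet> e_t \<and> w \<bullet> e_t \<le> z \<bullet> e_t)}"
    by (auto simp: pcube_def inner_e)
  also have "\<dots> \<in> sets borel" by measurable
  finally show ?thesis .
qed

lemma pcube_mono: "0 < r \<Longrightarrow> r \<le> r' \<Longrightarrow> pcube r z \<subseteq> pcube r' z"
proof
  fix w assume r: "0 < r" "r \<le> r'" and w: "w \<in> pcube r z"
  have "r\<^sup>2 \<le> r'\<^sup>2" using r by (intro power_mono) auto
  moreover have "\<bar>fst w $ i - fst z $ i\<bar> < r'" for i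
    using w r(2) by (auto simp: pcube_def intro: less_le_trans)
  moreover have "snd z - r\<^sup>2 < snd w" "snd w \<le> snd z" using w by (auto simp: pcube_def)
  ultimately show "w \<in> pcube r' z" unfolding pcube_def by (intro CollectI conjI allI) auto
qed

lemma pcube_small:
  fixes \<Omega> :: "(real ^ 'n::finite) set"
  assumes "open \<Omega>" "x \<in> \<Omega>" "a < t"
  shows "\<exists>r>0. \<forall>z\<in>pcube r (x, t). fst z \<in> \<Omega> \<and> a < snd z \<and> snd z \<le> t"
proof -
  obtain d where d: "d > 0" "ball x d \<subseteq> \<Omega>" using assms(1,2) open_contains_ball by blast
  define r where "r = min (d / (real CARD('n) + 1)) (min 1 (t - a))"
  have n1: "real CARD('n) + 1 > 0" by (simp add: add_nonneg_pos)
  have r: "r > 0" "r * (real CARD('n) + 1) \<le> d" "r \<le> 1" "r \<le> t - a"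
  proof -
    show "r > 0" using d assms n1 by (simp add: r_def)
    have "r \<le> d / (real CARD('n) + 1)" by (simp add: r_def)
    then show "r * (real CARD('n) + 1) \<le> d" using n1 by (simp add: pos_le_divide_eq)
    show "r \<le> 1" "r \<le> t - a" by (auto simp: r_def)
  qed
  have "fst z \<in> \<Omega> \<and> a < snd z \<and> snd z \<le> t" if z: "z \<in> pcube r (x, t)" for z
  proof -
    have "norm (fst z - x) \<le> (\<Sum>i\<in>UNIV. \<bar>(fst z - x) $ i\<bar>)" by (rule norm_le_l1_cart)
    also have "\<dots> \<le> (\<Sum>i\<in>(UNIV :: 'n set). r)" using z by (intro sum_mono) (auto simp: pcube_def less_imp_le)
    also have "\<dots> = r * real CARD('n)" by simp
    also have "\<dots> < r * (real CARD('n) + 1)" using r(1) by (simp add: distrib_left)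
    finally have "norm (fst z - x) < d" using r(2) by linarith
    then have "fst z \<in> \<Omega>" using d(2) by (auto simp: dist_norm norm_minus_commute subset_iff)
    moreover have "r\<^sup>2 \<le> r" using r by (simp add: power2_eq_square mult_left_le_one_le)
    then have "a < snd z" "snd z \<le> t" using z r by (auto simp: pcube_def)
    ultimately show ?thesis by blast
  qed
  with r(1) show ?thesis by blast
qed

text \<open>At a maximum of \<open>u - w\<close> away from the initial time and the lateral
  boundary, \<open>w\<close> is an admissible test function even at the final time, as the cylinders
  in the definition look only backward. There the excess \<open>\<epsilon>\<close> makes the limit
  of essential infima positive, a contradiction. On the boundary \<open>0 \<le> w\<close> gives the
  bound for \<open>u - w\<close>, and \<open>w \<le> A\<close> returns from \<open>u - w\<close> to
  \<open>u\<close>.\<close>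

lemma comparison:
  fixes u f \<mu> F M :: "'n::finite spacetime \<Rightarrow> real"
  assumes lam: "0 < lam" and p: "1 \<le> p"
    and T: "0 < T" "T \<le> 1" and \<Omega>: "open \<Omega>" "\<Omega> \<noteq> {}" "\<Omega> \<subseteq> {x. norm x < 1}"
    and G1: "\<forall>z\<in>cyl \<Omega> T. \<forall>\<xi>. \<forall>X\<in>sym_mats. \<forall>Y\<in>sym_mats. pucci_minus lam Lam (X - Y) \<le> G z \<xi> X - G z \<xi> Y"
    and G2: "\<forall>z\<in>cyl \<Omega> T. \<forall>\<xi>. \<bar>G z \<xi> 0\<bar> \<le> \<mu> z * norm \<xi> powr m"
    and uc: "continuous_on (closure (cyl \<Omega> T)) u"
    and visc: "visc_subsolution p \<Omega> T (\<lambda>z \<xi> X. G z \<xi> X - f z) u"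
    and sol: "super_sol lam Lam p m A F M w wt wx wxx"
    and ab: "0 \<le> a" "a < b" "b \<le> T" and \<epsilon>: "0 < \<epsilon>"
    and data: "AE z in lborel. z \<in> cyl \<Omega> T \<longrightarrow> a < snd z \<longrightarrow> snd z \<le> b \<longrightarrow> f z + \<epsilon> \<le> F z \<and> \<mu> z \<le> M z"
    and bd: "\<forall>z\<in>pbdry \<Omega> T. u z \<le> P" "\<forall>x\<in>closure \<Omega>. u (x, a) \<le> P"
  shows "\<forall>z\<in>closure \<Omega> \<times> {a..b}. u z \<le> P + A"
proof -
  let ?D = "closure \<Omega> \<times> {a..b}"
  have clT: "closure {0<..T} = {0..T}" using T by simp
  have clQ: "closure (cyl \<Omega> T) = closure \<Omega> \<times> {0..T}" unfolding cyl_def closure_Times clT ..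
  have cl1: "norm x \<le> 1" if "x \<in> closure \<Omega>" for x
  proof -
    have "closure \<Omega> \<subseteq> cball 0 1" using \<Omega>(3) by (intro closure_minimal) (auto simp: less_imp_le)
    then show ?thesis using that by auto
  qed
  have bO: "bounded \<Omega>" using \<Omega>(3) by (intro boundedI[of _ 1]) auto
  then have cD: "compact ?D" by (intro compact_Times) (auto simp: compact_closure)
  have Dn: "?D \<noteq> {}" using \<Omega>(2) ab by auto
  have DQ: "?D \<subseteq> closure (cyl \<Omega> T)" unfolding clQ using ab by auto
  have QI: "closure \<Omega> \<times> {0..T} \<subseteq> inner_cyl"
  proof
    fix z assume "z \<in> closure \<Omega> \<times> {0..T}"
    then have "norm (fst z) \<le> 1" "0 \<le> snd z" "snd z \<le> 1" using cl1 T by auto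
    then show "z \<in> inner_cyl" by (cases z) (auto simp: inner_cyl_def)
  qed
  have cI: "cyl \<Omega> T \<subseteq> inner_cyl" using closure_subset[of "cyl \<Omega> T"] clQ QI by blast
  have wc: "continuous_on inner_cyl w" and wb: "\<And>z. 0 \<le> w z \<and> w z \<le> A" and sym: "\<And>z. wxx z \<in> sym_mats"
    and pde: "AE z in lborel. z \<in> inner_cyl \<longrightarrow> F z + M z * norm (wx z) powr m \<le> wt z + pucci_minus lam Lam (wxx z)"
    using sol unfolding super_sol_def by blast+
  have "continuous_on ?D (\<lambda>z. u z - w z)"
    using continuous_on_subset[OF uc DQ] continuous_on_subset[OF wc, of ?D] DQ clQ QI by (intro continuous_on_diff) auto
  then obtain z0 where z0: "z0 \<in> ?D" "\<And>z. z \<in> ?D \<Longrightarrow> u z - w z \<le> u z0 - w z0"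
    using continuous_attains_sup[OF cD Dn] by blast
  have "u z0 - w z0 \<le> P"
  proof -
    obtain x0 t0 where zz: "z0 = (x0, t0)" by (cases z0)
    have x0: "x0 \<in> closure \<Omega>" and t0: "a \<le> t0" "t0 \<le> b" using z0(1) zz by auto
    consider "t0 = a" | "x0 \<in> frontier \<Omega>" | "x0 \<in> \<Omega>" "a < t0"
      using x0 t0 \<Omega>(1) by (cases "x0 \<in> \<Omega>"; cases "t0 = a") (auto simp: frontier_def interior_open)
    then show ?thesis
    proof cases
      case 1
      then have "u z0 \<le> P" using bd(2) x0 zz by auto
      then show ?thesis using wb[of z0] by linarith
    next
      case 2
      have below: "u (x0, s) \<le> P" if "0 \<le> s" "s < T" for s using bd(1) 2 that by (auto simp: pbdry_def)
      have "u (x0, t0) \<le> P"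
      proof (cases "t0 < T")
        case True
        then show ?thesis using below ab t0 by auto
      next
        \<comment> \<open>\<open>pbdry\<close> omits the lateral boundary at time \<open>T\<close>;
          there the bound follows from earlier times by continuity.\<close>
        case False
        then have tT: "t0 = T" using t0 ab by auto
        have "continuous_on {0..T} (\<lambda>s. u (x0, s))"
          by (rule continuous_on_compose2[OF uc]) (use x0 in \<open>auto simp: clQ intro!: continuous_intros\<close>)
        then have "((\<lambda>s. u (x0, s)) \<longlongrightarrow> u (x0, T)) (at T within {0..T})"
          using T by (auto simp: continuous_on_def)
        then have "((\<lambda>s. u (x0, s)) \<longlongrightarrow> u (x0, T)) (at_left T)"
          using T by (simp add: at_within_Icc_at_left)
        moreover have "\<forall>\<^sub>F s in at_left T. u (x0, s) \<le> P"
          by (rule eventually_at_leftI[of 0]) (use below T in auto)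
        ultimately show ?thesis unfolding tT by (intro tendsto_upperbound) auto
      qed
      then have "u z0 \<le> P" using zz by simp
      then show ?thesis using wb[of z0] by linarith
    next
      case 3
      obtain r where r: "r > 0" "\<And>z. z \<in> pcube r (x0, t0) \<Longrightarrow> fst z \<in> \<Omega> \<and> a < snd z \<and> snd z \<le> t0"
        using pcube_small[OF \<Omega>(1) 3] by blast
      have pc: "z \<in> cyl \<Omega> T \<and> z \<in> ?D \<and> a < snd z \<and> snd z \<le> b" if "z \<in> pcube r (x0, t0)" for z
      proof -
        have "fst z \<in> \<Omega>" "a < snd z" "snd z \<le> t0" using r(2)[OF that] by auto
        moreover from this have "fst z \<in> closure \<Omega>" using closure_subset by blast
        ultimately show ?thesis using t0 ab by (cases z) (auto simp: cyl_def)
      qed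
      let ?h = "\<lambda>z. wt z + (G z (wx z) (wxx z) - f z)"
      have z0Q: "z0 \<in> cyl \<Omega> T" using 3 t0 ab zz by (auto simp: cyl_def)
      have "Lim (at_right 0) (\<lambda>\<epsilon>. ess_inf (pcube \<epsilon> z0) ?h) \<le> 0"
      proof -
        have c: "continuous_on (cyl \<Omega> T) w" by (rule continuous_on_subset[OF wc cI])
        have W: "W21_loc p \<Omega> T w wt wx wxx" by (rule super_sol_W21_loc[OF sol cI p])
        have mx: "\<exists>r>0. pcube r z0 \<subseteq> cyl \<Omega> T \<and> (\<forall>z\<in>pcube r z0. u z - w z \<le> u z0 - w z0)"
          using r(1) pc z0(2) zz by blast
        show ?thesis using visc z0Q c W mx unfolding visc_subsolution_def by blast
      qed
      moreover have "ereal \<epsilon> \<le> Lim (at_right 0) (\<lambda>\<epsilon>. ess_inf (pcube \<epsilon> z0) ?h)"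
      proof (rule Lim_antimono_ge[of _ r])
        have pL: "pcube s z0 \<in> sets lebesgue" for s using pcube_borel[of s z0] by simp
        show "ess_inf (pcube s' z0) ?h \<le> ess_inf (pcube s z0) ?h" if "0 < s" "s \<le> s'" for s s'
          by (rule ess_inf_antimono[OF pcube_mono[OF that] pL pL])
        have "AE z in lborel. z \<in> pcube r z0 \<longrightarrow> ereal \<epsilon> \<le> ereal (?h z)"
          using pde data
        proof eventually_elim
          case (elim z)
          show ?case
          proof
            assume z: "z \<in> pcube r z0"
            have zQ: "z \<in> cyl \<Omega> T" "a < snd z" "snd z \<le> b" using pc[of z] z zz by auto
            have zI: "z \<in> inner_cyl" using zQ(1) cI by blast
            have 1: "F z + M z * norm (wx z) powr m \<le> wt z + pucci_minus lam Lam (wxx z)" using elim(1) zI by blast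
            have 2: "f z + \<epsilon> \<le> F z" "\<mu> z \<le> M z" using elim(2) zQ by blast+
            have 3: "\<mu> z * norm (wx z) powr m \<le> M z * norm (wx z) powr m" using 2(2) by (intro mult_right_mono) auto
            have s0: "(0 :: real ^ 'n ^ 'n) \<in> sym_mats" by (simp add: sym_mats_def transpose_def vec_eq_iff)
            \<comment> \<open>Ellipticity compares with the zero matrix, where the growth condition
              controls \<open>G\<close>; this is where the Hessian has to be symmetric.\<close>
            have "pucci_minus lam Lam (wxx z - 0) \<le> G z (wx z) (wxx z) - G z (wx z) 0" using G1 zQ(1) sym[of z] s0 by blast
            then have 4: "pucci_minus lam Lam (wxx z) \<le> G z (wx z) (wxx z) - G z (wx z) 0" by simp
            have 5: "\<bar>G z (wx z) 0\<bar> \<le> \<mu> z * norm (wx z) powr m" using G2 zQ(1) by blast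
            have "\<epsilon> \<le> ?h z" using 1 2(1) 3 4 5 by linarith
            then show "ereal \<epsilon> \<le> ereal (?h z)" by simp
          qed
        qed
        then have "AE z in lebesgue. z \<in> pcube r z0 \<longrightarrow> ereal \<epsilon> \<le> ereal (?h z)" by (rule AE_completion)
        then have "AE z in lebesgue_on (pcube r z0). ereal \<epsilon> \<le> ereal (?h z)" using pL by (simp add: AE_restrict_space_iff)
        then show "ereal \<epsilon> \<le> ess_inf (pcube r z0) ?h" unfolding ess_inf_def by (intro Sup_upper) simp
      qed (rule r(1))
      ultimately have "ereal \<epsilon> \<le> 0" by (rule order_trans[rotated])
      then show ?thesis using \<epsilon> by simp
    qed
  qed
  show ?thesis
  proof
    fix z assume "z \<in> ?D"
    from z0(2)[OF this] \<open>u z0 - w z0 \<le> P\<close> wb[of z] show "u z \<le> P + A" by linarith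
  qed
qed

section \<open>Subdivision of the time interval\<close>

text \<open>A hyperplane of constant time is a null set, so the indicator functions converge almost
  everywhere. Continuity lets the intermediate value theorem find the cut points.\<close>

lemma time_integral_continuous:
  fixes g :: "'n::finite spacetime \<Rightarrow> real"
  assumes g: "integrable lborel g"
  shows "continuous_on UNIV (\<lambda>t. \<integral>z. indicat_real {z. snd z \<le> t} z * g z \<partial>lborel)"
proof (rule continuous_on_sequentiallyI)
  fix s :: "nat \<Rightarrow> real" and t assume s: "s \<longlonglongrightarrow> t"
  have [measurable]: "g \<in> borel_measurable borel" using g by simp
  have [measurable]: "{z :: 'n spacetime. snd z \<le> t} \<in> sets borel" for t :: real
    by (intro borel_closed closed_Collect_le continuous_intros)
  have "negligible {z :: 'n spacetime. z \<bullet> e_t = t}"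
    by (rule negligible_standard_hyperplane[OF e_t_Basis])
  then have "AE z in lebesgue. z \<notin> {z :: 'n spacetime. z \<bullet> e_t = t}"
    by (intro AE_not_in) (simp add: negligible_iff_null_sets)
  then have ne: "AE z :: 'n spacetime in lborel. snd z \<noteq> t" by (simp add: AE_completion_iff inner_e)
  show "(\<lambda>n. \<integral>z. indicat_real {z. snd z \<le> s n} z * g z \<partial>lborel) \<longlonglongrightarrow> (\<integral>z. indicat_real {z. snd z \<le> t} z * g z \<partial>lborel)"
  proof (rule integral_dominated_convergence[where w = "\<lambda>z. \<bar>g z\<bar>"])
    show "AE z in lborel. (\<lambda>n. indicat_real {z. snd z \<le> s n} z * g z) \<longlonglongrightarrow> indicat_real {z. snd z \<le> t} z * g z"
      using ne
    proof eventually_elim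
      case (elim z)
      have "\<forall>\<^sub>F n in sequentially. indicat_real {z. snd z \<le> s n} z = indicat_real {z. snd z \<le> t} z"
      proof (cases "snd z < t")
        case True
        then have "\<forall>\<^sub>F n in sequentially. snd z < s n" using order_tendstoD(1)[OF s] by blast
        then show ?thesis by eventually_elim (use True in auto)
      next
        case False
        then have "t < snd z" using elim by simp
        then have "\<forall>\<^sub>F n in sequentially. s n < snd z" using order_tendstoD(2)[OF s] by blast
        then show ?thesis by eventually_elim (use False elim in auto)
      qed
      then have "(\<lambda>n. indicat_real {z. snd z \<le> s n} z) \<longlonglongrightarrow> indicat_real {z. snd z \<le> t} z"
        by (rule tendsto_eventually)
      then show ?case by (intro tendsto_mult tendsto_const)
    qed
    show "AE z in lborel. norm (indicat_real {z. snd z \<le> s n} z * g z) \<le> \<bar>g z\<bar>" for n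
      by (rule AE_I2) (auto simp: indicator_def)
  qed (use g in auto)
qed

lemma time_integral_diff:
  fixes g :: "'n::finite spacetime \<Rightarrow> real"
  assumes g: "integrable lborel g" and "t \<le> t'"
  shows "(\<integral>z. indicat_real {z. snd z \<le> t'} z * g z \<partial>lborel) - (\<integral>z. indicat_real {z. snd z \<le> t} z * g z \<partial>lborel) =
    (\<integral>z. indicat_real {z. t < snd z \<and> snd z \<le> t'} z * g z \<partial>lborel)"
    and "integrable lborel (\<lambda>z. indicat_real {z. t < snd z \<and> snd z \<le> t'} z * g z)"
proof -
  have [measurable]: "{z :: 'n spacetime. snd z \<le> t} \<in> sets borel" for t :: real
    by (intro borel_closed closed_Collect_le continuous_intros)
  have i: "integrable lborel (\<lambda>z. indicat_real {z. snd z \<le> t} z * g z)" for t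
  proof (rule Bochner_Integration.integrable_bound[OF g])
    have [measurable]: "g \<in> borel_measurable borel" using g by simp
    show "(\<lambda>z. indicat_real {z. snd z \<le> t} z * g z) \<in> borel_measurable lborel" by measurable
  qed (auto simp: indicator_def)
  have eq: "indicat_real {z. t < snd z \<and> snd z \<le> t'} z * g z =
      indicat_real {z. snd z \<le> t'} z * g z - indicat_real {z. snd z \<le> t} z * g z" for z
    using assms(2) by (auto simp: indicator_def)
  show "(\<integral>z. indicat_real {z. snd z \<le> t'} z * g z \<partial>lborel) - (\<integral>z. indicat_real {z. snd z \<le> t} z * g z \<partial>lborel) =
    (\<integral>z. indicat_real {z. t < snd z \<and> snd z \<le> t'} z * g z \<partial>lborel)"
    unfolding eq using i by simp
  show "integrable lborel (\<lambda>z. indicat_real {z. t < snd z \<and> snd z \<le> t'} z * g z)"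
    unfolding eq using i by simp
qed

text \<open>Instead of Hoelder's inequality for the sum over the time intervals, each summand is estimated by its
  tangent at the mean value; this turns the induction into a linear one.\<close>

lemma partition_induction:
  fixes \<phi> \<Psi> :: "real \<Rightarrow> real" and B :: "real \<Rightarrow> real \<Rightarrow> bool"
  assumes T: "0 \<le> T" and \<phi>: "continuous_on {0..T} \<phi>" "\<phi> 0 = 0" "0 \<le> \<phi> T"
    and \<Psi>: "\<And>t t'. 0 \<le> t \<Longrightarrow> t \<le> t' \<Longrightarrow> t' \<le> T \<Longrightarrow> \<Psi> t \<le> \<Psi> t'"
    and p: "1 \<le> p" and c: "0 < c" and L: "0 \<le> L" and N: "0 < N"
    and step: "\<And>t t' s. 0 \<le> t \<Longrightarrow> t \<le> t' \<Longrightarrow> t' \<le> T \<Longrightarrow> \<phi> t' - \<phi> t \<le> \<phi> T / real N \<Longrightarrow> B t s \<Longrightarrow>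
        B t' (s + L * ((\<Psi> t' - \<Psi> t) powr (1 / p) + \<eta>))"
    and mono: "\<And>t s s'. B t s \<Longrightarrow> s \<le> s' \<Longrightarrow> B t s'"
    and B0: "B 0 P"
  shows "B T (P + L * (real N * ((1 - 1 / p) * c + \<eta>) + 1 / p * (c powr (1 - p) * (\<Psi> T - \<Psi> 0))))"
proof -
  define R where "R i t = P + L * (real i * ((1 - 1 / p) * c + \<eta>) + 1 / p * (c powr (1 - p) * (\<Psi> t - \<Psi> 0)))" for i t
  have one: "B t' (R (Suc i) t')" if "0 \<le> t" "t \<le> t'" "t' \<le> T" "\<phi> t' - \<phi> t \<le> \<phi> T / real N" "B t (R i t)" for i t t'
  proof (rule mono[OF step[OF that]])
    have d: "0 \<le> \<Psi> t' - \<Psi> t" using \<Psi>[OF that(1-3)] by simp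
    have "(\<Psi> t' - \<Psi> t) powr (1 / p) \<le> (1 - 1 / p) * c + 1 / p * (c powr (1 - p) * ((\<Psi> t' - \<Psi> t) powr (1 / p)) powr p)"
      by (rule tangent_powr) (use c p in auto)
    also have "((\<Psi> t' - \<Psi> t) powr (1 / p)) powr p = \<Psi> t' - \<Psi> t" using d p by (simp add: powr_powr)
    finally have "L * ((\<Psi> t' - \<Psi> t) powr (1 / p) + \<eta>) \<le>
        L * ((1 - 1 / p) * c + 1 / p * (c powr (1 - p) * (\<Psi> t' - \<Psi> t)) + \<eta>)"
      using L by (intro mult_left_mono) auto
    also have "R i t + \<dots> = R (Suc i) t'"
      by (simp add: R_def algebra_simps)
    finally show "R i t + L * ((\<Psi> t' - \<Psi> t) powr (1 / p) + \<eta>) \<le> R (Suc i) t'" by simp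
  qed
  \<comment> \<open>The cut point with index \<open>i\<close> carries the fraction
    \<open>i / N\<close> of the total of \<open>\<phi>\<close>. Only \<open>i < N\<close> is treated
    here, since the last piece has to end at \<open>T\<close> itself and \<open>\<phi>\<close> may
    reach its final value earlier.\<close>
  have "\<exists>t. 0 \<le> t \<and> t \<le> T \<and> \<phi> t = real i * (\<phi> T / real N) \<and> B t (R i t)" if "i < N" for i
    using that
  proof (induction i)
    case 0
    then show ?case using T \<phi>(2) B0 by (intro exI[of _ 0]) (simp add: R_def)
  next
    case (Suc i)
    then obtain t where t: "0 \<le> t" "t \<le> T" "\<phi> t = real i * (\<phi> T / real N)" "B t (R i t)" by auto
    have "real (Suc i) * (\<phi> T / real N) \<le> real N * (\<phi> T / real N)"
      using Suc.prems \<phi>(3) by (intro mult_right_mono) auto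
    then have le: "real (Suc i) * (\<phi> T / real N) \<le> \<phi> T" using N by simp
    have ge: "\<phi> t \<le> real (Suc i) * (\<phi> T / real N)" unfolding t(3) using \<phi>(3) by (intro mult_right_mono) auto
    obtain t' where t': "t \<le> t'" "t' \<le> T" "\<phi> t' = real (Suc i) * (\<phi> T / real N)"
      using IVT'[of \<phi> t "real (Suc i) * (\<phi> T / real N)" T] ge le t(2) continuous_on_subset[OF \<phi>(1), of "{t..T}"] t(1) by auto
    have "B t' (R (Suc i) t')"
      by (rule one[OF t(1) t'(1,2) _ t(4)]) (simp add: t'(3) t(3) add_divide_distrib algebra_simps)
    then show ?case using t t' by (intro exI[of _ t']) auto
  qed
  from this[of "N - 1"] N obtain t where t: "0 \<le> t" "t \<le> T" "\<phi> t = real (N - 1) * (\<phi> T / real N)" "B t (R (N - 1) t)" by auto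
  have "\<phi> T - \<phi> t = \<phi> T / real N" unfolding t(3) using N by (simp add: of_nat_diff field_simps)
  then have "B T (R (Suc (N - 1)) T)" by (intro one[OF t(1,2) order_refl _ t(4)]) simp
  then show ?thesis using N by (simp add: R_def)
qed

lemma Lp_bound_restrict:
  fixes g :: "'n::finite spacetime \<Rightarrow> real"
  assumes g: "Lp_bound p A g" and t: "t \<le> t'" and p: "0 < p"
    and le: "(\<integral>z. indicat_real {z. snd z \<le> t'} z * \<bar>g z\<bar> powr p \<partial>lborel) -
      (\<integral>z. indicat_real {z. snd z \<le> t} z * \<bar>g z\<bar> powr p \<partial>lborel) \<le> Y powr p"
    and S[measurable]: "S \<in> sets borel" and sub: "S \<subseteq> {z. t < snd z \<and> snd z \<le> t'}"
  shows "Lp_bound p Y (\<lambda>z. indicat_real S z * \<bar>g z\<bar>)"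
proof -
  note [measurable] = Lp_bound_measurable[OF g]
  have gi: "integrable lborel (\<lambda>z. \<bar>g z\<bar> powr p)" using g by (simp add: Lp_bound_def)
  note d = time_integral_diff[OF gi t]
  have pt: "\<bar>indicat_real S z * \<bar>g z\<bar>\<bar> powr p \<le> indicat_real {z. t < snd z \<and> snd z \<le> t'} z * \<bar>g z\<bar> powr p" for z
    using sub by (auto simp: indicator_def)
  have i: "integrable lborel (\<lambda>z. \<bar>indicat_real S z * \<bar>g z\<bar>\<bar> powr p)"
  proof (rule integrable_abs_le[OF d(2)])
    show "\<bar>\<bar>indicat_real S z * \<bar>g z\<bar>\<bar> powr p\<bar> \<le> indicat_real {z. t < snd z \<and> snd z \<le> t'} z * \<bar>g z\<bar> powr p" for z
      using pt[of z] by simp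
  qed simp
  have "(\<integral>z. \<bar>indicat_real S z * \<bar>g z\<bar>\<bar> powr p \<partial>lborel) \<le> (\<integral>z. indicat_real {z. t < snd z \<and> snd z \<le> t'} z * \<bar>g z\<bar> powr p \<partial>lborel)"
    by (rule integral_mono[OF i d(2) pt])
  also have "\<dots> \<le> Y powr p" using le d(1) by simp
  finally show ?thesis using i by (simp add: Lp_bound_def)
qed

text \<open>Supplies the strict inequality for the comparison at an arbitrarily small cost in the
  \<open>L^p\<close> norm.\<close>

lemma small_constant:
  assumes "0 < (\<eta> :: real)" "1 \<le> p"
  shows "\<exists>\<epsilon>>0. Lp_bound p \<eta> (\<lambda>z. \<epsilon> * indicat_real (inner_cyl :: 'n::finite spacetime set) z)"
proof -
  let ?I = "inner_cyl :: 'n spacetime set"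
  define v where "v = measure lborel ?I"
  have v: "0 \<le> v" by (simp add: v_def)
  define \<epsilon> where "\<epsilon> = \<eta> / (1 + v)"
  have \<epsilon>: "\<epsilon> > 0" using assms v by (simp add: \<epsilon>_def)
  have ib[measurable]: "?I \<in> sets borel" by (rule borel_open[OF open_inner_cyl])
  have eq: "\<bar>\<epsilon> * indicat_real ?I z\<bar> powr p = \<epsilon> powr p * indicat_real ?I z" for z
    using \<epsilon> by (simp add: indicator_def)
  have i: "integrable lborel (\<lambda>z. \<epsilon> powr p * indicat_real ?I z)"
    using inner_cyl_finite[where 'n='n] by (simp add: integrable_indicator_iff)
  have "(\<integral>z. \<epsilon> powr p * indicat_real ?I z \<partial>lborel) = \<epsilon> powr p * v" by (simp add: v_def)
  also have "\<dots> \<le> \<epsilon> powr p * (1 + v) powr p"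
  proof (rule mult_left_mono)
    have "v \<le> (1 + v) powr 1" using v by simp
    also have "\<dots> \<le> (1 + v) powr p" using v assms by (intro powr_mono) auto
    finally show "v \<le> (1 + v) powr p" .
  qed simp
  also have "\<dots> = \<eta> powr p" using v assms by (simp add: \<epsilon>_def powr_mult[symmetric])
  finally have "Lp_bound p \<eta> (\<lambda>z. \<epsilon> * indicat_real ?I z)"
    unfolding Lp_bound_def eq using i by simp
  with \<epsilon> show ?thesis by blast
qed

text \<open>The exponent equals \<open>(p * (m * q - d) - (m - 1) * q * d) / (p * q)\<close>, and
  \<open>m * q - d\<close> is positive because \<open>q > d\<close> and \<open>m > 1\<close>;
  clearing denominators in the condition on \<open>p\<close> does the rest.\<close>

lemma exponent_condition:
  fixes m p q d :: real
  assumes "1 < m" "d < q" "0 < p" "p \<le> q" "0 < d" "p > (m - 1) * q * d / (m * q - d)"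
  shows "0 < m - d / p * (m - (1 - p / q))"
proof -
  have q: "q > 0" using assms by linarith
  have "q < m * q" using assms(1) q by simp
  then have den: "m * q - d > 0" using assms(2) by linarith
  then have "(m - 1) * q * d < p * (m * q - d)" using assms(6) by (simp add: pos_divide_less_eq)
  moreover have "m - d / p * (m - (1 - p / q)) = (p * (m * q - d) - (m - 1) * q * d) / (p * q)"
    using assms(3) q by (simp add: field_simps)
  ultimately show ?thesis using assms(3) q by simp
qed

text \<open>The cut points share out the integral of \<open>\<bar>\<mu>\<bar> powr q\<close> evenly,
  so on a piece the norm of \<open>\<mu>\<close> is at most \<open>V / N powr (1 / q)\<close>. The
  lower bound on \<open>N\<close> says that this meets the smallness condition even on a piece that
  carries the whole bound \<open>F\<close> for \<open>f\<close>.\<close>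

lemma subdivision_bound:
  fixes u f \<mu> :: "'n::finite spacetime \<Rightarrow> real"
  assumes super: "\<forall>(f :: 'n spacetime \<Rightarrow> real) \<mu> K U. 0 < K \<longrightarrow> 0 < U \<longrightarrow> Lp_bound p K f \<longrightarrow> (\<forall>z. 0 \<le> f z) \<longrightarrow>
      Lp_bound q U \<mu> \<longrightarrow> (\<forall>z. 0 \<le> \<mu> z) \<longrightarrow> U * K powr (m - 1) \<le> \<delta> \<longrightarrow>
      (\<exists>w wt wx wxx. super_sol lam Lam p m (C0 * K) f \<mu> w wt wx wxx)"
    and lam: "0 < lam" and p: "1 \<le> p" "p \<le> q" and m: "1 < m" and C0: "0 < C0" and \<delta>: "0 < \<delta>"
    and T: "0 < T" "T \<le> 1" and \<Omega>: "open \<Omega>" "\<Omega> \<noteq> {}" "\<Omega> \<subseteq> {x. norm x < 1}"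
    and f: "Lp_on p (cyl \<Omega> T) f" and \<mu>: "Lp_on q (cyl \<Omega> T) \<mu>"
    and G1: "\<forall>z\<in>cyl \<Omega> T. \<forall>\<xi>. \<forall>X\<in>sym_mats. \<forall>Y\<in>sym_mats. pucci_minus lam Lam (X - Y) \<le> G z \<xi> X - G z \<xi> Y"
    and G2: "\<forall>z\<in>cyl \<Omega> T. \<forall>\<xi>. \<bar>G z \<xi> 0\<bar> \<le> \<mu> z * norm \<xi> powr m"
    and uc: "continuous_on (closure (cyl \<Omega> T)) u"
    and visc: "visc_subsolution p \<Omega> T (\<lambda>z \<xi> X. G z \<xi> X - f z) u"
    and P: "\<forall>z\<in>pbdry \<Omega> T. u z \<le> P"
    and F: "0 < F" "Lp_norm p (cyl \<Omega> T) f \<le> F" and V: "0 < V" "Lp_norm q (cyl \<Omega> T) \<mu> \<le> V"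
    and N: "0 < N" "8 powr ((m - 1) * q) / \<delta> powr q * (F powr ((m - 1) * q) * V powr q) \<le> real N"
    and z: "z \<in> cyl \<Omega> T"
  shows "u z \<le> P + 4 * C0 * (F * real N powr ((p - 1) / p))"
proof -
  have q: "1 \<le> q" "0 < q" using p by auto
  have p0: "0 < p" using p by simp
  have Qb[measurable]: "cyl \<Omega> T \<in> sets borel" unfolding cyl_def using \<Omega>(1) by (intro borel_Times) auto
  obtain fb where fb: "Lp_bound p F fb" "AE z in lebesgue_on (cyl \<Omega> T). f z = fb z" "\<forall>z. z \<notin> cyl \<Omega> T \<longrightarrow> fb z = 0"
    using borel_version_Lp_bound[OF f Qb F(2) p0] by blast
  obtain mb where mb: "Lp_bound q V mb" "AE z in lebesgue_on (cyl \<Omega> T). \<mu> z = mb z" "\<forall>z. z \<notin> cyl \<Omega> T \<longrightarrow> mb z = 0"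
    using borel_version_Lp_bound[OF \<mu> Qb V(2) q(2)] by blast
  note [measurable] = Lp_bound_measurable[OF fb(1)] Lp_bound_measurable[OF mb(1)]
  have fbi: "integrable lborel (\<lambda>z. \<bar>fb z\<bar> powr p)" and mbi: "integrable lborel (\<lambda>z. \<bar>mb z\<bar> powr q)"
    using fb(1) mb(1) by (auto simp: Lp_bound_def)
  define \<Psi> where "\<Psi> t = (\<integral>z. indicat_real {z. snd z \<le> t} z * \<bar>fb z\<bar> powr p \<partial>lborel)" for t
  define \<phi> where "\<phi> t = (\<integral>z. indicat_real {z. snd z \<le> t} z * \<bar>mb z\<bar> powr q \<partial>lborel)" for t
  have snd_meas[measurable]: "{z :: 'n spacetime. snd z \<le> t} \<in> sets borel" for t :: real
    by (intro borel_closed closed_Collect_le continuous_intros)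
  have inc: "(\<integral>z. indicat_real {z. snd z \<le> t} z * g z \<partial>lborel) \<le> (\<integral>z. indicat_real {z. snd z \<le> t'} z * g z \<partial>lborel)"
    if "t \<le> t'" "integrable lborel g" "\<And>z. 0 \<le> g z" for t t' and g :: "'n spacetime \<Rightarrow> real"
  proof -
    have "0 \<le> (\<integral>z. indicat_real {z. t < snd z \<and> snd z \<le> t'} z * g z \<partial>lborel)"
      using that(3) by (intro Bochner_Integration.integral_nonneg mult_nonneg_nonneg) auto
    then show ?thesis using time_integral_diff(1)[OF that(2,1)] by linarith
  qed
  have \<phi>0: "\<phi> 0 = 0"
  proof -
    have zero: "indicat_real {z. snd z \<le> 0} z * \<bar>mb z\<bar> powr q = 0" for z
    proof (cases "z \<in> cyl \<Omega> T")
      case True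
      then have "0 < snd z" by (auto simp: cyl_def)
      then show ?thesis by simp
    next
      case False
      then have "mb z = 0" using mb(3) by blast
      then show ?thesis by simp
    qed
    show ?thesis unfolding \<phi>_def zero by simp
  qed
  have \<phi>nn: "0 \<le> \<phi> t" for t unfolding \<phi>_def by (intro Bochner_Integration.integral_nonneg mult_nonneg_nonneg) auto
  have \<phi>le: "\<phi> T \<le> V powr q"
  proof -
    have "\<phi> T \<le> (\<integral>z. \<bar>mb z\<bar> powr q \<partial>lborel)" unfolding \<phi>_def
    proof (rule integral_mono)
      show "integrable lborel (\<lambda>z. indicat_real {z. snd z \<le> T} z * \<bar>mb z\<bar> powr q)"
      proof (rule Bochner_Integration.integrable_bound[OF mbi])
        show "(\<lambda>z. indicat_real {z. snd z \<le> T} z * \<bar>mb z\<bar> powr q) \<in> borel_measurable lborel" by measurable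
      qed (auto simp: indicator_def)
    qed (use mbi in \<open>auto simp: indicator_def\<close>)
    then show ?thesis using mb(1) by (simp add: Lp_bound_def)
  qed
  have \<Psi>le: "\<Psi> t' - \<Psi> t \<le> F powr p" if "t \<le> t'" for t t'
  proof -
    have "\<Psi> t' - \<Psi> t = (\<integral>z. indicat_real {z. t < snd z \<and> snd z \<le> t'} z * \<bar>fb z\<bar> powr p \<partial>lborel)"
      unfolding \<Psi>_def by (rule time_integral_diff(1)[OF fbi that])
    also have "\<dots> \<le> (\<integral>z. \<bar>fb z\<bar> powr p \<partial>lborel)"
      by (rule integral_mono[OF time_integral_diff(2)[OF fbi that] fbi]) (auto simp: indicator_def)
    finally show ?thesis using fb(1) by (simp add: Lp_bound_def)
  qed
  have clQ: "closure (cyl \<Omega> T) = closure \<Omega> \<times> {0..T}"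
    unfolding cyl_def closure_Times using T by simp
  \<comment> \<open>The part \<open>P \<le> s\<close> is carried along because the comparison on
    later pieces needs \<open>s\<close> to dominate \<open>u\<close> on the whole parabolic
    boundary.\<close>
  define Bd where "Bd t s \<longleftrightarrow> P \<le> s \<and> (\<forall>z\<in>closure \<Omega> \<times> {0..t}. u z \<le> s)" for t s
  have bm: "Bd t s'" if "Bd t s" "s \<le> s'" for t s s' using that unfolding Bd_def by (auto intro: order_trans)
  have main: "u z \<le> P + 4 * C0 * (real N * ((1 - 1 / p) * c + \<eta>) + 1 / p * (c powr (1 - p) * (\<Psi> T - \<Psi> 0)))"
    if \<eta>: "0 < \<eta>" "\<eta> \<le> F" and c: "0 < c" for \<eta> c
  proof -
    obtain \<epsilon> where \<epsilon>: "\<epsilon> > 0" "Lp_bound p \<eta> (\<lambda>z. \<epsilon> * indicat_real (inner_cyl :: 'n spacetime set) z)"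
      using small_constant[OF \<eta>(1) p(1)] by blast
    have ib[measurable]: "(inner_cyl :: 'n spacetime set) \<in> sets borel" by (rule borel_open[OF open_inner_cyl])
    have "Bd T (P + (4 * C0) * (real N * ((1 - 1 / p) * c + \<eta>) + 1 / p * (c powr (1 - p) * (\<Psi> T - \<Psi> 0))))"
    proof (rule partition_induction[where \<phi> = \<phi>])
      show "continuous_on {0..T} \<phi>" unfolding \<phi>_def
        by (rule continuous_on_subset[OF time_integral_continuous[OF mbi]]) simp
      show "\<Psi> t \<le> \<Psi> t'" if "0 \<le> t" "t \<le> t'" "t' \<le> T" for t t'
        unfolding \<Psi>_def by (rule inc[OF that(2) fbi]) simp
      show "Bd t s'" if "Bd t s" "s \<le> s'" for t s s' using that by (rule bm)
      show "Bd 0 P"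
        unfolding Bd_def
      proof (intro conjI order_refl ballI)
        fix z assume z: "z \<in> closure \<Omega> \<times> {0..(0::real)}"
        then have "fst z \<in> closure \<Omega>" "snd z = 0" by auto
        then have "z \<in> pbdry \<Omega> T" using T \<Omega>(1)
          by (cases z) (auto simp: pbdry_def frontier_def interior_open)
        then show "u z \<le> P" using P by blast
      qed
      fix t t' s assume t: "0 \<le> t" "t \<le> t'" "t' \<le> T" and small: "\<phi> t' - \<phi> t \<le> \<phi> T / real N" and Bt: "Bd t s"
      define y where "y = (\<Psi> t' - \<Psi> t) powr (1 / p)"
      have \<Psi>d: "0 \<le> \<Psi> t' - \<Psi> t" unfolding \<Psi>_def using inc[OF t(2) fbi] by simp
      have y0: "0 \<le> y" by (simp add: y_def)
      have yp: "y powr p = \<Psi> t' - \<Psi> t" using \<Psi>d p0 by (simp add: y_def powr_powr)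
      have yF: "y \<le> F"
      proof -
        have "y \<le> (F powr p) powr (1 / p)" unfolding y_def using \<Psi>d \<Psi>le[OF t(2)] p0 by (intro powr_mono2) auto
        then show ?thesis using F(1) p0 by (simp add: powr_powr)
      qed
      show "Bd t' (s + (4 * C0) * ((\<Psi> t' - \<Psi> t) powr (1 / p) + \<eta>))"
      \<comment> \<open>Cut points may coincide, whereas the comparison needs a nondegenerate
        interval.\<close>
      proof (cases "t = t'")
        case True
        have "s \<le> s + (4 * C0) * ((\<Psi> t' - \<Psi> t) powr (1 / p) + \<eta>)"
          unfolding y_def[symmetric] using C0 y0 \<eta> by simp
        from bm[OF Bt this] show ?thesis by (simp only: True)
      next
        case False
        then have tt: "t < t'" using t by simp
        define S where "S = {z :: 'n spacetime. z \<in> inner_cyl \<and> t < snd z \<and> snd z \<le> t'}"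
        have Sb[measurable]: "S \<in> sets borel"
        proof -
          have "S = inner_cyl \<inter> ({z. snd z \<le> t'} - {z. snd z \<le> t})" by (auto simp: S_def)
          then show ?thesis by simp
        qed
        \<comment> \<open>Absolute values make the data of the piece nonnegative, as the
          construction of supersolutions requires; the second summand is the room for
          strictness.\<close>
        define Fd where "Fd z = indicat_real S z * \<bar>fb z\<bar> + indicat_real S z * (\<epsilon> * indicat_real inner_cyl z)" for z
        define Md where "Md z = indicat_real S z * \<bar>mb z\<bar>" for z
        \<comment> \<open>The factor 4 is the constant of \<open>Lp_bound_add\<close>. As
          \<open>y\<close> and \<open>\<eta>\<close> are at most \<open>F\<close>, this is at most
          \<open>8 * F\<close>, the source of the 8 in the condition on \<open>N\<close>.\<close>
        define K where "K = 4 * (y + \<eta>)"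
        define U where "U = (V powr q / real N) powr (1 / q)"
        have K: "0 < K" using y0 \<eta> by (simp add: K_def)
        have U: "0 < U" using V N by (simp add: U_def)
        have Uq: "U powr q = V powr q / real N" using V N q by (simp add: U_def powr_powr)
        have FL: "Lp_bound p K Fd"
          unfolding Fd_def K_def
        proof (rule Lp_bound_add)
          show "Lp_bound p y (\<lambda>z. indicat_real S z * \<bar>fb z\<bar>)"
            by (rule Lp_bound_restrict[OF fb(1) t(2) p0 _ Sb]) (auto simp: yp \<Psi>_def S_def)
          show "Lp_bound p \<eta> (\<lambda>z. indicat_real S z * (\<epsilon> * indicat_real inner_cyl z))"
            by (rule Lp_bound_dominated[OF \<epsilon>(2)]) (use p in \<open>auto simp: indicator_def\<close>)
        qed (use y0 \<eta> p in auto)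
        have MdL: "Lp_bound q U Md"
          unfolding Md_def
        proof (rule Lp_bound_restrict[OF mb(1) t(2) q(2) _ Sb])
          have "\<phi> t' - \<phi> t \<le> V powr q / real N" using small \<phi>le N by (meson divide_right_mono of_nat_0_le_iff order_trans)
          then show "(\<integral>z. indicat_real {z. snd z \<le> t'} z * \<bar>mb z\<bar> powr q \<partial>lborel) -
            (\<integral>z. indicat_real {z. snd z \<le> t} z * \<bar>mb z\<bar> powr q \<partial>lborel) \<le> U powr q"
            by (simp add: \<phi>_def Uq)
        qed (auto simp: S_def)
        have smallness: "U * K powr (m - 1) \<le> \<delta>"
        proof -
          have "K powr (m - 1) \<le> (8 * F) powr (m - 1)" using K yF \<eta> m by (intro powr_mono2) (auto simp: K_def)
          then have "U * K powr (m - 1) \<le> U * (8 * F) powr (m - 1)" using U by (intro mult_left_mono) auto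
          also have "\<dots> = ((U * (8 * F) powr (m - 1)) powr q) powr (1 / q)" using U q by (simp add: powr_powr)
          also have "\<dots> \<le> (\<delta> powr q) powr (1 / q)"
          proof (rule powr_mono2)
            have "(U * (8 * F) powr (m - 1)) powr q = V powr q / real N * (8 powr ((m - 1) * q) * F powr ((m - 1) * q))"
              using U F(1) by (simp add: powr_mult powr_powr Uq)
            also have "\<dots> \<le> \<delta> powr q"
              using N \<delta> by (simp add: field_simps)
            finally show "(U * (8 * F) powr (m - 1)) powr q \<le> \<delta> powr q" .
          qed (use q in auto)
          also have "\<dots> = \<delta>" using \<delta> q by (simp add: powr_powr)
          finally show ?thesis .
        qed
        have F0: "\<forall>z. 0 \<le> Fd z" and M0: "\<forall>z. 0 \<le> Md z" using \<epsilon>(1) unfolding Fd_def Md_def by (auto simp: indicator_def)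
        obtain w wt wx wxx where sol: "super_sol lam Lam p m (C0 * K) Fd Md w wt wx wxx"
          using super K U FL F0 MdL M0 smallness by blast
        have data: "AE z in lborel. z \<in> cyl \<Omega> T \<longrightarrow> t < snd z \<longrightarrow> snd z \<le> t' \<longrightarrow> f z + \<epsilon> \<le> Fd z \<and> \<mu> z \<le> Md z"
          using lebesgue_on_AE_lborel[OF fb(2) Qb] lebesgue_on_AE_lborel[OF mb(2) Qb]
        proof eventually_elim
          case (elim z)
          show ?case
          proof (intro impI)
            assume z: "z \<in> cyl \<Omega> T" "t < snd z" "snd z \<le> t'"
            have "norm (fst z) < 1" "0 < snd z" "snd z \<le> 1" using z(1) \<Omega>(3) T by (auto simp: cyl_def)
            then have "z \<in> inner_cyl" by (cases z) (auto simp: inner_cyl_def)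
            then have "z \<in> S" "z \<in> inner_cyl" using z by (auto simp: S_def)
            then have "Fd z = \<bar>fb z\<bar> + \<epsilon>" "Md z = \<bar>mb z\<bar>" by (simp_all add: Fd_def Md_def)
            moreover have "f z = fb z" "\<mu> z = mb z" using elim z(1) by blast+
            ultimately show "f z + \<epsilon> \<le> Fd z \<and> \<mu> z \<le> Md z" by auto
          qed
        qed
        have sP: "P \<le> s" "\<And>z. z \<in> closure \<Omega> \<times> {0..t} \<Longrightarrow> u z \<le> s" using Bt unfolding Bd_def by blast+
        have cmp: "\<forall>z\<in>closure \<Omega> \<times> {t..t'}. u z \<le> s + C0 * K"
        proof (rule comparison[OF lam p(1) T \<Omega> G1 G2 uc visc sol t(1) tt t(3) \<epsilon>(1) data])
          show "\<forall>z\<in>pbdry \<Omega> T. u z \<le> s" using P sP(1) by (auto intro: order_trans)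
          show "\<forall>x\<in>closure \<Omega>. u (x, t) \<le> s" using sP(2) t by auto
        qed
        have CK: "s + C0 * K = s + (4 * C0) * ((\<Psi> t' - \<Psi> t) powr (1 / p) + \<eta>)" by (simp add: K_def y_def)
        have CK0: "0 \<le> C0 * K" using C0 K by simp
        show ?thesis
          unfolding Bd_def CK[symmetric]
        proof (intro conjI ballI)
          show "P \<le> s + C0 * K" using sP(1) CK0 by linarith
          fix z assume z: "z \<in> closure \<Omega> \<times> {0..t'}"
          show "u z \<le> s + C0 * K"
          proof (cases "snd z \<le> t")
            case True
            then have "u z \<le> s" using z by (intro sP(2)) auto
            then show ?thesis using CK0 by linarith
          next
            case False
            then show ?thesis using z cmp by auto
          qed
        qed
      qed
    qed (use T \<phi>0 \<phi>nn p c C0 N in auto)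
    moreover have "z \<in> closure \<Omega> \<times> {0..T}" using z closure_subset[of "cyl \<Omega> T"] clQ by blast
    ultimately show ?thesis unfolding Bd_def by blast
  qed
  \<comment> \<open>The bound for \<open>f\<close> on one piece if the integral of
    \<open>\<bar>f\<bar> powr p\<close> were shared out evenly among the \<open>N\<close> pieces.
    This \<open>c\<close> minimizes the tangent bound for the sum of the norms.\<close>
  define c where "c = F * real N powr (- (1 / p))"
  have c: "0 < c" using F N by (simp add: c_def)
  have eq: "real N * ((1 - 1 / p) * c) + 1 / p * (c powr (1 - p) * F powr p) = F * real N powr ((p - 1) / p)"
  proof -
    have Nr: "0 < real N" using N by simp
    have 1: "real N * c = F * real N powr ((p - 1) / p)"
    proof -
      have "real N * c = F * (real N powr 1 * real N powr (- (1 / p)))" using Nr by (simp add: c_def)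
      also have "real N powr 1 * real N powr (- (1 / p)) = real N powr ((p - 1) / p)"
      proof -
        have "1 + - (1 / p) = (p - 1) / p" using p0 by (simp add: field_simps)
        then show ?thesis unfolding powr_add[symmetric] by (simp only:)
      qed
      finally show ?thesis .
    qed
    have "c powr (1 - p) * F powr p = (F powr (1 - p) * F powr p) * real N powr (- (1 / p) * (1 - p))"
      using F Nr by (simp add: c_def powr_mult powr_powr)
    also have "F powr (1 - p) * F powr p = F" using F by (simp flip: powr_add)
    also have "- (1 / p) * (1 - p) = (p - 1) / p" using p0 by (simp add: field_simps)
    finally have 2: "c powr (1 - p) * F powr p = F * real N powr ((p - 1) / p)" .
    have "real N * ((1 - 1 / p) * c) = (1 - 1 / p) * (real N * c)" by simp
    then show ?thesis unfolding 1 2 by (simp add: left_diff_distrib)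
  qed
  have "u z \<le> P + 4 * C0 * (F * real N powr ((p - 1) / p)) + e" if e: "0 < e" for e
  proof -
    \<comment> \<open>Small enough that the contributions of the \<open>N\<close> added constants
      together cost at most \<open>e\<close>.\<close>
    define \<eta> where "\<eta> = min F (e / (4 * C0 * real N))"
    have \<eta>: "0 < \<eta>" "\<eta> \<le> F" "\<eta> \<le> e / (4 * C0 * real N)" using F e C0 N by (auto simp: \<eta>_def)
    have "1 / p * (c powr (1 - p) * (\<Psi> T - \<Psi> 0)) \<le> 1 / p * (c powr (1 - p) * F powr p)"
      using \<Psi>le[of 0 T] T p0 by (intro mult_left_mono) auto
    then have "real N * ((1 - 1 / p) * c + \<eta>) + 1 / p * (c powr (1 - p) * (\<Psi> T - \<Psi> 0)) \<le>
        F * real N powr ((p - 1) / p) + real N * \<eta>"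
      unfolding eq[symmetric] distrib_left by linarith
    then have "4 * C0 * (real N * ((1 - 1 / p) * c + \<eta>) + 1 / p * (c powr (1 - p) * (\<Psi> T - \<Psi> 0))) \<le>
        4 * C0 * (F * real N powr ((p - 1) / p) + real N * \<eta>)"
      using C0 by (intro mult_left_mono) auto
    also have "\<dots> = 4 * C0 * (F * real N powr ((p - 1) / p)) + \<eta> * (4 * C0 * real N)" by (simp add: algebra_simps)
    also have "\<eta> * (4 * C0 * real N) \<le> e" using \<eta>(3) C0 N by (simp add: pos_le_divide_eq)
    finally show ?thesis using main[OF \<eta>(1,2) c] by linarith
  qed
  then show ?thesis by (rule field_le_epsilon)
qed

theorem theorem5p3:
  fixes lam Lam p1 m p q :: real
  assumes "0 < lam" and "lam \<le> Lam"
    and "ABP_exponent TYPE('n::finite) lam Lam p1"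
    and "1 < m" and "real CARD('n) + 2 < q" and "p1 < p" and "p \<le> q"
    and "p > (m - 1) * q * (real CARD('n) + 2) / (m * q - real CARD('n) - 2)"
  shows "\<exists>C>0. \<forall>(\<Omega> :: (real ^ 'n) set) T f \<mu> G u.
    0 < T \<and> T \<le> 1 \<and>
    open \<Omega> \<and> connected \<Omega> \<and> \<Omega> \<noteq> {} \<and> \<Omega> \<subseteq> {x. norm x < 1} \<and>
    Lp_on p (cyl \<Omega> T) f \<and>
    Lp_on q (cyl \<Omega> T) \<mu> \<and> (\<forall>z\<in>cyl \<Omega> T. 0 \<le> \<mu> z) \<and>
    measurable_operator (cyl \<Omega> T) G \<and>
    (\<forall>z\<in>cyl \<Omega> T. \<forall>\<xi>. \<forall>X\<in>sym_mats. \<forall>Y\<in>sym_mats.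
       pucci_minus lam Lam (X - Y) \<le> G z \<xi> X - G z \<xi> Y \<and>
       G z \<xi> X - G z \<xi> Y \<le> pucci_plus lam Lam (X - Y)) \<and>
    (\<forall>z\<in>cyl \<Omega> T. \<forall>\<xi>. \<bar>G z \<xi> 0\<bar> \<le> \<mu> z * norm \<xi> powr m) \<and>
    continuous_on (closure (cyl \<Omega> T)) u \<and>
    visc_subsolution p \<Omega> T (\<lambda>z \<xi> X. G z \<xi> X - f z) u
    \<longrightarrow>
    (SUP z\<in>cyl \<Omega> T. u z) \<le> (SUP z\<in>pbdry \<Omega> T. u z) +
      C * (1 + Lp_norm p (cyl \<Omega> T) f powr ((m - 1) * q) * Lp_norm q (cyl \<Omega> T) \<mu> powr q)
            powr ((p - 1) / p) *
        Lp_norm p (cyl \<Omega> T) f"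
proof -
  define d where "d = real CARD('n) + 2"
  have d: "0 < d" by (simp add: d_def add_nonneg_pos)
  have "d / 2 \<le> p1" using assms(3) unfolding ABP_exponent_def d_def by (elim conjE)
  moreover have "2 \<le> d" by (simp add: d_def)
  ultimately have p: "1 < p" using assms(6) by linarith
  have q: "1 < q" using p assms(7) by linarith
  have md: "m * q - real CARD('n) - 2 = m * q - d" by (simp add: d_def)
  have \<beta>: "0 < m - d / p * (m - (1 - p / q))"
  proof (rule exponent_condition)
    show "p > (m - 1) * q * d / (m * q - d)" using assms(8) unfolding md d_def[symmetric] .
  qed (use assms p d in \<open>auto simp: d_def\<close>)
  obtain C0 \<delta> where C0: "C0 > 0" and \<delta>: "\<delta> > 0" and super: "\<forall>(f :: 'n spacetime \<Rightarrow> real) \<mu> K U. 0 < K \<longrightarrow> 0 < U \<longrightarrow> Lp_bound p K f \<longrightarrow> (\<forall>z. 0 \<le> f z) \<longrightarrow>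
      Lp_bound q U \<mu> \<longrightarrow> (\<forall>z. 0 \<le> \<mu> z) \<longrightarrow> U * K powr (m - 1) \<le> \<delta> \<longrightarrow>
      (\<exists>w wt wx wxx. super_sol lam Lam p m (C0 * K) f \<mu> w wt wx wxx)"
    using super_sol_exists[OF assms(1-4,6) less_imp_le[OF p] assms(7) \<beta>[unfolded d_def]]
    by (elim exE conjE) (rule that; assumption)
  define \<kappa> where "\<kappa> = 8 powr ((m - 1) * q) / \<delta> powr q"
  have \<kappa>: "0 \<le> \<kappa>" by (simp add: \<kappa>_def)
  \<comment> \<open>The number of pieces will be at most \<open>\<kappa> + 2\<close> times one plus
    the product of the powers of the two norms; the 2 covers rounding up and one extra
    piece.\<close>
  define C where "C = 4 * C0 * (\<kappa> + 2) powr ((p - 1) / p)"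
  have C: "C > 0" using C0 \<kappa> by (simp add: C_def)
  show ?thesis
  proof (intro exI[of _ C] conjI C allI impI, elim conjE)
    fix \<Omega> :: "(real ^ 'n) set" and T :: real and f \<mu> :: "'n spacetime \<Rightarrow> real" and G and u :: "'n spacetime \<Rightarrow> real"
    assume T: "0 < T" "T \<le> 1" and \<Omega>: "open \<Omega>" "\<Omega> \<noteq> {}" "\<Omega> \<subseteq> {x. norm x < 1}"
      and f: "Lp_on p (cyl \<Omega> T) f" and \<mu>: "Lp_on q (cyl \<Omega> T) \<mu>"
      and G: "\<forall>z\<in>cyl \<Omega> T. \<forall>\<xi>. \<forall>X\<in>sym_mats. \<forall>Y\<in>sym_mats.
       pucci_minus lam Lam (X - Y) \<le> G z \<xi> X - G z \<xi> Y \<and>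
       G z \<xi> X - G z \<xi> Y \<le> pucci_plus lam Lam (X - Y)"
      and G2: "\<forall>z\<in>cyl \<Omega> T. \<forall>\<xi>. \<bar>G z \<xi> 0\<bar> \<le> \<mu> z * norm \<xi> powr m"
      and uc: "continuous_on (closure (cyl \<Omega> T)) u"
      and visc: "visc_subsolution p \<Omega> T (\<lambda>z \<xi> X. G z \<xi> X - f z) u"
    have G1: "\<forall>z\<in>cyl \<Omega> T. \<forall>\<xi>. \<forall>X\<in>sym_mats. \<forall>Y\<in>sym_mats. pucci_minus lam Lam (X - Y) \<le> G z \<xi> X - G z \<xi> Y"
      using G by blast
    define P where "P = (SUP z\<in>pbdry \<Omega> T. u z)"
    have clQ: "closure (cyl \<Omega> T) = closure \<Omega> \<times> {0..T}"
      unfolding cyl_def closure_Times using T by simp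
    \<comment> \<open>The real supremum \<open>P\<close> is known to bound \<open>u\<close> only
      once the values are bounded, which the compact closure of the cylinder provides.\<close>
    have "bounded \<Omega>" using \<Omega>(3) by (intro boundedI[of _ 1]) auto
    then have "compact (closure \<Omega> \<times> {0..T})" by (intro compact_Times) (auto simp: compact_closure)
    then have "bounded (u ` (closure (cyl \<Omega> T)))"
      unfolding clQ[symmetric] by (intro compact_imp_bounded compact_continuous_image uc)
    moreover have pb: "pbdry \<Omega> T \<subseteq> closure (cyl \<Omega> T)"
      unfolding clQ pbdry_def using T closure_subset[of \<Omega>] by (auto simp: frontier_def)
    ultimately have "bounded (u ` pbdry \<Omega> T)" by (meson bounded_subset image_mono)
    then have "bdd_above (u ` pbdry \<Omega> T)" by (rule bounded_imp_bdd_above)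
    then have P: "\<forall>z\<in>pbdry \<Omega> T. u z \<le> P" unfolding P_def by (auto intro: cSUP_upper)
    let ?f = "Lp_norm p (cyl \<Omega> T) f" and ?m = "Lp_norm q (cyl \<Omega> T) \<mu>"
    have nn: "0 \<le> ?f" "0 \<le> ?m" by (simp_all add: Lp_norm_def)
    \<comment> \<open>Both norms are enlarged by \<open>h\<close>, since the subdivision needs
      positive bounds and either norm may vanish.\<close>
    have bound: "u z \<le> P + C * (1 + (?f + h) powr ((m - 1) * q) * (?m + h) powr q) powr ((p - 1) / p) * (?f + h)"
      if h: "0 < h" and z: "z \<in> cyl \<Omega> T" for h z
    proof -
      let ?F = "?f + h" and ?V = "?m + h"
      have F: "0 < ?F" "?f \<le> ?F" and V: "0 < ?V" "?m \<le> ?V" using nn h by auto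
      define X where "X = ?F powr ((m - 1) * q) * ?V powr q"
      have X: "0 \<le> X" by (simp add: X_def)
      \<comment> \<open>The added one makes \<open>N\<close> positive at once; it is absorbed by the
        2 in \<open>\<kappa> + 2\<close>.\<close>
      define N where "N = nat \<lceil>\<kappa> * X\<rceil> + 1"
      have \<kappa>X: "0 \<le> \<kappa> * X" using \<kappa> X by simp
      have N: "0 < N" "\<kappa> * X \<le> real N" "real N \<le> (\<kappa> + 2) * (1 + X)"
      proof -
        show "0 < N" by (simp add: N_def)
        have r: "real (nat \<lceil>\<kappa> * X\<rceil>) = of_int \<lceil>\<kappa> * X\<rceil>" using \<kappa>X by simp
        show "\<kappa> * X \<le> real N" unfolding N_def of_nat_add of_nat_1 r using le_of_int_ceiling[of "\<kappa> * X"] by linarith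
        have "real N \<le> \<kappa> * X + 2" unfolding N_def of_nat_add of_nat_1 r using of_int_ceiling_le_add_one[of "\<kappa> * X"] by linarith
        also have "\<dots> \<le> (\<kappa> + 2) * (1 + X)" using \<kappa> X by (simp add: algebra_simps)
        finally show "real N \<le> (\<kappa> + 2) * (1 + X)" .
      qed
      have "u z \<le> P + 4 * C0 * (?F * real N powr ((p - 1) / p))"
        by (rule subdivision_bound[OF super assms(1) less_imp_le[OF p] assms(7,4) C0 \<delta> T \<Omega> f \<mu> G1 G2 uc visc P F V N(1) _ z])
          (use N(2) in \<open>simp only: \<kappa>_def X_def\<close>)
      also have "real N powr ((p - 1) / p) \<le> ((\<kappa> + 2) * (1 + X)) powr ((p - 1) / p)"
        using N(3) p by (intro powr_mono2) auto
      then have "4 * C0 * (?F * real N powr ((p - 1) / p)) \<le> 4 * C0 * (?F * ((\<kappa> + 2) * (1 + X)) powr ((p - 1) / p))"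
        using C0 F by (intro mult_left_mono) auto
      also have "\<dots> = C * (1 + X) powr ((p - 1) / p) * ?F"
        using \<kappa> X by (simp add: C_def powr_mult)
      finally show ?thesis by (simp add: X_def)
    qed
    have sup: "(SUP z\<in>cyl \<Omega> T. u z) \<le> P + C * (1 + (?f + h) powr ((m - 1) * q) * (?m + h) powr q) powr ((p - 1) / p) * (?f + h)"
      if "0 < h" for h
    proof (rule cSUP_least)
      show "cyl \<Omega> T \<noteq> {}" using \<Omega>(2) T by (auto simp: cyl_def)
    qed (rule bound[OF that])
    have lim: "((\<lambda>h. P + C * (1 + (?f + h) powr ((m - 1) * q) * (?m + h) powr q) powr ((p - 1) / p) * (?f + h)) \<longlongrightarrow>
        P + C * (1 + (?f + 0) powr ((m - 1) * q) * (?m + 0) powr q) powr ((p - 1) / p) * (?f + 0)) (at_right 0)"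
    proof -
      \<comment> \<open>The base may tend to 0 from the right, where the limit agrees with the value
        of \<open>powr\<close> because the exponent is positive.\<close>
      have pw: "((\<lambda>h. (x + h) powr a) \<longlongrightarrow> (x + 0) powr a) (at_right 0)" if "0 \<le> x" "0 < a" for x a :: real
      proof (rule tendsto_powr')
        have "\<forall>\<^sub>F h in at_right 0. 0 \<le> x + h" by (rule eventually_at_rightI[of 0 1]) (use that in auto)
        then show "x + 0 \<noteq> 0 \<or> 0 < a \<and> (\<forall>\<^sub>F h in at_right 0. 0 \<le> x + h)" using that by blast
        show "((\<lambda>h. x + h) \<longlongrightarrow> x + 0) (at_right 0)" by (intro tendsto_add tendsto_const tendsto_ident_at)
      qed (rule tendsto_const)
      have e1: "0 < (m - 1) * q" "0 < q" "0 < (p - 1) / p" using assms(4) p q by auto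
      have "1 + (?f + 0) powr ((m - 1) * q) * (?m + 0) powr q \<noteq> 0"
      proof -
        have "0 \<le> (?f + 0) powr ((m - 1) * q) * (?m + 0) powr q" by simp
        then show ?thesis by linarith
      qed
      then show ?thesis
        by (intro tendsto_add tendsto_mult tendsto_const tendsto_ident_at tendsto_powr pw e1 nn)
    qed
    have "(SUP z\<in>cyl \<Omega> T. u z) \<le> P + C * (1 + (?f + 0) powr ((m - 1) * q) * (?m + 0) powr q) powr ((p - 1) / p) * (?f + 0)"
    proof (rule tendsto_lowerbound[OF lim])
      show "\<forall>\<^sub>F h in at_right 0. (SUP z\<in>cyl \<Omega> T. u z) \<le> P + C * (1 + (?f + h) powr ((m - 1) * q) * (?m + h) powr q) powr ((p - 1) / p) * (?f + h)"
        by (rule eventually_at_rightI[of 0 1]) (use sup in auto)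
    qed simp
    then show "(SUP z\<in>cyl \<Omega> T. u z) \<le> (SUP z\<in>pbdry \<Omega> T. u z) +
      C * (1 + ?f powr ((m - 1) * q) * ?m powr q) powr ((p - 1) / p) * ?f" by (simp add: P_def)
  qed
qed

end
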